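(* The spaces $\tilde{\mathcal{D}}_0$ and $\mathcal{D}_1$ are both $\pi$-cores for the Ornstein--Uhlenbeck generator $\mathcal{L}$ on $C_b(H)$, with $\mathcal{D}_1\subset\tilde{\mathcal{D}}_0$. They are also invariant for the Ornstein--Uhlenbeck semigroup, i.e. $P_t(\tilde{\mathcal{D}}_0)\subset\tilde{\mathcal{D}}_0$ and $P_t(\mathcal{D}_1)\subset\mathcal{D}_1$ for all $t\ge0$, and, for any $f\in\tilde{\mathcal{D}}_0$, one has $\mathcal{L}f=\mathcal{L}_0f$.
   Context: Let $H$ be a real separable Hilbert space with inner product $\langle\cdot,\cdot\rangle$ and norm $|\cdot|$, and $L_2(H)$ the Hilbert space of Hilbert--Schmidt operators on $H$. $C_b(H)$ (resp. $C_b(H,H)$) is the space of bounded continuous functions from $H$ to $\mathbb{R}$ (resp. to $H$); $\|\cdot\|_0$ is the sup norm. Let $Q:H\to H$ be a non-negative symmetric trace-class operator, $a\in H$, and $\nu$ a $\sigma$-finite Borel measure on $H$ with $\nu(\{0\})=0$ and $\int_H(1\wedge|y|^2)\,\nu(dy)<\infty$. Let $Z=(Z_t)_{t\ge0}$ be an $H$-valued Lévy process with $\mathbb{E}[e^{i\langle Z_t,h\rangle}]=e^{-t\psi(h)}$, where $$\psi(h)=\tfrac12\langle Qh,h\rangle-i\langle a,h\rangle-\int_H\big(e^{i\langle h,y\rangle}-1-i\langle h,y\rangle\mathbf{1}_{\{|y|\le1\}}\big)\,\nu(dy),\quad h\in H.$$ Let $A:D(A)\subset H\to H$ generate a $C_0$-semigroup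 $(e^{tA})$ on $H$, with adjoint $A^*:D(A^* )\subset H\to H$, which generates $(e^{tA^*})$. Put $X_t^x=e^{tA}x+Y_t$, $Y_t=\int_0^te^{(t-s)A}\,dZ_s$. The law $\mu_t$ of $Y_t$ is the Borel probability measure on $H$ with characteristic function $\hat\mu_t(h)=\exp\big(-\int_0^t\psi(e^{sA^*}h)\,ds\big)$, $h\in H$. The Ornstein--Uhlenbeck semigroup is $$P_tf(x)=\mathbb{E}[f(X_t^x)]=\int_Hf(e^{tA}x+y)\,\mu_t(dy),\quad t\ge0,\ x\in H,\ f\in C_b(H)$$ (extended linearly to complex-valued $f$); it maps $C_b(H)$ into itself. Generator: $D(\mathcal{L})$ is the set of $f\in C_b(H)$ for which there is $g\in C_b(H)$ with $\lim_{h\to0^+}\frac{P_hf(x)-f(x)}{h}=g(x)$ for every $x\in H$ and $\sup_{h>0}h^{-1}\|P_hf-f\|_0<\infty$; then $\mathcal{L}f=g$. $C_b^2(H)$ is the space of $f\in C_b(H)$, twice Fréchet differentiable on $H$, with $Df\in C_b(H,H)$, $D^2f(x)\in L_2(H)$ for all $x$, and $D^2f:H\to L_2(H)$ bounded and continuous. $C_A^2(H)$ is the set of $f\in C_b^2(H)$ with $Df(x)\in D(A^* )$ for all $x\in H$ and $A^*Df\in C_b(H,H)$. For $f\in C_A^2(H)$, $x\in H$, $$\mathcal{L}_0f(x)=\langle x,A^*Df(x)\rangle+\int_H\big(f(x+y)-f(x)-\mathbf{1}_{\{|y|\le1\}}\langle y,Df(x)\rangle\big)\,\nu(dy)+\tfrac12\mathrm{Tr}(QD^2f(x))+\langle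 a,Df(x)\rangle.$$ $\tilde{\mathcal{D}}_0=\{f\in C_A^2(H):\ x\mapsto\langle x,A^*Df(x)\rangle\in C_b(H)\}$. $\mathcal{D}_1$ is the (real) linear span of the real and imaginary parts of the maps $\phi_{b,h}:H\to\mathbb{C}$, $$\phi_{b,h}(x)=\int_0^bP_s\big(e^{i\langle\cdot,h\rangle}\big)(x)\,ds=\int_0^be^{i\langle e^{sA}x,h\rangle}e^{-\int_0^s\psi(e^{rA^*}h)\,dr}\,ds,\qquad h\in D(A^* ),\ b>0.$$ $\pi$-convergence: $(f_n)\subset C_b(H)$ $\pi$-converges to $f\in C_b(H)$, written $f_n\xrightarrow{\pi}f$, if $\sup_n\|f_n\|_0<\infty$ and $f_n(x)\to f(x)$ for every $x\in H$. An $m$-indexed multisequence $(f_{n_1,\dots,n_m})\subset C_b(H)$ $\pi$-converges to $f\in C_b(H)$ if for each $i=1,\dots,m-1$ there is an $i$-indexed multisequence $(f_{n_1,\dots,n_i})\subset C_b(H)$ such that, for all $n_1,\dots,n_i$, $f_{n_1,\dots,n_{i+1}}\xrightarrow{\pi}f_{n_1,\dots,n_i}$ as $n_{i+1}\to\infty$, and $f_{n_1}\xrightarrow{\pi}f$ as $n_1\to\infty$. A set $E\subset C_b(H)$ is $\pi$-dense if every $f\in C_b(H)$ is the $\pi$-limit of some $m$-indexed multisequence (for some $m$) in $E$. A subspace $\mathcal{D}\subset D(\mathcal{L})$ is a $\pi$-core for $\mathcal{L}$ if $\mathcal{D}$ is $\pi$-dense in $C_b(H)$ and for every $f\in D(\mathcal{L})$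 there is an $m$-indexed multisequence (for some $m$) $(f_{n_1,\dots,n_m})\subset\mathcal{D}$ with $f_{n_1,\dots,n_m}\xrightarrow{\pi}f$ and $\mathcal{L}f_{n_1,\dots,n_m}\xrightarrow{\pi}\mathcal{L}f$. *)

theory Defs
  imports "HOL-Probability.Probability"
begin

text \<open>
  The real separable Hilbert space is a type of sort \<open>{real_inner, polish_space}\<close>: an inner product
  space that is complete and second countable. The space $C_b$ is the set \<open>bcontfun\<close> of the
  library.
\<close>

definition supnorm :: "('a \<Rightarrow> 'b::real_normed_vector) \<Rightarrow> real" where
  "supnorm f = (SUP x. norm (f x))"


subsection \<open>Orthonormal bases, Hilbert--Schmidt operators, trace\<close>

definition is_onb :: "'a::real_inner set \<Rightarrow> bool" where
  "is_onb B \<longleftrightarrow> pairwise orthogonal B \<and> (\<forall>e\<in>B. norm e = 1) \<and> closure (span B) = UNIV"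

text \<open>
  One fixed orthonormal basis; the notions built on it below do not depend on the choice.
\<close>
definition std_onb :: "'a::real_inner set" where
  "std_onb = (SOME B. is_onb B)"

definition hilbert_schmidt :: "('a::real_inner \<Rightarrow> 'a) \<Rightarrow> bool" where
  "hilbert_schmidt T \<longleftrightarrow> bounded_linear T \<and> (\<lambda>e. (norm (T e))\<^sup>2) summable_on std_onb"

definition hs_norm :: "('a::real_inner \<Rightarrow> 'a) \<Rightarrow> real" where
  "hs_norm T = sqrt (\<Sum>\<^sub>\<infinity>e\<in>std_onb. (norm (T e))\<^sup>2)"

definition op_trace :: "('a::real_inner \<Rightarrow> 'a) \<Rightarrow> real" where
  "op_trace T = (\<Sum>\<^sub>\<infinity>e\<in>std_onb. T e \<bullet> e)"

text \<open>
  For a non-negative symmetric operator one has $|Q| = Q$, so that being of trace class means that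
  the series of the non-negative terms $\langle Qe,e\rangle$ converges.
\<close>
definition nonneg_sym_trace_class :: "('a::real_inner \<Rightarrow> 'a) \<Rightarrow> bool" where
  "nonneg_sym_trace_class Q \<longleftrightarrow>
     bounded_linear Q \<and> (\<forall>x y. Q x \<bullet> y = x \<bullet> Q y) \<and> (\<forall>x. Q x \<bullet> x \<ge> 0) \<and>
     (\<lambda>e. Q e \<bullet> e) summable_on std_onb"


subsection \<open>Strongly continuous semigroups, generators, adjoints\<close>

text \<open>
  A one-parameter semigroup is a function on the reals of which only the values at \<open>t \<ge> 0\<close> matter;
  an unbounded operator is a domain \<open>DA\<close> together with a total function \<open>A\<close> of which only the
  values on \<open>DA\<close> matter.
\<close>

definition c0_semigroup :: "(real \<Rightarrow> 'a::real_normed_vector \<Rightarrow> 'a) \<Rightarrow> bool" where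
  "c0_semigroup S \<longleftrightarrow>
     (\<forall>t\<ge>0. bounded_linear (S t)) \<and> (\<forall>x. S 0 x = x) \<and>
     (\<forall>s\<ge>0. \<forall>t\<ge>0. \<forall>x. S (s + t) x = S s (S t x)) \<and>
     (\<forall>x. ((\<lambda>t. S t x) \<longlongrightarrow> x) (at_right 0))"

definition generates ::
  "'a::real_normed_vector set \<Rightarrow> ('a \<Rightarrow> 'a) \<Rightarrow> (real \<Rightarrow> 'a \<Rightarrow> 'a) \<Rightarrow> bool" where
  "generates DA A S \<longleftrightarrow>
     c0_semigroup S \<and>
     DA = {x. \<exists>y. ((\<lambda>t. (S t x - x) /\<^sub>R t) \<longlongrightarrow> y) (at_right 0)} \<and>
     (\<forall>x\<in>DA. ((\<lambda>t. (S t x - x) /\<^sub>R t) \<longlongrightarrow> A x) (at_right 0))"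

definition adj_dom :: "'a::real_inner set \<Rightarrow> ('a \<Rightarrow> 'a) \<Rightarrow> 'a set" where
  "adj_dom DA A = {h. \<exists>z. \<forall>x\<in>DA. A x \<bullet> h = x \<bullet> z}"

definition adj_op :: "'a::real_inner set \<Rightarrow> ('a \<Rightarrow> 'a) \<Rightarrow> 'a \<Rightarrow> 'a" where
  "adj_op DA A h = (THE z. \<forall>x\<in>DA. A x \<bullet> h = x \<bullet> z)"


subsection \<open>Levy data and the Ornstein--Uhlenbeck semigroup\<close>

definition levy_measure :: "'a::real_inner measure \<Rightarrow> bool" where
  "levy_measure \<nu> \<longleftrightarrow>
     sets \<nu> = sets borel \<and> sigma_finite_measure \<nu> \<and> emeasure \<nu> {0} = 0 \<and>
     (\<integral>\<^sup>+ y. ennreal (min 1 ((norm y)\<^sup>2)) \<partial>\<nu>) < \<infinity>"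

definition levy_exponent ::
  "('a::real_inner \<Rightarrow> 'a) \<Rightarrow> 'a \<Rightarrow> 'a measure \<Rightarrow> 'a \<Rightarrow> complex" where
  "levy_exponent Q a \<nu> h =
     complex_of_real (1 / 2 * (Q h \<bullet> h)) - \<i> * complex_of_real (a \<bullet> h)
     - (\<integral>y. (iexp (h \<bullet> y) - 1
              - \<i> * complex_of_real ((h \<bullet> y) * indicator {y. norm y \<le> 1} y)) \<partial>\<nu>)"

text \<open>
  \<open>\<mu> t\<close> is the law of the stochastic convolution $Y_t = \int_0^t e^{(t-s)A}\,dZ_s$, described by its
  characteristic function (which determines it); \<open>Sadj\<close> stands for the semigroup $e^{tA^*}$.
\<close>
definition convolution_laws ::
  "('a::{real_inner, polish_space} \<Rightarrow> 'a) \<Rightarrow> 'a \<Rightarrow> 'a measure \<Rightarrow> (real \<Rightarrow> 'a \<Rightarrow> 'a) \<Rightarrow>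
   (real \<Rightarrow> 'a measure) \<Rightarrow> bool" where
  "convolution_laws Q a \<nu> Sadj \<mu> \<longleftrightarrow>
     (\<forall>t\<ge>0. prob_space (\<mu> t) \<and> sets (\<mu> t) = sets borel \<and>
        (\<forall>h. (\<integral>y. iexp (h \<bullet> y) \<partial>\<mu> t)
              = exp (- integral {0..t} (\<lambda>s. levy_exponent Q a \<nu> (Sadj s h)))))"

text \<open>Used for real-valued and for complex-valued \<open>f\<close>.\<close>
definition ou_semigroup ::
  "(real \<Rightarrow> 'a::{real_inner, polish_space} \<Rightarrow> 'a) \<Rightarrow> (real \<Rightarrow> 'a measure) \<Rightarrow> real \<Rightarrow>
   ('a \<Rightarrow> 'b::{banach, second_countable_topology}) \<Rightarrow> 'a \<Rightarrow> 'b" where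
  "ou_semigroup S \<mu> t f x = (\<integral>y. f (S t x + y) \<partial>\<mu> t)"


subsection \<open>The generator on $C_b$\<close>

definition gen_dom ::
  "(real \<Rightarrow> ('a::topological_space \<Rightarrow> real) \<Rightarrow> 'a \<Rightarrow> real) \<Rightarrow> ('a \<Rightarrow> real) set" where
  "gen_dom P =
     {f \<in> bcontfun.
        (\<exists>g\<in>bcontfun. \<forall>x. ((\<lambda>h. (P h f x - f x) / h) \<longlongrightarrow> g x) (at_right 0)) \<and>
        bdd_above ((\<lambda>h. supnorm (\<lambda>x. P h f x - f x) / h) ` {0<..})}"

definition gen ::
  "(real \<Rightarrow> ('a::topological_space \<Rightarrow> real) \<Rightarrow> 'a \<Rightarrow> real) \<Rightarrow> ('a \<Rightarrow> real) \<Rightarrow> 'a \<Rightarrow> real" where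
  "gen P f x = Lim (at_right 0) (\<lambda>h. (P h f x - f x) / h)"


subsection \<open>Smooth functions and the explicit operator\<close>

definition grad :: "('a::real_inner \<Rightarrow> real) \<Rightarrow> 'a \<Rightarrow> 'a" where
  "grad f x = (THE v. GDERIV f x :> v)"

definition hess :: "('a::real_inner \<Rightarrow> real) \<Rightarrow> 'a \<Rightarrow> 'a \<Rightarrow> 'a" where
  "hess f x = frechet_derivative (grad f) (at x)"

definition Cb2 :: "('a::real_inner \<Rightarrow> real) set" where
  "Cb2 =
     {f \<in> bcontfun.
        (\<forall>x. \<exists>v. GDERIV f x :> v) \<and> grad f \<in> bcontfun \<and>
        (\<forall>x. grad f differentiable (at x)) \<and>
        (\<forall>x. hilbert_schmidt (hess f x)) \<and>
        (\<exists>C. \<forall>x. hs_norm (hess f x) \<le> C) \<and>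
        (\<forall>x. ((\<lambda>y. hs_norm (\<lambda>v. hess f y v - hess f x v)) \<longlongrightarrow> 0) (at x))}"

definition CA2 :: "'a::real_inner set \<Rightarrow> ('a \<Rightarrow> 'a) \<Rightarrow> ('a \<Rightarrow> real) set" where
  "CA2 DA A =
     {f \<in> Cb2. (\<forall>x. grad f x \<in> adj_dom DA A) \<and> (\<lambda>x. adj_op DA A (grad f x)) \<in> bcontfun}"

definition L0 ::
  "('a::{real_inner, polish_space} \<Rightarrow> 'a) \<Rightarrow> 'a \<Rightarrow> 'a measure \<Rightarrow> 'a set \<Rightarrow> ('a \<Rightarrow> 'a) \<Rightarrow>
   ('a \<Rightarrow> real) \<Rightarrow> 'a \<Rightarrow> real" where
  "L0 Q a \<nu> DA A f x =
     x \<bullet> adj_op DA A (grad f x)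
     + (\<integral>y. (f (x + y) - f x - indicator {y. norm y \<le> 1} y * (y \<bullet> grad f x)) \<partial>\<nu>)
     + 1 / 2 * op_trace (\<lambda>v. Q (hess f x v))
     + a \<bullet> grad f x"

definition D0_tilde :: "'a::real_inner set \<Rightarrow> ('a \<Rightarrow> 'a) \<Rightarrow> ('a \<Rightarrow> real) set" where
  "D0_tilde DA A = {f \<in> CA2 DA A. (\<lambda>x. x \<bullet> adj_op DA A (grad f x)) \<in> bcontfun}"

definition phi ::
  "(real \<Rightarrow> 'a::{real_inner, polish_space} \<Rightarrow> 'a) \<Rightarrow> (real \<Rightarrow> 'a measure) \<Rightarrow> real \<Rightarrow> 'a \<Rightarrow>
   'a \<Rightarrow> complex" where
  "phi S \<mu> b h x = integral {0..b} (\<lambda>s. ou_semigroup S \<mu> s (\<lambda>z. iexp (z \<bullet> h)) x)"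

text \<open>
  The real linear span; function types carry no vector space structure in the library.
\<close>
definition fun_span :: "('a \<Rightarrow> real) set \<Rightarrow> ('a \<Rightarrow> real) set" where
  "fun_span G = {\<lambda>x. \<Sum>i<n. c i * g i x | (n::nat) c g. \<forall>i<n. g i \<in> G}"

definition fun_subspace :: "('a \<Rightarrow> real) set \<Rightarrow> bool" where
  "fun_subspace E \<longleftrightarrow>
     (\<lambda>x. 0) \<in> E \<and> (\<forall>f\<in>E. \<forall>g\<in>E. (\<lambda>x. f x + g x) \<in> E) \<and> (\<forall>c. \<forall>f\<in>E. (\<lambda>x. c * f x) \<in> E)"

definition D1 ::
  "(real \<Rightarrow> 'a::{real_inner, polish_space} \<Rightarrow> 'a) \<Rightarrow> (real \<Rightarrow> 'a measure) \<Rightarrow> 'a set \<Rightarrow> ('a \<Rightarrow> 'a) \<Rightarrow>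
   ('a \<Rightarrow> real) set" where
  "D1 S \<mu> DA A =
     fun_span ({\<lambda>x. Re (phi S \<mu> b h x) | b h. b > 0 \<and> h \<in> adj_dom DA A} \<union>
               {\<lambda>x. Im (phi S \<mu> b h x) | b h. b > 0 \<and> h \<in> adj_dom DA A})"


subsection \<open>$\pi$-convergence and $\pi$-cores\<close>

definition pi_conv ::
  "(nat \<Rightarrow> 'a::topological_space \<Rightarrow> real) \<Rightarrow> ('a \<Rightarrow> real) \<Rightarrow> bool" where
  "pi_conv F f \<longleftrightarrow>
     (\<forall>n. F n \<in> bcontfun) \<and> f \<in> bcontfun \<and>
     bdd_above (range (\<lambda>n. supnorm (F n))) \<and> (\<forall>x. (\<lambda>n. F n x) \<longlonglongrightarrow> f x)"

text \<open>
  An \<open>m\<close>-indexed multisequence is a function \<open>F\<close> on index lists $[n_1,\dots,n_m]$ of length \<open>m\<close>.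
  The function \<open>G\<close> collects the given multisequence (lists of length \<open>m\<close>), the intermediate
  \<open>i\<close>-indexed multisequences (lists of length \<open>i\<close>) and the limit (the empty list).
\<close>
definition multi_pi_conv ::
  "nat \<Rightarrow> (nat list \<Rightarrow> 'a::topological_space \<Rightarrow> real) \<Rightarrow> ('a \<Rightarrow> real) \<Rightarrow> bool" where
  "multi_pi_conv m F f \<longleftrightarrow>
     m \<ge> 1 \<and>
     (\<exists>G. G [] = f \<and> (\<forall>ns. length ns = m \<longrightarrow> G ns = F ns) \<and>
          (\<forall>ns. length ns < m \<longrightarrow> pi_conv (\<lambda>n. G (ns @ [n])) (G ns)))"

definition pi_dense :: "('a::topological_space \<Rightarrow> real) set \<Rightarrow> bool" where
  "pi_dense E \<longleftrightarrow>
     E \<subseteq> bcontfun \<and>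
     (\<forall>f\<in>bcontfun. \<exists>m F. (\<forall>ns. length ns = m \<longrightarrow> F ns \<in> E) \<and> multi_pi_conv m F f)"

definition pi_core ::
  "(real \<Rightarrow> ('a::topological_space \<Rightarrow> real) \<Rightarrow> 'a \<Rightarrow> real) \<Rightarrow> ('a \<Rightarrow> real) set \<Rightarrow> bool" where
  "pi_core P E \<longleftrightarrow>
     fun_subspace E \<and> E \<subseteq> gen_dom P \<and> pi_dense E \<and>
     (\<forall>f\<in>gen_dom P. \<exists>m F. (\<forall>ns. length ns = m \<longrightarrow> F ns \<in> E) \<and>
        multi_pi_conv m F f \<and> multi_pi_conv m (\<lambda>ns. gen P (F ns)) (gen P f))"

end

theory Submission
  imports Defs
begin

text \<open>
  On trigonometric functions \<open>P\<close> is explicit, so the characteristic function of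
  \<open>\<mu> t\<close> gives Dynkin's formula for \<open>t \<mapsto> \<integral> f d\<mu>
  t\<close> by differentiating in time. It extends to all \<open>f\<close> of class
  \<open>C_b^2\<close> because averaging \<open>f\<close> twice over small boxes turns its
  derivatives into difference quotients, for which bounded pointwise approximation by trigonometric
  functions is enough; cylindrical projections then remove the restriction to finitely many
  directions. A Gaussian average of one minus the characteristic function, which bounds the mass of
  \<open>\<mu> t\<close> away from the origin, yields stochastic continuity, and with Dynkin's
  formula the generator on \<open>D0_tilde\<close>. The drift of \<open>P t f\<close> stays bounded
  because \<open>P t\<close> commutes with the generator. For the cores, \<open>n\<close> times the
  integral of \<open>P s g\<^sub>k\<close> over \<open>[0, 1/n]\<close> with trigonometric
  \<open>g\<^sub>k\<close> approximating \<open>f\<close> lies in \<open>D1\<close>, its image under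
  the generator is \<open>n (P (1/n) g\<^sub>k - g\<^sub>k)\<close>, and both converge when first
  \<open>k\<close> and then \<open>n\<close> tends to infinity.
\<close>

section \<open>Orthonormal sequences and Hilbert--Schmidt operators\<close>

text \<open>Zero entries are allowed, so that finite-dimensional spaces need no separate treatment.\<close>
definition onb_seq :: "(nat \<Rightarrow> 'a::real_inner) \<Rightarrow> bool" where
  "onb_seq e \<longleftrightarrow> (\<forall>i j. i \<noteq> j \<longrightarrow> e i \<bullet> e j = 0) \<and> (\<forall>i. norm (e i) = 1 \<or> e i = 0) \<and>
     (\<forall>x. (\<lambda>n. \<Sum>i<n. (x \<bullet> e i) *\<^sub>R e i) \<longlonglongrightarrow> x)"

definition proj :: "(nat \<Rightarrow> 'a::real_inner) \<Rightarrow> nat \<Rightarrow> 'a \<Rightarrow> 'a" where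
  "proj e n x = (\<Sum>i<n. (x \<bullet> e i) *\<^sub>R e i)"

lemma bounded_linear_proj: "bounded_linear (proj e n)"
  unfolding proj_def
  by (intro bounded_linear_sum bounded_linear_scaleR_const bounded_linear_inner_left)

lemma ortho_norm_sum:
  fixes e :: "nat \<Rightarrow> 'a::real_inner"
  assumes "\<And>i j. i \<noteq> j \<Longrightarrow> e i \<bullet> e j = 0"
  shows "(norm (\<Sum>i<n. c i *\<^sub>R e i))\<^sup>2 = (\<Sum>i<n. (c i)\<^sup>2 * (norm (e i))\<^sup>2)"
proof (induction n)
  case (Suc n)
  have "(\<Sum>i<n. c i *\<^sub>R e i) \<bullet> (c n *\<^sub>R e n) = 0"
    using assms by (auto simp: inner_sum_left intro!: sum.neutral)
  then have "(norm ((\<Sum>i<n. c i *\<^sub>R e i) + c n *\<^sub>R e n))\<^sup>2 =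
     (norm (\<Sum>i<n. c i *\<^sub>R e i))\<^sup>2 + (norm (c n *\<^sub>R e n))\<^sup>2"
    by (simp add: norm_add_Pythagorean orthogonal_def)
  then show ?case using Suc by (simp add: power_mult_distrib)
qed simp

lemma norm_proj_le:
  assumes o: "\<And>i j. i \<noteq> j \<Longrightarrow> e i \<bullet> e j = 0" and u: "\<And>i. norm (e i) = 1 \<or> e i = 0"
  shows "norm (proj e n x) \<le> norm x"
proof -
  have 1: "(norm (proj e n x))\<^sup>2 = (\<Sum>i<n. (x \<bullet> e i)\<^sup>2)"
  proof -
    have "(x \<bullet> e i)\<^sup>2 * (norm (e i))\<^sup>2 = (x \<bullet> e i)\<^sup>2" for i using u[of i] by auto
    then have "(\<Sum>i<n. (x \<bullet> e i)\<^sup>2 * (norm (e i))\<^sup>2) = (\<Sum>i<n. (x \<bullet> e i)\<^sup>2)" by metis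
    then show ?thesis unfolding proj_def using ortho_norm_sum[of e "\<lambda>i. x \<bullet> e i" n] o by simp
  qed
  have 2: "x \<bullet> proj e n x = (\<Sum>i<n. (x \<bullet> e i)\<^sup>2)"
    by (simp add: proj_def inner_sum_right power2_eq_square)
  have "0 \<le> (x - proj e n x) \<bullet> (x - proj e n x)" by simp
  also have "\<dots> = (norm x)\<^sup>2 - 2 * (x \<bullet> proj e n x) + (norm (proj e n x))\<^sup>2"
    by (simp add: inner_diff_left inner_diff_right inner_commute power2_norm_eq_inner)
  finally have "(norm (proj e n x))\<^sup>2 \<le> (norm x)\<^sup>2" using 1 2 by simp
  then show ?thesis by (simp add: abs_le_square_iff)
qed

lemma onb_seqI:
  fixes e :: "nat \<Rightarrow> 'a::real_inner"
  assumes o: "\<And>i j. i \<noteq> j \<Longrightarrow> e i \<bullet> e j = 0" and u: "\<And>i. norm (e i) = 1 \<or> e i = 0"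
    and d: "closure (span (range e)) = UNIV"
  shows "onb_seq e"
proof -
  have *: "\<exists>N. \<forall>n\<ge>N. proj e n y = y" if "y \<in> span (range e)" for y
    using that
  proof (induction rule: span_induct_alt)
    case base
    then show ?case by (simp add: proj_def)
  next
    case (step c b y)
    from step obtain N where N: "\<forall>n\<ge>N. proj e n y = y" by auto
    from step obtain j where b: "b = e j" by auto
    have "proj e n (c *\<^sub>R b + y) = c *\<^sub>R b + y" if "n \<ge> max N (Suc j)" for n
    proof -
      have "proj e n (e j) = (\<Sum>i<n. if i = j then e j else 0)"
        unfolding proj_def
      proof (rule sum.cong[OF refl])
        fix i show "(e j \<bullet> e i) *\<^sub>R e i = (if i = j then e j else 0)"
          using o[of j i] u[of j] by (auto simp: dot_square_norm)
      qed
      also have "\<dots> = e j" using that by simp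
      finally show ?thesis using N that b
        by (simp add: linear_add[OF bounded_linear.linear[OF bounded_linear_proj]]
           linear_scale[OF bounded_linear.linear[OF bounded_linear_proj]])
    qed
    then show ?case by blast
  qed
  have "(\<lambda>n. proj e n x) \<longlonglongrightarrow> x" for x
  proof (rule LIMSEQ_I)
    fix r :: real assume "r > 0"
    have "x \<in> closure (span (range e))" using d by simp
    then obtain y where y: "y \<in> span (range e)" "dist y x < r / 2"
      using closure_approachable \<open>r > 0\<close> by (metis half_gt_zero)
    from * y obtain N where N: "\<forall>n\<ge>N. proj e n y = y" by auto
    have "norm (proj e n x - x) < r" if "n \<ge> N" for n
    proof -
      have "proj e n x - x = proj e n (x - y) + (y - x)"
        using N that by (simp add: linear_diff[OF bounded_linear.linear[OF bounded_linear_proj]])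
      also have "norm \<dots> \<le> norm (x - y) + norm (y - x)"
        by (intro order_trans[OF norm_triangle_ineq] add_mono norm_proj_le o u) auto
      finally show ?thesis using y by (simp add: dist_norm norm_minus_commute)
    qed
    then show "\<exists>no. \<forall>n\<ge>no. norm (proj e n x - x) < r" by blast
  qed
  then show ?thesis using o u by (simp add: onb_seq_def proj_def)
qed

context
  fixes e :: "nat \<Rightarrow> 'a::real_inner"
  assumes e: "onb_seq e"
begin

lemma onb_ortho: "i \<noteq> j \<Longrightarrow> e i \<bullet> e j = 0" and onb_unit: "norm (e i) = 1 \<or> e i = 0"
  using e by (auto simp: onb_seq_def)

lemma onb_norm_le: "norm (e i) \<le> 1"
  using onb_unit[of i] by auto

lemma proj_tendsto: "(\<lambda>n. proj e n x) \<longlonglongrightarrow> x"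
  using e by (simp add: onb_seq_def proj_def)

lemma onb_norm_proj_le: "norm (proj e n x) \<le> norm x"
  by (rule norm_proj_le[OF onb_ortho onb_unit]) auto

lemma parseval: "(\<lambda>i. (x \<bullet> e i) * (y \<bullet> e i)) sums (x \<bullet> y)"
proof -
  have "(\<lambda>n. proj e n x \<bullet> y) \<longlonglongrightarrow> x \<bullet> y" by (intro tendsto_intros proj_tendsto)
  then show ?thesis by (simp add: sums_def proj_def inner_sum_left inner_commute[of y])
qed

lemma parseval_norm: "(\<lambda>i. (x \<bullet> e i)\<^sup>2) sums (norm x)\<^sup>2"
  using parseval[of x x] by (simp add: power2_eq_square dot_square_norm)

lemma bessel: "(\<Sum>i<n. (x \<bullet> e i)\<^sup>2) \<le> (norm x)\<^sup>2"
  using sum_le_suminf[OF sums_summable[OF parseval_norm[of x]], of "{..<n}"]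
    sums_unique[OF parseval_norm[of x]] by simp

lemma onb_norm_sum: "(norm (\<Sum>i<n. c i *\<^sub>R e i))\<^sup>2 \<le> (\<Sum>i<n. (c i)\<^sup>2)"
proof -
  have "(c i)\<^sup>2 * (norm (e i))\<^sup>2 \<le> (c i)\<^sup>2" for i using onb_unit[of i] by auto
  then show ?thesis by (subst ortho_norm_sum[OF onb_ortho]) (auto intro: sum_mono)
qed

lemma inner_proj_left: "proj e n x \<bullet> y = x \<bullet> proj e n y"
  by (simp add: proj_def inner_sum_left inner_sum_right inner_commute mult.commute)

lemma proj_inner_onb: "proj e n x \<bullet> e i = (if i < n then x \<bullet> e i else 0)"
proof -
  have "proj e n x \<bullet> e i = (\<Sum>j<n. if j = i then x \<bullet> e i else 0)"
    unfolding proj_def inner_sum_left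
    by (rule sum.cong[OF refl]) (use onb_ortho onb_unit[of i] in \<open>auto simp: dot_square_norm\<close>)
  then show ?thesis by simp
qed

lemma proj_proj: "proj e n (proj e n x) = proj e n x"
  by (simp add: proj_def[of e n "proj e n x"] proj_inner_onb) (simp add: proj_def)

end

lemma Cauchy_le_incseq:
  fixes m :: "nat \<Rightarrow> 'a::real_normed_vector" and s :: "nat \<Rightarrow> real"
  assumes "\<And>i j. i \<le> j \<Longrightarrow> (norm (m j - m i))\<^sup>2 \<le> s j - s i" and "convergent s"
  shows "Cauchy m"
proof (rule CauchyI')
  fix r :: real assume "r > 0"
  then have "r\<^sup>2 > 0" by simp
  from assms(2) have "Cauchy s" by (simp add: Cauchy_convergent_iff)
  then obtain M where M: "\<And>i j. i \<ge> M \<Longrightarrow> j \<ge> M \<Longrightarrow> norm (s i - s j) < r\<^sup>2"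
    using CauchyD[OF _ \<open>r\<^sup>2 > 0\<close>] by blast
  have "dist (m i) (m j) < r" if "i \<ge> M" "i < j" for i j
  proof -
    have "(norm (m j - m i))\<^sup>2 < r\<^sup>2"
      using assms(1)[of i j] M[of j i] that by auto
    then show ?thesis using \<open>r > 0\<close> by (simp add: dist_norm norm_minus_commute power_less_imp_less_base)
  qed
  then show "\<exists>M. \<forall>i\<ge>M. \<forall>j>i. dist (m i) (m j) < r" by blast
qed

fun gram_schmidt :: "(nat \<Rightarrow> 'a::real_inner) \<Rightarrow> nat \<Rightarrow> 'a" where
  "gram_schmidt d k = sgn (d k - (\<Sum>i<k. (d k \<bullet> gram_schmidt d i) *\<^sub>R gram_schmidt d i))"

declare gram_schmidt.simps [simp del]

lemma gram_schmidt_unit: "norm (gram_schmidt d k) = 1 \<or> gram_schmidt d k = 0"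
proof -
  have "gram_schmidt d k = sgn (d k - (\<Sum>i<k. (d k \<bullet> gram_schmidt d i) *\<^sub>R gram_schmidt d i))"
    by (rule gram_schmidt.simps)
  then show ?thesis by (metis norm_sgn sgn_zero_iff)
qed

lemma gram_schmidt_ortho_less: "i < k \<Longrightarrow> gram_schmidt d k \<bullet> gram_schmidt d i = 0"
proof (induction k arbitrary: i rule: less_induct)
  case (less k)
  let ?g = "gram_schmidt d"
  have "(\<Sum>j<k. (d k \<bullet> ?g j) * (?g j \<bullet> ?g i)) = (\<Sum>j<k. if j = i then d k \<bullet> ?g i else 0)"
  proof (rule sum.cong[OF refl])
    fix j assume "j \<in> {..<k}"
    then show "(d k \<bullet> ?g j) * (?g j \<bullet> ?g i) = (if j = i then d k \<bullet> ?g i else 0)"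
      using less.IH[of j i] less.IH[of i j] less.prems gram_schmidt_unit[of d i]
      by (cases i j rule: linorder_cases) (auto simp: inner_commute dot_square_norm)
  qed
  then have "(d k - (\<Sum>j<k. (d k \<bullet> ?g j) *\<^sub>R ?g j)) \<bullet> ?g i = 0"
    using less.prems by (simp add: inner_diff_left inner_sum_left)
  then show ?case by (subst gram_schmidt.simps[of d k]) (simp add: sgn_div_norm)
qed

lemma gram_schmidt_ortho: "i \<noteq> k \<Longrightarrow> gram_schmidt d i \<bullet> gram_schmidt d k = 0"
  by (metis gram_schmidt_ortho_less inner_commute linorder_neqE_nat)

lemma gram_schmidt_in:
  assumes "subspace V" "\<And>k. d k \<in> V" shows "gram_schmidt d k \<in> V"
proof (induction k rule: less_induct)
  case (less k)
  show ?case
    by (subst gram_schmidt.simps[of d k])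
      (auto simp: sgn_div_norm intro!: subspace_mul subspace_diff subspace_sum assms less)
qed

lemma in_span_gram_schmidt: "d k \<in> span (range (gram_schmidt d))"
proof -
  let ?g = "gram_schmidt d"
  define r where "r = d k - (\<Sum>i<k. (d k \<bullet> ?g i) *\<^sub>R ?g i)"
  have "?g k = sgn r" unfolding r_def by (rule gram_schmidt.simps)
  then have "norm r *\<^sub>R ?g k = r" by (cases "r = 0") (simp_all add: sgn_div_norm)
  then have "d k = norm r *\<^sub>R ?g k + (\<Sum>i<k. (d k \<bullet> ?g i) *\<^sub>R ?g i)"
    by (simp add: r_def)
  also have "\<dots> \<in> span (range ?g)"
    by (intro span_add span_scale span_sum) (auto intro: span_base)
  finally show ?thesis .
qed

lemma onb_seq_in_dense_subspace:
  fixes V :: "'a::{real_inner, polish_space} set"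
  assumes "subspace V" "closure V = UNIV"
  obtains e where "onb_seq e" "\<And>i. e i \<in> V"
proof -
  obtain T where T: "countable T" "T \<subseteq> V" "V \<subseteq> closure T" using separable[of V] by metis
  have ne: "T \<noteq> {}" using T assms(2) by auto
  define d where "d = from_nat_into T"
  have rd: "range d = T" using T ne by (simp add: d_def range_from_nat_into)
  have "onb_seq (gram_schmidt d)"
  proof (rule onb_seqI)
    have "T \<subseteq> span (range (gram_schmidt d))" using in_span_gram_schmidt rd by blast
    then have "closure T \<subseteq> closure (span (range (gram_schmidt d)))" by (rule closure_mono)
    moreover have "closure T = UNIV"
      using closure_mono[OF T(3)] assms(2) by auto
    ultimately show "closure (span (range (gram_schmidt d))) = UNIV" by blast
  qed (use gram_schmidt_ortho gram_schmidt_unit in \<open>blast+\<close>)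
  then show thesis
    using that gram_schmidt_in[OF assms(1), of d] rd T(2) by blast
qed

lemma is_onb_std_onb: "is_onb (std_onb :: 'a::{real_inner, polish_space} set)"
proof -
  obtain e :: "nat \<Rightarrow> 'a" where e: "onb_seq e"
    using onb_seq_in_dense_subspace[of UNIV] by auto
  have "is_onb (range e - {0})"
    unfolding is_onb_def
  proof (intro conjI ballI)
    show "pairwise orthogonal (range e - {0})"
      unfolding pairwise_def orthogonal_def
    proof (intro ballI impI)
      fix x y assume "x \<in> range e - {0}" "y \<in> range e - {0}" "x \<noteq> y"
      then obtain i j where "x = e i" "y = e j" "i \<noteq> j" by blast
      then show "x \<bullet> y = 0" using onb_ortho[OF e, of i j] by simp
    qed
    show "norm x = 1" if "x \<in> range e - {0}" for x
      using that onb_unit[OF e] by auto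
    have "x \<in> closure (span (range e - {0}))" for x
      unfolding closure_sequential
    proof (intro exI conjI allI)
      show "proj e n x \<in> span (range e - {0})" for n
        unfolding proj_def
        by (intro span_sum span_scale) (metis Diff_iff rangeI singletonD span_base span_zero)
      show "(\<lambda>n. proj e n x) \<longlonglongrightarrow> x" by (rule proj_tendsto[OF e])
    qed
    then show "closure (span (range e - {0})) = UNIV" by auto
  qed
  then show ?thesis unfolding std_onb_def by (rule someI)
qed

lemma countable_std_onb: "countable (std_onb :: 'a::{real_inner, polish_space} set)"
proof -
  let ?B = "std_onb :: 'a set"
  have d: "2 \<le> (dist x y)\<^sup>2" if "x \<in> ?B" "y \<in> ?B" "x \<noteq> y" for x y
  proof -
    have "x \<bullet> y = 0" "norm x = 1" "norm y = 1"
      using is_onb_std_onb that by (auto simp: is_onb_def pairwise_def orthogonal_def)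
    then have "(norm (x + - y))\<^sup>2 = 2"
      using norm_add_Pythagorean[of x "- y"] by (simp add: orthogonal_def)
    then show ?thesis by (simp add: dist_norm)
  qed
  have inj: "inj_on (\<lambda>x. ball x (1/2)) ?B"
  proof (rule inj_onI, rule ccontr)
    fix x y assume xy: "x \<in> ?B" "y \<in> ?B" "ball x (1/2) = ball y (1/2)" "x \<noteq> y"
    then have "dist x y < 1/2" by (metis centre_in_ball half_gt_zero_iff mem_ball zero_less_one)
    then have "(dist x y)\<^sup>2 < 1" by (simp add: power_less_one_iff)
    then show False using d[OF xy(1,2,4)] by simp
  qed
  have "disjoint ((\<lambda>x. ball x (1/2)) ` ?B)"
  proof (rule disjointI)
    fix a b assume "a \<in> (\<lambda>x. ball x (1/2)) ` ?B" "b \<in> (\<lambda>x. ball x (1/2)) ` ?B" "a \<noteq> b"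
    then obtain x y where xy: "a = ball x (1/2)" "b = ball y (1/2)" "x \<in> ?B" "y \<in> ?B" "x \<noteq> y" by auto
    have "False" if "dist x z < 1/2" "dist y z < 1/2" for z
    proof -
      have "dist x y < 1" using dist_triangle2[of x y z] that by linarith
      then have "(dist x y)\<^sup>2 < 1" by (simp add: power_less_one_iff)
      then show False using d[OF xy(3,4,5)] by simp
    qed
    then show "a \<inter> b = {}" using xy by auto
  qed
  then have "countable ((\<lambda>x. ball x (1/2)) ` ?B)"
    by (intro countable_disjoint_open_subsets) auto
  then show ?thesis using inj by (rule countable_image_inj_on)
qed

definition sb :: "nat \<Rightarrow> 'a::{real_inner, polish_space}" where
  "sb i = (if i \<in> to_nat_on (std_onb :: 'a set) ` std_onb then from_nat_into std_onb i else 0)"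

lemma sb_to_nat: "b \<in> (std_onb :: 'a::{real_inner, polish_space} set) \<Longrightarrow> sb (to_nat_on (std_onb :: 'a set) b) = b"
  by (auto simp: sb_def from_nat_into_to_nat_on[OF countable_std_onb])

lemma has_sum_std_onb_iff:
  fixes g :: "'a::{real_inner, polish_space} \<Rightarrow> real"
  assumes "g 0 = 0"
  shows "(g has_sum s) std_onb \<longleftrightarrow> ((\<lambda>i. g (sb i)) has_sum s) UNIV"
proof -
  let ?J = "to_nat_on (std_onb :: 'a set) ` std_onb"
  have "((\<lambda>i. g (sb i)) has_sum s) UNIV \<longleftrightarrow> ((\<lambda>i. g (sb i)) has_sum s) ?J"
    by (rule has_sum_cong_neutral) (use assms in \<open>auto simp: sb_def\<close>)
  also have "\<dots> \<longleftrightarrow> (((\<lambda>i. g (sb i)) \<circ> to_nat_on (std_onb :: 'a set)) has_sum s) std_onb"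
    by (rule has_sum_reindex) (rule inj_on_to_nat_on[OF countable_std_onb])
  also have "\<dots> \<longleftrightarrow> (g has_sum s) std_onb"
    by (rule has_sum_cong) (simp add: sb_to_nat)
  finally show ?thesis by simp
qed

lemma onb_seq_sb: "onb_seq (sb :: nat \<Rightarrow> 'a::{real_inner, polish_space})"
proof (rule onb_seqI)
  let ?B = "std_onb :: 'a set"
  have B: "pairwise orthogonal ?B" "\<And>e. e \<in> ?B \<Longrightarrow> norm e = 1" "closure (span ?B) = UNIV"
    using is_onb_std_onb[where 'a='a] by (auto simp: is_onb_def)
  have c: "(\<exists>b\<in>?B. i = to_nat_on ?B b \<and> sb i = b) \<or> sb i = (0::'a)" for i
  proof (cases "i \<in> to_nat_on ?B ` ?B")
    case True
    then show ?thesis using sb_to_nat[where 'a='a] by blast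
  qed (simp add: sb_def)
  show "sb i \<bullet> (sb j::'a) = 0" if "i \<noteq> j" for i j
  proof (cases "sb i = (0::'a) \<or> sb j = (0::'a)")
    case False
    then obtain b b' where "b \<in> ?B" "i = to_nat_on ?B b" "sb i = b" "b' \<in> ?B" "j = to_nat_on ?B b'" "sb j = b'"
      using c[of i] c[of j] by blast
    then show ?thesis using that B(1) by (auto simp: pairwise_def orthogonal_def)
  qed auto
  show "norm (sb i :: 'a) = 1 \<or> sb i = (0::'a)" for i
    using c[of i] B(2) by auto
  have "?B \<subseteq> range sb" using sb_to_nat by (metis rangeI subsetI)
  then have "closure (span ?B) \<subseteq> closure (span (range sb))" by (intro closure_mono span_mono)
  then show "closure (span (range (sb :: nat \<Rightarrow> 'a))) = UNIV" using B(3) by auto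
qed

lemma hilbert_schmidt_iff:
  fixes T :: "'a::{real_inner, polish_space} \<Rightarrow> 'a"
  shows "hilbert_schmidt T \<longleftrightarrow> bounded_linear T \<and> summable (\<lambda>i. (norm (T (sb i)))\<^sup>2)"
proof -
  { assume T: "bounded_linear T"
    have "(\<lambda>e. (norm (T e))\<^sup>2) summable_on std_onb \<longleftrightarrow> (\<lambda>i. (norm (T (sb i)))\<^sup>2) summable_on UNIV"
      unfolding summable_on_def by (subst has_sum_std_onb_iff) (auto simp: linear_0[OF bounded_linear.linear[OF T]])
    also have "\<dots> \<longleftrightarrow> summable (\<lambda>i. (norm (T (sb i)))\<^sup>2)"
      by (rule summable_on_UNIV_nonneg_real_iff) simp
    finally have "(\<lambda>e. (norm (T e))\<^sup>2) summable_on std_onb \<longleftrightarrow> summable (\<lambda>i. (norm (T (sb i)))\<^sup>2)" . }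
  then show ?thesis unfolding hilbert_schmidt_def by auto
qed

lemma infsum_std_onb_eq:
  fixes g :: "'a::{real_inner, polish_space} \<Rightarrow> real"
  assumes "g 0 = 0" "summable (\<lambda>i. \<bar>g (sb i)\<bar>)"
  shows "(\<Sum>\<^sub>\<infinity>b\<in>std_onb. g b) = (\<Sum>i. g (sb i))"
proof (rule infsumI)
  show "(g has_sum (\<Sum>i. g (sb i))) std_onb"
    unfolding has_sum_std_onb_iff[where g=g, OF assms(1)]
    by (rule norm_summable_imp_has_sum) (use assms(2) summable_rabs_cancel[OF assms(2)] in \<open>auto intro: summable_sums\<close>)
qed

lemma hs_norm_eq:
  fixes T :: "'a::{real_inner, polish_space} \<Rightarrow> 'a"
  assumes "hilbert_schmidt T"
  shows "hs_norm T = sqrt (\<Sum>i. (norm (T (sb i)))\<^sup>2)"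
  unfolding hs_norm_def using assms
  by (subst infsum_std_onb_eq) (auto simp: hilbert_schmidt_iff linear_0[OF bounded_linear.linear])

lemma op_trace_eq:
  fixes T :: "'a::{real_inner, polish_space} \<Rightarrow> 'a"
  assumes "summable (\<lambda>i. \<bar>T (sb i) \<bullet> sb i\<bar>)"
  shows "op_trace T = (\<Sum>i. T (sb i) \<bullet> sb i)"
  unfolding op_trace_def using assms by (subst infsum_std_onb_eq) auto

lemma riesz_representation:
  fixes \<phi> :: "'a::{real_inner, polish_space} \<Rightarrow> real"
  assumes "bounded_linear \<phi>"
  obtains m where "\<And>x. \<phi> x = x \<bullet> m"
proof -
  interpret \<phi>: bounded_linear \<phi> by fact
  obtain e :: "nat \<Rightarrow> 'a" where e: "onb_seq e"
    using onb_seq_in_dense_subspace[of UNIV] by auto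
  obtain K where K: "\<And>x. norm (\<phi> x) \<le> norm x * K" "K > 0" using \<phi>.pos_bounded by blast
  define m where "m n = (\<Sum>i<n. \<phi> (e i) *\<^sub>R e i)" for n
  define s where "s n = (\<Sum>i<n. (\<phi> (e i))\<^sup>2)" for n
  have ms: "(norm (m n))\<^sup>2 \<le> s n" for n
    unfolding m_def s_def by (rule onb_norm_sum[OF e])
  have "s n \<le> K\<^sup>2" for n
  proof -
    have "s n = \<phi> (m n)"
      by (simp add: m_def s_def \<phi>.sum \<phi>.scaleR power2_eq_square)
    also have "\<dots> \<le> norm (m n) * K" using K(1)[of "m n"] by simp
    finally have "s n \<le> norm (m n) * K" .
    then have "s n * s n \<le> (norm (m n) * K) * (norm (m n) * K)"
    proof -
      have "0 \<le> s n" by (simp add: s_def sum_nonneg)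
      with \<open>s n \<le> norm (m n) * K\<close> show ?thesis by (intro mult_mono) auto
    qed
    also have "\<dots> \<le> s n * K\<^sup>2" using ms[of n] K(2)
      by (simp add: power2_eq_square mult_ac mult_left_mono)
    finally show ?thesis
      by (cases "s n > 0") (use K in \<open>auto simp: not_less power2_eq_square intro: order_trans[of _ 0]\<close>)
  qed
  moreover have "incseq s" by (auto simp: s_def incseq_Suc_iff)
  ultimately have "convergent s" by (metis incseq_convergent convergentI)
  moreover have "(norm (m j - m i))\<^sup>2 \<le> s j - s i" if "i \<le> j" for i j
  proof -
    have *: "sum f {..<j} - sum f {..<i} = (\<Sum>k<j. if i \<le> k then f k else 0)" for f :: "nat \<Rightarrow> 'b::real_vector"
    proof -
      have "{..<j} = {..<i} \<union> {i..<j}" using that by auto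
      then have "sum f {..<j} = sum f {..<i} + sum f {i..<j}"
  by (simp add: sum.union_disjoint ivl_disj_int)
      moreover have "(\<Sum>k<j. if i \<le> k then f k else 0) = sum f {i..<j}"
        by (rule sum.mono_neutral_cong_right) auto
      ultimately show ?thesis by simp
    qed
    have "m j - m i = (\<Sum>k<j. (if i \<le> k then \<phi> (e k) else 0) *\<^sub>R e k)"
      unfolding m_def * by (rule sum.cong) auto
    also have "(norm \<dots>)\<^sup>2 \<le> (\<Sum>k<j. (if i \<le> k then \<phi> (e k) else 0)\<^sup>2)"
      by (rule onb_norm_sum[OF e])
    also have "\<dots> = s j - s i" unfolding s_def * by (rule sum.cong) auto
    finally show ?thesis .
  qed
  ultimately have "Cauchy m" by (intro Cauchy_le_incseq[of m s])
  then obtain l where l: "m \<longlonglongrightarrow> l" by (auto simp: Cauchy_convergent_iff convergent_def)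
  have "\<phi> x = x \<bullet> l" for x
  proof (rule LIMSEQ_unique)
    show "(\<lambda>n. \<phi> (proj e n x)) \<longlonglongrightarrow> \<phi> x" by (intro \<phi>.tendsto proj_tendsto e)
    have "\<phi> (proj e n x) = x \<bullet> m n" for n
      by (simp add: proj_def m_def \<phi>.sum \<phi>.scaleR inner_sum_right mult.commute)
    then show "(\<lambda>n. \<phi> (proj e n x)) \<longlonglongrightarrow> x \<bullet> l" using l by (auto intro!: tendsto_intros)
  qed
  then show thesis by (rule that)
qed

lemma adjoint_inner:
  fixes T :: "'a::{real_inner, polish_space} \<Rightarrow> 'b::real_inner"
  assumes "bounded_linear T"
  shows "T x \<bullet> y = x \<bullet> adjoint T y"
proof -
  have "\<exists>m. \<forall>x. T x \<bullet> y = x \<bullet> m" for y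
  proof -
    have "bounded_linear (\<lambda>x. T x \<bullet> y)"
      using assms by (intro bounded_linear_compose[OF bounded_linear_inner_left])
    from riesz_representation[OF this] show ?thesis by metis
  qed
  then have "\<exists>f. \<forall>x y. T x \<bullet> y = x \<bullet> f y" by metis
  then have "\<forall>x y. T x \<bullet> y = x \<bullet> adjoint T y" unfolding adjoint_def by (rule someI_ex)
  then show ?thesis by blast
qed

lemma inner_le_imp_norm_le:
  fixes x :: "'a::real_inner"
  assumes "\<And>v. v \<bullet> x \<le> c * norm v" "0 \<le> c"
  shows "norm x \<le> c"
proof (cases "x = 0")
  case False
  have "norm x * norm x \<le> c * norm x" using assms(1)[of x] by (simp add: dot_square_norm power2_eq_square)
  then show ?thesis using False by simp
qed (use assms in auto)

lemma norm_adjoint_le: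
  fixes T :: "'a::{real_inner, polish_space} \<Rightarrow> 'b::real_inner"
  assumes "bounded_linear T" "\<And>x. norm (T x) \<le> M * norm x" "0 \<le> M"
  shows "norm (adjoint T y) \<le> M * norm y"
proof (rule inner_le_imp_norm_le)
  show "v \<bullet> adjoint T y \<le> M * norm y * norm v" for v
    using adjoint_inner[OF assms(1), of v y] norm_cauchy_schwarz[of "T v" y]
      mult_right_mono[OF assms(2)[of v], of "norm y"] by (simp add: mult_ac)
qed (use assms in auto)

lemma summable_mult_square:
  fixes a b :: "nat \<Rightarrow> real"
  assumes a: "summable (\<lambda>i. (a i)\<^sup>2)" and b: "summable (\<lambda>i. (b i)\<^sup>2)"
  shows "summable (\<lambda>i. \<bar>a i * b i\<bar>)"
    and "(\<Sum>i. \<bar>a i * b i\<bar>) \<le> sqrt (\<Sum>i. (a i)\<^sup>2) * sqrt (\<Sum>i. (b i)\<^sup>2)"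
proof -
  have *: "(\<Sum>i<n. \<bar>a i * b i\<bar>) \<le> sqrt (\<Sum>i. (a i)\<^sup>2) * sqrt (\<Sum>i. (b i)\<^sup>2)" for n
  proof -
    have "(\<Sum>i<n. \<bar>a i * b i\<bar>) \<le> L2_set a {..<n} * L2_set b {..<n}"
      using L2_set_mult_ineq[of a b "{..<n}"] by (simp add: abs_mult)
    also have "\<dots> \<le> sqrt (\<Sum>i. (a i)\<^sup>2) * sqrt (\<Sum>i. (b i)\<^sup>2)"
      unfolding L2_set_def
      by (intro mult_mono real_sqrt_le_mono sum_le_suminf a b) (auto intro!: sum_nonneg suminf_nonneg a b)
    finally show ?thesis .
  qed
  show s: "summable (\<lambda>i. \<bar>a i * b i\<bar>)"
    by (rule summableI_nonneg_bounded[OF _ *]) simp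
  show "(\<Sum>i. \<bar>a i * b i\<bar>) \<le> sqrt (\<Sum>i. (a i)\<^sup>2) * sqrt (\<Sum>i. (b i)\<^sup>2)"
    by (rule suminf_le_const[OF s *])
qed

lemma summable_inner_square:
  fixes a b :: "nat \<Rightarrow> 'a::real_inner"
  assumes a: "summable (\<lambda>i. (norm (a i))\<^sup>2)" and b: "summable (\<lambda>i. (norm (b i))\<^sup>2)"
  shows "summable (\<lambda>i. \<bar>a i \<bullet> b i\<bar>)"
    and "\<bar>\<Sum>i. a i \<bullet> b i\<bar> \<le> sqrt (\<Sum>i. (norm (a i))\<^sup>2) * sqrt (\<Sum>i. (norm (b i))\<^sup>2)"
proof -
  note m = summable_mult_square[OF a b]
  have le: "\<bar>a i \<bullet> b i\<bar> \<le> \<bar>norm (a i) * norm (b i)\<bar>" for i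
    using Cauchy_Schwarz_ineq2[of "a i" "b i"] by simp
  show s: "summable (\<lambda>i. \<bar>a i \<bullet> b i\<bar>)"
    by (rule summable_comparison_test'[OF m(1), of 0]) (use le in auto)
  have "\<bar>\<Sum>i. a i \<bullet> b i\<bar> \<le> (\<Sum>i. \<bar>a i \<bullet> b i\<bar>)" by (rule summable_rabs[OF s])
  also have "\<dots> \<le> (\<Sum>i. \<bar>norm (a i) * norm (b i)\<bar>)" by (rule suminf_le[OF le s m(1)])
  finally show "\<bar>\<Sum>i. a i \<bullet> b i\<bar> \<le> sqrt (\<Sum>i. (norm (a i))\<^sup>2) * sqrt (\<Sum>i. (norm (b i))\<^sup>2)"
    using m(2) by linarith
qed

lemma bounded_linear_bound:
  assumes "bounded_linear T"
  obtains M where "M \<ge> 0" "\<And>x. norm (T x) \<le> M * norm x"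
proof -
  obtain K where "0 \<le> K" "\<forall>x. norm (T x) \<le> norm x * K"
    using bounded_linear.nonneg_bounded[OF assms] by blast
  then show thesis by (intro that[of K]) (auto simp: mult.commute)
qed

lemma bounded_linear_adjoint:
  fixes T :: "'a::{real_inner, polish_space} \<Rightarrow> 'b::real_inner"
  assumes "bounded_linear T"
  shows "bounded_linear (adjoint T)"
proof -
  obtain M where M: "M \<ge> 0" "\<And>x. norm (T x) \<le> M * norm x" using bounded_linear_bound[OF assms] by blast
  show ?thesis
  proof (rule bounded_linear_intro)
    show "adjoint T (x + y) = adjoint T x + adjoint T y" for x y
      by (rule vector_eq_ldot[THEN iffD1], rule allI)
        (simp add: adjoint_inner[OF assms, symmetric] inner_right_distrib)
    show "adjoint T (c *\<^sub>R x) = c *\<^sub>R adjoint T x" for c x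
      by (rule vector_eq_ldot[THEN iffD1], rule allI)
        (simp add: adjoint_inner[OF assms, symmetric])
    show "norm (adjoint T x) \<le> norm x * M" for x
      using norm_adjoint_le[OF assms M(2) M(1), of x] by (simp add: mult.commute)
  qed
qed

lemma square_summable_adjoint:
  assumes e: "onb_seq e" and e': "onb_seq e'"
    and T: "\<And>x y. T x \<bullet> y = x \<bullet> T' y"
    and s: "summable (\<lambda>i. (norm (T (e i)))\<^sup>2)"
  shows "(\<Sum>j<n. (norm (T' (e' j)))\<^sup>2) \<le> (\<Sum>i. (norm (T (e i)))\<^sup>2)"
proof -
  have sm: "(\<lambda>i. (T (e i) \<bullet> e' j)\<^sup>2) sums (norm (T' (e' j)))\<^sup>2" for j
    using parseval_norm[OF e, of "T' (e' j)"] T[of _ "e' j"] by (simp add: inner_commute[of "T' (e' j)"])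
  have "(\<lambda>i. \<Sum>j<n. (T (e i) \<bullet> e' j)\<^sup>2) sums (\<Sum>j<n. (norm (T' (e' j)))\<^sup>2)"
    by (rule sums_sum) (rule sm)
  then have "(\<Sum>j<n. (norm (T' (e' j)))\<^sup>2) = (\<Sum>i. \<Sum>j<n. (T (e i) \<bullet> e' j)\<^sup>2)"
    and s2: "summable (\<lambda>i. \<Sum>j<n. (T (e i) \<bullet> e' j)\<^sup>2)"
    by (auto simp: sums_iff)
  moreover have "(\<Sum>i. \<Sum>j<n. (T (e i) \<bullet> e' j)\<^sup>2) \<le> (\<Sum>i. (norm (T (e i)))\<^sup>2)"
    by (rule suminf_le[OF bessel[OF e'] s2 s])
  ultimately show ?thesis by simp
qed

lemma hs_bounded_linear: "hilbert_schmidt T \<Longrightarrow> bounded_linear T"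
  by (simp add: hilbert_schmidt_def)

lemma hs_norm_sums:
  fixes T :: "'a::{real_inner, polish_space} \<Rightarrow> 'a"
  assumes "hilbert_schmidt T"
  shows "(\<lambda>i. (norm (T (sb i)))\<^sup>2) sums (hs_norm T)\<^sup>2"
proof -
  have s: "summable (\<lambda>i. (norm (T (sb i)))\<^sup>2)" using assms by (simp add: hilbert_schmidt_iff)
  then have "0 \<le> (\<Sum>i. (norm (T (sb i)))\<^sup>2)" by (intro suminf_nonneg) auto
  then show ?thesis using s by (simp add: hs_norm_eq[OF assms] summable_sums)
qed

lemma hs_norm_nonneg: "0 \<le> hs_norm T"
  unfolding hs_norm_def by (simp add: infsum_nonneg)

lemma hs_partial_le:
  fixes T :: "'a::{real_inner, polish_space} \<Rightarrow> 'a"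
  assumes "hilbert_schmidt T"
  shows "(\<Sum>i<n. (norm (T (sb i)))\<^sup>2) \<le> (hs_norm T)\<^sup>2"
  using sum_le_suminf[OF sums_summable[OF hs_norm_sums[OF assms]], of "{..<n}"]
    sums_unique[OF hs_norm_sums[OF assms]] by simp

lemma hsI:
  fixes T :: "'a::{real_inner, polish_space} \<Rightarrow> 'a"
  assumes "bounded_linear T" and le: "\<And>n. (\<Sum>i<n. (norm (T (sb i)))\<^sup>2) \<le> c\<^sup>2" and "0 \<le> c"
  shows "hilbert_schmidt T" "hs_norm T \<le> c"
proof -
  have s: "summable (\<lambda>i. (norm (T (sb i)))\<^sup>2)"
    by (rule summableI_nonneg_bounded[OF _ le]) simp
  then show T: "hilbert_schmidt T" using assms by (simp add: hilbert_schmidt_iff)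
  have "(hs_norm T)\<^sup>2 \<le> c\<^sup>2"
    using suminf_le_const[OF s le] sums_unique[OF hs_norm_sums[OF T]] by simp
  then show "hs_norm T \<le> c" using \<open>0 \<le> c\<close> by (simp add: abs_le_square_iff[symmetric] hs_norm_nonneg)
qed

lemma hs_adjoint_pair:
  fixes T :: "'a::{real_inner, polish_space} \<Rightarrow> 'a"
  assumes T: "hilbert_schmidt T" and T': "bounded_linear T'" and a: "\<And>x y. T x \<bullet> y = x \<bullet> T' y"
  shows "hilbert_schmidt T'" "hs_norm T' \<le> hs_norm T"
proof -
  have "(\<Sum>i<n. (norm (T' (sb i)))\<^sup>2) \<le> (hs_norm T)\<^sup>2" for n
    using square_summable_adjoint[OF onb_seq_sb onb_seq_sb, of T T', OF a sums_summable[OF hs_norm_sums[OF T]]]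
      sums_unique[OF hs_norm_sums[OF T]] by simp
  from hsI[OF T' this hs_norm_nonneg] show "hilbert_schmidt T'" "hs_norm T' \<le> hs_norm T" .
qed

lemma norm_le_hs_norm:
  fixes T :: "'a::{real_inner, polish_space} \<Rightarrow> 'a"
  assumes T: "hilbert_schmidt T"
  shows "norm (T x) \<le> hs_norm T * norm x"
proof -
  interpret T: bounded_linear T using T by (rule hs_bounded_linear)
  have *: "norm (T (proj sb n x)) \<le> hs_norm T * norm x" for n
  proof -
    have "norm (T (proj sb n x)) \<le> (\<Sum>i<n. \<bar>norm (T (sb i))\<bar> * \<bar>x \<bullet> sb i\<bar>)"
      unfolding proj_def T.sum T.scaleR
      by (rule sum_norm_le) (simp add: mult.commute)
    also have "\<dots> \<le> L2_set (\<lambda>i. norm (T (sb i))) {..<n} * L2_set (\<lambda>i. x \<bullet> sb i) {..<n}"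
      by (rule L2_set_mult_ineq)
    also have "\<dots> \<le> hs_norm T * norm x"
      unfolding L2_set_def
    proof (intro mult_mono)
      show "sqrt (\<Sum>i<n. (norm (T (sb i)))\<^sup>2) \<le> hs_norm T"
        by (rule real_le_lsqrt) (auto simp: hs_norm_nonneg hs_partial_le[OF T])
      show "sqrt (\<Sum>i<n. (x \<bullet> sb i)\<^sup>2) \<le> norm x"
        by (rule real_le_lsqrt) (auto simp: bessel[OF onb_seq_sb])
    qed (auto simp: hs_norm_nonneg sum_nonneg)
    finally show ?thesis .
  qed
  have "(\<lambda>n. norm (T (proj sb n x))) \<longlonglongrightarrow> norm (T x)"
    by (intro tendsto_norm T.tendsto proj_tendsto onb_seq_sb)
  then show ?thesis by (rule LIMSEQ_le_const2) (use * in auto)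
qed

lemma hs_add:
  fixes T R :: "'a::{real_inner, polish_space} \<Rightarrow> 'a"
  assumes T: "hilbert_schmidt T" and R: "hilbert_schmidt R"
  shows "hilbert_schmidt (\<lambda>v. T v + R v)" "hs_norm (\<lambda>v. T v + R v) \<le> hs_norm T + hs_norm R"
proof -
  have "(\<Sum>i<n. (norm (T (sb i) + R (sb i)))\<^sup>2) \<le> (hs_norm T + hs_norm R)\<^sup>2" for n
  proof -
    have "L2_set (\<lambda>i. norm (T (sb i) + R (sb i))) {..<n}
        \<le> L2_set (\<lambda>i. norm (T (sb i)) + norm (R (sb i))) {..<n}"
      by (rule L2_set_mono) (auto intro: norm_triangle_ineq)
    also have "\<dots> \<le> L2_set (\<lambda>i. norm (T (sb i))) {..<n} + L2_set (\<lambda>i. norm (R (sb i))) {..<n}"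
      by (rule L2_set_triangle_ineq)
    also have "\<dots> \<le> hs_norm T + hs_norm R"
      unfolding L2_set_def
      by (intro add_mono real_le_lsqrt) (auto simp: hs_norm_nonneg hs_partial_le[OF T] hs_partial_le[OF R])
    finally have "sqrt (\<Sum>i<n. (norm (T (sb i) + R (sb i)))\<^sup>2) \<le> hs_norm T + hs_norm R"
      by (simp add: L2_set_def)
    then show ?thesis by (rule sqrt_le_D)
  qed
  from hsI[OF bounded_linear_add[OF T[THEN hs_bounded_linear] R[THEN hs_bounded_linear]] this
      add_nonneg_nonneg[OF hs_norm_nonneg hs_norm_nonneg]]
  show "hilbert_schmidt (\<lambda>v. T v + R v)" "hs_norm (\<lambda>v. T v + R v) \<le> hs_norm T + hs_norm R" .
qed

lemma hs_comp_left:
  fixes T :: "'a::{real_inner, polish_space} \<Rightarrow> 'a"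
  assumes T: "hilbert_schmidt T" and R: "bounded_linear R" "\<And>x. norm (R x) \<le> M * norm x" "0 \<le> M"
  shows "hilbert_schmidt (\<lambda>v. R (T v))" "hs_norm (\<lambda>v. R (T v)) \<le> M * hs_norm T"
proof -
  have "(\<Sum>i<n. (norm (R (T (sb i))))\<^sup>2) \<le> (M * hs_norm T)\<^sup>2" for n
  proof -
    have "(\<Sum>i<n. (norm (R (T (sb i))))\<^sup>2) \<le> (\<Sum>i<n. M\<^sup>2 * (norm (T (sb i)))\<^sup>2)"
      by (rule sum_mono) (use R(2) power_mono[OF R(2) norm_ge_zero] in \<open>auto simp: power_mult_distrib\<close>)
    also have "\<dots> \<le> M\<^sup>2 * (hs_norm T)\<^sup>2"
      by (subst sum_distrib_left[symmetric]) (intro mult_left_mono hs_partial_le T, simp)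
    finally show ?thesis by (simp add: power_mult_distrib)
  qed
  from hsI[OF bounded_linear_compose[OF R(1) hs_bounded_linear[OF T]] this mult_nonneg_nonneg[OF R(3) hs_norm_nonneg]]
  show "hilbert_schmidt (\<lambda>v. R (T v))" "hs_norm (\<lambda>v. R (T v)) \<le> M * hs_norm T" .
qed

lemma hs_comp_right:
  fixes T :: "'a::{real_inner, polish_space} \<Rightarrow> 'a"
  assumes T: "hilbert_schmidt T" and R: "bounded_linear R" "\<And>x. norm (R x) \<le> M * norm x" "0 \<le> M"
  shows "hilbert_schmidt (\<lambda>v. T (R v))" "hs_norm (\<lambda>v. T (R v)) \<le> M * hs_norm T"
proof -
  note bT = hs_bounded_linear[OF T]
  note aT = hs_adjoint_pair[OF T bounded_linear_adjoint[OF bT] adjoint_inner[OF bT]]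
  note 1 = hs_comp_left[OF aT(1) bounded_linear_adjoint[OF R(1)] norm_adjoint_le[OF R] R(3)]
  have b: "bounded_linear (\<lambda>v. T (R v))" by (rule bounded_linear_compose[OF bT R(1)])
  have a: "adjoint R (adjoint T x) \<bullet> y = x \<bullet> T (R y)" for x y
    using adjoint_inner[OF bT, of "R y" x] adjoint_inner[OF R(1), of y "adjoint T x"]
    by (simp add: inner_commute)
  note 2 = hs_adjoint_pair[OF 1(1) b a]
  show "hilbert_schmidt (\<lambda>v. T (R v))" by (rule 2)
  have "hs_norm (\<lambda>v. T (R v)) \<le> M * hs_norm (adjoint T)" using 2(2) 1(2) by linarith
  also have "\<dots> \<le> M * hs_norm T" using aT(2) R(3) by (rule mult_left_mono)
  finally show "hs_norm (\<lambda>v. T (R v)) \<le> M * hs_norm T" .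
qed

lemma hs_scaleR:
  fixes T :: "'a::{real_inner, polish_space} \<Rightarrow> 'a"
  assumes T: "hilbert_schmidt T"
  shows "hilbert_schmidt (\<lambda>v. c *\<^sub>R T v)" "hs_norm (\<lambda>v. c *\<^sub>R T v) \<le> \<bar>c\<bar> * hs_norm T"
  using hs_comp_left[OF T bounded_linear_scaleR_right, of c "\<bar>c\<bar>"] by auto

lemma hs_diff:
  fixes T R :: "'a::{real_inner, polish_space} \<Rightarrow> 'a"
  assumes T: "hilbert_schmidt T" and R: "hilbert_schmidt R"
  shows "hilbert_schmidt (\<lambda>v. T v - R v)" "hs_norm (\<lambda>v. T v - R v) \<le> hs_norm T + hs_norm R"
  using hs_add[OF T hs_scaleR(1)[OF R, of "-1"]] hs_scaleR(2)[OF R, of "-1"] by auto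

lemma hs_rank_one:
  fixes h k :: "'a::{real_inner, polish_space}"
  shows "hilbert_schmidt (\<lambda>v. (v \<bullet> h) *\<^sub>R k)" "hs_norm (\<lambda>v. (v \<bullet> h) *\<^sub>R k) \<le> norm h * norm k"
proof -
  have "(\<Sum>i<n. (norm ((sb i \<bullet> h) *\<^sub>R k))\<^sup>2) \<le> (norm h * norm k)\<^sup>2" for n
  proof -
    have "(\<Sum>i<n. (norm ((sb i \<bullet> h) *\<^sub>R k))\<^sup>2) = (\<Sum>i<n. (h \<bullet> sb i)\<^sup>2) * (norm k)\<^sup>2"
      by (simp add: power_mult_distrib sum_distrib_right inner_commute)
    then show ?thesis
      using mult_right_mono[OF bessel[OF onb_seq_sb, where n=n and x=h], of "(norm k)\<^sup>2"]
      by (simp add: power_mult_distrib)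
  qed
  from hsI[OF bounded_linear_compose[OF bounded_linear_scaleR_left bounded_linear_inner_left] this
      mult_nonneg_nonneg[OF norm_ge_zero norm_ge_zero]]
  show "hilbert_schmidt (\<lambda>v. (v \<bullet> h) *\<^sub>R k)" "hs_norm (\<lambda>v. (v \<bullet> h) *\<^sub>R k) \<le> norm h * norm k" .
qed

lemma hs_zero: "hilbert_schmidt (\<lambda>v. 0 :: 'a::{real_inner, polish_space})"
  using hs_rank_one(1)[of 0 "0::'a"] by simp

context
  fixes Q :: "'a::{real_inner, polish_space} \<Rightarrow> 'a"
  assumes Q: "nonneg_sym_trace_class Q"
begin

lemma nst_linear: "bounded_linear Q" and nst_sym: "Q x \<bullet> y = x \<bullet> Q y" and nst_nonneg: "0 \<le> Q x \<bullet> x"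
  using Q by (auto simp: nonneg_sym_trace_class_def)

lemma nst_trace_summable: "summable (\<lambda>i. Q (sb i) \<bullet> sb i)"
proof -
  have "(\<lambda>e. Q e \<bullet> e) summable_on std_onb" using Q unfolding nonneg_sym_trace_class_def by blast
  then obtain s where "((\<lambda>e. Q e \<bullet> e) has_sum s) std_onb" by (auto simp: summable_on_def)
  then have "((\<lambda>i. Q (sb i) \<bullet> sb i) has_sum s) UNIV" by (subst (asm) has_sum_std_onb_iff) auto
  then show ?thesis by (auto dest: has_sum_imp_sums simp: summable_def)
qed

end

lemma psd_cauchy_schwarz:
  fixes Q :: "'a::real_inner \<Rightarrow> 'a"
  assumes "linear Q" and sym: "\<And>x y. Q x \<bullet> y = x \<bullet> Q y" and pos: "\<And>x. 0 \<le> Q x \<bullet> x"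
  shows "(Q x \<bullet> y)\<^sup>2 \<le> (Q x \<bullet> x) * (Q y \<bullet> y)"
proof -
  interpret Q: linear Q by fact
  have exp: "Q (y + t *\<^sub>R x) \<bullet> (y + t *\<^sub>R x) = Q y \<bullet> y + 2 * t * (Q x \<bullet> y) + t\<^sup>2 * (Q x \<bullet> x)" for t
    using sym[of x y] by (simp add: Q.add Q.scale inner_left_distrib inner_right_distrib power2_eq_square
      inner_commute algebra_simps)
  show ?thesis
  proof (cases "Q x \<bullet> x = 0")
    case True
    have "Q x \<bullet> y = 0"
    proof (rule ccontr)
      assume n: "Q x \<bullet> y \<noteq> 0"
      have "0 \<le> Q y \<bullet> y + 2 * t * (Q x \<bullet> y)" for t
        using pos[of "y + t *\<^sub>R x"] exp[of t] True by simp
      from this[of "- (Q y \<bullet> y + 1) / (2 * (Q x \<bullet> y))"] show False using n by (simp add: field_simps)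
    qed
    then show ?thesis using True by simp
  next
    case False
    then have p: "Q x \<bullet> x > 0" using pos[of x] by linarith
    have "0 \<le> Q y \<bullet> y + 2 * (- (Q x \<bullet> y) / (Q x \<bullet> x)) * (Q x \<bullet> y) + (- (Q x \<bullet> y) / (Q x \<bullet> x))\<^sup>2 * (Q x \<bullet> x)"
      using pos[of "y + (- (Q x \<bullet> y) / (Q x \<bullet> x)) *\<^sub>R x"] unfolding exp .
    also have "\<dots> = Q y \<bullet> y - (Q x \<bullet> y)\<^sup>2 / (Q x \<bullet> x)"
      using p by (simp add: power2_eq_square field_simps)
    finally show ?thesis using p by (simp add: field_simps)
  qed
qed

lemma nst_hilbert_schmidt:
  fixes Q :: "'a::{real_inner, polish_space} \<Rightarrow> 'a"
  assumes Q: "nonneg_sym_trace_class Q"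
  shows "hilbert_schmidt Q"
proof -
  obtain K where K: "K \<ge> 0" "\<And>x. norm (Q x) \<le> K * norm x" using bounded_linear_bound[OF nst_linear[OF Q]] by blast
  have le: "(norm (Q x))\<^sup>2 \<le> K * (Q x \<bullet> x)" for x
  proof (cases "Q x = 0")
    case False
    have "((norm (Q x))\<^sup>2)\<^sup>2 \<le> (Q x \<bullet> x) * (Q (Q x) \<bullet> Q x)"
      using psd_cauchy_schwarz[OF bounded_linear.linear[OF nst_linear[OF Q]] nst_sym[OF Q] nst_nonneg[OF Q], of x "Q x"]
      by (simp add: dot_square_norm)
    also have "\<dots> \<le> (Q x \<bullet> x) * (K * (norm (Q x))\<^sup>2)"
    proof (intro mult_left_mono nst_nonneg[OF Q])
      have "Q (Q x) \<bullet> Q x \<le> norm (Q (Q x)) * norm (Q x)" by (rule norm_cauchy_schwarz)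
      also have "\<dots> \<le> (K * norm (Q x)) * norm (Q x)" by (intro mult_right_mono K) simp
      finally show "Q (Q x) \<bullet> Q x \<le> K * (norm (Q x))\<^sup>2" by (simp add: power2_eq_square)
    qed
    finally have "(norm (Q x))\<^sup>2 * (norm (Q x))\<^sup>2 \<le> (K * (Q x \<bullet> x)) * (norm (Q x))\<^sup>2"
      by (simp add: power2_eq_square mult_ac)
    then show ?thesis by (rule mult_right_le_imp_le) (simp add: False)
  qed (simp add: K nst_nonneg[OF Q])
  have "summable (\<lambda>i. (norm (Q (sb i)))\<^sup>2)"
    by (rule summable_comparison_test'[OF summable_mult[OF nst_trace_summable[OF Q], of K], of 0])
      (use le in auto)
  then show ?thesis using nst_linear[OF Q] by (simp add: hilbert_schmidt_iff)
qed

lemma op_trace_comp: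
  fixes Q T :: "'a::{real_inner, polish_space} \<Rightarrow> 'a"
  assumes Q: "nonneg_sym_trace_class Q" and T: "hilbert_schmidt T"
  shows "(\<lambda>i. T (sb i) \<bullet> Q (sb i)) sums op_trace (\<lambda>v. Q (T v))"
    and "\<bar>op_trace (\<lambda>v. Q (T v))\<bar> \<le> hs_norm Q * hs_norm T"
proof -
  note s = hs_norm_sums[OF T] hs_norm_sums[OF nst_hilbert_schmidt[OF Q]]
  note m = summable_inner_square[OF s[THEN sums_summable]]
  have eq: "Q (T (sb i)) \<bullet> sb i = T (sb i) \<bullet> Q (sb i)" for i by (rule nst_sym[OF Q])
  have o: "op_trace (\<lambda>v. Q (T v)) = (\<Sum>i. T (sb i) \<bullet> Q (sb i))"
    using m(1) by (subst op_trace_eq) (simp_all add: eq)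
  then show "(\<lambda>i. T (sb i) \<bullet> Q (sb i)) sums op_trace (\<lambda>v. Q (T v))"
    using summable_rabs_cancel[OF m(1)] by (simp add: summable_sums)
  show "\<bar>op_trace (\<lambda>v. Q (T v))\<bar> \<le> hs_norm Q * hs_norm T"
    using m(2) o s[THEN sums_unique, symmetric] by (simp add: hs_norm_nonneg mult.commute)
qed

lemma op_trace_tendsto:
  fixes Q :: "'a::{real_inner, polish_space} \<Rightarrow> 'a"
  assumes Q: "nonneg_sym_trace_class Q"
    and T: "\<And>k. hilbert_schmidt (T k)" "\<And>k. hs_norm (T k) \<le> C" "hilbert_schmidt T'"
    and lim: "\<And>u v. (\<lambda>k. u \<bullet> T k v) \<longlonglongrightarrow> u \<bullet> T' v"
  shows "(\<lambda>k. op_trace (\<lambda>v. Q (T k v))) \<longlonglongrightarrow> op_trace (\<lambda>v. Q (T' v))"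
proof -
  define D where "D k v = T k v - T' v" for k v
  define C' where "C' = C + hs_norm T'"
  have D: "hilbert_schmidt (D k)" "hs_norm (D k) \<le> C'" for k
    unfolding D_def C'_def using hs_diff[OF T(1)[of k] T(3)] T(2)[of k] by auto
  have C': "0 \<le> C'" using D(2)[of 0] hs_norm_nonneg[of "D 0"] by linarith
  note sQ = hs_norm_sums[OF nst_hilbert_schmidt[OF Q]]
  have "(\<lambda>k. \<Sum>i. D k (sb i) \<bullet> Q (sb i)) \<longlonglongrightarrow> 0"
  proof (rule LIMSEQ_I)
    fix r :: real assume "r > 0"
    define \<delta> where "\<delta> = (r / (2 * (C' + 1)))\<^sup>2"
    have "\<delta> > 0" using \<open>r > 0\<close> C' by (simp add: \<delta>_def)
    obtain N where N: "norm (\<Sum>i. (norm (Q (sb (i + N))))\<^sup>2) < \<delta>"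
      using suminf_exist_split[OF \<open>\<delta> > 0\<close> sums_summable[OF sQ]] by blast
    have "(\<lambda>k. \<Sum>i<N. D k (sb i) \<bullet> Q (sb i)) \<longlonglongrightarrow> (\<Sum>i<N. 0)"
    proof (rule tendsto_sum)
      fix i
      have "(\<lambda>k. Q (sb i) \<bullet> T k (sb i) - Q (sb i) \<bullet> T' (sb i)) \<longlonglongrightarrow> Q (sb i) \<bullet> T' (sb i) - Q (sb i) \<bullet> T' (sb i)"
        by (intro tendsto_intros lim)
      then show "(\<lambda>k. D k (sb i) \<bullet> Q (sb i)) \<longlonglongrightarrow> 0"
        by (simp add: D_def inner_diff_right inner_commute[of _ "Q (sb i)"])
    qed
    then obtain K where K: "\<And>k. k \<ge> K \<Longrightarrow> norm (\<Sum>i<N. D k (sb i) \<bullet> Q (sb i)) < r / 2"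
      using LIMSEQ_D[of _ 0 "r/2"] \<open>r > 0\<close> by fastforce
    have "norm ((\<Sum>i. D k (sb i) \<bullet> Q (sb i)) - 0) < r" if "k \<ge> K" for k
    proof -
      note sD = hs_norm_sums[OF D(1)[of k]]
      have s: "summable (\<lambda>i. D k (sb i) \<bullet> Q (sb i))"
        using op_trace_comp(1)[OF Q D(1)] by (rule sums_summable)
      have sD': "summable (\<lambda>i. (norm (D k (sb (i + N))))\<^sup>2)" and sQ': "summable (\<lambda>i. (norm (Q (sb (i + N))))\<^sup>2)"
        using summable_ignore_initial_segment[OF sums_summable[OF sD], of N]
          summable_ignore_initial_segment[OF sums_summable[OF sQ], of N] by auto
      have "(\<Sum>i. (norm (D k (sb (i + N))))\<^sup>2) \<le> (hs_norm (D k))\<^sup>2"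
        using suminf_split_initial_segment[OF sums_summable[OF sD], of N] sums_unique[OF sD]
          sum_nonneg[of "{..<N}" "\<lambda>i. (norm (D k (sb i)))\<^sup>2"] by simp
      also have "\<dots> \<le> C'\<^sup>2" by (intro power_mono D hs_norm_nonneg)
      finally have "sqrt (\<Sum>i. (norm (D k (sb (i + N))))\<^sup>2) \<le> C'" using C' by (intro real_le_lsqrt) auto
      moreover have "sqrt (\<Sum>i. (norm (Q (sb (i + N))))\<^sup>2) \<le> r / (2 * (C' + 1))"
        using N \<open>r > 0\<close> C' by (intro real_le_lsqrt) (auto simp: \<delta>_def)
      ultimately have "sqrt (\<Sum>i. (norm (D k (sb (i + N))))\<^sup>2) * sqrt (\<Sum>i. (norm (Q (sb (i + N))))\<^sup>2)
          \<le> C' * (r / (2 * (C' + 1)))"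
        using C' by (intro mult_mono) (auto intro: suminf_nonneg sQ')
      then have "\<bar>\<Sum>i. D k (sb (i + N)) \<bullet> Q (sb (i + N))\<bar> \<le> C' * (r / (2 * (C' + 1)))"
        using summable_inner_square(2)[OF sD' sQ'] by linarith
      also have "\<dots> \<le> r / 2" using C' \<open>r > 0\<close> by (simp add: field_simps)
      finally show ?thesis
        using suminf_split_initial_segment[OF s, of N] K[OF that] by simp
    qed
    then show "\<exists>no. \<forall>k\<ge>no. norm ((\<Sum>i. D k (sb i) \<bullet> Q (sb i)) - 0) < r" by blast
  qed
  moreover have "(\<Sum>i. D k (sb i) \<bullet> Q (sb i)) = op_trace (\<lambda>v. Q (T k v)) - op_trace (\<lambda>v. Q (T' v))" for k
    using sums_diff[OF op_trace_comp(1)[OF Q T(1)[of k]] op_trace_comp(1)[OF Q T(3)]]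
    by (simp add: D_def inner_diff_left sums_iff)
  ultimately show ?thesis by (simp add: LIM_zero_iff)
qed

primrec cholesky :: "('a::{real_inner, polish_space} \<Rightarrow> 'a) \<Rightarrow> nat \<Rightarrow> 'a \<Rightarrow> 'a" where
  "cholesky Q 0 = Q"
| "cholesky Q (Suc k) = (\<lambda>x. cholesky Q k x -
     (x \<bullet> cholesky Q k (sb k) / (cholesky Q k (sb k) \<bullet> sb k)) *\<^sub>R cholesky Q k (sb k))"

lemma cholesky_step:
  fixes Q :: "'a::{real_inner, polish_space} \<Rightarrow> 'a"
  assumes Q: "nonneg_sym_trace_class Q"
  shows "linear (cholesky Q k) \<and> (\<forall>x y. cholesky Q k x \<bullet> y = x \<bullet> cholesky Q k y) \<and>
    (\<forall>x. 0 \<le> cholesky Q k x \<bullet> x) \<and> (\<forall>j<k. cholesky Q k (sb j) = 0)"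
proof (induction k)
  case 0
  then show ?case
    using nst_linear[OF Q] nst_sym[OF Q] nst_nonneg[OF Q] by (simp add: bounded_linear.linear)
next
  case (Suc k)
  let ?Q = "cholesky Q k" and ?e = "sb k :: 'a"
  from Suc have l: "linear ?Q" and sym: "\<And>x y. ?Q x \<bullet> y = x \<bullet> ?Q y" and pos: "\<And>x. 0 \<le> ?Q x \<bullet> x"
    and z: "\<And>j. j < k \<Longrightarrow> ?Q (sb j) = 0" by auto
  interpret l: linear ?Q by fact
  have cs: "(?Q x \<bullet> y)\<^sup>2 \<le> (?Q x \<bullet> x) * (?Q y \<bullet> y)" for x y by (rule psd_cauchy_schwarz[OF l sym pos])
  have zero: "?Q ?e = 0" if "?Q ?e \<bullet> ?e = 0"
    using cs[of ?e "?Q ?e"] that by simp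
  have "linear (cholesky Q (Suc k))"
    by (rule linearI) (simp_all add: l.add l.scale inner_left_distrib add_divide_distrib algebra_simps)
  moreover have "cholesky Q (Suc k) x \<bullet> y = x \<bullet> cholesky Q (Suc k) y" for x y
    using sym[of x y] by (simp add: inner_diff_left inner_diff_right inner_commute mult_ac)
  moreover have "0 \<le> cholesky Q (Suc k) x \<bullet> x" for x
  proof (cases "?Q ?e \<bullet> ?e = 0")
    case False
    then have "?Q ?e \<bullet> ?e > 0" using pos[of ?e] by linarith
    then show ?thesis using cs[of ?e x]
      by (simp add: inner_diff_left inner_diff_right power2_eq_square field_simps inner_commute)
  qed (simp add: zero pos)
  moreover have "cholesky Q (Suc k) (sb j) = 0" if "j < Suc k" for j
  proof (cases "j = k")
    case True
    then show ?thesis using zero by (cases "?Q ?e \<bullet> ?e = 0") (auto simp: inner_commute)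
  next
    case False
    then have "j < k" using that by simp
    then show ?thesis using z[of j] sym[of "sb j" ?e] by simp
  qed
  ultimately show ?case by blast
qed

lemma trace_class_sum_squares:
  fixes Q :: "'a::{real_inner, polish_space} \<Rightarrow> 'a"
  assumes Q: "nonneg_sym_trace_class Q"
  obtains q :: "nat \<Rightarrow> 'a" where "summable (\<lambda>k. (norm (q k))\<^sup>2)" "\<And>x. (\<lambda>k. (q k \<bullet> x)\<^sup>2) sums (Q x \<bullet> x)"
proof -
  let ?Q = "cholesky Q"
  note ch = cholesky_step[OF Q]
  define q where "q k = (1 / sqrt (?Q k (sb k) \<bullet> sb k)) *\<^sub>R ?Q k (sb k)" for k
  have sq: "(q k \<bullet> x)\<^sup>2 = (x \<bullet> ?Q k (sb k))\<^sup>2 / (?Q k (sb k) \<bullet> sb k)" for k x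
    using ch[of k] by (simp add: q_def power_divide power_mult_distrib inner_commute)
  have step: "?Q (Suc k) x \<bullet> x = ?Q k x \<bullet> x - (q k \<bullet> x)\<^sup>2" for k x
    unfolding sq by (simp add: inner_diff_left inner_diff_right power2_eq_square inner_commute[of _ x])
  have part: "(\<Sum>k<n. (q k \<bullet> x)\<^sup>2) = Q x \<bullet> x - ?Q n x \<bullet> x" for n x
    by (induction n) (use step in \<open>auto simp del: cholesky.simps(2)\<close>)
  obtain K where K: "K \<ge> 0" "\<And>x. norm (Q x) \<le> K * norm x" using bounded_linear_bound[OF nst_linear[OF Q]] by blast
  have lim: "(\<lambda>n. ?Q n x \<bullet> x) \<longlonglongrightarrow> 0" for x
  proof (rule tendsto_sandwich[where f="\<lambda>_. 0" and h="\<lambda>n. K * (norm (x - proj sb n x))\<^sup>2"])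
    let ?r = "\<lambda>n. x - proj sb n x"
    have "?Q n x \<bullet> x \<le> K * (norm (?r n))\<^sup>2" for n
    proof -
      interpret l: linear "?Q n" using ch by blast
      have "?Q n (proj sb n x) = 0"
        using ch[of n] by (simp add: proj_def l.sum l.scale)
      then have 1: "?Q n x = ?Q n (?r n)" by (simp add: l.diff)
      then have "?Q n x \<bullet> x = ?r n \<bullet> ?Q n x" using ch[of n] by simp
      also have "\<dots> = ?Q n (?r n) \<bullet> ?r n" by (simp add: 1 inner_commute)
      also have "\<dots> \<le> Q (?r n) \<bullet> ?r n" using part[where n=n and x="?r n"] sum_nonneg[of "{..<n}" "\<lambda>k. (q k \<bullet> ?r n)\<^sup>2"] by simp
      also have "\<dots> \<le> norm (Q (?r n)) * norm (?r n)" by (rule norm_cauchy_schwarz)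
      also have "\<dots> \<le> K * norm (?r n) * norm (?r n)" by (intro mult_right_mono K) simp
      finally show ?thesis by (simp add: power2_eq_square)
    qed
    then show "\<forall>\<^sub>F n in sequentially. ?Q n x \<bullet> x \<le> K * (norm (?r n))\<^sup>2" by simp
    have "(\<lambda>n. K * (norm (?r n))\<^sup>2) \<longlonglongrightarrow> K * (norm (x - x))\<^sup>2"
      by (intro tendsto_intros proj_tendsto onb_seq_sb)
    then show "(\<lambda>n. K * (norm (?r n))\<^sup>2) \<longlonglongrightarrow> 0" by simp
    show "\<forall>\<^sub>F n in sequentially. 0 \<le> ?Q n x \<bullet> x" using ch by (intro always_eventually) blast
  qed simp
  have sums: "(\<lambda>k. (q k \<bullet> x)\<^sup>2) sums (Q x \<bullet> x)" for x
    unfolding sums_def part using tendsto_diff[OF tendsto_const lim[of x], of "Q x \<bullet> x"] by simp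
  have "(\<Sum>k<n. (norm (q k))\<^sup>2) \<le> (\<Sum>j. Q (sb j) \<bullet> sb j)" for n
  proof -
    have s: "(\<lambda>j. \<Sum>k<n. (q k \<bullet> sb j)\<^sup>2) sums (\<Sum>k<n. (norm (q k))\<^sup>2)"
      by (rule sums_sum) (rule parseval_norm[OF onb_seq_sb])
    have "(\<Sum>k<n. (q k \<bullet> sb j)\<^sup>2) \<le> Q (sb j) \<bullet> sb j" for j
    proof -
      have "0 \<le> ?Q n (sb j) \<bullet> sb j" using ch[of n] by blast
      then show ?thesis unfolding part by simp
    qed
    then show ?thesis
      using suminf_le[OF _ sums_summable[OF s] nst_trace_summable[OF Q]] sums_unique[OF s] by simp
  qed
  then have "summable (\<lambda>k. (norm (q k))\<^sup>2)" by (intro summableI_nonneg_bounded) auto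
  then show thesis using sums by (rule that)
qed

section \<open>Weak integrals\<close>

text \<open>
  The Hilbert space is not of sort \<open>banach\<close>, so that its elements are integrated weakly, with the
  help of the Riesz representation.
\<close>
definition wint :: "'b measure \<Rightarrow> ('b \<Rightarrow> 'a::real_inner) \<Rightarrow> 'a" where
  "wint M f = (THE m. \<forall>v. v \<bullet> m = (\<integral>\<omega>. v \<bullet> f \<omega> \<partial>M))"

lemma inner_wint:
  fixes f :: "'b \<Rightarrow> 'a::{real_inner, polish_space}"
  assumes "finite_measure M" and [measurable]: "\<And>v. (\<lambda>\<omega>. v \<bullet> f \<omega>) \<in> borel_measurable M"
    and C: "\<And>\<omega>. \<omega> \<in> space M \<Longrightarrow> norm (f \<omega>) \<le> C"
  shows "v \<bullet> wint M f = (\<integral>\<omega>. v \<bullet> f \<omega> \<partial>M)"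
proof -
  interpret finite_measure M by fact
  have le: "\<bar>v \<bullet> f \<omega>\<bar> \<le> norm v * C" if "\<omega> \<in> space M" for v \<omega>
    using Cauchy_Schwarz_ineq2[of v "f \<omega>"] mult_left_mono[OF C[OF that], of "norm v"] by simp
  have int: "integrable M (\<lambda>\<omega>. v \<bullet> f \<omega>)" for v
    by (rule integrable_const_bound[where B="norm v * C"]) (use le in auto)
  have "bounded_linear (\<lambda>v. \<integral>\<omega>. v \<bullet> f \<omega> \<partial>M)"
  proof (rule bounded_linear_intro)
    show "(\<integral>\<omega>. (x + y) \<bullet> f \<omega> \<partial>M) = (\<integral>\<omega>. x \<bullet> f \<omega> \<partial>M) + (\<integral>\<omega>. y \<bullet> f \<omega> \<partial>M)" for x y
      by (simp add: inner_left_distrib int)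
    show "(\<integral>\<omega>. (r *\<^sub>R x) \<bullet> f \<omega> \<partial>M) = r *\<^sub>R (\<integral>\<omega>. x \<bullet> f \<omega> \<partial>M)" for r x
      by simp
    show "norm (\<integral>\<omega>. x \<bullet> f \<omega> \<partial>M) \<le> norm x * (C * measure M (space M))" for x
    proof -
      have "norm (\<integral>\<omega>. x \<bullet> f \<omega> \<partial>M) \<le> (\<integral>\<omega>. norm (x \<bullet> f \<omega>) \<partial>M)" by (rule integral_norm_bound)
      also have "\<dots> \<le> (\<integral>\<omega>. norm x * C \<partial>M)"
        by (rule integral_mono) (use le int in auto)
      finally show ?thesis by (simp add: mult_ac)
    qed
  qed
  then obtain m where m: "\<And>v. (\<integral>\<omega>. v \<bullet> f \<omega> \<partial>M) = v \<bullet> m" by (rule riesz_representation) blast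
  have "\<forall>v. v \<bullet> wint M f = (\<integral>\<omega>. v \<bullet> f \<omega> \<partial>M)"
    unfolding wint_def
  proof (rule theI[where a=m])
    show "m' = m" if "\<forall>v. v \<bullet> m' = (\<integral>\<omega>. v \<bullet> f \<omega> \<partial>M)" for m'
      using that m by (metis vector_eq_ldot)
  qed (simp add: m)
  then show ?thesis by blast
qed

lemma norm_wint_le:
  fixes f :: "'b \<Rightarrow> 'a::{real_inner, polish_space}"
  assumes "finite_measure M" and [measurable]: "\<And>v. (\<lambda>\<omega>. v \<bullet> f \<omega>) \<in> borel_measurable M"
    and C: "\<And>\<omega>. \<omega> \<in> space M \<Longrightarrow> norm (f \<omega>) \<le> C"
    and g: "integrable M g" "\<And>\<omega>. \<omega> \<in> space M \<Longrightarrow> norm (f \<omega>) \<le> g \<omega>"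
  shows "norm (wint M f) \<le> (\<integral>\<omega>. g \<omega> \<partial>M)"
proof (rule inner_le_imp_norm_le)
  interpret finite_measure M by fact
  show "v \<bullet> wint M f \<le> (\<integral>\<omega>. g \<omega> \<partial>M) * norm v" for v
  proof -
    have le: "v \<bullet> f \<omega> \<le> g \<omega> * norm v" if "\<omega> \<in> space M" for \<omega>
      using norm_cauchy_schwarz[of v "f \<omega>"] mult_left_mono[OF g(2)[OF that], of "norm v"] by (simp add: mult.commute)
    have "\<bar>v \<bullet> f \<omega>\<bar> \<le> norm v * C" if "\<omega> \<in> space M" for \<omega>
      using Cauchy_Schwarz_ineq2[of v "f \<omega>"] mult_left_mono[OF C[OF that], of "norm v"] by simp
    then have int: "integrable M (\<lambda>\<omega>. v \<bullet> f \<omega>)"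
      by (intro integrable_const_bound[where B="norm v * C"]) auto
    have "v \<bullet> wint M f = (\<integral>\<omega>. v \<bullet> f \<omega> \<partial>M)" by (rule inner_wint[OF assms(1,2) C])
    also have "\<dots> \<le> (\<integral>\<omega>. g \<omega> * norm v \<partial>M)"
      by (rule integral_mono[OF int]) (use g le in auto)
    finally show ?thesis by simp
  qed
  show "0 \<le> (\<integral>\<omega>. g \<omega> \<partial>M)"
    by (rule integral_nonneg_AE) (use g(2) norm_ge_zero order_trans in \<open>blast intro: AE_I2\<close>)
qed

abbreviation lebI :: "real \<Rightarrow> real \<Rightarrow> real measure" where
  "lebI a b \<equiv> restrict_space lborel {a..b}"

lemma finite_measure_lebI: "finite_measure (lebI a b)"
proof (rule finite_measureI)
  have "emeasure lborel {a..b} < \<infinity>" by (rule emeasure_lborel_cbox_finite[where 'a=real, unfolded cbox_interval]) 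
  then show "emeasure (lebI a b) (space (lebI a b)) \<noteq> \<infinity>"
    by (simp add: emeasure_restrict_space space_restrict_space)
qed

lemma measure_lebI: "a \<le> b \<Longrightarrow> measure (lebI a b) (space (lebI a b)) = b - a"
  by (simp add: measure_restrict_space space_restrict_space)

lemma space_lebI [simp]: "space (lebI a b) = {a..b}"
  by (simp add: space_restrict_space)

lemma borel_measurable_lebI:
  assumes "continuous_on {a..b} f" shows "f \<in> borel_measurable (lebI a b)"
proof -
  have "sets (lebI a b) = sets (restrict_space borel {a..b})"
    by (rule sets_restrict_space_cong) simp
  then show ?thesis
    using borel_measurable_continuous_on_restrict[OF assms]
      measurable_cong_sets[of "lebI a b" "restrict_space borel {a..b}" borel borel] by blast
qed

lemma integral_lebI:
  fixes f :: "real \<Rightarrow> 'a::euclidean_space"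
  assumes "continuous_on {a..b} f"
  shows "(\<integral>s. f s \<partial>lebI a b) = integral {a..b} f"
proof -
  have "(\<integral>s. f s \<partial>lebI a b) = (LINT s:{a..b}|lborel. f s)"
    by (subst integral_restrict_space) (auto simp: set_lebesgue_integral_def)
  also have "\<dots> = integral {a..b} f"
    by (rule set_borel_integral_eq_integral) (rule borel_integrable_atLeastAtMost', fact)
  finally show ?thesis .
qed

section \<open>Strongly continuous semigroups\<close>

lemma uniform_boundedness:
  fixes F :: "nat \<Rightarrow> 'a::{real_normed_vector, complete_space} \<Rightarrow> 'b::real_normed_vector"
  assumes lin: "\<And>n. bounded_linear (F n)" and bd: "\<And>x. \<exists>B. \<forall>n. norm (F n x) \<le> B"
  obtains M where "M \<ge> 0" "\<And>n x. norm (F n x) \<le> M * norm x"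
proof -
  define C where "C k = {x. \<forall>n. norm (F n x) \<le> real k}" for k :: nat
  have cl: "closed (C k)" for k
  proof -
    have "C k = (\<Inter>n. {x. norm (F n x) \<le> real k})" by (auto simp: C_def)
    then show ?thesis
      by (auto intro!: closed_INT closed_Collect_le continuous_intros linear_continuous_on[OF lin])
  qed
  have U: "(\<Union>k. C k) = UNIV"
  proof -
    have "x \<in> (\<Union>k. C k)" for x
    proof -
      obtain B where B: "\<And>n. norm (F n x) \<le> B" using bd by blast
      obtain k :: nat where "B \<le> real k" using real_arch_simple by blast
      then have "x \<in> C k" using B order_trans by (fastforce simp: C_def)
      then show ?thesis by blast
    qed
    then show ?thesis by blast
  qed
  have "\<exists>k. interior (C k) \<noteq> {}"
  proof (rule ccontr)
    assume "\<nexists>k. interior (C k) \<noteq> {}"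
    then have "(euclidean :: 'a topology) interior_of (\<Union> (range C)) = {}"
      by (intro Baire_category_alt) (auto simp: completely_metrizable_space_euclidean cl)
    then show False using U by simp
  qed
  then obtain k x0 r where r: "r > 0" "ball x0 r \<subseteq> C k"
    by (metis all_not_in_conv interior_subset mem_interior)
  have *: "norm (F n x) \<le> (4 * real k / r) * norm x" for n x
  proof (cases "x = 0")
    case False
    interpret F: bounded_linear "F n" by (rule lin)
    define y where "y = (r / (2 * norm x)) *\<^sub>R x"
    have ny: "norm y < r" using False r by (simp add: y_def)
    have "x0 + y \<in> C k" "x0 \<in> C k" using r ny by (auto simp: dist_norm)
    then have "norm (F n (x0 + y)) \<le> real k" "norm (F n x0) \<le> real k" by (auto simp: C_def)
    moreover have "F n y = F n (x0 + y) - F n x0" by (simp add: F.add)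
    ultimately have "norm (F n y) \<le> 2 * real k" using norm_triangle_ineq4[of "F n (x0 + y)" "F n x0"] by simp
    moreover have "norm (F n y) = (r / (2 * norm x)) * norm (F n x)"
      using r False by (simp add: y_def F.scaleR)
    ultimately show ?thesis using r False by (simp add: field_simps)
  qed (simp add: linear_0[OF bounded_linear.linear[OF lin]])
  show thesis by (rule that[OF _ *]) (use r in simp)
qed

context
  fixes S :: "real \<Rightarrow> 'a::{real_normed_vector, complete_space} \<Rightarrow> 'a"
  assumes S: "c0_semigroup S"
begin

lemma c0_linear: "t \<ge> 0 \<Longrightarrow> bounded_linear (S t)" and c0_zero: "S 0 x = x"
  and c0_add: "s \<ge> 0 \<Longrightarrow> t \<ge> 0 \<Longrightarrow> S (s + t) x = S s (S t x)"
  and c0_right: "((\<lambda>t. S t x) \<longlongrightarrow> x) (at_right 0)"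
  using S by (auto simp: c0_semigroup_def)

lemma c0_right_seq:
  assumes "t \<longlonglongrightarrow> 0" "\<And>n. t n \<ge> 0" shows "(\<lambda>n. S (t n) x) \<longlonglongrightarrow> x"
proof (rule tendstoI)
  fix e :: real assume "e > 0"
  from tendstoD[OF c0_right this, of x]
  obtain d where d: "d > 0" "\<And>s. 0 < s \<Longrightarrow> s < d \<Longrightarrow> dist (S s x) x < e"
    unfolding eventually_at_right_field by auto
  have "\<forall>\<^sub>F n in sequentially. t n < d" using assms(1) d(1) by (rule order_tendstoD)
  then show "\<forall>\<^sub>F n in sequentially. dist (S (t n) x) x < e"
  proof (rule eventually_mono)
    fix n assume "t n < d"
    then show "dist (S (t n) x) x < e"
      using d(2)[of "t n"] assms(2)[of n] \<open>e > 0\<close> by (cases "t n = 0") (auto simp: c0_zero)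
  qed
qed

lemma c0_bounded_near_0: "\<exists>\<delta>>0. \<exists>M\<ge>0. \<forall>t\<in>{0..\<delta>}. \<forall>x. norm (S t x) \<le> M * norm x"
proof (rule ccontr)
  assume n: "\<not> ?thesis"
  have "\<exists>t x. 0 \<le> t \<and> t \<le> 1 / real (Suc n) \<and> norm (S t x) > real n * norm x" for n
  proof (rule ccontr)
    assume "\<not> ?thesis"
    then have "\<forall>t\<in>{0..1 / real (Suc n)}. \<forall>x. norm (S t x) \<le> real n * norm x"
      by (meson atLeastAtMost_iff not_le)
    moreover have "1 / real (Suc n) > 0" "real n \<ge> 0" by auto
    ultimately show False using \<open>\<not> (\<exists>\<delta>>0. \<exists>M\<ge>0. \<forall>t\<in>{0..\<delta>}. \<forall>x. norm (S t x) \<le> M * norm x)\<close> by blast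
  qed
  then obtain t x where t: "\<And>n. 0 \<le> t n" "\<And>n. t n \<le> 1 / real (Suc n)" "\<And>n. norm (S (t n) (x n)) > real n * norm (x n)"
    by metis
  have "t \<longlonglongrightarrow> 0"
    by (rule tendsto_sandwich[of "\<lambda>_. 0" _ _ "\<lambda>n. 1 / real (Suc n)"])
      (use t LIMSEQ_inverse_real_of_nat in \<open>auto simp: inverse_eq_divide\<close>)
  then have lim: "(\<lambda>n. S (t n) y) \<longlonglongrightarrow> y" for y using t(1) by (rule c0_right_seq)
  have "\<exists>B. \<forall>n. norm (S (t n) y) \<le> B" for y
    using Bseq_def convergent_imp_Bseq lim[of y] by (metis convergentI)
  then obtain M where M: "\<And>n y. norm (S (t n) y) \<le> M * norm y"
    using uniform_boundedness[of "\<lambda>n. S (t n)"] c0_linear t(1) by metis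
  obtain n :: nat where "M \<le> real n" using real_arch_simple by blast
  then show False using t(3)[of n] M[of n "x n"] mult_right_mono[of M "real n" "norm (x n)"] by simp
qed

lemma c0_bounded: "\<exists>M\<ge>1. \<forall>t\<in>{0..T}. \<forall>x. norm (S t x) \<le> M * norm x"
proof -
  obtain \<delta> M where d: "\<delta> > 0" "M \<ge> 0" "\<And>t x. 0 \<le> t \<Longrightarrow> t \<le> \<delta> \<Longrightarrow> norm (S t x) \<le> M * norm x"
    using c0_bounded_near_0 by (metis atLeastAtMost_iff)
  define N where "N = max 1 M"
  have N: "N \<ge> 1" "\<And>t x. 0 \<le> t \<Longrightarrow> t \<le> \<delta> \<Longrightarrow> norm (S t x) \<le> N * norm x"
  proof -
    fix t x assume "0 \<le> t" "t \<le> \<delta>"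
    then have "norm (S t x) \<le> M * norm x" by (rule d(3))
    also have "\<dots> \<le> N * norm x" by (intro mult_right_mono) (auto simp: N_def)
    finally show "norm (S t x) \<le> N * norm x" .
  qed (simp add: N_def)
  have *: "norm (S t x) \<le> N ^ k * norm x" if "0 \<le> t" "t \<le> real k * \<delta>" for k t x
    using that
  proof (induction k arbitrary: t x)
    case 0
    then show ?case by (simp add: c0_zero)
  next
    case (Suc k)
    show ?case
    proof (cases "t \<le> \<delta>")
      case True
      then have "norm (S t x) \<le> N * norm x" using N Suc.prems by simp
      also have "\<dots> \<le> N ^ Suc k * norm x" using N(1) by (intro mult_right_mono) (auto simp: self_le_power)
      finally show ?thesis .
    next
      case False
      then have "S t x = S (t - \<delta>) (S \<delta> x)" using c0_add[of "t - \<delta>" \<delta> x] d by simp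
      also have "norm \<dots> \<le> N ^ k * norm (S \<delta> x)" by (rule Suc.IH) (use False Suc.prems in \<open>auto simp: algebra_simps\<close>)
      also have "\<dots> \<le> N ^ k * (N * norm x)" using N d by (intro mult_left_mono) auto
      finally show ?thesis by (simp add: mult_ac)
    qed
  qed
  obtain k :: nat where "T / \<delta> \<le> real k" using real_arch_simple by blast
  then have "T \<le> real k * \<delta>" using d by (simp add: field_simps)
  then show ?thesis using * N(1) by (intro exI[of _ "N ^ k"]) auto
qed

lemma c0_continuous: "continuous_on {0..} (\<lambda>t. S t x)"
  unfolding continuous_on_sequentially
proof (intro allI ballI impI, elim conjE)
  fix t :: "nat \<Rightarrow> real" and l assume l: "l \<in> {0..}" and t: "\<forall>n. t n \<in> {0..}" "t \<longlonglongrightarrow> l"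
  obtain M where M: "M \<ge> 1" "\<And>s x. s \<in> {0..l+1} \<Longrightarrow> norm (S s x) \<le> M * norm x" using c0_bounded[of "l+1"] by blast
  have "(\<lambda>n. S \<bar>t n - l\<bar> x) \<longlonglongrightarrow> x"
    by (rule c0_right_seq) (use t in \<open>auto intro!: tendsto_rabs_zero simp: LIM_zero_iff\<close>)
  then have "(\<lambda>n. M * norm (S \<bar>t n - l\<bar> x - x)) \<longlonglongrightarrow> 0"
    by (intro tendsto_mult_right_zero tendsto_norm_zero LIM_zero)
  moreover have "\<forall>\<^sub>F n in sequentially. norm (S (t n) x - S l x) \<le> M * norm (S \<bar>t n - l\<bar> x - x)"
  proof -
    have "\<forall>\<^sub>F n in sequentially. t n < l + 1" using t(2) by (rule order_tendstoD) simp
    then show ?thesis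
    proof (rule eventually_mono)
      fix n assume n: "t n < l + 1"
      define m where "m = min (t n) l"
      have m: "m \<in> {0..l+1}" using t(1) l by (auto simp: m_def)
      interpret Sm: bounded_linear "S m" using m by (intro c0_linear) simp
      have "S (t n) x - S l x = S m (S \<bar>t n - l\<bar> x - x) \<or> S (t n) x - S l x = - S m (S \<bar>t n - l\<bar> x - x)"
      proof (cases "t n \<le> l")
        case True
        then have "S (t n) x = S m x" "S l x = S m (S \<bar>t n - l\<bar> x)"
          using c0_add[of "t n" "l - t n" x] t(1) by (auto simp: m_def)
        then show ?thesis by (simp add: Sm.diff)
      next
        case False
        then have "S l x = S m x" "S (t n) x = S m (S \<bar>t n - l\<bar> x)"
          using c0_add[of l "t n - l" x] l by (auto simp: m_def)
        then show ?thesis by (simp add: Sm.diff)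
      qed
      then have "norm (S (t n) x - S l x) = norm (S m (S \<bar>t n - l\<bar> x - x))" by (metis norm_minus_cancel)
      then show "norm (S (t n) x - S l x) \<le> M * norm (S \<bar>t n - l\<bar> x - x)" using M(2)[OF m] by simp
    qed
  qed
  ultimately have "(\<lambda>n. S (t n) x - S l x) \<longlonglongrightarrow> 0"
    by (rule Lim_null_comparison[rotated])
  then show "((\<lambda>t. S t x) \<circ> t) \<longlonglongrightarrow> S l x" by (simp add: comp_def LIM_zero_iff)
qed

lemma c0_joint:
  assumes "t \<longlonglongrightarrow> l" "\<And>n. t n \<ge> 0" "x \<longlonglongrightarrow> y"
  shows "(\<lambda>n. S (t n) (x n)) \<longlonglongrightarrow> S l y"
proof -
  have l: "l \<ge> 0" using LIMSEQ_le_const[OF assms(1)] assms(2) by blast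
  obtain B where B: "\<And>n. \<bar>t n\<bar> \<le> B" using convergent_imp_Bseq[OF convergentI[OF assms(1)]] by (auto simp: Bseq_def)
  obtain M where M: "M \<ge> 1" "\<And>s x. s \<in> {0..B} \<Longrightarrow> norm (S s x) \<le> M * norm x" using c0_bounded[of B] by blast
  have 1: "(\<lambda>n. S (t n) y) \<longlonglongrightarrow> S l y"
    using c0_continuous[of y] assms l unfolding continuous_on_sequentially comp_def by force
  have 2: "(\<lambda>n. M * norm (x n - y)) \<longlonglongrightarrow> 0"
    using assms(3) by (intro tendsto_mult_right_zero tendsto_norm_zero LIM_zero)
  have 3: "norm (S (t n) (x n - y)) \<le> M * norm (x n - y)" for n
    using M(2)[of "t n"] B[of n] assms(2)[of n] by auto
  have "(\<lambda>n. S (t n) (x n - y)) \<longlonglongrightarrow> 0"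
    by (rule Lim_null_comparison[OF always_eventually[OF allI[OF 3]] 2])
  from tendsto_add[OF this 1] have "(\<lambda>n. S (t n) (x n - y) + S (t n) y) \<longlonglongrightarrow> S l y" by simp
  moreover have "S (t n) (x n - y) + S (t n) y = S (t n) (x n)" for n
    using linear_diff[OF bounded_linear.linear[OF c0_linear[OF assms(2)]], of n "x n" y] by simp
  ultimately show ?thesis by simp
qed

end

context
  fixes DA :: "'a::{real_normed_vector, complete_space} set" and A S
  assumes gen: "generates DA A S"
begin

lemma gen_c0: "c0_semigroup S" using gen by (simp add: generates_def)

lemma gen_lim: "x \<in> DA \<Longrightarrow> ((\<lambda>t. (S t x - x) /\<^sub>R t) \<longlongrightarrow> A x) (at_right 0)"
  using gen by (simp add: generates_def)

lemma generatorI: "((\<lambda>t. (S t x - x) /\<^sub>R t) \<longlongrightarrow> y) (at_right 0) \<Longrightarrow> x \<in> DA \<and> A x = y"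
proof -
  assume l: "((\<lambda>t. (S t x - x) /\<^sub>R t) \<longlongrightarrow> y) (at_right 0)"
  then have x: "x \<in> DA" using gen unfolding generates_def by blast
  then show "x \<in> DA \<and> A x = y" using tendsto_unique[OF _ gen_lim[OF x] l] by simp
qed

lemma gen_commute:
  assumes x: "x \<in> DA" and t: "t \<ge> 0"
  shows "S t x \<in> DA" "A (S t x) = S t (A x)"
proof -
  have "((\<lambda>h. S t ((S h x - x) /\<^sub>R h)) \<longlongrightarrow> S t (A x)) (at_right 0)"
    by (intro bounded_linear.tendsto[OF c0_linear[OF gen_c0 t]] gen_lim x)
  moreover have "\<forall>\<^sub>F h in at_right 0. S t ((S h x - x) /\<^sub>R h) = (S h (S t x) - S t x) /\<^sub>R h"
    using eventually_at_right_less[of 0]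
  proof (rule eventually_mono)
    fix h :: real assume "0 < h"
    then show "S t ((S h x - x) /\<^sub>R h) = (S h (S t x) - S t x) /\<^sub>R h"
      using c0_add[OF gen_c0, of h t x] c0_add[OF gen_c0, of t h x] t c0_linear[OF gen_c0 t]
      by (simp add: linear_simps add.commute)
  qed
  ultimately have "((\<lambda>h. (S h (S t x) - S t x) /\<^sub>R h) \<longlongrightarrow> S t (A x)) (at_right 0)"
    by (rule Lim_transform_eventually)
  from generatorI[OF this] show "S t x \<in> DA" "A (S t x) = S t (A x)" by auto
qed

lemma gen_has_vector_derivative:
  assumes x: "x \<in> DA" and t: "t \<ge> 0"
  shows "((\<lambda>s. S s x) has_vector_derivative S t (A x)) (at t within {0..})"
proof -
  note c0 = gen_c0
  obtain M where M: "M \<ge> 1" "\<And>s x. s \<in> {0..t} \<Longrightarrow> norm (S s x) \<le> M * norm x" using c0_bounded[OF c0, of t] by blast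
  have "((\<lambda>s. (S s x - S t x) /\<^sub>R (s - t)) \<longlongrightarrow> S t (A x)) (at t within {0..})"
  proof (rule tendstoI)
    fix e :: real assume "e > 0"
    define e' where "e' = e / (2 * M)"
    have "e' > 0" using \<open>e > 0\<close> M by (simp add: e'_def)
    have "\<forall>\<^sub>F h in at_right 0. dist ((S h x - x) /\<^sub>R h) (A x) < e'"
      by (rule tendstoD[OF gen_lim[OF x] \<open>e' > 0\<close>])
    then obtain d1 where d1: "d1 > 0" "\<And>h. 0 < h \<Longrightarrow> h < d1 \<Longrightarrow> norm ((S h x - x) /\<^sub>R h - A x) < e'"
      unfolding eventually_at_right_field by (auto simp: dist_norm)
    have lim: "((\<lambda>s. S s (A x)) \<longlongrightarrow> S t (A x)) (at t within {0..})"
      using c0_continuous[OF c0, of "A x"] t by (simp add: continuous_on)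
    obtain d2 where d2: "d2 > 0" "\<And>s. s \<ge> 0 \<Longrightarrow> dist s t < d2 \<Longrightarrow> norm (S s (A x) - S t (A x)) < e / 2"
    proof -
      assume *: "\<And>d2. d2 > 0 \<Longrightarrow> (\<And>s. s \<ge> 0 \<Longrightarrow> dist s t < d2 \<Longrightarrow> norm (S s (A x) - S t (A x)) < e / 2) \<Longrightarrow> thesis"
      from tendstoD[OF lim, of "e/2"] \<open>e > 0\<close>
      obtain d where d: "d > 0" "\<And>s. s \<ge> 0 \<Longrightarrow> s \<noteq> t \<Longrightarrow> dist s t < d \<Longrightarrow> dist (S s (A x)) (S t (A x)) < e / 2"
        unfolding eventually_at by auto
      show thesis
        by (rule *[OF d(1)]) (metis d(2) \<open>e > 0\<close> diff_self dist_norm half_gt_zero norm_zero)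
    qed
    have "dist ((S s x - S t x) /\<^sub>R (s - t)) (S t (A x)) < e" if s: "s \<ge> 0" "s \<noteq> t" "dist s t < min d1 d2" for s
    proof -
      define m h where "m = min s t" and "h = \<bar>s - t\<bar>"
      have m: "m \<in> {0..t}" "h > 0" "h < d1" using s t by (auto simp: m_def h_def dist_real_def)
      interpret Sm: bounded_linear "S m" using m by (intro c0_linear[OF c0]) simp
      have "S (m + h) x = S m (S h x)" using m by (intro c0_add[OF c0]) auto
      then have eq: "(S s x - S t x) /\<^sub>R (s - t) = S m ((S h x - x) /\<^sub>R h)"
      proof (cases "s \<ge> t")
        case False
        then have "m = s" "m + h = t" "s - t = - h" by (auto simp: m_def h_def)
        then have "S t x = S m (S h x)" "S s x = S m x" "inverse (s - t) = - inverse h"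
          using \<open>S (m + h) x = S m (S h x)\<close> by auto
        then show ?thesis by (simp add: Sm.diff Sm.scaleR scaleR_diff_right)
      next
        case True
        then have "S s x = S m (S h x)" "S t x = S m x" "inverse (s - t) = inverse h"
          using \<open>S (m + h) x = S m (S h x)\<close> by (auto simp: m_def h_def)
        then show ?thesis by (simp add: Sm.diff Sm.scaleR scaleR_diff_right)
      qed
      have "dist m t < d2" using s by (auto simp: m_def dist_real_def)
      then have a: "norm (S m (A x) - S t (A x)) < e / 2" using d2 m by auto
      have "norm (S m ((S h x - x) /\<^sub>R h - A x)) \<le> M * norm ((S h x - x) /\<^sub>R h - A x)" by (rule M(2)[OF m(1)])
      also have "\<dots> < M * e'" using d1(2)[OF m(2,3)] M(1) by simp
      also have "\<dots> = e / 2" using M(1) by (simp add: e'_def)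
      finally have b: "norm (S m ((S h x - x) /\<^sub>R h) - S m (A x)) < e / 2" by (simp add: Sm.diff)
      show ?thesis unfolding eq dist_norm using norm_triangle_lt[OF order_less_le_trans[OF add_strict_mono[OF a b]], of e]
        by (simp add: algebra_simps)
    qed
    then show "\<forall>\<^sub>F s in at t within {0..}. dist ((S s x - S t x) /\<^sub>R (s - t)) (S t (A x)) < e"
      unfolding eventually_at using d1(1) d2(1) by (intro exI[of _ "min d1 d2"]) auto
  qed
  then have "((\<lambda>s. (S s x - S t x) /\<^sub>R (s - t) - S t (A x)) \<longlongrightarrow> 0) (at t within {0..})"
    by (rule LIM_zero)
  then have "((\<lambda>s. norm ((S s x - S t x) /\<^sub>R (s - t) - S t (A x))) \<longlongrightarrow> 0) (at t within {0..})"
    by (rule tendsto_norm_zero)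
  moreover have "\<forall>\<^sub>F s in at t within {0..}. norm ((S s x - S t x) /\<^sub>R (s - t) - S t (A x)) =
      norm (S s x - S t x - (s - t) *\<^sub>R S t (A x)) / norm (s - t)"
    unfolding eventually_at
  proof (intro exI[of _ 1] conjI ballI impI)
    fix s assume "s \<noteq> t \<and> dist s t < 1"
    then have "S s x - S t x - (s - t) *\<^sub>R S t (A x) = (s - t) *\<^sub>R ((S s x - S t x) /\<^sub>R (s - t) - S t (A x))"
      by (simp add: scaleR_diff_right)
    then show "norm ((S s x - S t x) /\<^sub>R (s - t) - S t (A x)) =
      norm (S s x - S t x - (s - t) *\<^sub>R S t (A x)) / norm (s - t)" using \<open>s \<noteq> t \<and> dist s t < 1\<close> by simp
  qed simp
  ultimately have "((\<lambda>s. norm (S s x - S t x - (s - t) *\<^sub>R S t (A x)) / norm (s - t)) \<longlongrightarrow> 0) (at t within {0..})"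
    by (rule Lim_transform_eventually)
  then show ?thesis
    unfolding has_vector_derivative_def has_derivative_iff_norm by (simp add: bounded_linear_scaleR_left)
qed

end

lemma integral_minus_const_bound:
  fixes g :: "real \<Rightarrow> real"
  assumes "a \<le> b" "continuous_on {a..b} g" "\<And>s. s \<in> {a..b} \<Longrightarrow> \<bar>g s - c\<bar> \<le> e"
  shows "\<bar>integral {a..b} g - (b - a) * c\<bar> \<le> (b - a) * e"
proof -
  have "integral {a..b} (\<lambda>s. g s - c) = integral {a..b} g - (b - a) * c"
    using assms integrable_continuous_real by (subst integral_diff) auto
  moreover have "norm (integral {a..b} (\<lambda>s. g s - c)) \<le> e * (b - a)"
    by (rule integral_bound) (use assms in \<open>auto intro!: continuous_intros\<close>)
  ultimately show ?thesis by (simp add: mult.commute)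
qed

lemma dense_inner_eqI:
  fixes u v :: "'a::real_inner"
  assumes "closure D = UNIV" "\<And>x. x \<in> D \<Longrightarrow> x \<bullet> u = x \<bullet> v"
  shows "u = v"
proof -
  have "closed {x. x \<bullet> u = x \<bullet> v}" by (intro closed_Collect_eq continuous_intros)
  then have "closure D \<subseteq> {x. x \<bullet> u = x \<bullet> v}" using assms(2) by (intro closure_minimal) auto
  then have "\<forall>x. x \<bullet> u = x \<bullet> v" using assms(1) by auto
  then show ?thesis by (simp only: vector_eq_ldot)
qed

lemma generator_domain_dense:
  fixes DA :: "'a::{real_inner, polish_space} set"
  assumes gen: "generates DA A S"
  shows "closure DA = UNIV"
proof -
  note c0 = gen_c0[OF gen]
  have "x \<in> closure DA" for x
    unfolding closure_approachable
  proof (intro allI impI)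
    fix e :: real assume "e > 0"
    define g where "g = (\<lambda>s. S s x)"
    have gc: "continuous_on {a..b} g" if "a \<ge> 0" for a b
      unfolding g_def by (rule continuous_on_subset[OF c0_continuous[OF c0]]) (use that in auto)
    have vc: "continuous_on {a..b} (\<lambda>s. v \<bullet> g s)" if "a \<ge> 0" for a b v
      using gc[OF that] by (intro continuous_intros)
    obtain t where t: "t > 0" "\<And>s. 0 \<le> s \<Longrightarrow> s \<le> t \<Longrightarrow> norm (g s - x) \<le> e / 2"
    proof -
      from tendstoD[OF c0_right[OF c0], of "e/2" x] \<open>e > 0\<close>
      obtain d where d: "d > 0" "\<And>s. 0 < s \<Longrightarrow> s < d \<Longrightarrow> dist (S s x) x < e / 2"
        unfolding eventually_at_right_field by auto
      show thesis
        by (rule that[of "d/2"]) (use d \<open>e > 0\<close> c0_zero[OF c0, of x] in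
           \<open>auto simp: g_def dist_norm less_imp_le le_less\<close>)
    qed
    obtain M where M: "M \<ge> 1" "\<And>s x. s \<in> {0..t} \<Longrightarrow> norm (S s x) \<le> M * norm x" using c0_bounded[OF c0, of t] by blast
    define y where "y = (1 / t) *\<^sub>R wint (lebI 0 t) g"
    define F where "F v u = integral {0..u} (\<lambda>s. v \<bullet> g s)" for v u
    have F_diff: "F v b - F v a = integral {a..b} (\<lambda>s. v \<bullet> g s)" if "0 \<le> a" "a \<le> b" for v a b
      unfolding F_def using Henstock_Kurzweil_Integration.integral_combine[OF that, of "\<lambda>s. v \<bullet> g s"]
        integrable_continuous_real[OF vc[of 0 b v]] by simp
    have vy: "v \<bullet> y = F v t / t" for v
    proof -
      have "v \<bullet> wint (lebI 0 t) g = (\<integral>s. v \<bullet> g s \<partial>lebI 0 t)"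
        by (rule inner_wint[OF finite_measure_lebI borel_measurable_lebI[OF vc], where C="M * norm x"])
          (use M in \<open>auto simp: g_def\<close>)
      then show ?thesis by (simp add: y_def F_def integral_lebI[OF vc])
    qed
    have Sy: "v \<bullet> S h y = (F v (t + h) - F v h) / t" if h: "h \<ge> 0" for v h
    proof -
      note bl = c0_linear[OF c0 h]
      have "v \<bullet> S h y = adjoint (S h) v \<bullet> y" using adjoint_inner[OF bl, of y v] by (simp add: inner_commute)
      also have "\<dots> = integral {0..t} (\<lambda>s. adjoint (S h) v \<bullet> g s) / t" unfolding vy F_def ..
      also have "integral {0..t} (\<lambda>s. adjoint (S h) v \<bullet> g s) = integral {0..t} (\<lambda>s. v \<bullet> g (s + h))"
      proof (rule integral_cong)
        fix s assume "s \<in> {0..t}"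
        then have "g (s + h) = S h (g s)" using c0_add[OF c0 h, of s x] by (simp add: g_def add.commute)
        then show "adjoint (S h) v \<bullet> g s = v \<bullet> g (s + h)"
          using adjoint_inner[OF bl, of "g s" v] by (simp add: inner_commute)
      qed
      also have "\<dots> = integral {0 + h..t + h} (\<lambda>s. v \<bullet> g s)"
        using integral_shift[of 0 h t "\<lambda>s. v \<bullet> g s"] vc[of "0 + h" "t + h" v] h by (simp add: comp_def)
      also have "\<dots> = F v (t + h) - F v h" using F_diff[of h "t + h" v] h t by simp
      finally show ?thesis .
    qed
    have "((\<lambda>h. (S h y - y) /\<^sub>R h) \<longlongrightarrow> (g t - x) /\<^sub>R t) (at_right 0)"
    proof (rule tendstoI)
      fix r :: real assume "r > 0"
      define r' where "r' = r * t / 4"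
      have "r' > 0" using \<open>r > 0\<close> t by (simp add: r'_def)
      have near: "\<exists>d>0. \<forall>s. u \<le> s \<and> s < u + d \<longrightarrow> norm (g s - g u) \<le> r'" if "u \<ge> 0" for u
      proof -
        have "(g \<longlongrightarrow> g u) (at u within {0..})"
          using c0_continuous[OF c0, of x] that by (simp add: continuous_on g_def)
        from tendstoD[OF this \<open>r' > 0\<close>] obtain d where
          "d > 0" "\<And>s. s \<ge> 0 \<Longrightarrow> s \<noteq> u \<Longrightarrow> dist s u < d \<Longrightarrow> dist (g s) (g u) < r'"
          unfolding eventually_at by auto
        then show ?thesis using that \<open>r' > 0\<close>
          by (intro exI[of _ d]) (force simp: dist_norm le_less)
      qed
      obtain d1 where d1: "d1 > 0" "\<And>s. 0 \<le> s \<Longrightarrow> s < d1 \<Longrightarrow> norm (g s - x) \<le> r'"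
        using near[of 0] by (auto simp: g_def c0_zero[OF c0])
      obtain d2 where d2: "d2 > 0" "\<And>s. t \<le> s \<Longrightarrow> s < t + d2 \<Longrightarrow> norm (g s - g t) \<le> r'"
        using near[of t] t by auto
      have "norm ((S h y - y) /\<^sub>R h - (g t - x) /\<^sub>R t) < r" if h: "0 < h" "h < min d1 d2" for h
      proof -
        have le: "\<bar>v \<bullet> w\<bar> \<le> norm v * r'" if "norm w \<le> r'" for v w :: 'a
          using Cauchy_Schwarz_ineq2[of v w] mult_left_mono[OF that, of "norm v"] by simp
        have "norm ((S h y - y) /\<^sub>R h - (g t - x) /\<^sub>R t) \<le> 2 * r' / t"
        proof (rule inner_le_imp_norm_le)
          fix v
          have 1: "\<bar>integral {t..t + h} (\<lambda>s. v \<bullet> g s) - (t + h - t) * (v \<bullet> g t)\<bar> \<le> (t + h - t) * (norm v * r')"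
            by (rule integral_minus_const_bound) (use h t vc d2 in \<open>auto simp flip: inner_diff_right intro!: le\<close>)
          have 2: "\<bar>integral {0..h} (\<lambda>s. v \<bullet> g s) - (h - 0) * (v \<bullet> x)\<bar> \<le> (h - 0) * (norm v * r')"
            by (rule integral_minus_const_bound) (use h t vc d1 in \<open>auto simp flip: inner_diff_right intro!: le\<close>)
          have 3: "v \<bullet> (S h y - y) = (integral {t..t + h} (\<lambda>s. v \<bullet> g s) - integral {0..h} (\<lambda>s. v \<bullet> g s)) / t"
            using Sy[of h v] vy[of v] F_diff[of t "t + h" v] h t
            by (simp add: inner_diff_right F_def field_simps)
          have "v \<bullet> ((S h y - y) /\<^sub>R h - (g t - x) /\<^sub>R t) =
             ((integral {t..t + h} (\<lambda>s. v \<bullet> g s) - h * (v \<bullet> g t)) - (integral {0..h} (\<lambda>s. v \<bullet> g s) - h * (v \<bullet> x))) / (t * h)"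
          proof -
            have "v \<bullet> (a /\<^sub>R h - b /\<^sub>R t) = (v \<bullet> a) / h - (v \<bullet> b) / t" for a b
              by (simp add: inner_diff_right divide_inverse mult.commute)
            then have "v \<bullet> ((S h y - y) /\<^sub>R h - (g t - x) /\<^sub>R t) = (v \<bullet> (S h y - y)) / h - (v \<bullet> g t - v \<bullet> x) / t"
              by (simp only: inner_diff_right[of v "g t" x])
            also have "\<dots> = (integral {t..t + h} (\<lambda>s. v \<bullet> g s) - integral {0..h} (\<lambda>s. v \<bullet> g s)) / t / h - (v \<bullet> g t - v \<bullet> x) / t"
              by (simp only: 3)
            finally show ?thesis using h t by (simp add: divide_simps) (simp add: algebra_simps)
          qed
          also have "\<dots> \<le> (2 * (h * (norm v * r'))) / (t * h)"
            using 1 2 h t by (intro divide_right_mono) (auto simp: abs_le_iff)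
          also have "\<dots> = 2 * r' / t * norm v" using h t by (simp add: field_simps)
          finally show "v \<bullet> ((S h y - y) /\<^sub>R h - (g t - x) /\<^sub>R t) \<le> 2 * r' / t * norm v" .
        qed (use \<open>r' > 0\<close> t in auto)
        also have "\<dots> < r" using t \<open>r > 0\<close> by (simp add: r'_def)
        finally show ?thesis .
      qed
      then show "\<forall>\<^sub>F h in at_right 0. dist ((S h y - y) /\<^sub>R h) ((g t - x) /\<^sub>R t) < r"
        unfolding eventually_at_right_field dist_norm using d1 d2 by (intro exI[of _ "min d1 d2"]) auto
    qed
    then have "y \<in> DA" using generatorI[OF gen] by blast
    moreover have "norm (y - x) \<le> e / 2"
    proof (rule inner_le_imp_norm_le)
      fix v
      have "\<bar>integral {0..t} (\<lambda>s. v \<bullet> g s) - (t - 0) * (v \<bullet> x)\<bar> \<le> (t - 0) * (norm v * (e / 2))"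
      proof (rule integral_minus_const_bound)
        fix s assume "s \<in> {0..t}"
        then show "\<bar>v \<bullet> g s - v \<bullet> x\<bar> \<le> norm v * (e / 2)"
          using Cauchy_Schwarz_ineq2[of v "g s - x"] mult_left_mono[OF t(2)[of s], of "norm v"]
          by (simp add: inner_diff_right)
      qed (use t vc in auto)
      then have "integral {0..t} (\<lambda>s. v \<bullet> g s) \<le> t * (v \<bullet> x) + t * (norm v * (e / 2))"
        unfolding diff_zero by linarith
      then have "v \<bullet> y - v \<bullet> x \<le> norm v * (e / 2)"
        using t(1) by (simp add: vy F_def field_simps)
      then show "v \<bullet> (y - x) \<le> e / 2 * norm v" by (simp add: inner_diff_right mult.commute)
    qed (use \<open>e > 0\<close> in auto)
    ultimately show "\<exists>y\<in>DA. dist y x < e" using \<open>e > 0\<close> by (intro bexI[of _ y]) (auto simp: dist_norm)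
  qed
  then show ?thesis by blast
qed

locale adjoint_semigroups =
  fixes DA :: "'a::{real_inner, polish_space} set" and A :: "'a \<Rightarrow> 'a"
    and S Sadj :: "real \<Rightarrow> 'a \<Rightarrow> 'a"
  assumes gen: "generates DA A S"
    and gen_adj: "generates (adj_dom DA A) (adj_op DA A) Sadj"
begin

lemma c0: "c0_semigroup S" and c0_adj: "c0_semigroup Sadj"
  using gen_c0[OF gen] gen_c0[OF gen_adj] .

lemma dense: "closure DA = UNIV" and dense_adj: "closure (adj_dom DA A) = UNIV"
  using generator_domain_dense[OF gen] generator_domain_dense[OF gen_adj] .

lemma adj_opI:
  assumes "\<And>x. x \<in> DA \<Longrightarrow> A x \<bullet> h = x \<bullet> z"
  shows "h \<in> adj_dom DA A" "adj_op DA A h = z"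
proof -
  show "h \<in> adj_dom DA A" using assms by (auto simp: adj_dom_def)
  show "adj_op DA A h = z"
    unfolding adj_op_def
  proof (rule the_equality)
    fix z' assume "\<forall>x\<in>DA. A x \<bullet> h = x \<bullet> z'"
    then show "z' = z" using assms by (intro dense_inner_eqI[OF dense]) auto
  qed (use assms in auto)
qed

lemma adj_op_inner:
  assumes "h \<in> adj_dom DA A" "x \<in> DA"
  shows "A x \<bullet> h = x \<bullet> adj_op DA A h"
proof -
  obtain z where "\<forall>x\<in>DA. A x \<bullet> h = x \<bullet> z" using assms by (auto simp: adj_dom_def)
  then show ?thesis using adj_opI(2)[of h z] assms by auto
qed

lemma adj_op_add:
  assumes "h \<in> adj_dom DA A" "k \<in> adj_dom DA A"
  shows "h + k \<in> adj_dom DA A" "adj_op DA A (h + k) = adj_op DA A h + adj_op DA A k"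
  using adj_opI[of "h + k" "adj_op DA A h + adj_op DA A k"] assms
  by (auto simp: adj_op_inner inner_right_distrib)

lemma adj_op_scale:
  assumes "h \<in> adj_dom DA A"
  shows "c *\<^sub>R h \<in> adj_dom DA A" "adj_op DA A (c *\<^sub>R h) = c *\<^sub>R adj_op DA A h"
  using adj_opI[of "c *\<^sub>R h" "c *\<^sub>R adj_op DA A h"] assms by (auto simp: adj_op_inner)

lemma adj_dom_subspace: "subspace (adj_dom DA A)"
proof (rule subspaceI)
  show "0 \<in> adj_dom DA A" by (rule adj_opI(1)[of 0 0]) simp
qed (auto intro: adj_op_add adj_op_scale)

lemma semigroup_adjoint:
  assumes t: "t \<ge> 0"
  shows "S t x \<bullet> h = x \<bullet> Sadj t h"
proof -
  have *: "S t x \<bullet> h = x \<bullet> Sadj t h" if x: "x \<in> DA" and h: "h \<in> adj_dom DA A" for x h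
  proof -
    have "((\<lambda>s. S (t - s) x \<bullet> Sadj s h) has_derivative (\<lambda>_. 0)) (at s within {0..t})" if s: "s \<in> {0..t}" for s
    proof -
      have "((\<lambda>s. t - s) has_vector_derivative - 1) (at s within {0..t})"
        by (auto intro!: derivative_eq_intros)
      moreover have "((\<lambda>s. S s x) has_vector_derivative S (t - s) (A x)) (at (t - s) within ((\<lambda>s. t - s) ` {0..t}))"
        by (rule has_vector_derivative_within_subset[OF gen_has_vector_derivative[OF gen x]]) (use s in auto)
      ultimately have 1: "((\<lambda>s. S (t - s) x) has_vector_derivative - S (t - s) (A x)) (at s within {0..t})"
        using vector_diff_chain_within by (fastforce simp: comp_def)
      have 2: "((\<lambda>s. Sadj s h) has_vector_derivative Sadj s (adj_op DA A h)) (at s within {0..t})"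
        by (rule has_vector_derivative_within_subset[OF gen_has_vector_derivative[OF gen_adj h]]) (use s in auto)
      have ts: "0 \<le> t - s" "0 \<le> s" using s by auto
      have "A (S (t - s) x) \<bullet> Sadj s h = S (t - s) x \<bullet> adj_op DA A (Sadj s h)"
        by (intro adj_op_inner gen_commute[OF gen x] gen_commute[OF gen_adj h] ts)
      then have "S (t - s) (A x) \<bullet> Sadj s h = S (t - s) x \<bullet> Sadj s (adj_op DA A h)"
        by (simp add: gen_commute(2)[OF gen x ts(1)] gen_commute(2)[OF gen_adj h ts(2)])
      then show ?thesis
        using has_derivative_inner[OF 1[unfolded has_vector_derivative_def] 2[unfolded has_vector_derivative_def]]
        by (simp add: algebra_simps)
    qed
    then have "\<exists>c. \<forall>s\<in>{0..t}. S (t - s) x \<bullet> Sadj s h = c"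
      by (intro has_derivative_zero_constant) auto
    then obtain c where c: "\<And>s. s \<in> {0..t} \<Longrightarrow> S (t - s) x \<bullet> Sadj s h = c" by blast
    show ?thesis using c[of 0] c[of t] t by (simp add: c0_zero[OF c0] c0_zero[OF c0_adj])
  qed
  have **: "S t x \<bullet> h = x \<bullet> Sadj t h" if h: "h \<in> adj_dom DA A" for h x
  proof -
    have "closed {x. S t x \<bullet> h = x \<bullet> Sadj t h}"
      by (intro closed_Collect_eq continuous_intros linear_continuous_on[OF c0_linear[OF c0 t]])
    then have "closure DA \<subseteq> {x. S t x \<bullet> h = x \<bullet> Sadj t h}" using * h by (intro closure_minimal) auto
    then show ?thesis using dense by auto
  qed
  have "closed {h. S t x \<bullet> h = x \<bullet> Sadj t h}"
    by (intro closed_Collect_eq continuous_intros linear_continuous_on[OF c0_linear[OF c0_adj t]])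
  then have "closure (adj_dom DA A) \<subseteq> {h. S t x \<bullet> h = x \<bullet> Sadj t h}" using ** by (intro closure_minimal) auto
  then show ?thesis using dense_adj by auto
qed

end

section \<open>Trigonometric functions\<close>

lemma fun_span_zero: "(\<lambda>x. 0) \<in> fun_span G"
  unfolding fun_span_def by (rule CollectI, rule exI[of _ 0]) auto

lemma fun_span_iff:
  "f \<in> fun_span G \<longleftrightarrow> (\<exists>(n::nat) c g. f = (\<lambda>x. \<Sum>i<n. c i * g i x) \<and> (\<forall>i<n. g i \<in> G))"
  unfolding fun_span_def by (rule mem_Collect_eq)

lemma fun_span_cons:
  assumes "g \<in> G" "f \<in> fun_span G" shows "(\<lambda>x. c * g x + f x) \<in> fun_span G"
proof -
  from assms(2)[unfolded fun_span_iff] obtain n :: nat and c' g'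
    where f: "f = (\<lambda>x. \<Sum>i<n. c' i * g' i x) \<and> (\<forall>i<n. g' i \<in> G)"
    by blast
  have "(\<lambda>x. c * g x + f x) = (\<lambda>x. \<Sum>i<Suc n. (c'(n := c)) i * (g'(n := g)) i x)"
    by (rule ext) (auto simp: f[THEN conjunct1] intro!: sum.cong)
  moreover have "\<forall>i<Suc n. (g'(n := g)) i \<in> G" using f assms(1) by (auto simp: less_Suc_eq)
  ultimately show ?thesis unfolding fun_span_iff by blast
qed

lemma fun_span_induct [consumes 1, case_names zero cons]:
  assumes "f \<in> fun_span G" "P (\<lambda>x. 0)"
    and step: "\<And>c g f. g \<in> G \<Longrightarrow> f \<in> fun_span G \<Longrightarrow> P f \<Longrightarrow> P (\<lambda>x. c * g x + f x)"
  shows "P f"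
proof -
  from assms(1)[unfolded fun_span_iff] obtain n :: nat and c g
    where f: "f = (\<lambda>x. \<Sum>i<n. c i * g i x) \<and> (\<forall>i<n. g i \<in> G)"
    by blast
  have "P (\<lambda>x. \<Sum>i<n. c i * g i x)" using f[THEN conjunct2]
  proof (induction n)
    case (Suc n)
    have "(\<lambda>x. \<Sum>i<n. c i * g i x) \<in> fun_span G" 
      unfolding fun_span_iff using Suc.prems by (intro exI[of _ n] exI[of _ c] exI[of _ g]) auto
    from step[OF _ this, of "g n" "c n"] Suc show ?case by (simp add: add.commute)
  qed (simp add: assms)
  then show ?thesis by (simp add: f)
qed

lemma fun_span_base: "g \<in> G \<Longrightarrow> g \<in> fun_span G"
  using fun_span_cons[OF _ fun_span_zero, of g G 1] by simp

lemma fun_span_add: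
  assumes "f \<in> fun_span G" "g \<in> fun_span G" shows "(\<lambda>x. f x + g x) \<in> fun_span G"
  using assms(1)
  by (induction rule: fun_span_induct) (use assms(2) in \<open>auto simp: add.assoc intro: fun_span_cons\<close>)

lemma fun_span_scale:
  assumes "f \<in> fun_span G" shows "(\<lambda>x. c * f x) \<in> fun_span G"
  using assms
proof (induction rule: fun_span_induct)
  case (cons d g f)
  then show ?case using fun_span_cons[OF cons(1,3), of "c * d"] by (simp add: algebra_simps)
qed (simp add: fun_span_zero)

lemma fun_subspace_span: "fun_subspace (fun_span G)"
  by (auto simp: fun_subspace_def fun_span_zero fun_span_add fun_span_scale)

definition wave :: "'a::real_inner \<Rightarrow> real \<Rightarrow> 'a \<Rightarrow> real" where
  "wave h c x = cos (x \<bullet> h + c)"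

definition trig :: "'a::real_inner set \<Rightarrow> ('a \<Rightarrow> real) set" where
  "trig V = fun_span {wave h c | h c. h \<in> V}"

lemma trig_wave: "h \<in> V \<Longrightarrow> wave h c \<in> trig V"
  unfolding trig_def by (rule fun_span_base) blast

lemma trig_induct [consumes 1, case_names zero cons]:
  assumes "f \<in> trig V" "P (\<lambda>x. 0)"
    and "\<And>a h c f. h \<in> V \<Longrightarrow> f \<in> trig V \<Longrightarrow> P f \<Longrightarrow> P (\<lambda>x. a * wave h c x + f x)"
  shows "P f"
  using assms(1) unfolding trig_def
  by (induction rule: fun_span_induct) (use assms(2,3) in \<open>auto simp: trig_def\<close>)

lemma trig_add: "f \<in> trig V \<Longrightarrow> g \<in> trig V \<Longrightarrow> (\<lambda>x. f x + g x) \<in> trig V"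
  and trig_scale: "f \<in> trig V \<Longrightarrow> (\<lambda>x. c * f x) \<in> trig V"
  unfolding trig_def by (rule fun_span_add fun_span_scale; assumption)+

lemma trig_const: "0 \<in> V \<Longrightarrow> (\<lambda>x. c) \<in> trig V"
  using trig_scale[OF trig_wave[of 0 V 0], of c] by (simp add: wave_def)

lemma trig_mult:
  assumes V: "subspace V" and "f \<in> trig V" "g \<in> trig V"
  shows "(\<lambda>x. f x * g x) \<in> trig V"
  using assms(2)
proof (induction rule: trig_induct)
  case zero
  show ?case using trig_const[OF subspace_0[OF V], of 0] by simp
next
  case (cons a h c f)
  have "(\<lambda>x. wave h c x * g x) \<in> trig V"
    using assms(3)
  proof (induction rule: trig_induct)
    case zero
    show ?case using trig_const[OF subspace_0[OF V], of 0] by simp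
  next
    case (cons b k d g)
    have "wave h c x * wave k d x = 1/2 * wave (h - k) (c - d) x + 1/2 * wave (h + k) (c + d) x" for x
      by (simp add: wave_def cos_times_cos inner_diff_right inner_add_right field_simps)
    then have "(\<lambda>x. wave h c x * (b * wave k d x + g x)) =
       (\<lambda>x. b * (1/2 * wave (h - k) (c - d) x + 1/2 * wave (h + k) (c + d) x) + wave h c x * g x)"
      by (auto simp: fun_eq_iff algebra_simps)
    also have "\<dots> \<in> trig V"
      by (intro trig_add trig_scale trig_wave cons subspace_add subspace_diff V \<open>h \<in> V\<close>)
    finally show ?case .
  qed
  then have "(\<lambda>x. a * (wave h c x * g x) + f x * g x) \<in> trig V" by (intro trig_add trig_scale cons)
  then show ?case by (simp add: algebra_simps)
qed

lemma abs_wave_le: "\<bar>wave h c x\<bar> \<le> 1" by (simp add: wave_def)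

lemma continuous_wave: "continuous_on T (wave h c)"
  unfolding wave_def by (intro continuous_intros)

lemma bcontfunI':
  assumes "continuous_on UNIV f" "\<And>x. norm (f x) \<le> C" shows "f \<in> bcontfun"
  using assms by (auto simp: bcontfun_def bounded_iff)

lemma bcontfun_bound:
  fixes f :: "'a::topological_space \<Rightarrow> 'b::real_normed_vector"
  assumes "f \<in> bcontfun" obtains C where "C \<ge> 0" "\<And>x. norm (f x) \<le> C"
  using assms by (auto simp: bcontfun_def bounded_iff) (metis norm_ge_zero order_trans)

lemma bcontfun_continuous: "f \<in> bcontfun \<Longrightarrow> continuous_on T f"
  by (auto simp: bcontfun_def intro: continuous_on_subset)

lemma trig_bcontfun: "f \<in> trig V \<Longrightarrow> f \<in> bcontfun"
proof (induction rule: trig_induct)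
  case (cons a h c f)
  then obtain C where C: "\<And>x. norm (f x) \<le> C" by (metis bcontfun_bound)
  show ?case
  proof (rule bcontfunI')
    show "continuous_on UNIV (\<lambda>x. a * wave h c x + f x)"
      by (intro continuous_intros continuous_wave bcontfun_continuous cons)
    show "norm (a * wave h c x + f x) \<le> \<bar>a\<bar> * 1 + C" for x
      by (intro order_trans[OF norm_triangle_ineq] add_mono C)
        (simp add: abs_mult mult_left_mono abs_wave_le del: mult_1_right)
  qed
qed (simp add: const_bcontfun)

definition brick :: "(nat \<Rightarrow> 'a::real_normed_vector) \<Rightarrow> real \<Rightarrow> nat \<Rightarrow> 'a set" where
  "brick e r n = {\<Sum>i<n. c i *\<^sub>R e i | c. \<forall>i. \<bar>c i\<bar> \<le> r}"

lemma compact_brick: "0 \<le> r \<Longrightarrow> compact (brick e r n)"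
proof (induction n)
  case 0
  have "brick e r 0 = {0}" using 0 by (auto simp: brick_def intro: exI[of _ "\<lambda>_. 0"])
  then show ?case by simp
next
  case (Suc n)
  have "brick e r (Suc n) = {x + y | x y. x \<in> brick e r n \<and> y \<in> (\<lambda>c. c *\<^sub>R e n) ` {-r..r}}" (is "?L = ?R")
  proof (intro equalityI subsetI)
    fix x assume "x \<in> ?L"
    then obtain c where c: "x = (\<Sum>i<Suc n. c i *\<^sub>R e i)" "\<forall>i. \<bar>c i\<bar> \<le> r" by (auto simp: brick_def)
    have "c n \<in> {-r..r}" using c(2) by (auto simp: abs_le_iff) (metis abs_le_iff minus_le_iff)
    moreover have "(\<Sum>i<n. c i *\<^sub>R e i) \<in> brick e r n" using c(2) by (auto simp: brick_def)
    ultimately have "\<exists>y z. x = y + z \<and> y \<in> brick e r n \<and> z \<in> (\<lambda>c. c *\<^sub>R e n) ` {-r..r}"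
      using c(1) by (intro exI[of _ "\<Sum>i<n. c i *\<^sub>R e i"] exI[of _ "c n *\<^sub>R e n"]) auto
    then show "x \<in> ?R" by blast
  next
    fix x assume "x \<in> ?R"
    then obtain c d where c: "x = (\<Sum>i<n. c i *\<^sub>R e i) + d *\<^sub>R e n" "\<forall>i. \<bar>c i\<bar> \<le> r" "\<bar>d\<bar> \<le> r"
      by (auto simp: brick_def abs_le_iff)
    then have "x = (\<Sum>i<Suc n. (c(n := d)) i *\<^sub>R e i)" "\<forall>i. \<bar>(c(n := d)) i\<bar> \<le> r" by auto
    then show "x \<in> ?L" unfolding brick_def by blast
  qed
  moreover have "compact ((\<lambda>c. c *\<^sub>R e n) ` {-r..r})"
    by (intro compact_continuous_image continuous_intros) auto
  ultimately show ?case using compact_sums[OF Suc.IH[OF Suc.prems]] by simp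
qed

definition squash :: "(nat \<Rightarrow> 'a::real_inner) \<Rightarrow> nat \<Rightarrow> 'a \<Rightarrow> 'a" where
  "squash e n x = (\<Sum>i<n. (real n * sin ((x \<bullet> e i) / real n)) *\<^sub>R e i)"

context
  fixes e :: "nat \<Rightarrow> 'a::{real_inner, polish_space}"
  assumes e: "onb_seq e"
begin

lemma squash_in_brick: "squash e n x \<in> brick e (real n) n"
  unfolding squash_def brick_def
  by (rule CollectI, rule exI[of _ "\<lambda>i. real n * sin ((x \<bullet> e i) / real n)"])
    (simp add: abs_mult mult_left_le)

lemma sum_inner_onb: "(\<Sum>j<n. c j *\<^sub>R e j) \<bullet> e i = (if i < n then c i * (norm (e i))\<^sup>2 else 0)"
proof -
  have "(\<Sum>j<n. c j *\<^sub>R e j) \<bullet> e i = (\<Sum>j<n. if j = i then c i * (norm (e i))\<^sup>2 else 0)"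
    unfolding inner_sum_left
    by (rule sum.cong[OF refl]) (use onb_ortho[OF e] in \<open>auto simp: dot_square_norm\<close>)
  then show ?thesis by simp
qed

lemma brick_separated:
  assumes "x \<in> brick e r n" "y \<in> brick e r n" "x \<noteq> y"
  shows "\<exists>i<n. x \<bullet> e i \<noteq> y \<bullet> e i"
proof (rule ccontr)
  assume n: "\<not> ?thesis"
  obtain c d where c: "x = (\<Sum>i<n. c i *\<^sub>R e i)" and d: "y = (\<Sum>i<n. d i *\<^sub>R e i)"
    using assms by (auto simp: brick_def)
  have "c i *\<^sub>R e i = d i *\<^sub>R e i" if "i < n" for i
  proof -
    have "x \<bullet> e i = y \<bullet> e i" using n that by auto
    then show ?thesis using onb_unit[OF e, of i] that by (auto simp: c d sum_inner_onb)
  qed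
  then have "x = y" unfolding c d by (intro sum.cong) auto
  then show False using assms by simp
qed

lemma abs_sin_minus_le: "\<bar>sin t - t\<bar> \<le> t\<^sup>2" for t :: real
proof -
  have "\<bar>sin t - (\<Sum>m<2. sin_coeff m * t ^ m)\<bar> \<le> inverse (fact 2) * \<bar>t\<bar> ^ 2"
    by (rule Maclaurin_sin_bound)
  then have "\<bar>sin t - t\<bar> \<le> 1/2 * t\<^sup>2" by (simp add: numeral_2_eq_2 sin_coeff_def)
  then show ?thesis using zero_le_power2[of t] by linarith
qed

lemma squash_tendsto: "(\<lambda>n. squash e n x) \<longlonglongrightarrow> x"
proof -
  have le: "norm (squash e n x - proj e n x) \<le> (norm x)\<^sup>2 / real n" if "n > 0" for n
  proof (rule power2_le_imp_le)
    have *: "(real n * sin ((x \<bullet> e i) / real n) - x \<bullet> e i)\<^sup>2 \<le> (x \<bullet> e i)\<^sup>2 * ((norm x)\<^sup>2 / (real n)\<^sup>2)" for i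
    proof -
      let ?u = "x \<bullet> e i"
      have "real n * sin (?u / real n) - ?u = real n * (sin (?u / real n) - ?u / real n)"
        using that by (simp add: right_diff_distrib)
      then have "\<bar>real n * sin (?u / real n) - ?u\<bar> = real n * \<bar>sin (?u / real n) - ?u / real n\<bar>"
        by (simp add: abs_mult)
      also have "\<dots> \<le> real n * (?u / real n)\<^sup>2" by (intro mult_left_mono abs_sin_minus_le) simp
      also have "\<dots> = ?u\<^sup>2 / real n" using that by (simp add: power2_eq_square)
      finally have "(real n * sin (?u / real n) - ?u)\<^sup>2 \<le> (?u\<^sup>2 / real n)\<^sup>2"
        by (simp add: abs_le_square_iff[symmetric])
      also have "\<dots> = ?u\<^sup>2 * (?u\<^sup>2 / (real n)\<^sup>2)" by (simp add: power2_eq_square)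
      also have "\<dots> \<le> ?u\<^sup>2 * ((norm x)\<^sup>2 / (real n)\<^sup>2)"
      proof (intro mult_left_mono divide_right_mono)
        have "\<bar>?u\<bar> \<le> norm x * norm (e i)" by (rule Cauchy_Schwarz_ineq2)
        also have "\<dots> \<le> norm x * 1" by (intro mult_left_mono onb_norm_le[OF e]) simp
        finally show "?u\<^sup>2 \<le> (norm x)\<^sup>2" by (simp add: abs_le_square_iff[symmetric])
      qed auto
      finally show ?thesis .
    qed
    have "squash e n x - proj e n x = (\<Sum>i<n. (real n * sin ((x \<bullet> e i) / real n) - x \<bullet> e i) *\<^sub>R e i)"
      by (simp add: squash_def proj_def sum_subtractf scaleR_diff_left)
    then have "(norm (squash e n x - proj e n x))\<^sup>2 \<le> (\<Sum>i<n. (real n * sin ((x \<bullet> e i) / real n) - x \<bullet> e i)\<^sup>2)"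
      using onb_norm_sum[OF e] by simp
    also have "\<dots> \<le> (\<Sum>i<n. (x \<bullet> e i)\<^sup>2) * ((norm x)\<^sup>2 / (real n)\<^sup>2)"
      unfolding sum_distrib_right by (intro sum_mono *)
    also have "\<dots> \<le> (norm x)\<^sup>2 * ((norm x)\<^sup>2 / (real n)\<^sup>2)"
      by (intro mult_right_mono bessel[OF e]) simp
    finally show "(norm (squash e n x - proj e n x))\<^sup>2 \<le> ((norm x)\<^sup>2 / real n)\<^sup>2"
      by (simp add: power2_eq_square)
  qed simp
  have "(\<lambda>n. squash e n x - proj e n x) \<longlonglongrightarrow> 0"
  proof (rule Lim_null_comparison)
    show "\<forall>\<^sub>F n in sequentially. norm (squash e n x - proj e n x) \<le> (norm x)\<^sup>2 / real n"
      using eventually_gt_at_top[of 0] by (rule eventually_mono) (rule le)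
    show "(\<lambda>n. (norm x)\<^sup>2 / real n) \<longlonglongrightarrow> 0" by (rule lim_const_over_n)
  qed
  from tendsto_add[OF this proj_tendsto[OF e, of x]] show ?thesis by simp
qed

end

lemma trig_approx:
  fixes V :: "'a::{real_inner, polish_space} set"
  assumes V: "subspace V" "closure V = UNIV" and f: "continuous_on UNIV f" "\<And>x. \<bar>f x\<bar> \<le> C"
  obtains g where "\<And>n. g n \<in> trig V" "\<And>n x. \<bar>g n x\<bar> \<le> C + 1" "\<And>x. (\<lambda>n. g n x) \<longlonglongrightarrow> f x"
proof -
  obtain e where e: "onb_seq e" "\<And>i. e i \<in> V" using onb_seq_in_dense_subspace[OF V] by blast
  have "\<exists>g. (continuous_on UNIV g \<and> (\<lambda>x. g (squash e n x)) \<in> trig V) \<and> (\<forall>x\<in>brick e (real n) n. \<bar>f x - g x\<bar> < 1 / real (Suc n))" for n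
  proof (rule Stone_Weierstrass_HOL)
    show "compact (brick e (real n) n)" by (rule compact_brick) simp
    show "continuous_on UNIV (\<lambda>x. c) \<and> (\<lambda>x. c) \<in> trig V" for c :: real
      using trig_const[OF subspace_0[OF V(1)]] by simp
    show "continuous_on (brick e (real n) n) g" if "continuous_on UNIV g \<and> (\<lambda>x. g (squash e n x)) \<in> trig V" for g :: "'a \<Rightarrow> real"
      using that continuous_on_subset by blast
    show "continuous_on UNIV (\<lambda>x. g x + h x) \<and> (\<lambda>x. g (squash e n x) + h (squash e n x)) \<in> trig V"
      if "(continuous_on UNIV g \<and> (\<lambda>x. g (squash e n x)) \<in> trig V) \<and> continuous_on UNIV h \<and> (\<lambda>x. h (squash e n x)) \<in> trig V"
      for g h :: "'a \<Rightarrow> real" using that by (auto intro!: trig_add continuous_intros)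
    show "continuous_on UNIV (\<lambda>x. g x * h x) \<and> (\<lambda>x. g (squash e n x) * h (squash e n x)) \<in> trig V"
      if "(continuous_on UNIV g \<and> (\<lambda>x. g (squash e n x)) \<in> trig V) \<and> continuous_on UNIV h \<and> (\<lambda>x. h (squash e n x)) \<in> trig V"
      for g h :: "'a \<Rightarrow> real" using that by (auto intro!: trig_mult V continuous_intros)
    show "\<exists>g. (continuous_on UNIV g \<and> (\<lambda>x. g (squash e n x)) \<in> trig V) \<and> g x \<noteq> g y"
      if xy: "x \<in> brick e (real n) n \<and> y \<in> brick e (real n) n \<and> x \<noteq> y" for x y
    proof -
      obtain i where i: "i < n" "x \<bullet> e i \<noteq> y \<bullet> e i" using brick_separated[OF e(1), of x "real n" n y] xy by blast
      have "squash e n z \<bullet> e i = (real n * (norm (e i))\<^sup>2) * wave ((1 / real n) *\<^sub>R e i) (- (pi / 2)) z" for z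
        using i(1) by (simp add: squash_def sum_inner_onb[OF e(1)] wave_def sin_cos_eq) (metis cos_minus minus_diff_eq)
      then have "(\<lambda>z. squash e n z \<bullet> e i) \<in> trig V"
        using trig_scale[OF trig_wave[of "(1 / real n) *\<^sub>R e i" V]] e(2) V(1) by (simp add: subspace_scale)
      then show ?thesis using i by (intro exI[of _ "\<lambda>z. z \<bullet> e i"]) (auto intro!: continuous_intros)
    qed
    show "continuous_on (brick e (real n) n) f" using f(1) continuous_on_subset by blast
  qed simp
  then obtain g where g: "\<And>n. (\<lambda>x. g n (squash e n x)) \<in> trig V"
    "\<And>n x. x \<in> brick e (real n) n \<Longrightarrow> \<bar>f x - g n x\<bar> < 1 / real (Suc n)"
    by metis
  have near: "\<bar>f (squash e n x) - g n (squash e n x)\<bar> < 1 / real (Suc n)" for n x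
    by (rule g(2)[OF squash_in_brick[OF e(1)]])
  show thesis
  proof (rule that[of "\<lambda>n x. g n (squash e n x)"])
    show "(\<lambda>x. g n (squash e n x)) \<in> trig V" for n by (rule g)
    show "\<bar>g n (squash e n x)\<bar> \<le> C + 1" for n x
    proof -
      have "1 / real (Suc n) \<le> 1" by simp
      then show ?thesis using near[of n x] f(2)[of "squash e n x"] by linarith
    qed
    have "(\<lambda>n. f (squash e n x) - g n (squash e n x)) \<longlonglongrightarrow> 0" for x
      by (rule Lim_null_comparison[OF _ LIMSEQ_inverse_real_of_nat])
        (use near in \<open>auto simp: inverse_eq_divide less_imp_le\<close>)
    moreover have "(\<lambda>n. f (squash e n x)) \<longlonglongrightarrow> f x" for x
      using f(1) squash_tendsto[OF e(1), of x] by (auto simp: continuous_on_sequentially comp_def)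
    ultimately show "(\<lambda>n. g n (squash e n x)) \<longlonglongrightarrow> f x" for x
      using tendsto_diff[of "\<lambda>n. f (squash e n x)" "f x" sequentially "\<lambda>n. f (squash e n x) - g n (squash e n x)" 0] by simp
  qed
qed

section \<open>Twice differentiable functions with Hilbert--Schmidt Hessian\<close>

definition C2 :: "('a::real_inner \<Rightarrow> real) \<Rightarrow> ('a \<Rightarrow> 'a) \<Rightarrow> ('a \<Rightarrow> 'a \<Rightarrow> 'a) \<Rightarrow> real \<Rightarrow> bool" where
  "C2 f g T C \<longleftrightarrow> (\<forall>x. \<bar>f x\<bar> \<le> C) \<and> (\<forall>x. GDERIV f x :> g x) \<and> (\<forall>x. norm (g x) \<le> C) \<and>
     (\<forall>x. (g has_derivative T x) (at x)) \<and> (\<forall>x. hilbert_schmidt (T x)) \<and>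
     (\<forall>x. hs_norm (T x) \<le> C) \<and> (\<forall>x. ((\<lambda>y. hs_norm (\<lambda>v. T y v - T x v)) \<longlongrightarrow> 0) (at x))"

lemma GDERIV_unique:
  assumes "GDERIV f x :> u" "GDERIV f x :> v" shows "u = v"
proof -
  have "(\<lambda>h. h \<bullet> u) = (\<lambda>h. h \<bullet> v)"
    using has_derivative_unique assms unfolding gderiv_def by blast
  then have "\<forall>h. h \<bullet> u = h \<bullet> v" by (simp add: fun_eq_iff)
  then show ?thesis by (simp only: vector_eq_ldot)
qed

context
  fixes f :: "'a::real_inner \<Rightarrow> real" and g T C
  assumes C2: "C2 f g T C"
begin

lemma C2_abs: "\<bar>f x\<bar> \<le> C" and C2_gderiv: "GDERIV f x :> g x" and C2_norm: "norm (g x) \<le> C"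
  and C2_deriv: "(g has_derivative T x) (at x)" and C2_hs: "hilbert_schmidt (T x)"
  and C2_hs_norm: "hs_norm (T x) \<le> C"
  and C2_cont: "((\<lambda>y. hs_norm (\<lambda>v. T y v - T x v)) \<longlongrightarrow> 0) (at x)"
  using C2 by (auto simp: C2_def)

lemma C2_nonneg: "0 \<le> C" using C2_abs[of 0] by simp

lemma C2_has_derivative: "(f has_derivative (\<lambda>v. v \<bullet> g x)) (at x)"
  using C2_gderiv by (simp add: gderiv_def)

lemma C2_continuous: "continuous_on X f"
  by (intro continuous_at_imp_continuous_on ballI has_derivative_continuous[OF C2_has_derivative])

lemma C2_grad_continuous: "continuous_on X g"
  by (intro continuous_at_imp_continuous_on ballI has_derivative_continuous[OF C2_deriv])

lemma C2_grad: "grad f = g"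
proof (rule ext)
  show "grad f x = g x" for x
    unfolding grad_def by (rule the_equality, rule C2_gderiv) (rule GDERIV_unique[OF _ C2_gderiv])
qed

lemma C2_hess: "hess f = T"
  by (rule ext) (auto simp: hess_def C2_grad intro!: frechet_derivative_at[symmetric] C2_deriv)

lemma C2_Cb2: "f \<in> Cb2"
  unfolding Cb2_def mem_Collect_eq C2_grad C2_hess
proof (intro conjI allI)
  show "f \<in> bcontfun" using C2_abs C2_continuous by (intro bcontfunI') auto
  show "g \<in> bcontfun" using C2_norm C2_grad_continuous by (intro bcontfunI') auto
  show "\<exists>v. GDERIV f x :> v" for x using C2_gderiv by blast
  show "g differentiable at x" for x using C2_deriv by (auto simp: differentiable_def)
  show "\<exists>C. \<forall>x. hs_norm (T x) \<le> C" using C2_hs_norm by blast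
qed (use C2_hs C2_cont in auto)

end

lemma Cb2_C2:
  assumes "f \<in> Cb2" obtains C where "C2 f (grad f) (hess f) C"
proof -
  have f: "f \<in> bcontfun" "\<And>x. \<exists>v. GDERIV f x :> v" "grad f \<in> bcontfun" "\<And>x. grad f differentiable (at x)"
    "\<And>x. hilbert_schmidt (hess f x)" "\<exists>C. \<forall>x. hs_norm (hess f x) \<le> C"
    "\<And>x. ((\<lambda>y. hs_norm (\<lambda>v. hess f y v - hess f x v)) \<longlongrightarrow> 0) (at x)"
    using assms by (auto simp: Cb2_def)
  obtain K1 where K1: "\<And>x. norm (f x) \<le> K1" using bcontfun_bound[OF f(1)] by blast
  obtain K2 where K2: "\<And>x. norm (grad f x) \<le> K2" using bcontfun_bound[OF f(3)] by blast
  obtain K3 where K3: "\<And>x. hs_norm (hess f x) \<le> K3" using f(6) by blast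
  have g: "GDERIV f x :> grad f x" for x
  proof -
    obtain v where "GDERIV f x :> v" using f(2) by blast
    then show ?thesis unfolding grad_def by (rule theI) (rule GDERIV_unique[OF _ \<open>GDERIV f x :> v\<close>])
  qed
  have h: "(grad f has_derivative hess f x) (at x)" for x
    unfolding hess_def using f(4) frechet_derivative_works by blast
  have "C2 f (grad f) (hess f) (max K1 (max K2 K3))"
    unfolding C2_def using f g h K1 K2 K3 by (simp add: le_max_iff_disj)
  then show thesis by (rule that)
qed

lemma C2_lipschitz:
  fixes f :: "'a::{real_inner, polish_space} \<Rightarrow> real"
  assumes C2: "C2 f g T C"
  shows "norm (g y - g x) \<le> C * norm (y - x)"
proof (rule differentiable_bound[of UNIV g T])
  show "(g has_derivative T z) (at z within UNIV)" for z using C2_deriv[OF C2] by simp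
  show "onorm (T z) \<le> C" for z
  proof (rule onorm_bound[OF C2_nonneg[OF C2]])
    fix v
    have "norm (T z v) \<le> hs_norm (T z) * norm v" by (rule norm_le_hs_norm[OF C2_hs[OF C2]])
    also have "\<dots> \<le> C * norm v" by (intro mult_right_mono C2_hs_norm[OF C2]) simp
    finally show "norm (T z v) \<le> C * norm v" .
  qed
qed auto

lemma C2_taylor:
  fixes f :: "'a::{real_inner, polish_space} \<Rightarrow> real"
  assumes C2: "C2 f g T C"
  shows "\<bar>f (x + v) - f x - v \<bullet> g x\<bar> \<le> C * (norm v)\<^sup>2"
proof -
  let ?F = "\<lambda>z. f z - z \<bullet> g x"
  have "norm (?F (x + v) - ?F x) \<le> (C * norm v) * norm (x + v - x)"
  proof (rule differentiable_bound[of "cball x (norm v)" ?F "\<lambda>z w. w \<bullet> g z - w \<bullet> g x"])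
    show "(?F has_derivative (\<lambda>w. w \<bullet> g z - w \<bullet> g x)) (at z within cball x (norm v))" for z
      by (intro has_derivative_diff has_derivative_at_withinI[OF C2_has_derivative[OF C2]]
        bounded_linear_imp_has_derivative bounded_linear_inner_left)
    show "onorm (\<lambda>w. w \<bullet> g z - w \<bullet> g x) \<le> C * norm v" if z: "z \<in> cball x (norm v)" for z
    proof (rule onorm_bound[OF mult_nonneg_nonneg[OF C2_nonneg[OF C2] norm_ge_zero]])
      fix w
      have "\<bar>w \<bullet> g z - w \<bullet> g x\<bar> \<le> norm w * norm (g z - g x)"
        using Cauchy_Schwarz_ineq2[of w "g z - g x"] by (simp add: inner_diff_right)
      also have "\<dots> \<le> norm w * (C * norm (z - x))"
        by (intro mult_left_mono C2_lipschitz[OF C2]) simp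
      also have "\<dots> \<le> norm w * (C * norm v)"
        by (intro mult_left_mono) (use z C2_nonneg[OF C2] in \<open>auto simp: dist_norm norm_minus_commute\<close>)
      finally show "norm (w \<bullet> g z - w \<bullet> g x) \<le> C * norm v * norm w" by (simp add: mult_ac)
    qed
  qed (auto simp: dist_norm)
  then show ?thesis by (simp add: inner_add_left power2_eq_square algebra_simps)
qed

lemma C2_zero: "C2 (\<lambda>x. 0) (\<lambda>x. 0) (\<lambda>x v. 0 :: 'a::{real_inner, polish_space}) 0"
proof -
  have "hs_norm (\<lambda>v. 0 :: 'a) \<le> 0" using hs_rank_one(2)[of 0 "0::'a"] by simp
  then have "hs_norm (\<lambda>v. 0 :: 'a) = 0" using hs_norm_nonneg[of "\<lambda>v. 0 :: 'a"] by linarith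
  then show ?thesis by (simp add: C2_def GDERIV_const hs_zero)
qed

lemma C2_add:
  fixes f :: "'a::{real_inner, polish_space} \<Rightarrow> real"
  assumes f: "C2 f g T C" and f': "C2 f' g' T' C'"
  shows "C2 (\<lambda>x. f x + f' x) (\<lambda>x. g x + g' x) (\<lambda>x v. T x v + T' x v) (C + C')"
  unfolding C2_def
proof (intro conjI allI)
  fix x
  show "\<bar>f x + f' x\<bar> \<le> C + C'" using C2_abs[OF f, of x] C2_abs[OF f', of x] by linarith
  show "norm (g x + g' x) \<le> C + C'"
    by (intro order_trans[OF norm_triangle_ineq] add_mono C2_norm[OF f] C2_norm[OF f'])
  show "GDERIV (\<lambda>x. f x + f' x) x :> g x + g' x" by (intro GDERIV_add C2_gderiv[OF f] C2_gderiv[OF f'])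
  show "((\<lambda>x. g x + g' x) has_derivative (\<lambda>v. T x v + T' x v)) (at x)"
    by (intro has_derivative_add C2_deriv[OF f] C2_deriv[OF f'])
  show "hilbert_schmidt (\<lambda>v. T x v + T' x v)" by (intro hs_add C2_hs[OF f] C2_hs[OF f'])
  show "hs_norm (\<lambda>v. T x v + T' x v) \<le> C + C'"
    using hs_add(2)[OF C2_hs[OF f, of x] C2_hs[OF f', of x]] C2_hs_norm[OF f, of x] C2_hs_norm[OF f', of x]
    by linarith
  have le: "hs_norm (\<lambda>v. T y v + T' y v - (T x v + T' x v)) \<le>
      hs_norm (\<lambda>v. T y v - T x v) + hs_norm (\<lambda>v. T' y v - T' x v)" for y
    using hs_add(2)[OF hs_diff(1)[OF C2_hs[OF f, of y] C2_hs[OF f, of x]]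
      hs_diff(1)[OF C2_hs[OF f', of y] C2_hs[OF f', of x]]] by (simp add: algebra_simps)
  show "((\<lambda>y. hs_norm (\<lambda>v. T y v + T' y v - (T x v + T' x v))) \<longlongrightarrow> 0) (at x)"
    by (rule tendsto_sandwich[OF _ _ tendsto_const tendsto_add_zero[OF C2_cont[OF f, of x] C2_cont[OF f', of x]]])
      (auto simp: hs_norm_nonneg le)
qed

lemma C2_scale:
  fixes f :: "'a::{real_inner, polish_space} \<Rightarrow> real"
  assumes f: "C2 f g T C"
  shows "C2 (\<lambda>x. c * f x) (\<lambda>x. c *\<^sub>R g x) (\<lambda>x v. c *\<^sub>R T x v) (\<bar>c\<bar> * C)"
  unfolding C2_def
proof (intro conjI allI)
  fix x
  show "\<bar>c * f x\<bar> \<le> \<bar>c\<bar> * C" using C2_abs[OF f, of x] by (simp add: abs_mult mult_left_mono)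
  show "norm (c *\<^sub>R g x) \<le> \<bar>c\<bar> * C" using C2_norm[OF f, of x] by (simp add: mult_left_mono)
  show "GDERIV (\<lambda>x. c * f x) x :> c *\<^sub>R g x"
    using has_derivative_mult_right[OF C2_has_derivative[OF f, of x], of c] by (simp add: gderiv_def)
  show "((\<lambda>x. c *\<^sub>R g x) has_derivative (\<lambda>v. c *\<^sub>R T x v)) (at x)"
    by (intro has_derivative_scaleR_right C2_deriv[OF f])
  show "hilbert_schmidt (\<lambda>v. c *\<^sub>R T x v)" by (intro hs_scaleR C2_hs[OF f])
  show "hs_norm (\<lambda>v. c *\<^sub>R T x v) \<le> \<bar>c\<bar> * C"
    using hs_scaleR(2)[OF C2_hs[OF f, of x], of c] mult_left_mono[OF C2_hs_norm[OF f, of x], of "\<bar>c\<bar>"] by linarith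
  have le: "hs_norm (\<lambda>v. c *\<^sub>R T y v - c *\<^sub>R T x v) \<le> \<bar>c\<bar> * hs_norm (\<lambda>v. T y v - T x v)" for y
    using hs_scaleR(2)[OF hs_diff(1)[OF C2_hs[OF f, of y] C2_hs[OF f, of x]], of c] by (simp add: scaleR_diff_right)
  show "((\<lambda>y. hs_norm (\<lambda>v. c *\<^sub>R T y v - c *\<^sub>R T x v)) \<longlongrightarrow> 0) (at x)"
    by (rule tendsto_sandwich[OF _ _ tendsto_const tendsto_mult_right_zero[OF C2_cont[OF f, of x], of "\<bar>c\<bar>"]])
      (auto simp: hs_norm_nonneg le)
qed

lemma C2_affine:
  fixes f :: "'a::{real_inner, polish_space} \<Rightarrow> real" and R :: "'a \<Rightarrow> 'a"
  assumes f: "C2 f g T C" and R: "bounded_linear R" "\<And>x. norm (R x) \<le> M * norm x" "1 \<le> M"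
  shows "C2 (\<lambda>x. f (w + R x)) (\<lambda>x. adjoint R (g (w + R x))) (\<lambda>x v. adjoint R (T (w + R x) (R v))) (M\<^sup>2 * C)"
  unfolding C2_def
proof (intro conjI allI)
  fix x
  have M: "0 \<le> M" "1 \<le> M\<^sup>2" "M \<le> M\<^sup>2" using R(3) by (auto simp: one_le_power self_le_power)
  note C = C2_nonneg[OF f]
  note aR = bounded_linear_adjoint[OF R(1)] norm_adjoint_le[OF R(1,2) M(1)]
  have dR: "((\<lambda>x. w + R x) has_derivative R) (at x)"
    using bounded_linear_imp_has_derivative[OF R(1)] by (auto intro!: derivative_eq_intros)
  have "\<bar>f (w + R x)\<bar> \<le> C" by (rule C2_abs[OF f])
  also have "C \<le> M\<^sup>2 * C" using M C mult_right_mono by fastforce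
  finally show "\<bar>f (w + R x)\<bar> \<le> M\<^sup>2 * C" .
  have "norm (adjoint R (g (w + R x))) \<le> M * norm (g (w + R x))" by (rule aR)
  also have "\<dots> \<le> M\<^sup>2 * C" by (intro mult_mono C2_norm[OF f] M) auto
  finally show "norm (adjoint R (g (w + R x))) \<le> M\<^sup>2 * C" .
  have "((\<lambda>x. f (w + R x)) has_derivative (\<lambda>v. R v \<bullet> g (w + R x))) (at x)"
    using has_derivative_compose[OF dR C2_has_derivative[OF f]] .
  then show "GDERIV (\<lambda>x. f (w + R x)) x :> adjoint R (g (w + R x))"
    by (simp add: gderiv_def adjoint_inner[OF R(1)])
  have "((\<lambda>x. g (w + R x)) has_derivative (\<lambda>v. T (w + R x) (R v))) (at x)"
    using has_derivative_compose[OF dR C2_deriv[OF f]] .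
  then show "((\<lambda>x. adjoint R (g (w + R x))) has_derivative (\<lambda>v. adjoint R (T (w + R x) (R v)))) (at x)"
    by (rule bounded_linear.has_derivative[OF aR(1)])
  have hs: "hilbert_schmidt (\<lambda>v. adjoint R (U (R v)))" "hs_norm (\<lambda>v. adjoint R (U (R v))) \<le> M\<^sup>2 * hs_norm U"
    if U: "hilbert_schmidt U" for U
  proof -
    note 1 = hs_comp_right[OF U R(1,2) M(1)]
    note 2 = hs_comp_left[OF 1(1) aR M(1)]
    show "hilbert_schmidt (\<lambda>v. adjoint R (U (R v)))" by (rule 2)
    show "hs_norm (\<lambda>v. adjoint R (U (R v))) \<le> M\<^sup>2 * hs_norm U"
      using 2(2) mult_left_mono[OF 1(2) M(1)] by (simp add: power2_eq_square mult_ac)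
  qed
  show "hilbert_schmidt (\<lambda>v. adjoint R (T (w + R x) (R v)))" by (intro hs C2_hs[OF f])
  show "hs_norm (\<lambda>v. adjoint R (T (w + R x) (R v))) \<le> M\<^sup>2 * C"
    using hs(2)[OF C2_hs[OF f, of "w + R x"]] mult_left_mono[OF C2_hs_norm[OF f, of "w + R x"], of "M\<^sup>2"] by simp
  have le: "hs_norm (\<lambda>v. adjoint R (T (w + R y) (R v)) - adjoint R (T (w + R x) (R v))) \<le>
      M\<^sup>2 * hs_norm (\<lambda>v. T (w + R y) v - T (w + R x) v)" for y
    using hs(2)[OF hs_diff(1)[OF C2_hs[OF f, of "w + R y"] C2_hs[OF f, of "w + R x"]]]
    by (simp add: linear_diff[OF bounded_linear.linear[OF aR(1)]])
  have "isCont (\<lambda>y. hs_norm (\<lambda>v. T y v - T (w + R x) v)) (w + R x)"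
  proof -
    have "hs_norm (\<lambda>v. T (w + R x) v - T (w + R x) v) = 0"
      using C2_nonneg[OF C2_zero] hs_rank_one(2)[of 0 "0::'a"] hs_norm_nonneg[of "\<lambda>v. 0 :: 'a"] by simp
    then show ?thesis using C2_cont[OF f, of "w + R x"] by (simp add: isCont_def)
  qed
  moreover have "isCont (\<lambda>y. w + R y) x" using dR by (rule has_derivative_continuous)
  ultimately have "isCont (\<lambda>y. hs_norm (\<lambda>v. T (w + R y) v - T (w + R x) v)) x"
    by (rule isCont_o2[rotated])
  then have "((\<lambda>y. hs_norm (\<lambda>v. T (w + R y) v - T (w + R x) v)) \<longlongrightarrow> hs_norm (\<lambda>v. 0 :: 'a)) (at x)"
    by (simp add: isCont_def)
  moreover have "hs_norm (\<lambda>v. 0 :: 'a) = 0"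
    using hs_rank_one(2)[of 0 "0::'a"] hs_norm_nonneg[of "\<lambda>v. 0 :: 'a"] by simp
  ultimately have 0: "((\<lambda>y. hs_norm (\<lambda>v. T (w + R y) v - T (w + R x) v)) \<longlongrightarrow> 0) (at x)" by simp
  show "((\<lambda>y. hs_norm (\<lambda>v. adjoint R (T (w + R y) (R v)) - adjoint R (T (w + R x) (R v)))) \<longlongrightarrow> 0) (at x)"
    by (rule tendsto_sandwich[OF _ _ tendsto_const tendsto_mult_right_zero[OF 0, of "M\<^sup>2"]])
      (auto simp: hs_norm_nonneg le)
qed

lemma C2_wave:
  fixes h :: "'a::{real_inner, polish_space}"
  shows "C2 (wave h c) (\<lambda>x. (- sin (x \<bullet> h + c)) *\<^sub>R h) (\<lambda>x v. (v \<bullet> h) *\<^sub>R ((- cos (x \<bullet> h + c)) *\<^sub>R h)) ((1 + norm h)\<^sup>2)"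
  unfolding C2_def
proof (intro conjI allI)
  fix x
  have b: "1 \<le> (1 + norm h)\<^sup>2" "norm h \<le> (1 + norm h)\<^sup>2" "norm h * norm h \<le> (1 + norm h)\<^sup>2"
    by (auto simp: power2_eq_square algebra_simps)
  show "\<bar>wave h c x\<bar> \<le> (1 + norm h)\<^sup>2" using abs_wave_le[of h c x] b by linarith
  have "norm ((- sin (x \<bullet> h + c)) *\<^sub>R h) \<le> 1 * norm h"
    unfolding norm_scaleR by (intro mult_right_mono) auto
  then show "norm ((- sin (x \<bullet> h + c)) *\<^sub>R h) \<le> (1 + norm h)\<^sup>2" using b by linarith
  show "GDERIV (wave h c) x :> (- sin (x \<bullet> h + c)) *\<^sub>R h"
    unfolding gderiv_def wave_def by (auto intro!: derivative_eq_intros)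
  show "((\<lambda>x. (- sin (x \<bullet> h + c)) *\<^sub>R h) has_derivative (\<lambda>v. (v \<bullet> h) *\<^sub>R ((- cos (x \<bullet> h + c)) *\<^sub>R h))) (at x)"
    by (auto intro!: derivative_eq_intros simp: fun_eq_iff)
  show "hilbert_schmidt (\<lambda>v. (v \<bullet> h) *\<^sub>R ((- cos (x \<bullet> h + c)) *\<^sub>R h))" by (rule hs_rank_one)
  have "norm h * norm ((- cos (x \<bullet> h + c)) *\<^sub>R h) \<le> norm h * (1 * norm h)"
    unfolding norm_scaleR by (intro mult_left_mono mult_right_mono) auto
  then show "hs_norm (\<lambda>v. (v \<bullet> h) *\<^sub>R ((- cos (x \<bullet> h + c)) *\<^sub>R h)) \<le> (1 + norm h)\<^sup>2"
    using hs_rank_one(2)[of h "(- cos (x \<bullet> h + c)) *\<^sub>R h"] b by linarith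
  have le: "hs_norm (\<lambda>v. (v \<bullet> h) *\<^sub>R ((- cos (y \<bullet> h + c)) *\<^sub>R h) - (v \<bullet> h) *\<^sub>R ((- cos (x \<bullet> h + c)) *\<^sub>R h)) \<le>
      norm h * norm ((- cos (y \<bullet> h + c)) *\<^sub>R h - (- cos (x \<bullet> h + c)) *\<^sub>R h)" for y
    using hs_rank_one(2)[of h "(- cos (y \<bullet> h + c)) *\<^sub>R h - (- cos (x \<bullet> h + c)) *\<^sub>R h"]
    by (simp only: scaleR_diff_right)
  have "((\<lambda>y. (- cos (y \<bullet> h + c)) *\<^sub>R h) \<longlongrightarrow> (- cos (x \<bullet> h + c)) *\<^sub>R h) (at x)"
    by (intro tendsto_intros)
  then have 0: "((\<lambda>y. norm ((- cos (y \<bullet> h + c)) *\<^sub>R h - (- cos (x \<bullet> h + c)) *\<^sub>R h)) \<longlongrightarrow> 0) (at x)"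
    by (intro tendsto_norm_zero LIM_zero)
  show "((\<lambda>y. hs_norm (\<lambda>v. (v \<bullet> h) *\<^sub>R ((- cos (y \<bullet> h + c)) *\<^sub>R h) - (v \<bullet> h) *\<^sub>R ((- cos (x \<bullet> h + c)) *\<^sub>R h))) \<longlongrightarrow> 0) (at x)"
    by (rule tendsto_sandwich[OF _ _ tendsto_const tendsto_mult_right_zero[OF 0, of "norm h"]])
      (use le in \<open>auto simp: hs_norm_nonneg\<close>)
qed

lemma wint_eqI:
  fixes m :: "'a::real_inner"
  assumes "\<And>v. v \<bullet> m = (\<integral>\<omega>. v \<bullet> f \<omega> \<partial>M)" shows "wint M f = m"
  unfolding wint_def
proof (rule the_equality)
  fix m' assume "\<forall>v. v \<bullet> m' = (\<integral>\<omega>. v \<bullet> f \<omega> \<partial>M)"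
  then have "\<forall>v. v \<bullet> m' = v \<bullet> m" using assms by simp
  then show "m' = m" by (simp only: vector_eq_ldot)
qed (use assms in auto)

lemma measurable_norm_weak:
  fixes f :: "'b \<Rightarrow> 'a::{real_inner, polish_space}"
  assumes [measurable]: "\<And>v. (\<lambda>\<omega>. v \<bullet> f \<omega>) \<in> borel_measurable M"
  shows "(\<lambda>\<omega>. norm (f \<omega>)) \<in> borel_measurable M"
proof -
  have "norm (f \<omega>) = sqrt (\<Sum>i. (sb i \<bullet> f \<omega>)\<^sup>2)" for \<omega>
  proof -
    have "(norm (f \<omega>))\<^sup>2 = (\<Sum>i. (sb i \<bullet> f \<omega>)\<^sup>2)"
      using sums_unique[OF parseval_norm[OF onb_seq_sb, of "f \<omega>"]] by (simp add: inner_commute[of "f \<omega>"])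
    then show ?thesis by (metis norm_ge_zero real_sqrt_unique)
  qed
  then show ?thesis by simp
qed

lemma measurable_hs_norm_weak:
  fixes T :: "'b \<Rightarrow> 'a \<Rightarrow> 'a::{real_inner, polish_space}"
  assumes m: "\<And>u v. (\<lambda>\<omega>. u \<bullet> T \<omega> v) \<in> borel_measurable M" and hs: "\<And>\<omega>. \<omega> \<in> space M \<Longrightarrow> hilbert_schmidt (T \<omega>)"
  shows "(\<lambda>\<omega>. hs_norm (T \<omega>)) \<in> borel_measurable M"
proof -
  have [measurable]: "(\<lambda>\<omega>. norm (T \<omega> v)) \<in> borel_measurable M" for v
    by (rule measurable_norm_weak) (rule m)
  have "(\<lambda>\<omega>. sqrt (\<Sum>i. (norm (T \<omega> (sb i)))\<^sup>2)) \<in> borel_measurable M" by measurable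
  then show ?thesis by (rule measurable_cong[THEN iffD2, rotated]) (rule hs_norm_eq[OF hs])
qed

text \<open>Testing against the operator itself avoids Jensen's inequality.\<close>
lemma hs_wint:
  fixes T :: "'b \<Rightarrow> 'a::{real_inner, polish_space} \<Rightarrow> 'a"
  assumes M: "finite_measure M" and m: "\<And>u v. (\<lambda>\<omega>. u \<bullet> T \<omega> v) \<in> borel_measurable M"
    and hs: "\<And>\<omega>. \<omega> \<in> space M \<Longrightarrow> hilbert_schmidt (T \<omega>)"
    and C: "\<And>\<omega>. \<omega> \<in> space M \<Longrightarrow> hs_norm (T \<omega>) \<le> C"
  shows "hilbert_schmidt (\<lambda>v. wint M (\<lambda>\<omega>. T \<omega> v))"
    and "hs_norm (\<lambda>v. wint M (\<lambda>\<omega>. T \<omega> v)) \<le> (\<integral>\<omega>. hs_norm (T \<omega>) \<partial>M)"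
proof -
  interpret finite_measure M by fact
  define W where "W v = wint M (\<lambda>\<omega>. T \<omega> v)" for v
  have bd: "norm (T \<omega> v) \<le> C * norm v" if "\<omega> \<in> space M" for \<omega> v
    using norm_le_hs_norm[OF hs[OF that], of v] mult_right_mono[OF C[OF that], of "norm v"] by simp
  have W: "u \<bullet> W v = (\<integral>\<omega>. u \<bullet> T \<omega> v \<partial>M)" for u v
    unfolding W_def by (rule inner_wint[OF M m bd])
  have [measurable]: "(\<lambda>\<omega>. hs_norm (T \<omega>)) \<in> borel_measurable M"
    using m hs by (rule measurable_hs_norm_weak)
  have hsi: "integrable M (\<lambda>\<omega>. hs_norm (T \<omega>))"
    by (rule integrable_const_bound[where B=C]) (use C in \<open>auto simp: hs_norm_nonneg\<close>)
  have int: "integrable M (\<lambda>\<omega>. u \<bullet> T \<omega> v)" for u v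
  proof (rule integrable_const_bound[where B="norm u * (C * norm v)"])
    have "\<bar>u \<bullet> T \<omega> v\<bar> \<le> norm u * (C * norm v)" if "\<omega> \<in> space M" for \<omega>
      using Cauchy_Schwarz_ineq2[of u "T \<omega> v"] mult_left_mono[OF bd[OF that, of v], of "norm u"] by simp
    then show "AE \<omega> in M. norm (u \<bullet> T \<omega> v) \<le> norm u * (C * norm v)" by auto
  qed (rule m)
  have lin: "T \<omega> (x + y) = T \<omega> x + T \<omega> y" "T \<omega> (c *\<^sub>R x) = c *\<^sub>R T \<omega> x" if "\<omega> \<in> space M" for \<omega> x y c
    using hs_bounded_linear[OF hs[OF that]] by (auto simp: linear_simps)
  have bl: "bounded_linear W"
  proof (rule bounded_linear_intro)
    show "W (x + y) = W x + W y" for x y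
      unfolding W_def[of "x + y"]
    proof (rule wint_eqI)
      fix v
      have "(\<integral>\<omega>. v \<bullet> T \<omega> (x + y) \<partial>M) = (\<integral>\<omega>. v \<bullet> T \<omega> x + v \<bullet> T \<omega> y \<partial>M)"
        by (rule Bochner_Integration.integral_cong) (auto simp: lin inner_right_distrib)
      then show "v \<bullet> (W x + W y) = (\<integral>\<omega>. v \<bullet> T \<omega> (x + y) \<partial>M)" by (simp add: inner_right_distrib W int)
    qed
    show "W (c *\<^sub>R x) = c *\<^sub>R W x" for c x
      unfolding W_def[of "c *\<^sub>R x"]
    proof (rule wint_eqI)
      fix v
      have "(\<integral>\<omega>. v \<bullet> T \<omega> (c *\<^sub>R x) \<partial>M) = (\<integral>\<omega>. c * (v \<bullet> T \<omega> x) \<partial>M)"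
        by (rule Bochner_Integration.integral_cong) (auto simp: lin)
      then show "v \<bullet> (c *\<^sub>R W x) = (\<integral>\<omega>. v \<bullet> T \<omega> (c *\<^sub>R x) \<partial>M)" by (simp add: W)
    qed
    show "norm (W x) \<le> norm x * (C * measure M (space M))" for x
    proof -
      have "norm (W x) \<le> (\<integral>\<omega>. C * norm x \<partial>M)"
        unfolding W_def by (rule norm_wint_le[OF M m bd]) (use bd in auto)
      then show ?thesis by (simp add: mult_ac)
    qed
  qed
  have nn: "0 \<le> (\<integral>\<omega>. hs_norm (T \<omega>) \<partial>M)" by (intro Bochner_Integration.integral_nonneg hs_norm_nonneg)
  have part: "(\<Sum>i<n. (norm (W (sb i)))\<^sup>2) \<le> (\<integral>\<omega>. hs_norm (T \<omega>) \<partial>M)\<^sup>2" for n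
  proof -
    define B where "B = L2_set (\<lambda>i. norm (W (sb i))) {..<n}"
    have B: "B \<ge> 0" by (simp add: B_def)
    have "(\<Sum>i<n. (norm (W (sb i)))\<^sup>2) = (\<Sum>i<n. \<integral>\<omega>. W (sb i) \<bullet> T \<omega> (sb i) \<partial>M)"
      by (simp add: W[symmetric] power2_norm_eq_inner)
    also have "\<dots> = (\<integral>\<omega>. (\<Sum>i<n. W (sb i) \<bullet> T \<omega> (sb i)) \<partial>M)"
      by (subst Bochner_Integration.integral_sum) (auto intro: int)
    also have "\<dots> \<le> (\<integral>\<omega>. B * hs_norm (T \<omega>) \<partial>M)"
    proof (rule integral_mono)
      fix \<omega> assume w: "\<omega> \<in> space M"
      have "(\<Sum>i<n. W (sb i) \<bullet> T \<omega> (sb i)) \<le> (\<Sum>i<n. \<bar>norm (W (sb i))\<bar> * \<bar>norm (T \<omega> (sb i))\<bar>)"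
        by (intro sum_mono) (simp add: norm_cauchy_schwarz)
      also have "\<dots> \<le> B * L2_set (\<lambda>i. norm (T \<omega> (sb i))) {..<n}"
        unfolding B_def by (rule L2_set_mult_ineq)
      also have "\<dots> \<le> B * hs_norm (T \<omega>)"
        unfolding L2_set_def[of "\<lambda>i. norm (T \<omega> (sb i))"]
        by (intro mult_left_mono B real_le_lsqrt hs_partial_le hs w) (auto simp: hs_norm_nonneg sum_nonneg)
      finally show "(\<Sum>i<n. W (sb i) \<bullet> T \<omega> (sb i)) \<le> B * hs_norm (T \<omega>)" .
    qed (use int hsi in auto)
    finally have "B * B \<le> B * (\<integral>\<omega>. hs_norm (T \<omega>) \<partial>M)"
      by (simp add: B_def L2_set_def sum_nonneg)
    then have "B \<le> (\<integral>\<omega>. hs_norm (T \<omega>) \<partial>M)" using B nn by (cases "B = 0") auto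
    then have "B\<^sup>2 \<le> (\<integral>\<omega>. hs_norm (T \<omega>) \<partial>M)\<^sup>2" using B by (rule power_mono)
    then show ?thesis by (simp add: B_def L2_set_def sum_nonneg)
  qed
  from hsI[OF bl part nn] show "hilbert_schmidt (\<lambda>v. wint M (\<lambda>\<omega>. T \<omega> v))"
    "hs_norm (\<lambda>v. wint M (\<lambda>\<omega>. T \<omega> v)) \<le> (\<integral>\<omega>. hs_norm (T \<omega>) \<partial>M)"
    by (simp_all add: W_def[abs_def])
qed

lemma wint_diff:
  fixes f g :: "'b \<Rightarrow> 'a::{real_inner, polish_space}"
  assumes M: "finite_measure M"
    and f: "\<And>v. (\<lambda>\<omega>. v \<bullet> f \<omega>) \<in> borel_measurable M" "\<And>\<omega>. \<omega> \<in> space M \<Longrightarrow> norm (f \<omega>) \<le> C"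
    and g: "\<And>v. (\<lambda>\<omega>. v \<bullet> g \<omega>) \<in> borel_measurable M" "\<And>\<omega>. \<omega> \<in> space M \<Longrightarrow> norm (g \<omega>) \<le> D"
  shows "wint M (\<lambda>\<omega>. f \<omega> - g \<omega>) = wint M f - wint M g"
proof (rule wint_eqI)
  fix v :: 'a
  interpret finite_measure M by fact
  have "integrable M (\<lambda>\<omega>. v \<bullet> f \<omega>)" if f: "(\<lambda>\<omega>. v \<bullet> f \<omega>) \<in> borel_measurable M" "\<And>\<omega>. \<omega> \<in> space M \<Longrightarrow> norm (f \<omega>) \<le> C" for f C
  proof (rule integrable_const_bound[where B="norm v * C"])
    have "\<bar>v \<bullet> f \<omega>\<bar> \<le> norm v * C" if "\<omega> \<in> space M" for \<omega>
      using Cauchy_Schwarz_ineq2[of v "f \<omega>"] mult_left_mono[OF f(2)[OF that], of "norm v"] by simp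
    then show "AE \<omega> in M. norm (v \<bullet> f \<omega>) \<le> norm v * C" by auto
  qed (rule f)
  from this[OF f(1)[of v] f(2)] this[OF g(1)[of v] g(2)] show "v \<bullet> (wint M f - wint M g) = (\<integral>\<omega>. v \<bullet> (f \<omega> - g \<omega>) \<partial>M)"
    by (simp add: inner_diff_right inner_wint[OF M f] inner_wint[OF M g])
qed

lemma continuous_wint:
  fixes g :: "'b \<Rightarrow> 'c::metric_space \<Rightarrow> 'a::{real_inner, polish_space}"
  assumes M: "finite_measure M" and m: "\<And>x v. (\<lambda>\<omega>. v \<bullet> g \<omega> x) \<in> borel_measurable M"
    and C: "\<And>x \<omega>. \<omega> \<in> space M \<Longrightarrow> norm (g \<omega> x) \<le> C"
    and cont: "\<And>\<omega>. \<omega> \<in> space M \<Longrightarrow> continuous_on UNIV (g \<omega>)"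
  shows "continuous_on UNIV (\<lambda>x. wint M (\<lambda>\<omega>. g \<omega> x))"
  unfolding continuous_on_sequentially
proof (intro allI ballI impI, elim conjE)
  fix X :: "nat \<Rightarrow> 'c" and x assume X: "X \<longlonglongrightarrow> x"
  interpret finite_measure M by fact
  have md: "(\<lambda>\<omega>. v \<bullet> (g \<omega> y - g \<omega> x)) \<in> borel_measurable M" for v y
    using m by (simp add: inner_diff_right)
  have mn: "(\<lambda>\<omega>. norm (g \<omega> y - g \<omega> x)) \<in> borel_measurable M" for y
    by (rule measurable_norm_weak) (rule md)
  have le: "norm (g \<omega> y - g \<omega> x) \<le> 2 * C" if "\<omega> \<in> space M" for \<omega> y
    using norm_triangle_ineq4[of "g \<omega> y" "g \<omega> x"] C[OF that, of x] C[OF that, of y] by linarith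
  have "(\<lambda>n. \<integral>\<omega>. norm (g \<omega> (X n) - g \<omega> x) \<partial>M) \<longlonglongrightarrow> (\<integral>\<omega>. 0 \<partial>M)"
  proof (rule integral_dominated_convergence[where w="\<lambda>_. 2 * C"])
    have "(\<lambda>n. norm (g \<omega> (X n) - g \<omega> x)) \<longlonglongrightarrow> 0" if "\<omega> \<in> space M" for \<omega>
      using cont[OF that] X by (intro tendsto_norm_zero LIM_zero) (auto simp: continuous_on_sequentially comp_def)
    then show "AE \<omega> in M. (\<lambda>n. norm (g \<omega> (X n) - g \<omega> x)) \<longlonglongrightarrow> 0" by auto
    show "AE \<omega> in M. norm (norm (g \<omega> (X n) - g \<omega> x)) \<le> 2 * C" for n using le by auto
  qed (use mn in auto)
  then have lim: "(\<lambda>n. \<integral>\<omega>. norm (g \<omega> (X n) - g \<omega> x) \<partial>M) \<longlonglongrightarrow> 0" by simp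
  have "norm (wint M (\<lambda>\<omega>. g \<omega> y) - wint M (\<lambda>\<omega>. g \<omega> x)) \<le> (\<integral>\<omega>. norm (g \<omega> y - g \<omega> x) \<partial>M)" for y
  proof -
    have "integrable M (\<lambda>\<omega>. norm (g \<omega> y - g \<omega> x))"
      by (rule integrable_const_bound[where B="2 * C"]) (use le mn in auto)
    then show ?thesis
      by (subst wint_diff[OF M m C m C, symmetric]) (auto intro!: norm_wint_le[OF M md le])
  qed
  then have "(\<lambda>n. wint M (\<lambda>\<omega>. g \<omega> (X n)) - wint M (\<lambda>\<omega>. g \<omega> x)) \<longlonglongrightarrow> 0"
    by (intro Lim_null_comparison[OF always_eventually[OF allI] lim])
  then show "((\<lambda>x. wint M (\<lambda>\<omega>. g \<omega> x)) \<circ> X) \<longlonglongrightarrow> wint M (\<lambda>\<omega>. g \<omega> x)"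
    by (simp add: comp_def LIM_zero_iff)
qed

lemma directional_derivative_seq:
  assumes "(f has_derivative D) (at x)"
  shows "(\<lambda>n. (f (x + (1 / real (Suc n)) *\<^sub>R v) - f x) /\<^sub>R (1 / real (Suc n))) \<longlonglongrightarrow> D v"
proof -
  interpret D: bounded_linear D using assms by (rule has_derivative_bounded_linear)
  have "((\<lambda>t. f (x + t *\<^sub>R v)) has_derivative (\<lambda>t. D (t *\<^sub>R v))) (at 0)"
    by (rule has_derivative_compose[where g=f and f="\<lambda>t. x + t *\<^sub>R v"])
      (use assms in \<open>auto intro!: derivative_eq_intros\<close>)
  then have "((\<lambda>t. f (x + t *\<^sub>R v)) has_vector_derivative D v) (at 0)"
    by (simp add: has_vector_derivative_def D.scaleR)
  then have lim: "((\<lambda>t. (f (x + t *\<^sub>R v) - f x) /\<^sub>R t) \<longlongrightarrow> D v) (at 0)"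
  proof -
    assume "((\<lambda>t. f (x + t *\<^sub>R v)) has_vector_derivative D v) (at 0)"
    then have l: "((\<lambda>t. norm (f (x + t *\<^sub>R v) - f x - t *\<^sub>R D v) / norm t) \<longlongrightarrow> 0) (at 0)"
      by (simp add: has_vector_derivative_def has_derivative_at)
    have *: "norm (f (x + t *\<^sub>R v) - f x - t *\<^sub>R D v) / norm t = norm ((f (x + t *\<^sub>R v) - f x) /\<^sub>R t - D v)" if "t \<noteq> 0" for t
    proof -
      have "f (x + t *\<^sub>R v) - f x - t *\<^sub>R D v = t *\<^sub>R ((f (x + t *\<^sub>R v) - f x) /\<^sub>R t - D v)"
        using that by (simp add: scaleR_diff_right)
      then show ?thesis using that by simp
    qed
    have "((\<lambda>t. norm ((f (x + t *\<^sub>R v) - f x) /\<^sub>R t - D v)) \<longlongrightarrow> 0) (at 0)"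
    proof (rule Lim_transform_eventually[OF l], unfold eventually_at_filter, rule always_eventually, intro allI impI)
      fix t :: real assume "t \<noteq> 0"
      then show "norm (f (x + t *\<^sub>R v) - f x - t *\<^sub>R D v) / norm t = norm ((f (x + t *\<^sub>R v) - f x) /\<^sub>R t - D v)"
        by (rule *)
    qed
    then have "((\<lambda>t. (f (x + t *\<^sub>R v) - f x) /\<^sub>R t - D v) \<longlongrightarrow> 0) (at 0)" by (rule tendsto_norm_zero_cancel)
    then show ?thesis by (rule LIM_zero_cancel)
  qed
  have "filterlim (\<lambda>n. 1 / real (Suc n)) (at 0) sequentially"
    unfolding filterlim_at using LIMSEQ_inverse_real_of_nat by (auto simp: inverse_eq_divide)
  from filterlim_compose[OF lim this] show ?thesis .
qed

lemma C2_integral: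
  fixes f :: "'b \<Rightarrow> 'a::{real_inner, polish_space} \<Rightarrow> real"
  assumes M: "finite_measure M" and f: "\<And>\<omega>. \<omega> \<in> space M \<Longrightarrow> C2 (f \<omega>) (g \<omega>) (T \<omega>) C"
    and m [measurable]: "\<And>x. (\<lambda>\<omega>. f \<omega> x) \<in> borel_measurable M" and C: "0 \<le> C"
  shows "\<And>x v. (\<lambda>\<omega>. v \<bullet> g \<omega> x) \<in> borel_measurable M"
    and "\<And>x u v. (\<lambda>\<omega>. u \<bullet> T \<omega> x v) \<in> borel_measurable M"
    and "C2 (\<lambda>x. \<integral>\<omega>. f \<omega> x \<partial>M) (\<lambda>x. wint M (\<lambda>\<omega>. g \<omega> x)) (\<lambda>x v. wint M (\<lambda>\<omega>. T \<omega> x v)) (C * measure M (space M))"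
proof -
  interpret finite_measure M by fact
  show mg: "(\<lambda>\<omega>. v \<bullet> g \<omega> x) \<in> borel_measurable M" for x v
  proof (rule borel_measurable_LIMSEQ_real)
    show "(\<lambda>n. (f \<omega> (x + (1 / real (Suc n)) *\<^sub>R v) - f \<omega> x) /\<^sub>R (1 / real (Suc n))) \<longlonglongrightarrow> v \<bullet> g \<omega> x"
      if "\<omega> \<in> space M" for \<omega>
      by (rule directional_derivative_seq[OF C2_has_derivative[OF f[OF that]]])
  qed simp
  show mT: "(\<lambda>\<omega>. u \<bullet> T \<omega> x v) \<in> borel_measurable M" for x u v
  proof (rule borel_measurable_LIMSEQ_real)
    show "(\<lambda>n. u \<bullet> ((g \<omega> (x + (1 / real (Suc n)) *\<^sub>R v) - g \<omega> x) /\<^sub>R (1 / real (Suc n)))) \<longlonglongrightarrow> u \<bullet> T \<omega> x v"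
      if "\<omega> \<in> space M" for \<omega>
      by (intro tendsto_intros directional_derivative_seq[OF C2_deriv[OF f[OF that]]])
  qed (use mg in \<open>simp add: inner_diff_right\<close>)
  note gb = C2_norm[OF f]
  have Tb: "norm (T \<omega> x v) \<le> C * norm v" if "\<omega> \<in> space M" for \<omega> x v
    using norm_le_hs_norm[OF C2_hs[OF f[OF that]], of x v] mult_right_mono[OF C2_hs_norm[OF f[OF that], of x], of "norm v"] by simp
  note G = inner_wint[OF M mg gb] and W = inner_wint[OF M mT Tb]
  note hsW = hs_wint[OF M mT C2_hs[OF f] C2_hs_norm[OF f]]
  have fi: "integrable M (\<lambda>\<omega>. f \<omega> x)" for x
    by (rule integrable_const_bound[where B=C]) (use C2_abs[OF f] in auto)
  have gi: "integrable M (\<lambda>\<omega>. v \<bullet> g \<omega> x)" for v x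
  proof (rule integrable_const_bound[where B="norm v * C"])
    have "\<bar>v \<bullet> g \<omega> x\<bar> \<le> norm v * C" if "\<omega> \<in> space M" for \<omega>
      using Cauchy_Schwarz_ineq2[of v "g \<omega> x"] mult_left_mono[OF gb[OF that, of x], of "norm v"] by simp
    then show "AE \<omega> in M. norm (v \<bullet> g \<omega> x) \<le> norm v * C" by auto
  qed (rule mg)
  have hsm: "(\<lambda>\<omega>. hs_norm (T \<omega> x)) \<in> borel_measurable M" for x
    by (rule measurable_hs_norm_weak[OF mT C2_hs[OF f]])
  have hsi: "integrable M (\<lambda>\<omega>. hs_norm (T \<omega> x))" for x
    by (rule integrable_const_bound[where B=C]) (use C2_hs_norm[OF f] hsm in \<open>auto simp: hs_norm_nonneg\<close>)
  show "C2 (\<lambda>x. \<integral>\<omega>. f \<omega> x \<partial>M) (\<lambda>x. wint M (\<lambda>\<omega>. g \<omega> x)) (\<lambda>x v. wint M (\<lambda>\<omega>. T \<omega> x v)) (C * measure M (space M))"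
    unfolding C2_def
  proof (intro conjI allI)
    fix x
    have "\<bar>\<integral>\<omega>. f \<omega> x \<partial>M\<bar> \<le> (\<integral>\<omega>. \<bar>f \<omega> x\<bar> \<partial>M)" by (rule integral_abs_bound)
    also have "\<dots> \<le> (\<integral>\<omega>. C \<partial>M)" by (rule integral_mono) (use fi C2_abs[OF f] in auto)
    finally show "\<bar>\<integral>\<omega>. f \<omega> x \<partial>M\<bar> \<le> C * measure M (space M)" by (simp add: mult.commute)
    have "norm (wint M (\<lambda>\<omega>. g \<omega> x)) \<le> (\<integral>\<omega>. C \<partial>M)"
      by (rule norm_wint_le[OF M mg gb]) (use gb in auto)
    then show "norm (wint M (\<lambda>\<omega>. g \<omega> x)) \<le> C * measure M (space M)" by (simp add: mult.commute)
    show "hilbert_schmidt (\<lambda>v. wint M (\<lambda>\<omega>. T \<omega> x v))" by (rule hsW)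
    have "hs_norm (\<lambda>v. wint M (\<lambda>\<omega>. T \<omega> x v)) \<le> (\<integral>\<omega>. hs_norm (T \<omega> x) \<partial>M)" by (rule hsW)
    also have "\<dots> \<le> (\<integral>\<omega>. C \<partial>M)" by (rule integral_mono) (use hsi C2_hs_norm[OF f] in auto)
    finally show "hs_norm (\<lambda>v. wint M (\<lambda>\<omega>. T \<omega> x v)) \<le> C * measure M (space M)" by (simp add: mult.commute)
    show "GDERIV (\<lambda>x. \<integral>\<omega>. f \<omega> x \<partial>M) x :> wint M (\<lambda>\<omega>. g \<omega> x)"
      unfolding gderiv_def has_derivative_at
    proof
      show "bounded_linear (\<lambda>v. v \<bullet> wint M (\<lambda>\<omega>. g \<omega> x))" by (rule bounded_linear_inner_left)
      have est: "\<bar>(\<integral>\<omega>. f \<omega> (x + v) \<partial>M) - (\<integral>\<omega>. f \<omega> x \<partial>M) - v \<bullet> wint M (\<lambda>\<omega>. g \<omega> x)\<bar> \<le> C * measure M (space M) * (norm v)\<^sup>2" for v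
      proof -
        have "(\<integral>\<omega>. f \<omega> (x + v) \<partial>M) - (\<integral>\<omega>. f \<omega> x \<partial>M) - v \<bullet> wint M (\<lambda>\<omega>. g \<omega> x) =
           (\<integral>\<omega>. f \<omega> (x + v) - f \<omega> x - v \<bullet> g \<omega> x \<partial>M)"
          by (simp add: fi gi G)
        also have "\<bar>\<dots>\<bar> \<le> (\<integral>\<omega>. \<bar>f \<omega> (x + v) - f \<omega> x - v \<bullet> g \<omega> x\<bar> \<partial>M)" by (rule integral_abs_bound)
        also have "\<dots> \<le> (\<integral>\<omega>. C * (norm v)\<^sup>2 \<partial>M)"
          by (rule integral_mono) (use fi gi C2_taylor[OF f] in auto)
        finally show ?thesis by (simp add: mult_ac)
      qed
      show "(\<lambda>v. norm ((\<integral>\<omega>. f \<omega> (x + v) \<partial>M) - (\<integral>\<omega>. f \<omega> x \<partial>M) - v \<bullet> wint M (\<lambda>\<omega>. g \<omega> x)) / norm v) \<midarrow>0\<rightarrow> 0"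
      proof (rule tendsto_sandwich[OF _ _ tendsto_const])
        show "((\<lambda>v. C * measure M (space M) * norm v) \<longlongrightarrow> 0) (at 0)"
          by (intro tendsto_mult_right_zero tendsto_norm_zero tendsto_ident_at)
        have "norm ((\<integral>\<omega>. f \<omega> (x + v) \<partial>M) - (\<integral>\<omega>. f \<omega> x \<partial>M) - v \<bullet> wint M (\<lambda>\<omega>. g \<omega> x)) / norm v
            \<le> C * measure M (space M) * norm v" for v
          using est[of v] by (cases "v = 0") (auto simp: divide_simps power2_eq_square mult_ac C)
        then show "\<forall>\<^sub>F v in at 0. norm ((\<integral>\<omega>. f \<omega> (x + v) \<partial>M) - (\<integral>\<omega>. f \<omega> x \<partial>M) - v \<bullet> wint M (\<lambda>\<omega>. g \<omega> x)) / norm v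
            \<le> C * measure M (space M) * norm v" by simp
      qed simp
    qed
    show "((\<lambda>x. wint M (\<lambda>\<omega>. g \<omega> x)) has_derivative (\<lambda>v. wint M (\<lambda>\<omega>. T \<omega> x v))) (at x)"
      unfolding has_derivative_at
    proof
      show "bounded_linear (\<lambda>v. wint M (\<lambda>\<omega>. T \<omega> x v))" by (rule hs_bounded_linear[OF hsW(1)])
      define R where "R \<omega> v = g \<omega> (x + v) - g \<omega> x - T \<omega> x v" for \<omega> v
      have R: "(\<lambda>\<omega>. u \<bullet> R \<omega> v) \<in> borel_measurable M" "\<omega> \<in> space M \<Longrightarrow> norm (R \<omega> v) \<le> 2 * C * norm v" for \<omega> u v
      proof -
        show "(\<lambda>\<omega>. u \<bullet> R \<omega> v) \<in> borel_measurable M" using mg mT by (simp add: R_def inner_diff_right)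
        show "norm (R \<omega> v) \<le> 2 * C * norm v" if "\<omega> \<in> space M"
          using C2_lipschitz[OF f[OF that], of "x + v" x] Tb[OF that, of x v]
            norm_triangle_ineq4[of "g \<omega> (x + v) - g \<omega> x" "T \<omega> x v"] by (simp add: R_def)
      qed
      have eq: "wint M (\<lambda>\<omega>. g \<omega> (x + v)) - wint M (\<lambda>\<omega>. g \<omega> x) - wint M (\<lambda>\<omega>. T \<omega> x v) = wint M (\<lambda>\<omega>. R \<omega> v)" for v
      proof -
        have 1: "(\<lambda>\<omega>. u \<bullet> (g \<omega> (x + v) - g \<omega> x)) \<in> borel_measurable M" for u
          using mg by (simp add: inner_diff_right)
        have 2: "norm (g \<omega> (x + v) - g \<omega> x) \<le> C * norm v" if "\<omega> \<in> space M" for \<omega>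
          using C2_lipschitz[OF f[OF that], of "x + v" x] by simp
        show ?thesis
          unfolding R_def
          using wint_diff[where C="C * norm v" and D="C * norm v", OF M 1 2 mT[of _ x v] Tb[of _ x v]]
            wint_diff[where C=C and D=C, OF M mg[of _ "x + v"] gb[of _ "x + v"] mg[of _ x] gb[of _ x]] by simp
      qed
      have mR: "(\<lambda>\<omega>. norm (R \<omega> v)) \<in> borel_measurable M" for v by (rule measurable_norm_weak) (rule R)
      have iR: "integrable M (\<lambda>\<omega>. norm (R \<omega> v))" for v
        by (rule integrable_const_bound[where B="2 * C * norm v"]) (use R(2) mR in auto)
      show "(\<lambda>v. norm (wint M (\<lambda>\<omega>. g \<omega> (x + v)) - wint M (\<lambda>\<omega>. g \<omega> x) - wint M (\<lambda>\<omega>. T \<omega> x v)) / norm v) \<midarrow>0\<rightarrow> 0"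
        unfolding eq tendsto_at_iff_sequentially
      proof (intro allI impI)
        fix X assume X: "\<forall>i. X i \<in> UNIV - {0 :: 'a}" "X \<longlonglongrightarrow> 0"
        have "(\<lambda>n. \<integral>\<omega>. norm (R \<omega> (X n)) / norm (X n) \<partial>M) \<longlonglongrightarrow> (\<integral>\<omega>. 0 \<partial>M)"
        proof (rule integral_dominated_convergence[where w="\<lambda>_. 2 * C"])
          have "(\<lambda>n. norm (R \<omega> (X n)) / norm (X n)) \<longlonglongrightarrow> 0" if "\<omega> \<in> space M" for \<omega>
            using C2_deriv[OF f[OF that], of x] X unfolding has_derivative_at R_def tendsto_at_iff_sequentially comp_def by blast
          then show "AE \<omega> in M. (\<lambda>n. norm (R \<omega> (X n)) / norm (X n)) \<longlonglongrightarrow> 0" by auto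
          show "AE \<omega> in M. norm (norm (R \<omega> (X n)) / norm (X n)) \<le> 2 * C" for n
            using R(2)[where v="X n"] X(1) by (auto simp: divide_simps C)
        qed (use mR in auto)
        then have lim: "(\<lambda>n. (\<integral>\<omega>. norm (R \<omega> (X n)) \<partial>M) / norm (X n)) \<longlonglongrightarrow> 0" by simp
        have "norm (wint M (\<lambda>\<omega>. R \<omega> v)) \<le> (\<integral>\<omega>. norm (R \<omega> v) \<partial>M)" for v
          by (rule norm_wint_le[OF M R iR]) auto
        then show "((\<lambda>v. norm (wint M (\<lambda>\<omega>. R \<omega> v)) / norm v) \<circ> X) \<longlonglongrightarrow> 0"
          unfolding comp_def
          by (intro tendsto_sandwich[OF always_eventually always_eventually tendsto_const lim])
            (auto intro: divide_right_mono)
      qed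
    qed
    have hd: "hs_norm (\<lambda>v. wint M (\<lambda>\<omega>. T \<omega> y v) - wint M (\<lambda>\<omega>. T \<omega> x v)) \<le> (\<integral>\<omega>. hs_norm (\<lambda>v. T \<omega> y v - T \<omega> x v) \<partial>M)"
      and md: "(\<lambda>\<omega>. hs_norm (\<lambda>v. T \<omega> y v - T \<omega> x v)) \<in> borel_measurable M"
      and bd: "\<omega> \<in> space M \<Longrightarrow> hs_norm (\<lambda>v. T \<omega> y v - T \<omega> x v) \<le> 2 * C" for y \<omega>
    proof -
      have m': "(\<lambda>\<omega>. u \<bullet> (T \<omega> y v - T \<omega> x v)) \<in> borel_measurable M" for u v
        using mT by (simp add: inner_diff_right)
      have h': "hilbert_schmidt (\<lambda>v. T \<omega> y v - T \<omega> x v)" if "\<omega> \<in> space M" for \<omega>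
        by (intro hs_diff C2_hs[OF f[OF that]])
      have b': "hs_norm (\<lambda>v. T \<omega> y v - T \<omega> x v) \<le> 2 * C" if "\<omega> \<in> space M" for \<omega>
        using hs_diff(2)[OF C2_hs[OF f[OF that], of y] C2_hs[OF f[OF that], of x]]
          C2_hs_norm[OF f[OF that], of x] C2_hs_norm[OF f[OF that], of y] by linarith
      show "\<omega> \<in> space M \<Longrightarrow> hs_norm (\<lambda>v. T \<omega> y v - T \<omega> x v) \<le> 2 * C" by (rule b')
      show "(\<lambda>\<omega>. hs_norm (\<lambda>v. T \<omega> y v - T \<omega> x v)) \<in> borel_measurable M"
        by (rule measurable_hs_norm_weak[OF m' h'])
      show "hs_norm (\<lambda>v. wint M (\<lambda>\<omega>. T \<omega> y v) - wint M (\<lambda>\<omega>. T \<omega> x v)) \<le> (\<integral>\<omega>. hs_norm (\<lambda>v. T \<omega> y v - T \<omega> x v) \<partial>M)"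
        using hs_wint(2)[OF M m' h' b'] by (simp add: wint_diff[OF M mT Tb mT Tb])
    qed
    show "((\<lambda>y. hs_norm (\<lambda>v. wint M (\<lambda>\<omega>. T \<omega> y v) - wint M (\<lambda>\<omega>. T \<omega> x v))) \<longlongrightarrow> 0) (at x)"
      unfolding tendsto_at_iff_sequentially
    proof (intro allI impI)
      fix X assume X: "\<forall>i. X i \<in> UNIV - {x}" "X \<longlonglongrightarrow> x"
      have "(\<lambda>n. \<integral>\<omega>. hs_norm (\<lambda>v. T \<omega> (X n) v - T \<omega> x v) \<partial>M) \<longlonglongrightarrow> (\<integral>\<omega>. 0 \<partial>M)"
      proof (rule integral_dominated_convergence[where w="\<lambda>_. 2 * C"])
        have "(\<lambda>n. hs_norm (\<lambda>v. T \<omega> (X n) v - T \<omega> x v)) \<longlonglongrightarrow> 0" if "\<omega> \<in> space M" for \<omega>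
          using C2_cont[OF f[OF that], of x] X unfolding tendsto_at_iff_sequentially comp_def by blast
        then show "AE \<omega> in M. (\<lambda>n. hs_norm (\<lambda>v. T \<omega> (X n) v - T \<omega> x v)) \<longlonglongrightarrow> 0" by auto
        show "AE \<omega> in M. norm (hs_norm (\<lambda>v. T \<omega> (X n) v - T \<omega> x v)) \<le> 2 * C" for n
          using bd by (auto simp: hs_norm_nonneg)
      qed (use md in auto)
      then have lim: "(\<lambda>n. \<integral>\<omega>. hs_norm (\<lambda>v. T \<omega> (X n) v - T \<omega> x v) \<partial>M) \<longlonglongrightarrow> 0" by simp
      show "((\<lambda>y. hs_norm (\<lambda>v. wint M (\<lambda>\<omega>. T \<omega> y v) - wint M (\<lambda>\<omega>. T \<omega> x v))) \<circ> X) \<longlonglongrightarrow> 0"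
        unfolding comp_def
        by (intro tendsto_sandwich[OF always_eventually always_eventually tendsto_const lim])
          (auto simp: hs_norm_nonneg hd)
    qed
  qed
qed

section \<open>The Levy part of the operator\<close>

locale levy_data =
  fixes Q :: "'a::{real_inner, polish_space} \<Rightarrow> 'a" and a :: 'a and \<nu> :: "'a measure"
  assumes Q: "nonneg_sym_trace_class Q" and levy: "levy_measure \<nu>"
begin

lemma sets_nu [measurable_cong]: "sets \<nu> = sets borel"
  using levy by (simp add: levy_measure_def)

lemma space_nu [simp]: "space \<nu> = UNIV"
  using sets_eq_imp_space_eq[OF sets_nu] by simp

sublocale nu: sigma_finite_measure \<nu>
  using levy by (simp add: levy_measure_def)

definition weight :: "'a \<Rightarrow> real" where "weight y = min 1 ((norm y)\<^sup>2)"

lemma weight_measurable [measurable]: "weight \<in> borel_measurable borel"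
  unfolding weight_def by measurable

lemma weight_nonneg: "0 \<le> weight y" by (simp add: weight_def)

lemma weight_integrable: "integrable \<nu> weight"
proof (rule integrableI_bounded)
  show "(\<integral>\<^sup>+ y. ennreal (norm (weight y)) \<partial>\<nu>) < \<infinity>"
    using levy by (simp add: levy_measure_def weight_def weight_nonneg)
qed measurable

definition L1 :: "('a \<Rightarrow> real) \<Rightarrow> 'a \<Rightarrow> real" where
  "L1 f x = (\<integral>y. (f (x + y) - f x - indicator {y. norm y \<le> 1} y * (y \<bullet> grad f x)) \<partial>\<nu>)
     + 1 / 2 * op_trace (\<lambda>v. Q (hess f x v)) + a \<bullet> grad f x"

lemma L0_eq: "L0 Q a \<nu> DA A f x = x \<bullet> adj_op DA A (grad f x) + L1 f x"
  by (simp add: L0_def L1_def)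

definition levy_const :: real where
  "levy_const = 2 * (\<integral>y. weight y \<partial>\<nu>) + 1 / 2 * hs_norm Q + norm a"

lemma levy_const_nonneg: "0 \<le> levy_const"
  by (simp add: levy_const_def hs_norm_nonneg weight_nonneg)

context
  fixes f :: "'a \<Rightarrow> real" and g T C
  assumes f: "C2 f g T C"
begin

lemma C2_measurable [measurable]: "f \<in> borel_measurable borel"
  by (rule borel_measurable_continuous_onI[OF C2_continuous[OF f]])

lemma jump_bound: "\<bar>f (x + y) - f x - indicator {y. norm y \<le> 1} y * (y \<bullet> g x)\<bar> \<le> 2 * C * weight y"
proof (cases "norm y \<le> 1")
  case True
  then have "(norm y)\<^sup>2 \<le> 1" by (simp add: power_le_one)
  then have w: "weight y = (norm y)\<^sup>2" by (simp add: weight_def)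
  have "C * (norm y)\<^sup>2 \<le> 2 * C * (norm y)\<^sup>2" using C2_nonneg[OF f] by (intro mult_right_mono) auto
  then show ?thesis using C2_taylor[OF f, of x y] True w by (auto simp: indicator_def)
next
  case False
  then have "(norm y)\<^sup>2 \<ge> 1" by simp
  then show ?thesis using False C2_abs[OF f, of x] C2_abs[OF f, of "x + y"]
    by (simp add: indicator_def weight_def)
qed

lemma jump_integrable:
  "integrable \<nu> (\<lambda>y. f (x + y) - f x - indicator {y. norm y \<le> 1} y * (y \<bullet> g x))"
proof (rule Bochner_Integration.integrable_bound)
  show "integrable \<nu> (\<lambda>y. 2 * C * weight y)" using weight_integrable by simp
  show "AE y in \<nu>. norm (f (x + y) - f x - indicator {y. norm y \<le> 1} y * (y \<bullet> g x)) \<le> norm (2 * C * weight y)"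
    using jump_bound[of x] C2_nonneg[OF f] weight_nonneg by (auto simp: abs_mult)
qed measurable

lemma L1_C2: "L1 f x = (\<integral>y. (f (x + y) - f x - indicator {y. norm y \<le> 1} y * (y \<bullet> g x)) \<partial>\<nu>)
     + 1 / 2 * op_trace (\<lambda>v. Q (T x v)) + a \<bullet> g x"
  by (simp add: L1_def C2_grad[OF f] C2_hess[OF f])

lemma L1_bound: "\<bar>L1 f x\<bar> \<le> levy_const * C"
proof -
  have "\<bar>\<integral>y. (f (x + y) - f x - indicator {y. norm y \<le> 1} y * (y \<bullet> g x)) \<partial>\<nu>\<bar> \<le> (\<integral>y. 2 * C * weight y \<partial>\<nu>)"
    by (rule order_trans[OF integral_abs_bound integral_mono])
      (use jump_integrable jump_bound weight_integrable in auto)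
  moreover have "\<bar>op_trace (\<lambda>v. Q (T x v))\<bar> \<le> hs_norm Q * C"
    by (rule order_trans[OF op_trace_comp(2)[OF Q C2_hs[OF f]] mult_left_mono[OF C2_hs_norm[OF f] hs_norm_nonneg]])
  moreover have "\<bar>a \<bullet> g x\<bar> \<le> norm a * C"
    by (rule order_trans[OF Cauchy_Schwarz_ineq2 mult_left_mono[OF C2_norm[OF f] norm_ge_zero]])
  ultimately show ?thesis by (simp add: L1_C2 levy_const_def algebra_simps)
qed

end

lemma L1_tendsto:
  assumes f: "\<And>k. C2 (f k) (g k) (T k) C" and f': "C2 f' g' T' C'"
    and lim: "\<And>y. (\<lambda>k. f k (x k + y)) \<longlonglongrightarrow> f' (x' + y)"
    and limg: "\<And>v. (\<lambda>k. v \<bullet> g k (x k)) \<longlonglongrightarrow> v \<bullet> g' x'"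
    and limT: "\<And>u v. (\<lambda>k. u \<bullet> T k (x k) v) \<longlonglongrightarrow> u \<bullet> T' x' v"
  shows "(\<lambda>k. L1 (f k) (x k)) \<longlonglongrightarrow> L1 f' x'"
  unfolding L1_C2[OF f] L1_C2[OF f']
proof (intro tendsto_add tendsto_mult tendsto_const limg op_trace_tendsto[OF Q, where C=C] C2_hs[OF f] C2_hs_norm[OF f] C2_hs[OF f'] limT)
  show "(\<lambda>k. \<integral>y. (f k (x k + y) - f k (x k) - indicator {y. norm y \<le> 1} y * (y \<bullet> g k (x k))) \<partial>\<nu>) \<longlonglongrightarrow>
     (\<integral>y. (f' (x' + y) - f' x' - indicator {y. norm y \<le> 1} y * (y \<bullet> g' x')) \<partial>\<nu>)"
  proof (rule integral_dominated_convergence[where w="\<lambda>y. 2 * C * weight y"])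
    show "integrable \<nu> (\<lambda>y. 2 * C * weight y)" using weight_integrable by simp
    show "AE y in \<nu>. (\<lambda>k. f k (x k + y) - f k (x k) - indicator {y. norm y \<le> 1} y * (y \<bullet> g k (x k)))
       \<longlonglongrightarrow> f' (x' + y) - f' x' - indicator {y. norm y \<le> 1} y * (y \<bullet> g' x')"
      using lim[of 0] by (intro AE_I2 tendsto_intros lim limg) simp
    show "AE y in \<nu>. norm (f k (x k + y) - f k (x k) - indicator {y. norm y \<le> 1} y * (y \<bullet> g k (x k))) \<le> 2 * C * weight y" for k
      using jump_bound[OF f] by simp
  qed (rule borel_measurable_integrable[OF jump_integrable[OF f]] borel_measurable_integrable[OF jump_integrable[OF f']])+
qed

lemma L1_linear:
  assumes f: "C2 f g T C" and f': "C2 f' g' T' C'"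
  shows "L1 (\<lambda>x. c * f x + f' x) x = c * L1 f x + L1 f' x"
proof -
  note cf = C2_add[OF C2_scale[OF f, of c] f']
  have "(\<integral>y. (c * f (x + y) + f' (x + y) - (c * f x + f' x) - indicator {y. norm y \<le> 1} y * (y \<bullet> (c *\<^sub>R g x + g' x))) \<partial>\<nu>)
     = (\<integral>y. (c * (f (x + y) - f x - indicator {y. norm y \<le> 1} y * (y \<bullet> g x)) +
        (f' (x + y) - f' x - indicator {y. norm y \<le> 1} y * (y \<bullet> g' x))) \<partial>\<nu>)"
    by (rule Bochner_Integration.integral_cong) (auto simp: inner_add_right algebra_simps)
  also have "\<dots> = c * (\<integral>y. (f (x + y) - f x - indicator {y. norm y \<le> 1} y * (y \<bullet> g x)) \<partial>\<nu>)
      + (\<integral>y. (f' (x + y) - f' x - indicator {y. norm y \<le> 1} y * (y \<bullet> g' x)) \<partial>\<nu>)"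
    using jump_integrable[OF f, of x] jump_integrable[OF f', of x]
    by (subst Bochner_Integration.integral_add) auto
  finally have 1: "(\<integral>y. (c * f (x + y) + f' (x + y) - (c * f x + f' x) - indicator {y. norm y \<le> 1} y * (y \<bullet> (c *\<^sub>R g x + g' x))) \<partial>\<nu>) = \<dots>" .
  have "(\<lambda>i. (c *\<^sub>R T x (sb i) + T' x (sb i)) \<bullet> Q (sb i)) sums (c * op_trace (\<lambda>v. Q (T x v)) + op_trace (\<lambda>v. Q (T' x v)))"
    using sums_add[OF sums_mult[OF op_trace_comp(1)[OF Q C2_hs[OF f, of x]], of c] op_trace_comp(1)[OF Q C2_hs[OF f', of x]]]
    by (simp add: inner_add_left)
  then have 2: "op_trace (\<lambda>v. Q (c *\<^sub>R T x v + T' x v)) = c * op_trace (\<lambda>v. Q (T x v)) + op_trace (\<lambda>v. Q (T' x v))"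
    using op_trace_comp(1)[OF Q C2_hs[OF cf, of x]] sums_unique2 by blast
  show ?thesis unfolding L1_C2[OF cf] L1_C2[OF f] L1_C2[OF f'] 1 2
    by (simp add: inner_add_right algebra_simps)
qed

abbreviation \<psi> :: "'a \<Rightarrow> complex" where "\<psi> \<equiv> levy_exponent Q a \<nu>"

definition psi_int :: "'a \<Rightarrow> 'a \<Rightarrow> complex" where
  "psi_int h y = iexp (h \<bullet> y) - 1 - \<i> * complex_of_real ((h \<bullet> y) * indicator {y. norm y \<le> 1} y)"

lemma psi_eq: "\<psi> h = complex_of_real (1 / 2 * (Q h \<bullet> h)) - \<i> * complex_of_real (a \<bullet> h) - (\<integral>y. psi_int h y \<partial>\<nu>)"
  by (simp add: levy_exponent_def psi_int_def)

lemma psi_int_measurable [measurable]: "psi_int h \<in> borel_measurable borel"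
  unfolding psi_int_def by measurable

lemma psi_int_bound: "cmod (psi_int h y) \<le> (if norm y \<le> 1 then (h \<bullet> y)\<^sup>2 else 2)"
proof (cases "norm y \<le> 1")
  case True
  have "cmod (iexp (h \<bullet> y) - (\<Sum>k\<le>1. (\<i> * (h \<bullet> y)) ^ k / fact k)) \<le> \<bar>h \<bullet> y\<bar> ^ Suc 1 / fact (Suc 1)"
    by (rule iexp_approx1)
  moreover have "(\<Sum>k\<le>1. (\<i> * complex_of_real (h \<bullet> y)) ^ k / fact k) = 1 + \<i> * complex_of_real (h \<bullet> y)"
    by simp
  ultimately have "cmod (psi_int h y) \<le> (h \<bullet> y)\<^sup>2 / 2"
    using True by (simp add: psi_int_def diff_diff_eq power2_eq_square)
  then show ?thesis using True zero_le_power2[of "h \<bullet> y"] by (simp only: if_True)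
next
  case False
  have "cmod (iexp (h \<bullet> y) - 1) \<le> cmod (iexp (h \<bullet> y)) + cmod 1" by (rule norm_triangle_ineq4)
  then show ?thesis using False by (simp add: psi_int_def)
qed

lemma psi_int_weight: "cmod (psi_int h y) \<le> (2 + (norm h)\<^sup>2) * weight y"
proof (cases "norm y \<le> 1")
  case True
  have "(h \<bullet> y)\<^sup>2 \<le> (norm h * norm y)\<^sup>2" using Cauchy_Schwarz_ineq2[of h y] by (simp add: abs_le_square_iff[symmetric])
  also have "\<dots> \<le> (2 + (norm h)\<^sup>2) * (norm y)\<^sup>2" by (simp add: power_mult_distrib mult_right_mono)
  also have "(norm y)\<^sup>2 = weight y" using True by (simp add: weight_def power_le_one)
  finally show ?thesis using psi_int_bound[of h y] True by simp
next
  case False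
  then have "weight y = 1" by (simp add: weight_def)
  then show ?thesis using psi_int_bound[of h y] False zero_le_power2[of "norm h"]
    by (simp only: if_False mult_1_right)
qed

lemma psi_int_integrable: "integrable \<nu> (psi_int h)"
proof (rule Bochner_Integration.integrable_bound)
  show "integrable \<nu> (\<lambda>y. (2 + (norm h)\<^sup>2) * weight y)" using weight_integrable by simp
  show "AE y in \<nu>. norm (psi_int h y) \<le> norm ((2 + (norm h)\<^sup>2) * weight y)"
    using psi_int_weight[of h] weight_nonneg by (auto simp: abs_mult)
qed measurable

lemma continuous_psi: "continuous_on UNIV \<psi>"
  unfolding continuous_on_sequentially
proof (intro allI ballI impI, elim conjE)
  fix X :: "nat \<Rightarrow> 'a" and x assume X: "X \<longlonglongrightarrow> x"
  obtain B where B: "\<And>n. norm (X n) \<le> B" "B > 0" using convergent_imp_Bseq[OF convergentI[OF X]] by (auto simp: Bseq_def)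
  have QX: "(\<lambda>n. Q (X n)) \<longlonglongrightarrow> Q x" by (rule bounded_linear.tendsto[OF nst_linear[OF Q] X])
  have "(\<lambda>n. \<integral>y. psi_int (X n) y \<partial>\<nu>) \<longlonglongrightarrow> (\<integral>y. psi_int x y \<partial>\<nu>)"
  proof (rule integral_dominated_convergence[where w="\<lambda>y. (2 + B\<^sup>2) * weight y"])
    show "integrable \<nu> (\<lambda>y. (2 + B\<^sup>2) * weight y)" using weight_integrable by simp
    show "AE y in \<nu>. (\<lambda>n. psi_int (X n) y) \<longlonglongrightarrow> psi_int x y"
      unfolding psi_int_def by (intro AE_I2 tendsto_intros X)
    show "AE y in \<nu>. norm (psi_int (X n) y) \<le> (2 + B\<^sup>2) * weight y" for n
    proof (rule AE_I2)
      fix y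
      have "(2 + (norm (X n))\<^sup>2) * weight y \<le> (2 + B\<^sup>2) * weight y"
        using B weight_nonneg by (intro mult_right_mono add_left_mono power_mono) auto
      then show "norm (psi_int (X n) y) \<le> (2 + B\<^sup>2) * weight y" using psi_int_weight[of "X n" y] by linarith
    qed
  qed measurable
  then show "(\<psi> \<circ> X) \<longlonglongrightarrow> \<psi> x"
    unfolding psi_eq comp_def by (intro tendsto_intros QX X)
qed

lemma L1_wave: "L1 (wave h c) x = - Re (\<psi> h * cis (x \<bullet> h + c))"
proof -
  let ?\<theta> = "x \<bullet> h + c"
  have J: "(\<integral>y. (wave h c (x + y) - wave h c x - indicator {y. norm y \<le> 1} y * (y \<bullet> ((- sin ?\<theta>) *\<^sub>R h))) \<partial>\<nu>)
     = Re ((\<integral>y. psi_int h y \<partial>\<nu>) * cis ?\<theta>)"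
  proof -
    have "Re ((\<integral>y. psi_int h y \<partial>\<nu>) * cis ?\<theta>) = Re (\<integral>y. psi_int h y * cis ?\<theta> \<partial>\<nu>)" by simp
    also have "\<dots> = (\<integral>y. Re (psi_int h y * cis ?\<theta>) \<partial>\<nu>)"
      by (rule integral_Re[symmetric]) (intro integrable_mult_left psi_int_integrable)
    also have "\<dots> = (\<integral>y. (wave h c (x + y) - wave h c x - indicator {y. norm y \<le> 1} y * (y \<bullet> ((- sin ?\<theta>) *\<^sub>R h))) \<partial>\<nu>)"
    proof (rule Bochner_Integration.integral_cong[OF refl])
      fix y
      have "wave h c (x + y) = cos (h \<bullet> y) * cos ?\<theta> - sin (h \<bullet> y) * sin ?\<theta>"
        by (simp add: wave_def inner_add_left inner_commute[of h] cos_add[symmetric] algebra_simps)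
      then show "Re (psi_int h y * cis ?\<theta>) = wave h c (x + y) - wave h c x - indicator {y. norm y \<le> 1} y * (y \<bullet> ((- sin ?\<theta>) *\<^sub>R h))"
        by (simp add: psi_int_def wave_def cis_conv_exp[symmetric] inner_commute[of y] algebra_simps)
    qed
    finally show ?thesis by simp
  qed
  have "(\<lambda>i. ((sb i \<bullet> h) *\<^sub>R ((- cos ?\<theta>) *\<^sub>R h)) \<bullet> Q (sb i)) sums (- cos ?\<theta> * (h \<bullet> Q h))"
  proof -
    have "h \<bullet> Q (sb i) = Q h \<bullet> sb i" for i by (rule nst_sym[OF Q, symmetric])
    then show ?thesis
      using sums_mult[OF parseval[OF onb_seq_sb, of h "Q h"], of "- cos ?\<theta>"]
      by (simp add: inner_commute[of _ h] mult_ac)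
  qed
  then have tr: "op_trace (\<lambda>v. Q ((v \<bullet> h) *\<^sub>R ((- cos ?\<theta>) *\<^sub>R h))) = - cos ?\<theta> * (h \<bullet> Q h)"
    using op_trace_comp(1)[OF Q C2_hs[OF C2_wave[of h c], of x]] sums_unique2 by blast
  show ?thesis
    unfolding L1_C2[OF C2_wave] J tr psi_eq
    by (simp add: algebra_simps inner_commute)
qed

end

section \<open>The Ornstein--Uhlenbeck semigroup on trigonometric functions\<close>

lemma C2_hess_tendsto:
  fixes f :: "'a::{real_inner, polish_space} \<Rightarrow> real"
  assumes f: "C2 f g T C" and X: "X \<longlonglongrightarrow> x" and V: "V \<longlonglongrightarrow> v"
  shows "(\<lambda>n. T (X n) (V n)) \<longlonglongrightarrow> T x v"
proof -
  note bl = hs_bounded_linear[OF C2_hs[OF f]]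
  obtain B where B: "\<And>n. norm (V n) \<le> B" "B > 0" using convergent_imp_Bseq[OF convergentI[OF V]] by (auto simp: Bseq_def)
  have zero: "hs_norm (\<lambda>v. T x v - T x v) = 0"
    using hs_rank_one(2)[of 0 "0::'a"] hs_norm_nonneg[of "\<lambda>v. 0 :: 'a"] by simp
  have "isCont (\<lambda>y. hs_norm (\<lambda>v. T y v - T x v)) x" using C2_cont[OF f, of x] zero by (simp add: isCont_def)
  then have "(\<lambda>n. hs_norm (\<lambda>v. T (X n) v - T x v)) \<longlonglongrightarrow> 0"
    using isCont_tendsto_compose[OF _ X] zero by force
  then have lim: "(\<lambda>n. hs_norm (\<lambda>v. T (X n) v - T x v) * B) \<longlonglongrightarrow> 0" by (rule tendsto_mult_left_zero)
  have le: "norm (T (X n) (V n) - T x (V n)) \<le> hs_norm (\<lambda>v. T (X n) v - T x v) * B" for n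
    using norm_le_hs_norm[OF hs_diff(1)[OF C2_hs[OF f, of "X n"] C2_hs[OF f, of x]], of "V n"]
      mult_left_mono[OF B(1)[of n] hs_norm_nonneg[of "\<lambda>v. T (X n) v - T x v"]] by linarith
  have "(\<lambda>n. T (X n) (V n) - T x (V n)) \<longlonglongrightarrow> 0"
    by (rule Lim_null_comparison[OF always_eventually[OF allI[OF le]] lim])
  from tendsto_add[OF this bounded_linear.tendsto[OF bl[of x] V]] show ?thesis by simp
qed

locale ou_data = adjoint_semigroups DA A S Sadj + levy_data Q a \<nu>
  for DA :: "'a::{real_inner, polish_space} set" and A :: "'a \<Rightarrow> 'a"
    and S Sadj :: "real \<Rightarrow> 'a \<Rightarrow> 'a" and Q :: "'a \<Rightarrow> 'a" and a :: 'a and \<nu> :: "'a measure" +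
  fixes \<mu> :: "real \<Rightarrow> 'a measure"
  assumes laws: "convolution_laws Q a \<nu> Sadj \<mu>"
begin

definition chf :: "real \<Rightarrow> 'a \<Rightarrow> complex" where
  "chf t h = exp (- integral {0..t} (\<lambda>s. \<psi> (Sadj s h)))"

lemma mu_prob: "t \<ge> 0 \<Longrightarrow> prob_space (\<mu> t)" and mu_sets: "t \<ge> 0 \<Longrightarrow> sets (\<mu> t) = sets borel"
  and mu_chf: "t \<ge> 0 \<Longrightarrow> (\<integral>y. iexp (h \<bullet> y) \<partial>\<mu> t) = chf t h"
  using laws by (auto simp: convolution_laws_def chf_def)

lemma mu_measurable: "t \<ge> 0 \<Longrightarrow> f \<in> borel_measurable borel \<Longrightarrow> f \<in> borel_measurable (\<mu> t)"
  using measurable_cong_sets[OF mu_sets refl] by blast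

lemma mu_integrable:
  fixes f :: "'a \<Rightarrow> 'b::{banach, second_countable_topology}"
  assumes "t \<ge> 0" "f \<in> borel_measurable borel" "\<And>x. norm (f x) \<le> C"
  shows "integrable (\<mu> t) f"
proof -
  interpret prob_space "\<mu> t" using assms by (intro mu_prob)
  show ?thesis by (rule integrable_const_bound[where B=C]) (use assms mu_measurable in auto)
qed

lemma mu_integral_bound:
  fixes f :: "'a \<Rightarrow> real"
  assumes "t \<ge> 0" "f \<in> borel_measurable borel" "\<And>x. \<bar>f x\<bar> \<le> C"
  shows "\<bar>\<integral>y. f y \<partial>\<mu> t\<bar> \<le> C"
proof -
  interpret prob_space "\<mu> t" using assms by (intro mu_prob)
  have "\<bar>\<integral>y. f y \<partial>\<mu> t\<bar> \<le> (\<integral>y. \<bar>f y\<bar> \<partial>\<mu> t)" by (rule integral_abs_bound)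
  also have "\<dots> \<le> (\<integral>y. C \<partial>\<mu> t)"
    by (rule integral_mono) (use mu_integrable[OF assms(1,2), of C] assms(3) in auto)
  finally show ?thesis by (simp add: prob_space)
qed

lemma mu_tendsto:
  fixes f :: "nat \<Rightarrow> 'a \<Rightarrow> real"
  assumes "t \<ge> 0" "\<And>n. f n \<in> borel_measurable borel" "\<And>n x. \<bar>f n x\<bar> \<le> C" "\<And>x. (\<lambda>n. f n x) \<longlonglongrightarrow> f' x"
  shows "(\<lambda>n. \<integral>y. f n y \<partial>\<mu> t) \<longlonglongrightarrow> (\<integral>y. f' y \<partial>\<mu> t)"
proof -
  interpret prob_space "\<mu> t" using assms by (intro mu_prob)
  have "f' \<in> borel_measurable borel" using assms(4,2) by (rule borel_measurable_LIMSEQ_real)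
  then show ?thesis
    using assms by (intro integral_dominated_convergence[where w="\<lambda>_. C"]) (auto intro: mu_measurable)
qed

lemma continuous_psi_Sadj: "0 \<le> u \<Longrightarrow> continuous_on {u..v} (\<lambda>s. \<psi> (Sadj s h))"
  using continuous_on_compose2[OF continuous_psi continuous_on_subset[OF c0_continuous[OF c0_adj, of h], of "{u..v}"]]
  by force

lemma chf_0: "chf 0 h = 1" by (simp add: chf_def)

lemma chf_has_vector_derivative:
  assumes "t \<in> {0..b}"
  shows "((\<lambda>t. chf t h) has_vector_derivative - (\<psi> (Sadj t h) * chf t h)) (at t within {0..b})"
proof -
  have "((\<lambda>t. integral {0..t} (\<lambda>s. \<psi> (Sadj s h))) has_vector_derivative \<psi> (Sadj t h)) (at t within {0..b})"
    using continuous_psi_Sadj assms by (intro integral_has_vector_derivative) auto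
  from field_vector_diff_chain_within[OF has_vector_derivative_minus[OF this]
      has_field_derivative_at_within[OF DERIV_exp]]
  show ?thesis by (simp add: chf_def comp_def mult.commute)
qed

lemma continuous_chf: "continuous_on {0..b} (\<lambda>t. chf t h)"
  using chf_has_vector_derivative has_vector_derivative_continuous
  by (fastforce simp: continuous_on_eq_continuous_within)

lemma continuous_chf_Ici: "continuous_on {0..} (\<lambda>t. chf t h)"
  unfolding continuous_on_sequentially
proof (intro allI ballI impI, elim conjE)
  fix X :: "nat \<Rightarrow> real" and x assume X: "\<forall>n. X n \<in> {0..}" "X \<longlonglongrightarrow> x" and x: "x \<in> {0..}"
  obtain B where "\<And>n. norm (X n) \<le> B" using convergent_imp_Bseq[OF convergentI[OF X(2)]] by (auto simp: Bseq_def)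
  then have B: "X n \<in> {0..max B x}" for n using X(1) by (simp add: abs_le_iff le_max_iff_disj)
  moreover have "x \<in> {0..max B x}" using x by simp
  ultimately show "((\<lambda>t. chf t h) \<circ> X) \<longlonglongrightarrow> chf x h"
    using continuous_chf[of "max B x" h] X(2) unfolding continuous_on_sequentially by blast
qed

lemma chf_diff:
  assumes "0 \<le> t"
  shows "chf t h - 1 = - integral {0..t} (\<lambda>s. \<psi> (Sadj s h) * chf s h)"
proof -
  have "((\<lambda>s. - (\<psi> (Sadj s h) * chf s h)) has_integral chf t h - chf 0 h) {0..t}"
    using assms by (intro fundamental_theorem_of_calculus chf_has_vector_derivative)
  then show ?thesis by (simp add: has_integral_iff chf_0 del: integral_mult_right integral_mult_left)
qed

lemma chf_add:
  assumes "0 \<le> t" "0 \<le> s"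
  shows "chf (t + s) h = chf t h * chf s (Sadj t h)"
proof -
  let ?f = "\<lambda>s. \<psi> (Sadj s h)"
  have "integral {0..t + s} ?f = integral {0..t} ?f + integral {t..t + s} ?f"
    using assms by (intro Henstock_Kurzweil_Integration.integral_combine[symmetric] integrable_continuous_real continuous_psi_Sadj) auto
  also have "integral {t..t + s} ?f = integral {0..s} (\<lambda>r. ?f (r + t))"
    using integral_shift[of 0 t s ?f] continuous_psi_Sadj[OF assms(1), of "s + t" h] by (simp add: comp_def add.commute)
  also have "\<dots> = integral {0..s} (\<lambda>r. \<psi> (Sadj r (Sadj t h)))"
    by (rule integral_cong) (use assms c0_add[OF c0_adj] in auto)
  finally show ?thesis by (simp add: chf_def exp_add[symmetric] algebra_simps)
qed

lemma mu_cis: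
  assumes "t \<ge> 0"
  shows "(\<integral>y. cis (c + y \<bullet> h) \<partial>\<mu> t) = cis c * chf t h" "integrable (\<mu> t) (\<lambda>y. cis (c + y \<bullet> h))"
proof -
  show i: "integrable (\<mu> t) (\<lambda>y. cis (c + y \<bullet> h))"
    by (rule mu_integrable[OF assms borel_measurable_continuous_onI, where C=1]) (auto intro!: continuous_intros)
  have "cis (c + y \<bullet> h) = cis c * iexp (h \<bullet> y)" for y
    unfolding cis_mult[symmetric] by (simp add: cis_conv_exp inner_commute)
  then show "(\<integral>y. cis (c + y \<bullet> h) \<partial>\<mu> t) = cis c * chf t h"
    by (simp add: mu_chf[OF assms])
qed

lemma mu_wave:
  assumes "t \<ge> 0"
  shows "(\<integral>y. wave h c (z + y) \<partial>\<mu> t) = Re (cis (z \<bullet> h + c) * chf t h)"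
proof -
  have "wave h c (z + y) = Re (cis ((z \<bullet> h + c) + y \<bullet> h))" for y
    by (simp add: wave_def inner_add_left algebra_simps)
  then show ?thesis using integral_Re[OF mu_cis(2)[OF assms]] mu_cis(1)[OF assms] by simp
qed

abbreviation P :: "real \<Rightarrow> ('a \<Rightarrow> real) \<Rightarrow> 'a \<Rightarrow> real" where "P \<equiv> ou_semigroup S \<mu>"

lemma P_eq: "P t f x = (\<integral>y. f (S t x + y) \<partial>\<mu> t)"
  by (simp add: ou_semigroup_def)

lemma P_wave:
  assumes "t \<ge> 0"
  shows "P t (wave h c) x = Re (cis (x \<bullet> Sadj t h + c) * chf t h)"
  using mu_wave[OF assms] semigroup_adjoint[OF assms] by (simp add: P_eq)

lemma shift_measurable: "continuous_on UNIV f \<Longrightarrow> (\<lambda>y. f (z + y :: 'a)) \<in> borel_measurable borel"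
  by (rule borel_measurable_continuous_onI[OF continuous_on_compose2[of UNIV f UNIV "\<lambda>y. z + y"]])
    (auto intro!: continuous_intros)

lemma P_abs_le:
  assumes "t \<ge> 0" "continuous_on UNIV f" "\<And>x. \<bar>f x\<bar> \<le> C"
  shows "\<bar>P t f x\<bar> \<le> C"
  unfolding P_eq using assms by (intro mu_integral_bound shift_measurable)

lemma P_tendsto:
  assumes "t \<ge> 0" "\<And>n. continuous_on UNIV (f n)" "\<And>n x. \<bar>f n x\<bar> \<le> C" "\<And>x. (\<lambda>n. f n x) \<longlonglongrightarrow> f' x"
  shows "(\<lambda>n. P t (f n) x) \<longlonglongrightarrow> P t f' x"
  unfolding P_eq using assms by (intro mu_tendsto[where C=C] shift_measurable)

lemma P_continuous:
  assumes "t \<ge> 0" "continuous_on UNIV f" "\<And>x. \<bar>f x\<bar> \<le> C"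
  shows "continuous_on UNIV (P t f)"
  unfolding continuous_on_sequentially
proof (intro allI ballI impI, elim conjE)
  fix X :: "nat \<Rightarrow> 'a" and x assume X: "X \<longlonglongrightarrow> x"
  have "(\<lambda>n. f (S t (X n) + y)) \<longlonglongrightarrow> f (S t x + y)" for y
  proof -
    have "(\<lambda>n. S t (X n) + y) \<longlonglongrightarrow> S t x + y"
      by (intro tendsto_intros bounded_linear.tendsto[OF c0_linear[OF c0 assms(1)] X])
    then show ?thesis using assms(2) by (auto simp: continuous_on_sequentially comp_def)
  qed
  then show "(P t f \<circ> X) \<longlonglongrightarrow> P t f x"
    unfolding P_eq comp_def using assms by (intro mu_tendsto[where C=C] shift_measurable)
qed

lemma P_linear:
  assumes "t \<ge> 0" "f \<in> bcontfun" "g \<in> bcontfun"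
  shows "P t (\<lambda>x. c * f x + g x) x = c * P t f x + P t g x"
proof -
  have *: "integrable (\<mu> t) (\<lambda>y. f (z + y))" if "f \<in> bcontfun" for f :: "'a \<Rightarrow> real" and z
  proof -
    obtain C where "\<And>x. norm (f x) \<le> C" using bcontfun_bound[OF \<open>f \<in> bcontfun\<close>] by blast
    then show ?thesis
      using assms(1) shift_measurable[OF bcontfun_continuous[OF that]] by (intro mu_integrable[where C=C]) auto
  qed
  show ?thesis unfolding P_eq using *[OF assms(2)] *[OF assms(3)] by simp
qed

lemma P_commute_wave:
  assumes "s \<ge> 0" "t \<ge> 0"
  shows "P s (P t (wave h c)) x = P (s + t) (wave h c) x"
proof -
  have polar: "of_real (cmod (chf t h)) * cis (u + Arg (chf t h)) = cis u * chf t h" for u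
  proof -
    have "cis u * chf t h = cis u * (of_real (cmod (chf t h)) * cis (Arg (chf t h)))"
      using rcis_cmod_Arg[of "chf t h"] by (simp add: rcis_def)
    then show ?thesis by (simp add: cis_mult[symmetric] mult_ac)
  qed
  have "P t (wave h c) x = cmod (chf t h) * wave (Sadj t h) (c + Arg (chf t h)) x" for x
  proof -
    have "cis (x \<bullet> Sadj t h + c) * chf t h = of_real (cmod (chf t h)) * cis (x \<bullet> Sadj t h + c + Arg (chf t h))"
      using polar[of "x \<bullet> Sadj t h + c"] by simp
    then show ?thesis by (simp add: P_wave[OF assms(2)] wave_def algebra_simps)
  qed
  then have e: "P t (wave h c) = (\<lambda>x. cmod (chf t h) * wave (Sadj t h) (c + Arg (chf t h)) x)" by auto
  have "P s (P t (wave h c)) x = cmod (chf t h) * Re (cis (x \<bullet> Sadj s (Sadj t h) + (c + Arg (chf t h))) * chf s (Sadj t h))"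
    unfolding e using P_wave[OF assms(1), of "Sadj t h"] by (simp add: P_eq)
  also have "\<dots> = Re (cis (x \<bullet> Sadj s (Sadj t h) + c) * (chf t h * chf s (Sadj t h)))"
  proof -
    have "of_real (cmod (chf t h)) * (cis (u + (c + Arg (chf t h))) * z) = cis (u + c) * (chf t h * z)" for u z
      by (simp only: add.assoc[symmetric] mult.assoc[symmetric] polar)
    moreover have r: "Re (of_real r * w) = r * Re w" for r w by simp
    ultimately show ?thesis by (simp only: r[symmetric])
  qed
  also have "\<dots> = P (s + t) (wave h c) x"
    using assms by (simp add: P_wave chf_add[of t s, symmetric] c0_add[OF c0_adj] add.commute)
  finally show ?thesis .
qed

end

section \<open>Dynkin's formula for the stochastic convolution\<close>

context ou_data
begin

text \<open>
  The generator of the time-inhomogeneous process \<open>Y\<close> at time \<open>s\<close>: the Levy part of the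
  operator, with the noise transported by \<open>S s\<close>.
\<close>
definition moved :: "('a \<Rightarrow> real) \<Rightarrow> real \<Rightarrow> 'a \<Rightarrow> real" where
  "moved f s w = L1 (\<lambda>x. f (w + S s x)) 0"

lemma S_bound: obtains M where "M \<ge> 1" "\<And>s x. 0 \<le> s \<Longrightarrow> s \<le> b \<Longrightarrow> norm (S s x) \<le> M * norm x"
  using c0_bounded[OF c0, of b] by auto

lemma moved_wave:
  assumes "s \<ge> 0"
  shows "moved (wave h c) s w = - Re (\<psi> (Sadj s h) * cis (w \<bullet> h + c))"
proof -
  have "(\<lambda>x. wave h c (w + S s x)) = wave (Sadj s h) (w \<bullet> h + c)"
    by (auto simp: fun_eq_iff wave_def inner_add_left semigroup_adjoint[OF assms] algebra_simps)
  then show ?thesis by (simp add: moved_def L1_wave)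
qed

lemma moved_bound:
  assumes f: "C2 f g T C" and s: "0 \<le> s" and M: "\<And>x. norm (S s x) \<le> M * norm x" "1 \<le> M"
  shows "\<bar>moved f s w\<bar> \<le> levy_const * (M\<^sup>2 * C)"
  unfolding moved_def by (rule L1_bound[OF C2_affine[OF f c0_linear[OF c0 s] M]])

lemma moved_linear:
  assumes f: "C2 f g T C" and f': "C2 f' g' T' C'" and s: "0 \<le> s"
  shows "moved (\<lambda>x. c * f x + f' x) s w = c * moved f s w + moved f' s w"
proof -
  obtain M where M: "M \<ge> 1" "\<And>r x. 0 \<le> r \<Longrightarrow> r \<le> s \<Longrightarrow> norm (S r x) \<le> M * norm x" by (rule S_bound[of s]) blast
  note a = C2_affine[OF _ c0_linear[OF c0 s] M(2)[OF s order_refl] M(1)]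
  show ?thesis unfolding moved_def by (rule L1_linear[OF a[OF f] a[OF f']])
qed

lemma moved_tendsto:
  assumes f: "C2 f g T C" and s: "s \<longlonglongrightarrow> l" "\<And>n. s n \<ge> 0" and w: "w \<longlonglongrightarrow> w'"
  shows "(\<lambda>n. moved f (s n) (w n)) \<longlonglongrightarrow> moved f l w'"
proof -
  have l: "l \<ge> 0" using LIMSEQ_le_const[OF s(1)] s(2) by blast
  obtain B where B: "\<And>n. \<bar>s n\<bar> \<le> B" using convergent_imp_Bseq[OF convergentI[OF s(1)]] by (auto simp: Bseq_def)
  obtain M where M: "M \<ge> 1" "\<And>s x. 0 \<le> s \<Longrightarrow> s \<le> max B l \<Longrightarrow> norm (S s x) \<le> M * norm x" by (rule S_bound) blast
  have sb: "s n \<le> max B l" for n using B[of n] by (simp add: abs_le_iff le_max_iff_disj)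
  note lin = c0_linear[OF c0 s(2)] and lin' = c0_linear[OF c0 l]
  note a = C2_affine[OF f lin M(2)[OF s(2) sb] M(1)] and a' = C2_affine[OF f lin' M(2)[OF l max.cobounded2] M(1)]
  have Sv: "(\<lambda>n. S (s n) v) \<longlonglongrightarrow> S l v" for v by (rule c0_joint[OF c0 s tendsto_const])
  have 0: "w n + S (s n) 0 = w n" "w' + S l 0 = w'" for n
    using linear_0[OF bounded_linear.linear[OF lin]] linear_0[OF bounded_linear.linear[OF lin']] by auto
  show ?thesis
    unfolding moved_def
  proof (rule L1_tendsto[OF a a'])
    have "(\<lambda>n. w n + S (s n) y) \<longlonglongrightarrow> w' + S l y" for y by (intro tendsto_intros w Sv)
    then show "(\<lambda>k. f (w k + S (s k) (0 + y))) \<longlonglongrightarrow> f (w' + S l (0 + y))" for y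
      using C2_continuous[OF f, of UNIV] by (auto simp: continuous_on_sequentially comp_def)
    have "(\<lambda>n. g (w n)) \<longlonglongrightarrow> g w'"
      using C2_grad_continuous[OF f, of UNIV] w by (auto simp: continuous_on_sequentially comp_def)
    then show "(\<lambda>k. v \<bullet> adjoint (S (s k)) (g (w k + S (s k) 0))) \<longlonglongrightarrow> v \<bullet> adjoint (S l) (g (w' + S l 0))" for v
      unfolding adjoint_inner[OF lin, symmetric] adjoint_inner[OF lin', symmetric] 0
      by (intro tendsto_intros Sv)
    show "(\<lambda>k. u \<bullet> adjoint (S (s k)) (T (w k + S (s k) 0) (S (s k) v))) \<longlonglongrightarrow> u \<bullet> adjoint (S l) (T (w' + S l 0) (S l v))" for u v
      unfolding adjoint_inner[OF lin, symmetric] adjoint_inner[OF lin', symmetric] 0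
      by (intro tendsto_intros Sv C2_hess_tendsto[OF f w])
  qed
qed

lemma moved_continuous:
  assumes f: "C2 f g T C" and s: "0 \<le> s"
  shows "continuous_on UNIV (moved f s)"
  using moved_tendsto[OF f tendsto_const[of s]] s
  by (auto simp: continuous_on_sequentially comp_def)

lemma L1_shift:
  assumes f: "C2 f g T C"
  shows "L1 (\<lambda>x. f (w + x)) y = L1 f (w + y)"
proof -
  have l: "bounded_linear (\<lambda>x :: 'a. x)" by (rule bounded_linear_ident)
  have "adjoint (\<lambda>x :: 'a. x) v = v" for v
  proof -
    have "\<forall>u. u \<bullet> adjoint (\<lambda>x :: 'a. x) v = u \<bullet> v" using adjoint_inner[OF l, of _ v] by auto
    then show ?thesis by (simp only: vector_eq_ldot)
  qed
  then show ?thesis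
    using L1_C2[OF C2_affine[OF f l, of 1 w], of y] L1_C2[OF f, of "w + y"] by (simp add: add.assoc)
qed

lemma moved_0: "C2 f g T C \<Longrightarrow> moved f 0 w = L1 f w"
  using L1_shift[of f g T C w 0] by (simp add: moved_def c0_zero[OF c0])

lemma L1_continuous:
  assumes f: "C2 f g T C" shows "continuous_on UNIV (L1 f)"
  using moved_continuous[OF f, of 0] moved_0[OF f] by simp

definition mean_moved :: "('a \<Rightarrow> real) \<Rightarrow> real \<Rightarrow> 'a \<Rightarrow> real" where
  "mean_moved f s z = (\<integral>y. moved f s (z + y) \<partial>\<mu> s)"

lemma mean_moved_bound:
  assumes f: "C2 f g T C" and s: "0 \<le> s" and M: "\<And>x. norm (S s x) \<le> M * norm x" "1 \<le> M"
  shows "\<bar>mean_moved f s z\<bar> \<le> levy_const * (M\<^sup>2 * C)"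
  unfolding mean_moved_def
  by (intro mu_integral_bound s shift_measurable moved_continuous[OF f s] moved_bound[OF f s M])

definition dynkin :: "('a \<Rightarrow> real) \<Rightarrow> bool" where
  "dynkin f \<longleftrightarrow> (\<forall>z. \<forall>t\<ge>0. (\<lambda>s. mean_moved f s z) \<in> borel_measurable (lebI 0 t) \<and>
     (\<integral>y. f (z + y) \<partial>\<mu> t) - f z = (\<integral>s. mean_moved f s z \<partial>lebI 0 t))"

lemma dynkin_wave: "dynkin (wave h c)"
  unfolding dynkin_def
proof (intro allI impI)
  fix z and t :: real assume t: "t \<ge> 0"
  let ?j = "\<lambda>s. - Re (cis (z \<bullet> h + c) * (\<psi> (Sadj s h) * chf s h))"
  have eq: "mean_moved (wave h c) s z = ?j s" if s: "s \<ge> 0" for s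
  proof -
    have "mean_moved (wave h c) s z = (\<integral>y. - Re (\<psi> (Sadj s h) * cis ((z \<bullet> h + c) + y \<bullet> h)) \<partial>\<mu> s)"
      unfolding mean_moved_def moved_wave[OF s] by (simp add: inner_add_left algebra_simps)
    also have "\<dots> = - Re (\<integral>y. \<psi> (Sadj s h) * cis ((z \<bullet> h + c) + y \<bullet> h) \<partial>\<mu> s)"
      using integral_Re[OF integrable_mult_right[OF mu_cis(2)[OF s]], of "\<psi> (Sadj s h)" "z \<bullet> h + c" h]
      by (simp only: Bochner_Integration.integral_minus)
    also have "\<dots> = ?j s" using mu_cis(1)[OF s] by (simp add: mult_ac)
    finally show ?thesis .
  qed
  have cj: "continuous_on {0..t} (\<lambda>s. \<psi> (Sadj s h) * chf s h)"
    by (intro continuous_intros continuous_psi_Sadj continuous_chf) simp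
  have c: "continuous_on {0..t} ?j"
    by (intro continuous_on_minus continuous_on_Re continuous_on_mult[OF continuous_on_const] cj)
  have m: "?j \<in> borel_measurable (lebI 0 t)" by (rule borel_measurable_lebI[OF c])
  have "(\<integral>s. mean_moved (wave h c) s z \<partial>lebI 0 t) = (\<integral>s. ?j s \<partial>lebI 0 t)"
    by (rule Bochner_Integration.integral_cong) (auto simp: eq)
  also have "\<dots> = integral {0..t} ?j" by (rule integral_lebI[OF c])
  also have "\<dots> = - Re (cis (z \<bullet> h + c) * integral {0..t} (\<lambda>s. \<psi> (Sadj s h) * chf s h))"
  proof -
    have "((\<lambda>s. cis (z \<bullet> h + c) * (\<psi> (Sadj s h) * chf s h)) has_integral
        cis (z \<bullet> h + c) * integral {0..t} (\<lambda>s. \<psi> (Sadj s h) * chf s h)) {0..t}"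
      by (intro has_integral_mult_right integrable_integral integrable_continuous_real cj)
    then show ?thesis by (intro integral_unique has_integral_neg has_integral_Re)
  qed
  also have "\<dots> = Re (cis (z \<bullet> h + c) * (chf t h - 1))" by (simp add: chf_diff[OF t])
  also have "\<dots> = (\<integral>y. wave h c (z + y) \<partial>\<mu> t) - wave h c z"
    unfolding mu_wave[OF t] by (simp add: wave_def right_diff_distrib)
  finally have e: "(\<integral>y. wave h c (z + y) \<partial>\<mu> t) - wave h c z = (\<integral>s. mean_moved (wave h c) s z \<partial>lebI 0 t)" by simp
  have "(\<lambda>s. mean_moved (wave h c) s z) \<in> borel_measurable (lebI 0 t)"
    by (rule measurable_cong[THEN iffD2, OF _ m]) (simp add: eq)
  with e show "(\<lambda>s. mean_moved (wave h c) s z) \<in> borel_measurable (lebI 0 t) \<and>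
     (\<integral>y. wave h c (z + y) \<partial>\<mu> t) - wave h c z = (\<integral>s. mean_moved (wave h c) s z \<partial>lebI 0 t)" by blast
qed

lemma mean_moved_integrable:
  assumes f: "C2 f g T C" and m: "(\<lambda>s. mean_moved f s z) \<in> borel_measurable (lebI 0 t)"
  shows "integrable (lebI 0 t) (\<lambda>s. mean_moved f s z)"
proof -
  interpret finite_measure "lebI 0 t" by (rule finite_measure_lebI)
  obtain M where M: "M \<ge> 1" "\<And>s x. 0 \<le> s \<Longrightarrow> s \<le> t \<Longrightarrow> norm (S s x) \<le> M * norm x" by (rule S_bound) blast
  have "\<bar>mean_moved f s z\<bar> \<le> levy_const * (M\<^sup>2 * C)" if "s \<in> {0..t}" for s
    using that M by (intro mean_moved_bound[OF f]) auto
  then show ?thesis by (intro integrable_const_bound[where B="levy_const * (M\<^sup>2 * C)"] m) auto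
qed

lemma dynkin_linear:
  assumes f: "C2 f g T C" "dynkin f" and f': "C2 f' g' T' C'" "dynkin f'"
  shows "dynkin (\<lambda>x. c * f x + f' x)"
  unfolding dynkin_def
proof (intro allI impI)
  fix z and t :: real assume t: "t \<ge> 0"
  have m: "(\<lambda>s. mean_moved f s z) \<in> borel_measurable (lebI 0 t)"
    "(\<lambda>s. mean_moved f' s z) \<in> borel_measurable (lebI 0 t)"
    and e: "(\<integral>y. f (z + y) \<partial>\<mu> t) - f z = (\<integral>s. mean_moved f s z \<partial>lebI 0 t)"
     "(\<integral>y. f' (z + y) \<partial>\<mu> t) - f' z = (\<integral>s. mean_moved f' s z \<partial>lebI 0 t)"
    using f f' t unfolding dynkin_def by auto
  note i = mean_moved_integrable[OF f(1) m(1)] mean_moved_integrable[OF f'(1) m(2)]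
  have eq: "mean_moved (\<lambda>x. c * f x + f' x) s z = c * mean_moved f s z + mean_moved f' s z" if s: "s \<ge> 0" for s
  proof -
    obtain M where M: "M \<ge> 1" "\<And>r x. 0 \<le> r \<Longrightarrow> r \<le> s \<Longrightarrow> norm (S r x) \<le> M * norm x" by (rule S_bound) blast
    have "integrable (\<mu> s) (\<lambda>y. moved f s (z + y))" if f: "C2 f g T C" for f g T C
      using moved_bound[OF f s M(2)[OF s order_refl] M(1)]
      by (intro mu_integrable s shift_measurable moved_continuous[OF f s]) auto
    from this[OF f(1)] this[OF f'(1)] show ?thesis
      unfolding mean_moved_def moved_linear[OF f(1) f'(1) s] by simp
  qed
  have i2: "integrable (\<mu> t) (\<lambda>y. f (z + y))" if f: "C2 f g T C" for f g T C
    using C2_abs[OF f] by (intro mu_integrable t shift_measurable C2_continuous[OF f]) auto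
  have m': "(\<lambda>s. mean_moved (\<lambda>x. c * f x + f' x) s z) \<in> borel_measurable (lebI 0 t)"
  proof (rule measurable_cong[THEN iffD2])
    show "mean_moved (\<lambda>x. c * f x + f' x) s z = c * mean_moved f s z + mean_moved f' s z" if "s \<in> space (lebI 0 t)" for s
      using that by (simp add: eq)
    show "(\<lambda>s. c * mean_moved f s z + mean_moved f' s z) \<in> borel_measurable (lebI 0 t)" using m by measurable
  qed
  have "(\<integral>s. mean_moved (\<lambda>x. c * f x + f' x) s z \<partial>lebI 0 t) = (\<integral>s. c * mean_moved f s z + mean_moved f' s z \<partial>lebI 0 t)"
    by (rule Bochner_Integration.integral_cong) (auto simp: eq)
  also have "\<dots> = c * ((\<integral>y. f (z + y) \<partial>\<mu> t) - f z) + ((\<integral>y. f' (z + y) \<partial>\<mu> t) - f' z)"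
    unfolding e using i by simp
  also have "\<dots> = (\<integral>y. c * f (z + y) + f' (z + y) \<partial>\<mu> t) - (c * f z + f' z)"
    using i2[OF f(1)] i2[OF f'(1)] by (simp add: right_diff_distrib)
  finally show "(\<lambda>s. mean_moved (\<lambda>x. c * f x + f' x) s z) \<in> borel_measurable (lebI 0 t) \<and>
     (\<integral>y. c * f (z + y) + f' (z + y) \<partial>\<mu> t) - (c * f z + f' z) = (\<integral>s. mean_moved (\<lambda>x. c * f x + f' x) s z \<partial>lebI 0 t)"
    using m' by simp
qed

lemma dynkin_closed:
  assumes f: "\<And>k. C2 (f k) (g k) (T k) C" "\<And>k. dynkin (f k)" and f': "C2 f' g' T' C'"
    and lim: "\<And>x. (\<lambda>k. f k x) \<longlonglongrightarrow> f' x"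
    and limg: "\<And>x v. (\<lambda>k. v \<bullet> g k x) \<longlonglongrightarrow> v \<bullet> g' x"
    and limT: "\<And>x u v. (\<lambda>k. u \<bullet> T k x v) \<longlonglongrightarrow> u \<bullet> T' x v"
  shows "dynkin f'"
  unfolding dynkin_def
proof (intro allI impI)
  fix z and t :: real assume t: "t \<ge> 0"
  obtain M where M: "M \<ge> 1" "\<And>s x. 0 \<le> s \<Longrightarrow> s \<le> t \<Longrightarrow> norm (S s x) \<le> M * norm x" by (rule S_bound) blast
  define B where "B = levy_const * (M\<^sup>2 * C)"
  have m: "(\<lambda>s. mean_moved (f k) s z) \<in> borel_measurable (lebI 0 t)"
    and e: "(\<integral>y. f k (z + y) \<partial>\<mu> t) - f k z = (\<integral>s. mean_moved (f k) s z \<partial>lebI 0 t)" for k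
    using f(2)[of k] t unfolding dynkin_def by auto
  have mv: "(\<lambda>k. moved (f k) s w) \<longlonglongrightarrow> moved f' s w" if s: "0 \<le> s" "s \<le> t" for s w
  proof -
    note lin = c0_linear[OF c0 s(1)]
    note a = C2_affine[OF f(1) lin M(2)[OF s] M(1)] and a' = C2_affine[OF f' lin M(2)[OF s] M(1)]
    show ?thesis
      unfolding moved_def
    proof (rule L1_tendsto[OF a a'])
      show "(\<lambda>k. v \<bullet> adjoint (S s) (g k (w + S s 0))) \<longlonglongrightarrow> v \<bullet> adjoint (S s) (g' (w + S s 0))" for v
        unfolding adjoint_inner[OF lin, symmetric] by (rule limg)
      show "(\<lambda>k. u \<bullet> adjoint (S s) (T k (w + S s 0) (S s v))) \<longlonglongrightarrow> u \<bullet> adjoint (S s) (T' (w + S s 0) (S s v))" for u v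
        unfolding adjoint_inner[OF lin, symmetric] by (rule limT)
    qed (rule lim)
  qed
  have mm: "(\<lambda>k. mean_moved (f k) s z) \<longlonglongrightarrow> mean_moved f' s z" if s: "0 \<le> s" "s \<le> t" for s
    unfolding mean_moved_def
    by (rule mu_tendsto[OF s(1) shift_measurable[OF moved_continuous[OF f(1) s(1)]] moved_bound[OF f(1) s(1) M(2)[OF s] M(1)] mv[OF s]])
  have m': "(\<lambda>s. mean_moved f' s z) \<in> borel_measurable (lebI 0 t)"
    by (rule borel_measurable_LIMSEQ_real[OF mm m]) auto
  have 1: "(\<lambda>k. \<integral>s. mean_moved (f k) s z \<partial>lebI 0 t) \<longlonglongrightarrow> (\<integral>s. mean_moved f' s z \<partial>lebI 0 t)"
  proof (rule integral_dominated_convergence[where w="\<lambda>_. B"])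
    show "integrable (lebI 0 t) (\<lambda>_. B)" by (rule finite_measure.integrable_const[OF finite_measure_lebI])
    show "AE s in lebI 0 t. (\<lambda>k. mean_moved (f k) s z) \<longlonglongrightarrow> mean_moved f' s z" using mm by (intro AE_I2) auto
    show "AE s in lebI 0 t. norm (mean_moved (f k) s z) \<le> B" for k
      using mean_moved_bound[OF f(1) _ M(2) M(1)] by (intro AE_I2) (auto simp: B_def)
  qed (use m m' in auto)
  have 2: "(\<lambda>k. (\<integral>y. f k (z + y) \<partial>\<mu> t) - f k z) \<longlonglongrightarrow> (\<integral>y. f' (z + y) \<partial>\<mu> t) - f' z"
    by (intro tendsto_diff lim mu_tendsto[OF t shift_measurable[OF C2_continuous[OF f(1)]] C2_abs[OF f(1)] lim])
  show "(\<lambda>s. mean_moved f' s z) \<in> borel_measurable (lebI 0 t) \<and>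
     (\<integral>y. f' (z + y) \<partial>\<mu> t) - f' z = (\<integral>s. mean_moved f' s z \<partial>lebI 0 t)"
    using m' LIMSEQ_unique[OF 2[unfolded e] 1] by blast
qed

lemma trig_C2:
  fixes f :: "'a \<Rightarrow> real"
  shows "f \<in> trig V \<Longrightarrow> \<exists>g T C. C2 f g T C"
proof (induction rule: trig_induct)
  case (cons b h c f)
  then show ?case using C2_add[OF C2_scale[OF C2_wave[of h c], of b]] by blast
qed (use C2_zero in blast)

lemma dynkin_trig:
  fixes f :: "'a \<Rightarrow> real"
  shows "f \<in> trig V \<Longrightarrow> dynkin f"
proof (induction rule: trig_induct)
  case zero
  have "dynkin (\<lambda>x. (-1) * wave 0 0 x + wave 0 0 x)"
    by (intro dynkin_linear[OF C2_wave dynkin_wave C2_wave dynkin_wave])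
  then show ?case by simp
next
  case (cons b h c f)
  then obtain g T C where "C2 f g T C" using trig_C2 by blast
  then show ?case using dynkin_linear[OF C2_wave dynkin_wave] cons by blast
qed

end

section \<open>Averaging along coordinate directions\<close>

lemma C2_bound:
  assumes "C2 f g T C" "\<And>x. \<bar>f x\<bar> \<le> D" "\<And>x. norm (g x) \<le> D" "\<And>x. hs_norm (T x) \<le> D"
  shows "C2 f g T D"
  using assms unfolding C2_def by blast

lemma adjoint_id: "adjoint (\<lambda>x. x) = (\<lambda>x :: 'a::real_inner. x)"
  by (rule adjoint_unique) simp

lemma C2_shift:
  fixes f :: "'a::{real_inner, polish_space} \<Rightarrow> real"
  assumes "C2 f g T C"
  shows "C2 (\<lambda>x. f (x + w)) (\<lambda>x. g (x + w)) (\<lambda>x. T (x + w)) C"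
  using C2_affine[OF assms bounded_linear_ident, of 1 w] by (simp add: adjoint_id add.commute)

definition avg :: "real \<Rightarrow> 'a::real_normed_vector \<Rightarrow> ('a \<Rightarrow> real) \<Rightarrow> 'a \<Rightarrow> real" where
  "avg r e F x = (\<integral>\<tau>. F (x + \<tau> *\<^sub>R e) \<partial>lebI (- r) r) / (2 * r)"

primrec avgs :: "real \<Rightarrow> 'a::real_normed_vector list \<Rightarrow> ('a \<Rightarrow> real) \<Rightarrow> 'a \<Rightarrow> real" where
  "avgs r [] F = F"
| "avgs r (e # L) F = avg r e (avgs r L F)"

context
  fixes r :: real assumes r: "r > 0"
begin

lemma line_continuous:
  fixes F :: "'a::real_normed_vector \<Rightarrow> real"
  shows "continuous_on UNIV F \<Longrightarrow> continuous_on X (\<lambda>\<tau>. F (x + \<tau> *\<^sub>R e))"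
  by (rule continuous_on_compose2[of UNIV F]) (auto intro!: continuous_intros)

lemma line_measurable:
  fixes F :: "'a::real_normed_vector \<Rightarrow> real"
  shows "continuous_on UNIV F \<Longrightarrow> (\<lambda>\<tau>. F (x + \<tau> *\<^sub>R e)) \<in> borel_measurable (lebI (- r) r)"
  by (intro borel_measurable_lebI line_continuous)

lemma line_integrable:
  fixes F :: "'a::real_normed_vector \<Rightarrow> real"
  assumes "continuous_on UNIV F" "\<And>x. \<bar>F x\<bar> \<le> C"
  shows "integrable (lebI (- r) r) (\<lambda>\<tau>. F (x + \<tau> *\<^sub>R e))"
  by (rule finite_measure.integrable_const_bound[OF finite_measure_lebI, where B=C])
    (use assms line_measurable in auto)

lemma avg_near:
  fixes F :: "'a::real_normed_vector \<Rightarrow> real"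
  assumes F: "continuous_on UNIV F" "\<And>x. \<bar>F x\<bar> \<le> C"
    and near: "\<And>\<tau>. \<bar>\<tau>\<bar> \<le> r \<Longrightarrow> \<bar>F (x + \<tau> *\<^sub>R e) - c\<bar> \<le> \<eta>"
  shows "\<bar>avg r e F x - c\<bar> \<le> \<eta>"
proof -
  interpret finite_measure "lebI (- r) r" by (rule finite_measure_lebI)
  have m: "measure (lebI (- r) r) {- r..r} = 2 * r" using measure_lebI[of "- r" r] r by simp
  note i = line_integrable[OF F, of x e]
  have "\<bar>\<integral>\<tau>. F (x + \<tau> *\<^sub>R e) - c \<partial>lebI (- r) r\<bar> \<le> (\<integral>\<tau>. \<bar>F (x + \<tau> *\<^sub>R e) - c\<bar> \<partial>lebI (- r) r)"
    by (rule integral_abs_bound)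
  also have "\<dots> \<le> (\<integral>\<tau>. \<eta> \<partial>lebI (- r) r)"
    by (rule integral_mono) (use i near in \<open>auto simp: abs_le_iff\<close>)
  also have "(\<integral>\<tau>. F (x + \<tau> *\<^sub>R e) - c \<partial>lebI (- r) r) = 2 * r * (avg r e F x - c)"
    using i r m by (simp add: avg_def field_simps)
  finally show ?thesis using r m by (simp add: abs_mult)
qed

lemma avg_abs_le:
  fixes F :: "'a::real_normed_vector \<Rightarrow> real"
  assumes F: "continuous_on UNIV F" "\<And>x. \<bar>F x\<bar> \<le> C"
  shows "\<bar>avg r e F x\<bar> \<le> C"
  using avg_near[OF F, of x e 0 C] F(2) by simp

lemma avg_tendsto:
  fixes F :: "nat \<Rightarrow> 'a::real_normed_vector \<Rightarrow> real"
  assumes F: "\<And>k. continuous_on UNIV (F k)" "\<And>k x. \<bar>F k x\<bar> \<le> C" "\<And>\<tau>. (\<lambda>k. F k (X k + \<tau> *\<^sub>R e)) \<longlonglongrightarrow> F' (x + \<tau> *\<^sub>R e)"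
  shows "(\<lambda>k. avg r e (F k) (X k)) \<longlonglongrightarrow> avg r e F' x"
  unfolding avg_def
proof (intro tendsto_divide tendsto_const)
  interpret finite_measure "lebI (- r) r" by (rule finite_measure_lebI)
  show "(\<lambda>k. \<integral>\<tau>. F k (X k + \<tau> *\<^sub>R e) \<partial>lebI (- r) r) \<longlonglongrightarrow> (\<integral>\<tau>. F' (x + \<tau> *\<^sub>R e) \<partial>lebI (- r) r)"
  proof (rule integral_dominated_convergence[where w="\<lambda>_. C"])
    show "(\<lambda>\<tau>. F' (x + \<tau> *\<^sub>R e)) \<in> borel_measurable (lebI (- r) r)"
      by (rule borel_measurable_LIMSEQ_real[OF F(3) line_measurable[OF F(1)]])
  qed (use F line_measurable[OF F(1)] in auto)
qed (use r in auto)

lemma avg_continuous: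
  fixes F :: "'a::real_normed_vector \<Rightarrow> real"
  assumes F: "continuous_on UNIV F" "\<And>x. \<bar>F x\<bar> \<le> C"
  shows "continuous_on UNIV (avg r e F)"
  unfolding continuous_on_sequentially
proof (intro allI ballI impI, elim conjE)
  fix X :: "nat \<Rightarrow> 'a" and x assume X: "X \<longlonglongrightarrow> x"
  have "(\<lambda>k. F (X k + \<tau> *\<^sub>R e)) \<longlonglongrightarrow> F (x + \<tau> *\<^sub>R e)" for \<tau>
  proof -
    have "(\<lambda>k. X k + \<tau> *\<^sub>R e) \<longlonglongrightarrow> x + \<tau> *\<^sub>R e" by (intro tendsto_intros X)
    then show ?thesis using F(1) by (auto simp: continuous_on_sequentially comp_def)
  qed
  then show "(avg r e F \<circ> X) \<longlonglongrightarrow> avg r e F x"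
    unfolding comp_def by (rule avg_tendsto[where F="\<lambda>_. F", OF F])
qed

lemma avgs_regular:
  fixes F :: "'a::real_normed_vector \<Rightarrow> real"
  assumes F: "continuous_on UNIV F" "\<And>x. \<bar>F x\<bar> \<le> C"
  shows "continuous_on UNIV (avgs r L F)" "\<bar>avgs r L F x\<bar> \<le> C"
proof -
  have "continuous_on UNIV (avgs r L F) \<and> (\<forall>x. \<bar>avgs r L F x\<bar> \<le> C)"
  proof (induction L)
    case (Cons e L)
    then show ?case using avg_continuous[of "avgs r L F" C e] avg_abs_le[of "avgs r L F" C e] by simp
  qed (use F in auto)
  then show "continuous_on UNIV (avgs r L F)" "\<bar>avgs r L F x\<bar> \<le> C" by auto
qed

lemma avgs_near:
  fixes F :: "'a::real_normed_vector \<Rightarrow> real"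
  assumes F: "continuous_on UNIV F" "\<And>x. \<bar>F x\<bar> \<le> C" and L: "\<And>e. e \<in> set L \<Longrightarrow> norm e \<le> 1"
    and near: "\<And>w. norm w \<le> real (length L) * r \<Longrightarrow> \<bar>F (x + w) - c\<bar> \<le> \<eta>"
  shows "\<bar>avgs r L F x - c\<bar> \<le> \<eta>"
  using L near
proof (induction L arbitrary: x)
  case Nil
  then show ?case using Nil(2)[of 0] by simp
next
  case (Cons e L)
  show ?case
    unfolding avgs.simps
  proof (rule avg_near[OF avgs_regular[OF F]])
    fix \<tau> assume t: "\<bar>\<tau>\<bar> \<le> r"
    show "\<bar>avgs r L F (x + \<tau> *\<^sub>R e) - c\<bar> \<le> \<eta>"
    proof (rule Cons.IH)
      show "norm e' \<le> 1" if "e' \<in> set L" for e' using Cons.prems(1) that by simp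
      fix w :: 'a assume w: "norm w \<le> real (length L) * r"
      have "norm (\<tau> *\<^sub>R e) \<le> r * 1"
        unfolding norm_scaleR by (intro mult_mono) (use t Cons.prems(1)[of e] r in auto)
      then have "norm (\<tau> *\<^sub>R e + w) \<le> real (length (e # L)) * r"
        using w norm_triangle_ineq[of "\<tau> *\<^sub>R e" w] by (simp add: algebra_simps)
      from Cons.prems(2)[OF this] show "\<bar>F (x + \<tau> *\<^sub>R e + w) - c\<bar> \<le> \<eta>" by (simp add: add.assoc)
    qed
  qed
qed

lemma C2_avg:
  fixes f :: "'a::{real_inner, polish_space} \<Rightarrow> real"
  assumes f: "C2 f g T C"
  shows "\<exists>g' T'. C2 (avg r e f) g' T' C \<and> (\<forall>v x. v \<bullet> g' x = avg r e (\<lambda>x. v \<bullet> g x) x) \<and>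
    (\<forall>u v x. u \<bullet> T' x v = avg r e (\<lambda>x. u \<bullet> T x v) x)"
proof -
  let ?M = "lebI (- r) r"
  note fin = finite_measure_lebI[of "- r" r]
  note sh = C2_shift[OF f]
  note m = line_measurable[OF C2_continuous[OF f], of _ e]
  note ci = C2_integral[OF fin sh m C2_nonneg[OF f]]
  have mm: "measure ?M (space ?M) = 2 * r" using measure_lebI[of "- r" r] r by simp
  define g' where "g' x = (1 / (2 * r)) *\<^sub>R wint ?M (\<lambda>\<tau>. g (x + \<tau> *\<^sub>R e))" for x
  define T' where "T' x v = (1 / (2 * r)) *\<^sub>R wint ?M (\<lambda>\<tau>. T (x + \<tau> *\<^sub>R e) v)" for x v
  have "C2 (\<lambda>x. (1 / (2 * r)) * (\<integral>\<tau>. f (x + \<tau> *\<^sub>R e) \<partial>?M)) g' T' (\<bar>1 / (2 * r)\<bar> * (C * measure ?M (space ?M)))"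
    unfolding g'_def T'_def by (rule C2_scale[OF ci(3)])
  then have 1: "C2 (avg r e f) g' T' C"
    using r mm by (simp add: avg_def[abs_def])
  have 2: "v \<bullet> g' x = avg r e (\<lambda>x. v \<bullet> g x) x" for v x
    using inner_wint[OF fin ci(1) C2_norm[OF f], of v x] by (simp add: g'_def avg_def)
  have Tb: "norm (T y v) \<le> C * norm v" for y v
    using norm_le_hs_norm[OF C2_hs[OF f], of y v] mult_right_mono[OF C2_hs_norm[OF f, of y], of "norm v"] by simp
  have 3: "u \<bullet> T' x v = avg r e (\<lambda>x. u \<bullet> T x v) x" for u v x
    using inner_wint[OF fin ci(2)[of _ x v] Tb, of u] by (simp add: T'_def avg_def)
  show ?thesis using 1 2 3 by blast
qed

lemma C2_avgs:
  fixes f :: "'a::{real_inner, polish_space} \<Rightarrow> real"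
  assumes f: "C2 f g T C"
  shows "\<exists>g' T'. C2 (avgs r L f) g' T' C \<and> (\<forall>v x. v \<bullet> g' x = avgs r L (\<lambda>x. v \<bullet> g x) x) \<and>
    (\<forall>u v x. u \<bullet> T' x v = avgs r L (\<lambda>x. u \<bullet> T x v) x)"
proof (induction L)
  case Nil
  then show ?case using f by auto
next
  case (Cons e L)
  then obtain g1 T1 where 1: "C2 (avgs r L f) g1 T1 C" "\<And>v x. v \<bullet> g1 x = avgs r L (\<lambda>x. v \<bullet> g x) x"
    "\<And>u v x. u \<bullet> T1 x v = avgs r L (\<lambda>x. u \<bullet> T x v) x" by blast
  obtain g2 T2 where 2: "C2 (avg r e (avgs r L f)) g2 T2 C" "\<And>v x. v \<bullet> g2 x = avg r e (\<lambda>x. v \<bullet> g1 x) x"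
    "\<And>u v x. u \<bullet> T2 x v = avg r e (\<lambda>x. u \<bullet> T1 x v) x" using C2_avg[OF 1(1)] by blast
  show ?case
    by (intro exI[of _ g2] exI[of _ T2]) (use 1 2 in auto)
qed

text \<open>
  The directional derivative along \<open>e\<close> of \<open>avgs r L F\<close>, for \<open>e \<in> set L\<close>, written without
  derivatives of \<open>F\<close>: the average along \<open>e\<close> turns the derivative into a difference quotient.
\<close>
primrec dquot :: "'a::real_normed_vector \<Rightarrow> 'a list \<Rightarrow> ('a \<Rightarrow> real) \<Rightarrow> 'a \<Rightarrow> real" where
  "dquot e [] F = (\<lambda>x. 0)"
| "dquot e (e' # L) F = (if e' = e then (\<lambda>x. (avgs r L F (x + r *\<^sub>R e) - avgs r L F (x + (- r) *\<^sub>R e)) / (2 * r))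
     else avg r e' (dquot e L F))"

lemma dquot_eq:
  fixes F :: "'a::real_normed_vector \<Rightarrow> real"
  assumes d: "\<And>L x. ((\<lambda>\<tau>. avgs r L F (x + \<tau> *\<^sub>R e)) has_real_derivative avgs r L F' x) (at 0)"
    and F': "continuous_on UNIV F'" "\<And>x. \<bar>F' x\<bar> \<le> C" and e: "e \<in> set L"
  shows "avgs r L F' = dquot e L F"
  using e
proof (induction L)
  case (Cons e' L)
  show ?case
  proof (cases "e' = e")
    case True
    have "avg r e (avgs r L F') x = (avgs r L F (x + r *\<^sub>R e) - avgs r L F (x + (- r) *\<^sub>R e)) / (2 * r)" for x
    proof -
      have "((\<lambda>\<tau>. avgs r L F (x + \<tau> *\<^sub>R e)) has_real_derivative avgs r L F' (x + \<tau> *\<^sub>R e)) (at \<tau>)" for \<tau>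
      proof -
        have "((\<lambda>\<sigma>. avgs r L F (x + (\<sigma> + \<tau>) *\<^sub>R e)) has_real_derivative avgs r L F' (x + \<tau> *\<^sub>R e)) (at 0)"
          using d[of L "x + \<tau> *\<^sub>R e"] by (simp add: algebra_simps)
        then show ?thesis
          using DERIV_shift[of "\<lambda>\<sigma>. avgs r L F (x + \<sigma> *\<^sub>R e)" "avgs r L F' (x + \<tau> *\<^sub>R e)" 0 \<tau>] by simp
      qed
      then have "((\<lambda>\<tau>. avgs r L F' (x + \<tau> *\<^sub>R e)) has_integral
          (avgs r L F (x + r *\<^sub>R e) - avgs r L F (x + (- r) *\<^sub>R e))) {- r..r}"
        using r by (intro fundamental_theorem_of_calculus)
          (auto simp: has_real_derivative_iff_has_vector_derivative[symmetric] intro: DERIV_subset)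
      then show ?thesis
        unfolding avg_def
        by (subst integral_lebI) (auto intro!: line_continuous avgs_regular[OF F'] simp: integral_unique)
    qed
    then show ?thesis using True by (simp add: fun_eq_iff)
  qed (use Cons in auto)
qed simp

lemma dquot_regular:
  fixes F :: "'a::real_normed_vector \<Rightarrow> real"
  assumes F: "continuous_on UNIV F" "\<And>x. \<bar>F x\<bar> \<le> C"
  shows "continuous_on UNIV (dquot e L F)" "\<bar>dquot e L F x\<bar> \<le> C / r"
proof -
  have C: "0 \<le> C" using F(2)[of 0] by simp
  have "continuous_on UNIV (dquot e L F) \<and> (\<forall>x. \<bar>dquot e L F x\<bar> \<le> C / r)"
  proof (induction L)
    case (Cons e' L)
    show ?case
    proof (cases "e' = e")
      case True
      have c: "continuous_on UNIV (\<lambda>x. avgs r L F (x + v))" for v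
        by (rule continuous_on_compose2[OF avgs_regular(1)[OF F]]) (auto intro!: continuous_intros)
      have "\<bar>(avgs r L F y - avgs r L F z) / (2 * r)\<bar> \<le> C / r" for y z
      proof -
        have "\<bar>avgs r L F y - avgs r L F z\<bar> \<le> 2 * C"
          using avgs_regular(2)[OF F, of L y] avgs_regular(2)[OF F, of L z] by linarith
        then show ?thesis using r by (simp add: abs_mult field_simps)
      qed
      then have "\<forall>x. \<bar>dquot e (e' # L) F x\<bar> \<le> C / r" using True by simp
      moreover have "continuous_on UNIV (dquot e (e' # L) F)"
        unfolding dquot.simps if_P[OF True] by (intro continuous_intros c) (use r in auto)
      ultimately show ?thesis by blast
    next
      case False
      then show ?thesis
        using Cons avg_continuous[of "dquot e L F" "C / r" e'] avg_abs_le[of "dquot e L F" "C / r" e'] by simp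
    qed
  qed (use C r in auto)
  then show "continuous_on UNIV (dquot e L F)" "\<bar>dquot e L F x\<bar> \<le> C / r" by auto
qed

lemma avgs_tendsto:
  fixes F :: "nat \<Rightarrow> 'a::real_normed_vector \<Rightarrow> real"
  assumes F: "\<And>k. continuous_on UNIV (F k)" "\<And>k x. \<bar>F k x\<bar> \<le> C" "\<And>x. (\<lambda>k. F k x) \<longlonglongrightarrow> F' x"
  shows "(\<lambda>k. avgs r L (F k) x) \<longlonglongrightarrow> avgs r L F' x"
proof (induction L arbitrary: x)
  case (Cons e L)
  show ?case unfolding avgs.simps
    by (rule avg_tendsto[OF avgs_regular[OF F(1,2)] Cons])
qed (simp add: F)

lemma dquot_tendsto:
  fixes F :: "nat \<Rightarrow> 'a::real_normed_vector \<Rightarrow> real"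
  assumes F: "\<And>k. continuous_on UNIV (F k)" "\<And>k x. \<bar>F k x\<bar> \<le> C" "\<And>x. (\<lambda>k. F k x) \<longlonglongrightarrow> F' x"
  shows "(\<lambda>k. dquot e L (F k) x) \<longlonglongrightarrow> dquot e L F' x"
proof (induction L arbitrary: x)
  case (Cons e' L)
  show ?case
  proof (cases "e' = e")
    case True
    then show ?thesis using r by (auto intro!: tendsto_intros avgs_tendsto[OF F])
  next
    case False
    then show ?thesis using avg_tendsto[OF dquot_regular[OF F(1,2)] Cons] by simp
  qed
qed simp

end

lemma avg_trig:
  fixes f :: "'a::{real_inner, polish_space} \<Rightarrow> real"
  assumes r: "r > 0" and f: "f \<in> trig V"
  shows "avg r e f \<in> trig V"
  using f
proof (induction rule: trig_induct)
  case zero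
  have "(\<lambda>x. 0) \<in> trig V" unfolding trig_def by (rule fun_span_zero)
  then show ?case by (simp add: avg_def[abs_def])
next
  case (cons b h c f)
  define I1 I2 where "I1 = (\<integral>\<tau>. cos (\<tau> * (e \<bullet> h)) \<partial>lebI (- r) r)" and "I2 = (\<integral>\<tau>. sin (\<tau> * (e \<bullet> h)) \<partial>lebI (- r) r)"
  have i: "integrable (lebI (- r) r) (\<lambda>\<tau>. cos (\<tau> * (e \<bullet> h)))" "integrable (lebI (- r) r) (\<lambda>\<tau>. sin (\<tau> * (e \<bullet> h)))"
    by (auto intro!: finite_measure.integrable_const_bound[OF finite_measure_lebI, where B=1]
        borel_measurable_lebI continuous_intros)
  obtain C where C: "\<And>x. norm (f x) \<le> C" using bcontfun_bound[OF trig_bcontfun[OF cons(2)]] by blast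
  have fi: "integrable (lebI (- r) r) (\<lambda>\<tau>. f (x + \<tau> *\<^sub>R e))" for x
    by (rule line_integrable[OF r bcontfun_continuous[OF trig_bcontfun[OF cons(2)]]]) (use C in auto)
  have "avg r e (\<lambda>x. b * wave h c x + f x) x =
      (b * I1 / (2 * r)) * wave h c x + ((b * I2 / (2 * r)) * wave h (c + pi / 2) x + avg r e f x)" for x
  proof -
    have "b * wave h c (x + \<tau> *\<^sub>R e) + f (x + \<tau> *\<^sub>R e) =
       b * wave h c x * cos (\<tau> * (e \<bullet> h)) + (b * wave h (c + pi / 2) x * sin (\<tau> * (e \<bullet> h)) + f (x + \<tau> *\<^sub>R e))" for \<tau>
    proof -
      have "wave h c (x + \<tau> *\<^sub>R e) = cos ((x \<bullet> h + c) + \<tau> * (e \<bullet> h))" by (simp add: wave_def inner_add_left algebra_simps)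
      also have "\<dots> = cos (x \<bullet> h + c) * cos (\<tau> * (e \<bullet> h)) - sin (x \<bullet> h + c) * sin (\<tau> * (e \<bullet> h))" by (rule cos_add)
      also have "sin (x \<bullet> h + c) = - wave h (c + pi / 2) x"
        using cos_add[of "x \<bullet> h + c" "pi / 2"] by (simp add: wave_def add.assoc)
      finally show ?thesis by (simp add: wave_def algebra_simps)
    qed
    then have "(\<integral>\<tau>. b * wave h c (x + \<tau> *\<^sub>R e) + f (x + \<tau> *\<^sub>R e) \<partial>lebI (- r) r) =
        b * wave h c x * I1 + (b * wave h (c + pi / 2) x * I2 + (\<integral>\<tau>. f (x + \<tau> *\<^sub>R e) \<partial>lebI (- r) r))"
      using i fi[of x] by (simp add: I1_def I2_def)
    then show ?thesis using r by (simp add: avg_def field_simps)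
  qed
  then have "avg r e (\<lambda>x. b * wave h c x + f x) =
    (\<lambda>x. (b * I1 / (2 * r)) * wave h c x + ((b * I2 / (2 * r)) * wave h (c + pi / 2) x + avg r e f x))" by blast
  also have "\<dots> \<in> trig V" by (intro trig_add trig_scale trig_wave cons)
  finally show ?case .
qed

lemma avgs_trig:
  fixes f :: "'a::{real_inner, polish_space} \<Rightarrow> real"
  assumes "r > 0" "f \<in> trig V" shows "avgs r L f \<in> trig V"
  by (induction L) (use assms avg_trig in auto)

lemma C2_unique:
  assumes "C2 f g T C" "C2 f g' T' C'" shows "g = g'" "T = T'"
  using C2_grad[OF assms(1)] C2_grad[OF assms(2)] C2_hess[OF assms(1)] C2_hess[OF assms(2)] by auto

lemma hs_sum:
  fixes T :: "'b \<Rightarrow> 'a::{real_inner, polish_space} \<Rightarrow> 'a"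
  assumes "finite I" "\<And>i. i \<in> I \<Longrightarrow> hilbert_schmidt (T i)" "\<And>i. i \<in> I \<Longrightarrow> hs_norm (T i) \<le> c"
  shows "hilbert_schmidt (\<lambda>v. \<Sum>i\<in>I. T i v)" "hs_norm (\<lambda>v. \<Sum>i\<in>I. T i v) \<le> real (card I) * c"
proof -
  have z: "hs_norm (\<lambda>v. 0 :: 'a) \<le> 0" using hs_rank_one(2)[of 0 "0::'a"] by simp
  have "hilbert_schmidt (\<lambda>v. \<Sum>i\<in>I. T i v) \<and> hs_norm (\<lambda>v. \<Sum>i\<in>I. T i v) \<le> real (card I) * c"
    using assms
  proof (induction I rule: finite_induct)
    case (insert i I)
    then show ?case
      using hs_add[of "T i" "\<lambda>v. \<Sum>i\<in>I. T i v"] by (fastforce simp: algebra_simps)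
  qed (simp add: hs_zero z)
  then show "hilbert_schmidt (\<lambda>v. \<Sum>i\<in>I. T i v)" "hs_norm (\<lambda>v. \<Sum>i\<in>I. T i v) \<le> real (card I) * c" by auto
qed

context
  fixes e :: "nat \<Rightarrow> 'a::{real_inner, polish_space}"
  assumes e: "onb_seq e"
begin

lemma adjoint_proj: "adjoint (proj e n) = proj e n"
  by (rule adjoint_unique) (simp add: inner_proj_left[OF e])

lemma C2_proj:
  fixes f :: "'a \<Rightarrow> real"
  assumes "C2 f g T C"
  shows "C2 (\<lambda>x. f (proj e n x)) (\<lambda>x. proj e n (g (proj e n x))) (\<lambda>x v. proj e n (T (proj e n x) (proj e n v))) C"
  using C2_affine[OF assms bounded_linear_proj, of e n 1 0] onb_norm_proj_le[OF e] by (simp add: adjoint_proj)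

lemma avgs_proj:
  assumes r: "r > 0" and inv: "\<And>x. F (proj e n x) = F x"
  shows "avgs r L F (proj e n x) = avgs r L F x"
proof (induction L arbitrary: x)
  case (Cons d L)
  have "avgs r L F (proj e n x + \<tau> *\<^sub>R d) = avgs r L F (x + \<tau> *\<^sub>R d)" for \<tau>
  proof -
    have "proj e n (proj e n x + \<tau> *\<^sub>R d) = proj e n (x + \<tau> *\<^sub>R d)"
      using bounded_linear.linear[OF bounded_linear_proj[of e n]]
      by (simp add: linear_add linear_scale proj_proj[OF e])
    then show ?thesis using Cons[of "proj e n x + \<tau> *\<^sub>R d"] Cons[of "x + \<tau> *\<^sub>R d"] by simp
  qed
  then show ?case by (simp add: avg_def)
qed (simp add: inv)

lemma cylinder_expansion:
  fixes f :: "'a \<Rightarrow> real"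
  assumes f: "C2 f g T C" and inv: "\<And>x. f (proj e n x) = f x"
  shows "g x = (\<Sum>i<n. (e i \<bullet> g x) *\<^sub>R e i)"
    and "T x v = (\<Sum>i<n. \<Sum>j<n. ((v \<bullet> e j) * (e i \<bullet> T x (e j))) *\<^sub>R e i)"
proof -
  let ?P = "proj e n"
  interpret P: bounded_linear ?P by (rule bounded_linear_proj)
  have "C2 f (\<lambda>x. ?P (g (?P x))) (\<lambda>x v. ?P (T (?P x) (?P v))) C"
    using C2_proj[OF f, of n] inv by simp
  from C2_unique[OF f this] have g: "g x = ?P (g (?P x))" and T: "T x v = ?P (T (?P x) (?P v))" for x v
    by metis+
  interpret T: bounded_linear "T x" by (rule hs_bounded_linear[OF C2_hs[OF f]])
  have "?P (g x) = g x" by (subst (1 2) g) (rule proj_proj[OF e])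
  then show "g x = (\<Sum>i<n. (e i \<bullet> g x) *\<^sub>R e i)" by (simp add: proj_def inner_commute)
  have 1: "?P (T x v) = T x v" by (subst (1 2) T) (rule proj_proj[OF e])
  have 2: "T x v = T x (?P v)" by (subst (1 2) T) (simp add: proj_proj[OF e])
  have "T x v = ?P (T x (?P v))" using 1 2 by simp
  also have "T x (?P v) = (\<Sum>j<n. (v \<bullet> e j) *\<^sub>R T x (e j))" by (simp add: proj_def T.sum T.scaleR)
  also have "?P \<dots> = (\<Sum>j<n. (v \<bullet> e j) *\<^sub>R (\<Sum>i<n. (e i \<bullet> T x (e j)) *\<^sub>R e i))"
    by (simp add: P.sum P.scaleR) (simp add: proj_def inner_commute)
  also have "\<dots> = (\<Sum>i<n. \<Sum>j<n. ((v \<bullet> e j) * (e i \<bullet> T x (e j))) *\<^sub>R e i)"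
    unfolding scaleR_sum_right by (subst sum.swap) simp
  finally show "T x v = (\<Sum>i<n. \<Sum>j<n. ((v \<bullet> e j) * (e i \<bullet> T x (e j))) *\<^sub>R e i)" .
qed

lemma cylinder_inner:
  fixes f :: "'a \<Rightarrow> real"
  assumes f: "C2 f g T C" and inv: "\<And>x. f (proj e n x) = f x"
  shows "u \<bullet> g x = (\<Sum>i<n. (e i \<bullet> g x) * (u \<bullet> e i))"
    and "u \<bullet> T x v = (\<Sum>i<n. \<Sum>j<n. ((v \<bullet> e j) * (e i \<bullet> T x (e j))) * (u \<bullet> e i))"
  using arg_cong[OF cylinder_expansion(1)[OF f inv, of x], of "inner u"]
    arg_cong[OF cylinder_expansion(2)[OF f inv, of x v], of "inner u"]
  by (simp_all only: inner_sum_right inner_scaleR_right)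

lemma cylinder_bound:
  fixes f :: "'a \<Rightarrow> real"
  assumes f: "C2 f g T C" and inv: "\<And>x. f (proj e n x) = f x" and B: "\<And>x. \<bar>f x\<bar> \<le> B"
    and K1: "\<And>i x. i < n \<Longrightarrow> \<bar>e i \<bullet> g x\<bar> \<le> K1" and K2: "\<And>i j x. i < n \<Longrightarrow> j < n \<Longrightarrow> \<bar>e i \<bullet> T x (e j)\<bar> \<le> K2"
  shows "C2 f g T (max B (max (real n * K1) (real n * (real n * K2))))"
proof (rule C2_bound[OF f])
  fix x
  show "\<bar>f x\<bar> \<le> max B (max (real n * K1) (real n * (real n * K2)))" using B[of x] by simp
  have "norm (\<Sum>i<n. (e i \<bullet> g x) *\<^sub>R e i) \<le> (\<Sum>i<n. K1)"
  proof (rule sum_norm_le)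
    fix i assume i: "i \<in> {..<n}"
    have "\<bar>e i \<bullet> g x\<bar> * norm (e i) \<le> \<bar>e i \<bullet> g x\<bar> * 1" by (intro mult_left_mono onb_norm_le[OF e]) simp
    then show "norm ((e i \<bullet> g x) *\<^sub>R e i) \<le> K1" using K1[of i x] i by simp
  qed
  then have "norm (g x) \<le> real n * K1"
    using arg_cong[OF cylinder_expansion(1)[OF f inv, of x], of norm] by simp
  then show "norm (g x) \<le> max B (max (real n * K1) (real n * (real n * K2)))" by simp
  have h: "hilbert_schmidt (\<lambda>v. ((v \<bullet> e j) * (e i \<bullet> T x (e j))) *\<^sub>R e i)"
    "hs_norm (\<lambda>v. ((v \<bullet> e j) * (e i \<bullet> T x (e j))) *\<^sub>R e i) \<le> K2" if "i < n" "j < n" for i j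
  proof -
    note r = hs_rank_one[of "e j" "(e i \<bullet> T x (e j)) *\<^sub>R e i"]
    show "hilbert_schmidt (\<lambda>v. ((v \<bullet> e j) * (e i \<bullet> T x (e j))) *\<^sub>R e i)" using r(1) by simp
    have "norm (e j) * norm ((e i \<bullet> T x (e j)) *\<^sub>R e i) \<le> 1 * (K2 * 1)"
      unfolding norm_scaleR
      by (intro mult_mono onb_norm_le[OF e]) (use K2[OF that, of x] in auto)
    then show "hs_norm (\<lambda>v. ((v \<bullet> e j) * (e i \<bullet> T x (e j))) *\<^sub>R e i) \<le> K2" using r(2) by simp
  qed
  have "hs_norm (\<lambda>v. \<Sum>i<n. \<Sum>j<n. ((v \<bullet> e j) * (e i \<bullet> T x (e j))) *\<^sub>R e i) \<le> real (card {..<n}) * (real (card {..<n}) * K2)"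
  proof (rule hs_sum)
    fix i assume i: "i \<in> {..<n}"
    show "hilbert_schmidt (\<lambda>v. \<Sum>j<n. ((v \<bullet> e j) * (e i \<bullet> T x (e j))) *\<^sub>R e i)"
      by (rule hs_sum(1)[where c=K2]) (use h i in auto)
    show "hs_norm (\<lambda>v. \<Sum>j<n. ((v \<bullet> e j) * (e i \<bullet> T x (e j))) *\<^sub>R e i) \<le> real (card {..<n}) * K2"
      by (rule hs_sum(2)) (use h i in auto)
  qed simp
  moreover have "T x = (\<lambda>v. \<Sum>i<n. \<Sum>j<n. ((v \<bullet> e j) * (e i \<bullet> T x (e j))) *\<^sub>R e i)"
    by (rule ext) (rule cylinder_expansion(2)[OF f inv])
  ultimately have "hs_norm (T x) \<le> real n * (real n * K2)" by simp
  then show "hs_norm (T x) \<le> max B (max (real n * K1) (real n * (real n * K2)))" by simp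
qed

end

context ou_data
begin

lemma dynkin_cylinder:
  assumes e: "onb_seq e" and f: "C2 f g T C" and inv: "\<And>x. f (proj e n x) = f x"
  shows "dynkin f"
proof -
  let ?P = "proj e n"
  define L where "L = map e [0..<n]"
  have L: "e i \<in> set L" if "i < n" for i using that by (auto simp: L_def)
  have nL: "norm d \<le> 1" if "d \<in> set (L @ L)" for d using that onb_norm_le[OF e] by (auto simp: L_def)
  have "closure (UNIV :: 'a set) = UNIV" by simp
  then obtain g0 where g0: "\<And>k. g0 k \<in> trig UNIV" "\<And>k x. \<bar>g0 k x\<bar> \<le> C + 1" "\<And>x. (\<lambda>k. g0 k x) \<longlonglongrightarrow> f x"
    using trig_approx[OF subspace_UNIV _ C2_continuous[OF f] C2_abs[OF f]] by blast
  define F where "F k x = g0 k (?P x)" for k x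
  have F_trig: "F k \<in> trig UNIV" for k
  proof -
    have "(\<lambda>x. h (?P x)) \<in> trig UNIV" if "h \<in> trig UNIV" for h
      using that
    proof (induction rule: trig_induct)
      case zero
      show ?case using trig_const[of UNIV 0] by simp
    next
      case (cons b h c h')
      have "wave h c (?P x) = wave (?P h) c x" for x by (simp add: wave_def inner_proj_left[OF e])
      then show ?case by (auto intro!: trig_add trig_scale trig_wave cons)
    qed
    then show ?thesis unfolding F_def[abs_def] using g0(1) by blast
  qed
  have F_bd: "\<bar>F k x\<bar> \<le> C + 1" for k x using g0(2) by (simp add: F_def)
  have F_lim: "(\<lambda>k. F k x) \<longlonglongrightarrow> f x" for x using g0(3)[of "?P x"] by (simp add: F_def inv)
  have F_inv: "F k (?P x) = F k x" for k x by (simp add: F_def proj_proj[OF e])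
  have F_cont: "continuous_on UNIV (F k)" for k
    by (rule bcontfun_continuous[OF trig_bcontfun[OF F_trig]])
  have "dynkin (avgs r (L @ L) f)" if r: "r > 0" for r
  proof -
    text \<open>Derivatives of the twice averaged function are iterated difference quotients of averages.\<close>
    have main: "\<exists>G W. C2 (avgs r L (avgs r L f)) G W C \<and>
        (\<forall>i<n. \<forall>x. e i \<bullet> G x = dquot r (e i) L (avgs r L f) x) \<and>
        (\<forall>i<n. \<forall>j<n. \<forall>x. e i \<bullet> W x (e j) = dquot r (e j) L (dquot r (e i) L f) x)"
      if f: "C2 f g T C" for f :: "'a \<Rightarrow> real" and g T C
    proof -
      have D1: "((\<lambda>\<tau>. f (x + \<tau> *\<^sub>R v)) has_real_derivative v \<bullet> g x) (at 0)" if "C2 f g T C" for f :: "'a \<Rightarrow> real" and g T C x and v :: 'a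
      proof -
        have "((\<lambda>\<tau>. f (x + \<tau> *\<^sub>R v)) has_derivative (\<lambda>t. (t *\<^sub>R v) \<bullet> g x)) (at 0)"
          by (rule has_derivative_compose[where g=f and f="\<lambda>t. x + t *\<^sub>R v"])
            (use C2_has_derivative[OF that, of x] in \<open>auto intro!: derivative_eq_intros\<close>)
        moreover have "(\<lambda>t. (t *\<^sub>R v) \<bullet> g x) = (*) (v \<bullet> g x)" by auto
        ultimately show ?thesis by (simp only: has_field_derivative_def)
      qed
      have D2: "((\<lambda>\<tau>. u \<bullet> g (x + \<tau> *\<^sub>R v)) has_real_derivative u \<bullet> T x v) (at 0)" if "C2 f g T C" for f :: "'a \<Rightarrow> real" and g T C x and u v :: 'a
      proof -
        interpret T: bounded_linear "T x" by (rule hs_bounded_linear[OF C2_hs[OF that]])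
        have "((\<lambda>\<tau>. g (x + \<tau> *\<^sub>R v)) has_derivative (\<lambda>t. T x (t *\<^sub>R v))) (at 0)"
          by (rule has_derivative_compose[where g=g and f="\<lambda>t. x + t *\<^sub>R v"])
            (use C2_deriv[OF that, of x] in \<open>auto intro!: derivative_eq_intros\<close>)
        then have "((\<lambda>\<tau>. u \<bullet> g (x + \<tau> *\<^sub>R v)) has_derivative (\<lambda>t. u \<bullet> T x (t *\<^sub>R v))) (at 0)"
          by (rule has_derivative_inner_right)
        moreover have "(\<lambda>t. u \<bullet> T x (t *\<^sub>R v)) = (*) (u \<bullet> T x v)" by (auto simp: T.scaleR)
        ultimately show ?thesis by (simp only: has_field_derivative_def)
      qed
      have reg1: "continuous_on UNIV (\<lambda>x. v \<bullet> g x)" "\<bar>v \<bullet> g x\<bar> \<le> norm v * C" if "C2 f g T C" for f :: "'a \<Rightarrow> real" and g T C and v x :: 'a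
        by (auto intro!: continuous_intros C2_grad_continuous[OF that]
            order_trans[OF Cauchy_Schwarz_ineq2 mult_left_mono[OF C2_norm[OF that]]])
      have reg2: "continuous_on UNIV (\<lambda>x. u \<bullet> T x v)" "\<bar>u \<bullet> T x v\<bar> \<le> norm u * (C * norm v)" if "C2 f g T C" for f :: "'a \<Rightarrow> real" and g T C and u v x :: 'a
      proof -
        show "continuous_on UNIV (\<lambda>x. u \<bullet> T x v)"
          unfolding continuous_on_sequentially comp_def
          by (auto intro!: tendsto_intros C2_hess_tendsto[OF that])
        have "norm (T x v) \<le> C * norm v"
          using norm_le_hs_norm[OF C2_hs[OF that], of x v] mult_right_mono[OF C2_hs_norm[OF that, of x], of "norm v"] by simp
        then show "\<bar>u \<bullet> T x v\<bar> \<le> norm u * (C * norm v)"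
          by (intro order_trans[OF Cauchy_Schwarz_ineq2 mult_left_mono]) auto
      qed
      have d1: "avgs r L (\<lambda>x. d \<bullet> g x) = dquot r d L f" if f: "C2 f g T C" and d: "d \<in> set L" for f :: "'a \<Rightarrow> real" and g T C d
      proof (rule dquot_eq[OF r _ reg1[OF f] d])
        fix L x
        obtain g' T' where "C2 (avgs r L f) g' T' C" "\<And>v x. v \<bullet> g' x = avgs r L (\<lambda>x. v \<bullet> g x) x"
          using C2_avgs[OF r f] by blast
        then show "((\<lambda>\<tau>. avgs r L f (x + \<tau> *\<^sub>R d)) has_real_derivative avgs r L (\<lambda>x. d \<bullet> g x) x) (at 0)"
          using D1 by metis
      qed
      have d2: "avgs r L (\<lambda>x. u \<bullet> T x d) = dquot r d L (\<lambda>x. u \<bullet> g x)" if f: "C2 f g T C" and d: "d \<in> set L" for f :: "'a \<Rightarrow> real" and g T C u d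
      proof (rule dquot_eq[OF r _ reg2[OF f] d])
        fix L x
        obtain g' T' where *: "C2 (avgs r L f) g' T' C" "\<And>v x. v \<bullet> g' x = avgs r L (\<lambda>x. v \<bullet> g x) x"
          "\<And>u v x. u \<bullet> T' x v = avgs r L (\<lambda>x. u \<bullet> T x v) x"
          using C2_avgs[OF r f] by blast
        show "((\<lambda>\<tau>. avgs r L (\<lambda>x. u \<bullet> g x) (x + \<tau> *\<^sub>R d)) has_real_derivative avgs r L (\<lambda>x. u \<bullet> T x d) x) (at 0)"
          using D2[OF *(1), of u x d] by (simp add: *(2,3))
      qed
      obtain g1 T1 where 1: "C2 (avgs r L f) g1 T1 C" "\<And>v x. v \<bullet> g1 x = avgs r L (\<lambda>x. v \<bullet> g x) x"
        using C2_avgs[OF r f] by blast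
      obtain g2 T2 where 2: "C2 (avgs r L (avgs r L f)) g2 T2 C" "\<And>v x. v \<bullet> g2 x = avgs r L (\<lambda>x. v \<bullet> g1 x) x"
        "\<And>u v x. u \<bullet> T2 x v = avgs r L (\<lambda>x. u \<bullet> T1 x v) x"
        using C2_avgs[OF r 1(1)] by blast
      have "(\<lambda>x. e i \<bullet> g1 x) = dquot r (e i) L f" if "i < n" for i
        using d1[OF f L[OF that]] 1(2) by (simp add: fun_eq_iff)
      then have "e i \<bullet> T2 x (e j) = dquot r (e j) L (dquot r (e i) L f) x" if "i < n" "j < n" for i j x
        using d2[OF 1(1) L[OF that(2)], of "e i"] that by (simp add: 2(3))
      moreover have "e i \<bullet> g2 x = dquot r (e i) L (avgs r L f) x" if "i < n" for i x
        using d1[OF 1(1) L[OF that]] by (simp add: 2(2))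
      ultimately show ?thesis using 2(1) by blast
    qed
    have app: "avgs r (L @ L) h = avgs r L (avgs r L h)" for h
    proof -
      have "avgs r (L1 @ L2) h = avgs r L1 (avgs r L2 h)" for L1 L2 by (induction L1) auto
      then show ?thesis by blast
    qed
    have "\<forall>k. \<exists>G W D. C2 (avgs r L (avgs r L (F k))) G W D \<and>
        (\<forall>i<n. \<forall>x. e i \<bullet> G x = dquot r (e i) L (avgs r L (F k)) x) \<and>
        (\<forall>i<n. \<forall>j<n. \<forall>x. e i \<bullet> W x (e j) = dquot r (e j) L (dquot r (e i) L (F k)) x)"
      using main trig_C2[OF F_trig] by meson
    then obtain G W D where GW: "\<And>k. C2 (avgs r L (avgs r L (F k))) (G k) (W k) (D k)"
      "\<And>k i x. i < n \<Longrightarrow> e i \<bullet> G k x = dquot r (e i) L (avgs r L (F k)) x"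
      "\<And>k i j x. i < n \<Longrightarrow> j < n \<Longrightarrow> e i \<bullet> W k x (e j) = dquot r (e j) L (dquot r (e i) L (F k)) x"
      by metis
    obtain G' W' where GW': "C2 (avgs r L (avgs r L f)) G' W' C"
      "\<And>i x. i < n \<Longrightarrow> e i \<bullet> G' x = dquot r (e i) L (avgs r L f) x"
      "\<And>i j x. i < n \<Longrightarrow> j < n \<Longrightarrow> e i \<bullet> W' x (e j) = dquot r (e j) L (dquot r (e i) L f) x"
      using main[OF f] by blast
    note A = avgs_regular[OF r F_cont F_bd] and Dq = dquot_regular[OF r F_cont F_bd]
    note lA = avgs_tendsto[OF r F_cont F_bd F_lim] and lD = dquot_tendsto[OF r F_cont F_bd F_lim]
    have ainv: "avgs r L (avgs r L (F k)) (?P x) = avgs r L (avgs r L (F k)) x"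
      "avgs r L (avgs r L f) (?P x) = avgs r L (avgs r L f) x" for k x
      by (intro avgs_proj[OF e r] F_inv inv)+
    have bdd: "C2 (avgs r L (avgs r L (F k))) (G k) (W k) (max (C + 1) (max (real n * ((C + 1) / r)) (real n * (real n * ((C + 1) / r / r)))))" for k
      by (rule cylinder_bound[OF e GW(1) ainv(1)])
        (simp_all add: GW(2,3) avgs_regular(2)[OF r A] dquot_regular(2)[OF r A] dquot_regular(2)[OF r Dq] del: divide_divide_eq_left)
    have "dynkin (avgs r L (avgs r L f))"
    proof (rule dynkin_closed[OF bdd _ GW'(1)])
      show "dynkin (avgs r L (avgs r L (F k)))" for k
        using dynkin_trig[OF avgs_trig[OF r avgs_trig[OF r F_trig]]] by blast
      show "(\<lambda>k. avgs r L (avgs r L (F k)) x) \<longlonglongrightarrow> avgs r L (avgs r L f) x" for x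
        by (rule avgs_tendsto[OF r A lA])
      have l1: "(\<lambda>k. e i \<bullet> G k x) \<longlonglongrightarrow> e i \<bullet> G' x" if "i < n" for i x
        unfolding GW(2)[OF that] GW'(2)[OF that] by (rule dquot_tendsto[OF r A lA])
      have l2: "(\<lambda>k. e i \<bullet> W k x (e j)) \<longlonglongrightarrow> e i \<bullet> W' x (e j)" if "i < n" "j < n" for i j x
        unfolding GW(3)[OF that] GW'(3)[OF that] by (rule dquot_tendsto[OF r Dq lD])
      show "(\<lambda>k. v \<bullet> G k x) \<longlonglongrightarrow> v \<bullet> G' x" for v x
        unfolding cylinder_inner(1)[OF e GW(1) ainv(1), of v _ x] cylinder_inner(1)[OF e GW'(1) ainv(2), of v x]
        by (intro tendsto_sum tendsto_mult tendsto_const l1) auto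
      show "(\<lambda>k. u \<bullet> W k x v) \<longlonglongrightarrow> u \<bullet> W' x v" for u v x
        unfolding cylinder_inner(2)[OF e GW(1) ainv(1), of u _ x v] cylinder_inner(2)[OF e GW'(1) ainv(2), of u x v]
        by (intro tendsto_sum tendsto_mult tendsto_const l2) auto
    qed
    then show ?thesis by (simp add: app)
  qed
  then have dyn: "dynkin (avgs (1 / real (Suc k)) (L @ L) f)" for k by simp
  have ex: "\<forall>k. \<exists>G W. C2 (avgs (1 / real (Suc k)) (L @ L) f) G W C \<and>
      (\<forall>v x. v \<bullet> G x = avgs (1 / real (Suc k)) (L @ L) (\<lambda>x. v \<bullet> g x) x) \<and>
      (\<forall>u v x. u \<bullet> W x v = avgs (1 / real (Suc k)) (L @ L) (\<lambda>x. u \<bullet> T x v) x)"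
    using C2_avgs[OF _ f] by simp
  then obtain G W where GW: "\<And>k. C2 (avgs (1 / real (Suc k)) (L @ L) f) (G k) (W k) C"
      "\<And>k v x. v \<bullet> G k x = avgs (1 / real (Suc k)) (L @ L) (\<lambda>x. v \<bullet> g x) x"
      "\<And>k u v x. u \<bullet> W k x v = avgs (1 / real (Suc k)) (L @ L) (\<lambda>x. u \<bullet> T x v) x"
    by metis
  have lim: "(\<lambda>k. avgs (1 / real (Suc k)) (L @ L) h x) \<longlonglongrightarrow> h x"
    if h: "continuous_on UNIV h" "\<And>x. \<bar>h x\<bar> \<le> B" for h x B
  proof (rule tendstoI)
    fix \<eta> :: real assume \<eta>: "\<eta> > 0"
    have "isCont h x" using h(1) by (simp add: continuous_on_eq_continuous_at)
    then obtain d where d: "d > 0" "\<And>y. dist y x < d \<Longrightarrow> dist (h y) (h x) < \<eta> / 2"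
      using \<eta> unfolding continuous_at_eps_delta by (metis half_gt_zero)
    have "(\<lambda>k. real (length (L @ L)) * (1 / real (Suc k))) \<longlonglongrightarrow> 0"
      using tendsto_mult_right_zero[OF LIMSEQ_inverse_real_of_nat] by (simp add: inverse_eq_divide)
    then have "\<forall>\<^sub>F k in sequentially. real (length (L @ L)) * (1 / real (Suc k)) < d" using d(1) by (rule order_tendstoD)
    then show "\<forall>\<^sub>F k in sequentially. dist (avgs (1 / real (Suc k)) (L @ L) h x) (h x) < \<eta>"
    proof (rule eventually_mono)
      fix k assume k: "real (length (L @ L)) * (1 / real (Suc k)) < d"
      have "\<bar>avgs (1 / real (Suc k)) (L @ L) h x - h x\<bar> \<le> \<eta> / 2"
      proof (rule avgs_near[OF _ h nL])
        fix w :: 'a assume "norm w \<le> real (length (L @ L)) * (1 / real (Suc k))"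
        then have "dist (x + w) x < d" using k by (simp add: dist_norm)
        from d(2)[OF this] show "\<bar>h (x + w) - h x\<bar> \<le> \<eta> / 2" by (simp add: dist_real_def)
      qed simp
      then show "dist (avgs (1 / real (Suc k)) (L @ L) h x) (h x) < \<eta>" using \<eta> by (simp add: dist_real_def)
    qed
  qed
  show ?thesis
  proof (rule dynkin_closed[OF GW(1) dyn f])
    show "(\<lambda>k. avgs (1 / real (Suc k)) (L @ L) f x) \<longlonglongrightarrow> f x" for x
      by (rule lim[OF C2_continuous[OF f] C2_abs[OF f]])
    show "(\<lambda>k. v \<bullet> G k x) \<longlonglongrightarrow> v \<bullet> g x" for v x
      unfolding GW(2)
      by (rule lim[where B="norm v * C"])
        (auto intro!: continuous_intros C2_grad_continuous[OF f]
            order_trans[OF Cauchy_Schwarz_ineq2 mult_left_mono[OF C2_norm[OF f]]])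
    show "(\<lambda>k. u \<bullet> W k x v) \<longlonglongrightarrow> u \<bullet> T x v" for u v x
      unfolding GW(3)
    proof (rule lim[where B="norm u * (C * norm v)"])
      show "continuous_on UNIV (\<lambda>x. u \<bullet> T x v)"
        unfolding continuous_on_sequentially comp_def
        by (auto intro!: tendsto_intros C2_hess_tendsto[OF f])
      have "norm (T x v) \<le> C * norm v" for x
        using norm_le_hs_norm[OF C2_hs[OF f], of x v] mult_right_mono[OF C2_hs_norm[OF f, of x], of "norm v"] by simp
      then show "\<bar>u \<bullet> T x v\<bar> \<le> norm u * (C * norm v)" for x
        by (intro order_trans[OF Cauchy_Schwarz_ineq2 mult_left_mono]) auto
    qed
  qed
qed

theorem dynkin_C2:
  assumes f: "C2 f g T C"
  shows "dynkin f"
proof -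
  have e: "onb_seq (sb :: nat \<Rightarrow> 'a)" by (rule onb_seq_sb)
  note Pt = proj_tendsto[OF e]
  show ?thesis
  proof (rule dynkin_closed[OF C2_proj[OF e f] _ f])
    show "dynkin (\<lambda>x. f (proj sb k x))" for k
      by (rule dynkin_cylinder[OF e C2_proj[OF e f], of k k]) (simp add: proj_proj[OF e])
    show "(\<lambda>k. f (proj sb k x)) \<longlonglongrightarrow> f x" for x
      using C2_continuous[OF f, of UNIV] Pt by (auto simp: continuous_on_sequentially comp_def)
    show "(\<lambda>k. v \<bullet> proj sb k (g (proj sb k x))) \<longlonglongrightarrow> v \<bullet> g x" for v x
    proof -
      have "(\<lambda>k. g (proj sb k x)) \<longlonglongrightarrow> g x"
        using C2_grad_continuous[OF f, of UNIV] Pt by (auto simp: continuous_on_sequentially comp_def)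
      then show ?thesis unfolding inner_proj_left[OF e, symmetric] by (intro tendsto_intros Pt)
    qed
    show "(\<lambda>k. u \<bullet> proj sb k (T (proj sb k x) (proj sb k v))) \<longlonglongrightarrow> u \<bullet> T x v" for u v x
      unfolding inner_proj_left[OF e, symmetric] by (intro tendsto_intros Pt C2_hess_tendsto[OF f])
  qed
qed

end

section \<open>Stochastic continuity\<close>

abbreviation gauss :: "nat \<Rightarrow> (nat \<Rightarrow> real) measure" where
  "gauss n \<equiv> PiM {..<n} (\<lambda>_. std_normal_distribution)"

definition gvec :: "(nat \<Rightarrow> 'a::real_inner) \<Rightarrow> nat \<Rightarrow> (nat \<Rightarrow> real) \<Rightarrow> 'a" where
  "gvec e n \<omega> = (\<Sum>i<n. \<omega> i *\<^sub>R e i)"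

lemma prob_gauss: "prob_space (gauss n)"
  by (rule prob_space_PiM) (rule prob_space_normal_density, simp)

lemma gvec_measurable [measurable]: "gvec e n \<in> borel_measurable (gauss n)"
  for e :: "nat \<Rightarrow> 'a::{real_inner, polish_space}"
  unfolding gvec_def by measurable

lemma gauss_cos:
  fixes e :: "nat \<Rightarrow> 'a::{real_inner, polish_space}"
  shows "(\<integral>\<omega>. cos (y \<bullet> gvec e n \<omega>) \<partial>gauss n) = exp (- (\<Sum>i<n. (y \<bullet> e i)\<^sup>2) / 2)"
proof -
  interpret prob_space "gauss n" by (rule prob_gauss)
  interpret N: prob_space std_normal_distribution by (rule prob_space_normal_density) simp
  interpret product_sigma_finite "\<lambda>_ :: nat. std_normal_distribution" ..
  have int: "integrable std_normal_distribution (\<lambda>\<tau>. iexp (c * \<tau>))" for c :: real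
    by (rule N.integrable_const_bound[where B=1]) auto
  have ch: "(\<integral>\<tau>. iexp (c * \<tau>) \<partial>std_normal_distribution) = exp (- c\<^sup>2 / 2)" for c :: real
    using fun_cong[OF char_std_normal_distribution, of c] by (simp add: char_def)
  have "(\<integral>\<omega>. iexp (y \<bullet> gvec e n \<omega>) \<partial>gauss n) = (\<integral>\<omega>. (\<Prod>i<n. iexp ((y \<bullet> e i) * \<omega> i)) \<partial>gauss n)"
    by (simp add: gvec_def inner_sum_right sum_distrib_left exp_sum mult.commute)
  also have "\<dots> = (\<Prod>i<n. (\<integral>\<tau>. iexp ((y \<bullet> e i) * \<tau>) \<partial>std_normal_distribution))"
    by (rule product_integral_prod) (use int in auto)
  also have "\<dots> = (\<Prod>i<n. complex_of_real (exp (- (y \<bullet> e i)\<^sup>2 / 2)))"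
    unfolding ch by (simp add: exp_of_real)
  also have "\<dots> = complex_of_real (exp (- (\<Sum>i<n. (y \<bullet> e i)\<^sup>2) / 2))"
    by (simp add: exp_sum[symmetric] sum_negf sum_divide_distrib flip: of_real_prod)
  finally have c: "(\<integral>\<omega>. iexp (y \<bullet> gvec e n \<omega>) \<partial>gauss n) = complex_of_real (exp (- (\<Sum>i<n. (y \<bullet> e i)\<^sup>2) / 2))" .
  have "integrable (gauss n) (\<lambda>\<omega>. iexp (y \<bullet> gvec e n \<omega>))"
    by (rule integrable_const_bound[where B=1]) auto
  from integral_Re[OF this] c show ?thesis by (simp add: cis_conv_exp[symmetric])
qed

text \<open>The second moments come from the characteristic function by Fatou's lemma.\<close>
lemma gauss_second_moment:
  fixes e :: "nat \<Rightarrow> 'a::{real_inner, polish_space}"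
  assumes e: "onb_seq e"
  shows "(\<integral>\<^sup>+\<omega>. ennreal ((y \<bullet> gvec e n \<omega>)\<^sup>2) \<partial>gauss n) \<le> ennreal ((norm y)\<^sup>2)"
proof -
  interpret prob_space "gauss n" by (rule prob_gauss)
  define t where "t k = 1 / real (Suc k)" for k
  have t: "t k > 0" for k by (simp add: t_def)
  have t0: "t \<longlonglongrightarrow> 0" unfolding t_def[abs_def] using LIMSEQ_inverse_real_of_nat by (simp add: inverse_eq_divide)
  let ?c = "\<lambda>k u :: real. 2 * (1 - cos (t k * u)) / (t k)\<^sup>2"
  have lim: "(\<lambda>k. ?c k u) \<longlonglongrightarrow> u\<^sup>2" for u
  proof (cases "u = 0")
    case False
    have eq: "?c k u = u\<^sup>2 * (sin (t k * u / 2) / (t k * u / 2))\<^sup>2" for k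
    proof -
      have "1 - cos (t k * u) = 2 * (sin (t k * u / 2))\<^sup>2"
        using cos_double_sin[of "t k * u / 2"] by simp
      then show ?thesis using t[of k] False by (simp add: power_divide power_mult_distrib field_simps)
    qed
    have "((\<lambda>x :: real. sin x / x) \<longlongrightarrow> 1) (at 0)"
      using DERIV_sin[of "0 :: real"] by (simp add: has_field_derivative_iff)
    moreover have "filterlim (\<lambda>k. t k * u / 2) (at 0) sequentially"
      unfolding filterlim_at using t False tendsto_mult_left_zero[OF t0, of "u / 2"]
      by (auto simp: less_imp_neq[OF t] intro!: always_eventually) (metis less_irrefl t)
    ultimately have "(\<lambda>k. sin (t k * u / 2) / (t k * u / 2)) \<longlonglongrightarrow> 1" by (rule filterlim_compose)
    then have "(\<lambda>k. u\<^sup>2 * (sin (t k * u / 2) / (t k * u / 2))\<^sup>2) \<longlonglongrightarrow> u\<^sup>2 * 1\<^sup>2" by (intro tendsto_intros)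
    then show ?thesis unfolding eq by simp
  qed simp
  have bd: "(\<integral>\<^sup>+\<omega>. ennreal (?c k (y \<bullet> gvec e n \<omega>)) \<partial>gauss n) \<le> ennreal ((norm y)\<^sup>2)" for k
  proof -
    have i: "integrable (gauss n) (\<lambda>\<omega>. cos ((t k *\<^sub>R y) \<bullet> gvec e n \<omega>))"
      by (rule integrable_const_bound[where B=1]) auto
    let ?s = "\<Sum>i<n. (y \<bullet> e i)\<^sup>2"
    have "(\<integral>\<^sup>+\<omega>. ennreal (?c k (y \<bullet> gvec e n \<omega>)) \<partial>gauss n) = ennreal (\<integral>\<omega>. ?c k (y \<bullet> gvec e n \<omega>) \<partial>gauss n)"
      by (rule nn_integral_eq_integral) (use i in \<open>auto\<close>)
    also have "(\<integral>\<omega>. ?c k (y \<bullet> gvec e n \<omega>) \<partial>gauss n) = 2 * (1 - (\<integral>\<omega>. cos ((t k *\<^sub>R y) \<bullet> gvec e n \<omega>) \<partial>gauss n)) / (t k)\<^sup>2"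
      using i by (simp add: prob_space)
    also have "\<dots> = 2 * (1 - exp (- ((t k)\<^sup>2 * ?s / 2))) / (t k)\<^sup>2"
      unfolding gauss_cos by (simp add: power_mult_distrib sum_distrib_left)
    also have "\<dots> \<le> 2 * ((t k)\<^sup>2 * ?s / 2) / (t k)\<^sup>2"
      using exp_ge_add_one_self[of "- ((t k)\<^sup>2 * ?s / 2)"] by (intro divide_right_mono) auto
    also have "\<dots> = ?s" using t[of k] by simp
    also have "\<dots> \<le> (norm y)\<^sup>2" by (rule bessel[OF e])
    finally show ?thesis by (simp add: ennreal_leI)
  qed
  have "(\<integral>\<^sup>+\<omega>. ennreal ((y \<bullet> gvec e n \<omega>)\<^sup>2) \<partial>gauss n) = (\<integral>\<^sup>+\<omega>. liminf (\<lambda>k. ennreal (?c k (y \<bullet> gvec e n \<omega>))) \<partial>gauss n)"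
    by (rule nn_integral_cong) (intro lim_imp_Liminf[symmetric] tendsto_ennrealI lim trivial_limit_sequentially)
  also have "\<dots> \<le> liminf (\<lambda>k. \<integral>\<^sup>+\<omega>. ennreal (?c k (y \<bullet> gvec e n \<omega>)) \<partial>gauss n)"
    by (rule nn_integral_liminf) measurable
  also have "\<dots> \<le> ennreal ((norm y)\<^sup>2)"
    using bd Liminf_le[of sequentially "\<lambda>k. \<integral>\<^sup>+\<omega>. ennreal (?c k (y \<bullet> gvec e n \<omega>)) \<partial>gauss n"] by (intro Liminf_le) (auto intro: always_eventually)
  finally show ?thesis .
qed

context ou_data
begin

lemma psi_nn_bound:
  fixes q :: "nat \<Rightarrow> 'a"
  assumes q: "\<And>x. (\<lambda>k. (q k \<bullet> x)\<^sup>2) sums (Q x \<bullet> x)"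
  shows "ennreal (cmod (\<psi> h)) \<le> (\<Sum>k. ennreal ((q k \<bullet> h)\<^sup>2)) + (1 + ennreal ((a \<bullet> h)\<^sup>2)) +
     (\<integral>\<^sup>+ y. ennreal (if norm y \<le> 1 then (y \<bullet> h)\<^sup>2 else 2) \<partial>\<nu>)"
proof -
  have Qh: "0 \<le> Q h \<bullet> h" by (rule nst_nonneg[OF Q])
  have J: "ennreal (cmod (\<integral>y. psi_int h y \<partial>\<nu>)) \<le> (\<integral>\<^sup>+ y. ennreal (if norm y \<le> 1 then (y \<bullet> h)\<^sup>2 else 2) \<partial>\<nu>)"
  proof -
    have "ennreal (cmod (\<integral>y. psi_int h y \<partial>\<nu>)) \<le> (\<integral>\<^sup>+ y. ennreal (cmod (psi_int h y)) \<partial>\<nu>)"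
      by (rule integral_norm_bound_ennreal[OF psi_int_integrable])
    also have "\<dots> \<le> (\<integral>\<^sup>+ y. ennreal (if norm y \<le> 1 then (y \<bullet> h)\<^sup>2 else 2) \<partial>\<nu>)"
      by (intro nn_integral_mono ennreal_leI) (use psi_int_bound[of h] in \<open>simp only: inner_commute[of _ h]\<close>)
    finally show ?thesis .
  qed
  have "cmod (\<psi> h) \<le> cmod (complex_of_real (1 / 2 * (Q h \<bullet> h)) - \<i> * complex_of_real (a \<bullet> h)) + cmod (\<integral>y. psi_int h y \<partial>\<nu>)"
    unfolding psi_eq by (rule norm_triangle_ineq4)
  also have "cmod (complex_of_real (1 / 2 * (Q h \<bullet> h)) - \<i> * complex_of_real (a \<bullet> h)) \<le>
      cmod (complex_of_real (1 / 2 * (Q h \<bullet> h))) + cmod (\<i> * complex_of_real (a \<bullet> h))" by (rule norm_triangle_ineq4)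
  also have "cmod (complex_of_real (1 / 2 * (Q h \<bullet> h))) = 1 / 2 * (Q h \<bullet> h)" using Qh by simp
  also have "cmod (\<i> * complex_of_real (a \<bullet> h)) = \<bar>a \<bullet> h\<bar>" by (simp add: norm_mult)
  also have "\<bar>a \<bullet> h\<bar> \<le> 1 + (a \<bullet> h)\<^sup>2"
  proof (cases "\<bar>a \<bullet> h\<bar> \<le> 1")
    case False
    then have "\<bar>a \<bullet> h\<bar> * 1 \<le> \<bar>a \<bullet> h\<bar> * \<bar>a \<bullet> h\<bar>" by (intro mult_left_mono) auto
    then show ?thesis by (simp add: power2_eq_square)
  qed (simp add: add_increasing2)
  finally have "cmod (\<psi> h) \<le> Q h \<bullet> h + (1 + (a \<bullet> h)\<^sup>2) + cmod (\<integral>y. psi_int h y \<partial>\<nu>)" using Qh by simp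
  then have "ennreal (cmod (\<psi> h)) \<le> ennreal (Q h \<bullet> h) + (1 + ennreal ((a \<bullet> h)\<^sup>2)) + ennreal (cmod (\<integral>y. psi_int h y \<partial>\<nu>))"
    using Qh by (simp add: ennreal_leI flip: ennreal_plus ennreal_1)
  also have "ennreal (Q h \<bullet> h) = (\<Sum>k. ennreal ((q k \<bullet> h)\<^sup>2))"
    using q[of h] by (subst suminf_ennreal2) (auto simp: sums_iff)
  finally show ?thesis using J by (meson add_left_mono order_trans)
qed

lemma gauss_psi_bound:
  assumes e: "onb_seq (e :: nat \<Rightarrow> 'a)"
  shows "\<exists>K. \<forall>n. \<forall>r\<in>{0..1}. (\<integral>\<^sup>+\<omega>. ennreal (cmod (\<psi> (Sadj r (gvec e n \<omega>)))) \<partial>gauss n) \<le> ennreal K"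
proof -
  obtain q :: "nat \<Rightarrow> 'a" where q: "summable (\<lambda>k. (norm (q k))\<^sup>2)" "\<And>x. (\<lambda>k. (q k \<bullet> x)\<^sup>2) sums (Q x \<bullet> x)"
    using trace_class_sum_squares[OF Q] by blast
  obtain M where M: "M \<ge> 1" "\<And>s x. 0 \<le> s \<Longrightarrow> s \<le> 1 \<Longrightarrow> norm (S s x) \<le> M * norm x" by (rule S_bound) blast
  have W: "(\<integral>\<^sup>+ y. ennreal (2 * M\<^sup>2 * weight y) \<partial>\<nu>) = ennreal (\<integral>y. 2 * M\<^sup>2 * weight y \<partial>\<nu>)"
    by (rule nn_integral_eq_integral) (use weight_integrable weight_nonneg in auto)
  define K where "K = (\<Sum>k. M\<^sup>2 * (norm (q k))\<^sup>2) + (1 + (M * norm a)\<^sup>2) + (\<integral>y. 2 * M\<^sup>2 * weight y \<partial>\<nu>)"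
  have "(\<integral>\<^sup>+\<omega>. ennreal (cmod (\<psi> (Sadj r (gvec e n \<omega>)))) \<partial>gauss n) \<le> ennreal K" if r: "r \<in> {0..1}" for n r
  proof -
    interpret G: prob_space "gauss n" by (rule prob_gauss)
    interpret pair_sigma_finite "gauss n" \<nu> ..
    have r': "0 \<le> r" "r \<le> 1" using r by auto
    have adj: "y \<bullet> Sadj r x = S r y \<bullet> x" for x y using semigroup_adjoint[OF r'(1)] by simp
    have mom: "(\<integral>\<^sup>+\<omega>. ennreal ((y \<bullet> Sadj r (gvec e n \<omega>))\<^sup>2) \<partial>gauss n) \<le> ennreal ((M * norm y)\<^sup>2)" for y
    proof -
      have "(norm (S r y))\<^sup>2 \<le> (M * norm y)\<^sup>2" using M(2)[OF r'] by (intro power_mono) auto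
      then show ?thesis unfolding adj using gauss_second_moment[OF e, where y="S r y" and n=n] ennreal_leI order_trans by blast
    qed
    have [measurable]: "S r \<in> borel_measurable borel"
      by (intro borel_measurable_continuous_onI linear_continuous_on c0_linear[OF c0 r'(1)])
    have "(\<integral>\<^sup>+\<omega>. ennreal (cmod (\<psi> (Sadj r (gvec e n \<omega>)))) \<partial>gauss n) \<le>
      (\<integral>\<^sup>+\<omega>. (\<Sum>k. ennreal ((q k \<bullet> Sadj r (gvec e n \<omega>))\<^sup>2)) + (1 + ennreal ((a \<bullet> Sadj r (gvec e n \<omega>))\<^sup>2)) +
       (\<integral>\<^sup>+ y. ennreal (if norm y \<le> 1 then (y \<bullet> Sadj r (gvec e n \<omega>))\<^sup>2 else 2) \<partial>\<nu>) \<partial>gauss n)"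
      by (intro nn_integral_mono psi_nn_bound[OF q(2)])
    also have "\<dots> = (\<Sum>k. \<integral>\<^sup>+\<omega>. ennreal ((q k \<bullet> Sadj r (gvec e n \<omega>))\<^sup>2) \<partial>gauss n)
       + (1 + (\<integral>\<^sup>+\<omega>. ennreal ((a \<bullet> Sadj r (gvec e n \<omega>))\<^sup>2) \<partial>gauss n))
       + (\<integral>\<^sup>+\<omega>. (\<integral>\<^sup>+ y. ennreal (if norm y \<le> 1 then (y \<bullet> Sadj r (gvec e n \<omega>))\<^sup>2 else 2) \<partial>\<nu>) \<partial>gauss n)"
      unfolding adj
      by (subst nn_integral_add, measurable)+ (simp add: nn_integral_suminf G.emeasure_space_1)
    also have "(\<integral>\<^sup>+\<omega>. (\<integral>\<^sup>+ y. ennreal (if norm y \<le> 1 then (y \<bullet> Sadj r (gvec e n \<omega>))\<^sup>2 else 2) \<partial>\<nu>) \<partial>gauss n) =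
      (\<integral>\<^sup>+ y. (\<integral>\<^sup>+\<omega>. ennreal (if norm y \<le> 1 then (y \<bullet> Sadj r (gvec e n \<omega>))\<^sup>2 else 2) \<partial>gauss n) \<partial>\<nu>)"
      unfolding adj by (rule Fubini'[symmetric]) measurable
    also have "\<dots> \<le> (\<integral>\<^sup>+ y. ennreal (2 * M\<^sup>2 * weight y) \<partial>\<nu>)"
    proof (rule nn_integral_mono)
      fix y
      show "(\<integral>\<^sup>+\<omega>. ennreal (if norm y \<le> 1 then (y \<bullet> Sadj r (gvec e n \<omega>))\<^sup>2 else 2) \<partial>gauss n) \<le> ennreal (2 * M\<^sup>2 * weight y)"
      proof (cases "norm y \<le> 1")
        case True
        then have w: "weight y = (norm y)\<^sup>2" by (simp add: weight_def power_le_one)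
        have "(M * norm y)\<^sup>2 \<le> 2 * M\<^sup>2 * weight y" by (simp add: w power_mult_distrib)
        then show ?thesis using mom[of y] True ennreal_leI order_trans by (simp only: if_True) blast
      next
        case False
        then have "weight y = 1" by (simp add: weight_def)
        moreover have "2 \<le> 2 * M\<^sup>2" using M(1) by (simp add: one_le_power)
        ultimately have "ennreal 2 \<le> ennreal (2 * M\<^sup>2 * weight y)" by (intro ennreal_leI) simp
        then show ?thesis using False by (simp add: G.emeasure_space_1)
      qed
    qed
    also have "\<dots> = ennreal (\<integral>y. 2 * M\<^sup>2 * weight y \<partial>\<nu>)" by (rule W)
    also have "(\<Sum>k. \<integral>\<^sup>+\<omega>. ennreal ((q k \<bullet> Sadj r (gvec e n \<omega>))\<^sup>2) \<partial>gauss n) \<le> (\<Sum>k. ennreal (M\<^sup>2 * (norm (q k))\<^sup>2))"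
      using mom by (intro suminf_le) (auto simp: power_mult_distrib)
    also have "(\<Sum>k. ennreal (M\<^sup>2 * (norm (q k))\<^sup>2)) = ennreal (\<Sum>k. M\<^sup>2 * (norm (q k))\<^sup>2)"
      using q(1) by (intro suminf_ennreal2 summable_mult) auto
    also have "(\<integral>\<^sup>+\<omega>. ennreal ((a \<bullet> Sadj r (gvec e n \<omega>))\<^sup>2) \<partial>gauss n) \<le> ennreal ((M * norm a)\<^sup>2)" by (rule mom)
    also have "ennreal (\<Sum>k. M\<^sup>2 * (norm (q k))\<^sup>2) + (1 + ennreal ((M * norm a)\<^sup>2)) + ennreal (\<integral>y. 2 * M\<^sup>2 * weight y \<partial>\<nu>) = ennreal K"
    proof -
      have "0 \<le> (\<Sum>k. M\<^sup>2 * (norm (q k))\<^sup>2)" by (intro suminf_nonneg summable_mult q(1)) auto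
      moreover have "0 \<le> (\<integral>y. 2 * M\<^sup>2 * weight y \<partial>\<nu>)" by (intro Bochner_Integration.integral_nonneg) (simp add: weight_nonneg)
      ultimately show ?thesis by (simp add: K_def flip: ennreal_plus ennreal_1)
    qed
    finally show ?thesis by (simp add: add_mono)
  qed
  then show ?thesis by blast
qed

lemma continuous_psi_flow: "continuous_on UNIV (\<lambda>(r, x). \<psi> (Sadj (max 0 r) x))"
  unfolding continuous_on_sequentially
proof (intro allI ballI impI, elim conjE)
  fix X :: "nat \<Rightarrow> real \<times> 'a" and p assume X: "X \<longlonglongrightarrow> p"
  have "(\<lambda>n. Sadj (max 0 (fst (X n))) (snd (X n))) \<longlonglongrightarrow> Sadj (max 0 (fst p)) (snd p)"
    by (intro c0_joint[OF c0_adj] tendsto_intros X) simp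
  then have "(\<lambda>n. \<psi> (Sadj (max 0 (fst (X n))) (snd (X n)))) \<longlonglongrightarrow> \<psi> (Sadj (max 0 (fst p)) (snd p))"
    using continuous_psi by (auto simp: continuous_on_sequentially comp_def)
  then show "((\<lambda>(r, x). \<psi> (Sadj (max 0 r) x)) \<circ> X) \<longlonglongrightarrow> (case p of (r, x) \<Rightarrow> \<psi> (Sadj (max 0 r) x))"
    by (simp add: comp_def case_prod_beta)
qed

lemma norm_chf_le: "t \<ge> 0 \<Longrightarrow> cmod (chf t h) \<le> 1"
proof -
  assume t: "t \<ge> 0"
  interpret prob_space "\<mu> t" using t by (rule mu_prob)
  have i: "integrable (\<mu> t) (\<lambda>y. iexp (h \<bullet> y))" by (rule mu_integrable[OF t, where C=1]) auto
  have "cmod (chf t h) \<le> (\<integral>y. cmod (iexp (h \<bullet> y)) \<partial>\<mu> t)"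
    unfolding mu_chf[OF t, symmetric] by (rule integral_norm_bound)
  then show ?thesis by (simp add: prob_space)
qed

lemma mu_moment: "\<exists>K\<ge>0. \<forall>s\<in>{0..1}. (\<integral>y. (1 - exp (- (norm y)\<^sup>2 / 2)) \<partial>\<mu> s) \<le> K * s"
proof -
  let ?e = "sb :: nat \<Rightarrow> 'a"
  have e: "onb_seq ?e" by (rule onb_seq_sb)
  obtain K0 where K0: "\<And>n r. r \<in> {0..1} \<Longrightarrow> (\<integral>\<^sup>+\<omega>. ennreal (cmod (\<psi> (Sadj r (gvec ?e n \<omega>)))) \<partial>gauss n) \<le> ennreal K0"
    using gauss_psi_bound[OF e] by blast
  define K where "K = max 0 K0"
  have K: "(\<integral>\<^sup>+\<omega>. ennreal (cmod (\<psi> (Sadj r (gvec ?e n \<omega>)))) \<partial>gauss n) \<le> ennreal K" if "r \<in> {0..1}" for n r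
    using K0[OF that, of n] by (rule order_trans) (simp add: K_def ennreal_leI)
  have "(\<integral>y. (1 - exp (- (norm y)\<^sup>2 / 2)) \<partial>\<mu> s) \<le> K * s" if s: "s \<in> {0..1}" for s
  proof -
    have s0: "0 \<le> s" "s \<le> 1" using s by auto
    interpret m: prob_space "\<mu> s" by (rule mu_prob[OF s0(1)])
    have le: "(\<integral>y. (1 - exp (- (\<Sum>i<n. (y \<bullet> ?e i)\<^sup>2) / 2)) \<partial>\<mu> s) \<le> K * s" for n
    proof -
      interpret G: prob_space "gauss n" by (rule prob_gauss)
      interpret L: finite_measure "lebI 0 s" by (rule finite_measure_lebI)
      interpret p: pair_prob_space "gauss n" "\<mu> s" ..
      interpret pl: pair_sigma_finite "gauss n" "lebI 0 s" ..
      let ?\<xi> = "gvec ?e n"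
      have [measurable_cong]: "sets (\<mu> s) = sets borel" by (rule mu_sets[OF s0(1)])
      have icos: "integrable (gauss n) (\<lambda>\<omega>. cos (y \<bullet> ?\<xi> \<omega>))" for y
        by (rule G.integrable_const_bound[where B=1]) auto
      have "(\<integral>y. (1 - exp (- (\<Sum>i<n. (y \<bullet> ?e i)\<^sup>2) / 2)) \<partial>\<mu> s) = (\<integral>y. (\<integral>\<omega>. 1 - cos (y \<bullet> ?\<xi> \<omega>) \<partial>gauss n) \<partial>\<mu> s)"
        using icos by (simp add: gauss_cos G.prob_space)
      also have "\<dots> = (\<integral>\<omega>. (\<integral>y. 1 - cos (y \<bullet> ?\<xi> \<omega>) \<partial>\<mu> s) \<partial>gauss n)"
        by (rule p.Fubini_integral) (auto intro!: p.integrable_const_bound[where B=2] simp: abs_le_iff)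
      also have "\<dots> = (\<integral>\<omega>. 1 - Re (chf s (?\<xi> \<omega>)) \<partial>gauss n)"
      proof (rule Bochner_Integration.integral_cong[OF refl])
        fix \<omega>
        have "wave (?\<xi> \<omega>) 0 (0 + y) = cos (y \<bullet> ?\<xi> \<omega>)" for y by (simp add: wave_def)
        then have "(\<integral>y. cos (y \<bullet> ?\<xi> \<omega>) \<partial>\<mu> s) = Re (chf s (?\<xi> \<omega>))"
          using mu_wave[OF s0(1), of "?\<xi> \<omega>" 0 0] by simp
        moreover have "integrable (\<mu> s) (\<lambda>y. cos (y \<bullet> ?\<xi> \<omega>))"
          by (rule m.integrable_const_bound[where B=1]) auto
        ultimately show "(\<integral>y. 1 - cos (y \<bullet> ?\<xi> \<omega>) \<partial>\<mu> s) = 1 - Re (chf s (?\<xi> \<omega>))"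
          by (simp add: m.prob_space)
      qed
      finally have A: "(\<integral>y. (1 - exp (- (\<Sum>i<n. (y \<bullet> ?e i)\<^sup>2) / 2)) \<partial>\<mu> s) = (\<integral>\<omega>. 1 - Re (chf s (?\<xi> \<omega>)) \<partial>gauss n)" .
      have [measurable]: "(\<lambda>(r, x). \<psi> (Sadj (max 0 r) x)) \<in> borel_measurable (borel \<Otimes>\<^sub>M borel)"
        unfolding borel_prod by (rule borel_measurable_continuous_onI[OF continuous_psi_flow])
      have [measurable]: "(\<lambda>r. r) \<in> borel_measurable (lebI 0 s)"
        by (rule borel_measurable_lebI) (rule continuous_on_id)
      have [measurable]: "(\<lambda>(\<omega>, r). \<psi> (Sadj (max 0 r) (?\<xi> \<omega>))) \<in> borel_measurable (gauss n \<Otimes>\<^sub>M lebI 0 s)"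
        by measurable
      have pt: "ennreal (1 - Re (chf s (?\<xi> \<omega>))) \<le> (\<integral>\<^sup>+ r. ennreal (cmod (\<psi> (Sadj (max 0 r) (?\<xi> \<omega>)))) \<partial>lebI 0 s)" for \<omega>
      proof -
        let ?h = "?\<xi> \<omega>"
        have cj: "continuous_on {0..s} (\<lambda>r. \<psi> (Sadj r ?h) * chf r ?h)"
          by (intro continuous_on_mult continuous_psi_Sadj continuous_chf) simp
        have i: "integrable (lebI 0 s) (\<lambda>r. \<psi> (Sadj r ?h) * chf r ?h)"
        proof -
          have "compact ((\<lambda>r. \<psi> (Sadj r ?h) * chf r ?h) ` {0..s})"
            using cj by (intro compact_continuous_image) auto
          then have "bounded ((\<lambda>r. \<psi> (Sadj r ?h) * chf r ?h) ` {0..s})" by (rule compact_imp_bounded)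
          then obtain B where "\<And>r. r \<in> {0..s} \<Longrightarrow> cmod (\<psi> (Sadj r ?h) * chf r ?h) \<le> B"
            unfolding bounded_iff by blast
          then show ?thesis
            by (intro L.integrable_const_bound[where B=B] borel_measurable_lebI cj) auto
        qed
        have "1 - Re (chf s ?h) \<le> cmod (chf s ?h - 1)"
          using abs_Re_le_cmod[of "chf s ?h - 1"] by simp
        also have "\<dots> = cmod (\<integral>r. \<psi> (Sadj r ?h) * chf r ?h \<partial>lebI 0 s)"
          unfolding chf_diff[OF s0(1)] integral_lebI[OF cj] by simp
        finally have "ennreal (1 - Re (chf s ?h)) \<le> (\<integral>\<^sup>+ r. ennreal (cmod (\<psi> (Sadj r ?h) * chf r ?h)) \<partial>lebI 0 s)"
          using integral_norm_bound_ennreal[OF i] ennreal_leI order_trans by blast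
        also have "\<dots> \<le> (\<integral>\<^sup>+ r. ennreal (cmod (\<psi> (Sadj (max 0 r) ?h))) \<partial>lebI 0 s)"
          by (intro nn_integral_mono ennreal_leI) (auto simp: norm_mult mult_left_le norm_chf_le)
        finally show ?thesis .
      qed
      have [measurable]: "(\<lambda>\<omega>. Re (chf s (?\<xi> \<omega>))) \<in> borel_measurable (gauss n)"
      proof -
        have "(\<lambda>\<omega>. (\<integral>y. cos (y \<bullet> ?\<xi> \<omega>) \<partial>\<mu> s)) \<in> borel_measurable (gauss n)"
          by (rule m.borel_measurable_lebesgue_integral) measurable
        moreover have "(\<integral>y. cos (y \<bullet> h) \<partial>\<mu> s) = Re (chf s h)" for h
          using mu_wave[OF s0(1), of h 0 0] by (simp add: wave_def)
        ultimately show ?thesis by simp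
      qed
      have Re_le: "\<bar>Re (chf s h)\<bar> \<le> 1" for h
        using abs_Re_le_cmod[of "chf s h"] norm_chf_le[OF s0(1), of h] by linarith
      have "ennreal (\<integral>\<omega>. 1 - Re (chf s (?\<xi> \<omega>)) \<partial>gauss n) = (\<integral>\<^sup>+\<omega>. ennreal (1 - Re (chf s (?\<xi> \<omega>))) \<partial>gauss n)"
        using Re_le by (intro nn_integral_eq_integral[symmetric] Bochner_Integration.integrable_diff
            G.integrable_const G.integrable_const_bound[where B=1]) (auto simp: abs_le_iff)
      also have "\<dots> \<le> (\<integral>\<^sup>+\<omega>. (\<integral>\<^sup>+ r. ennreal (cmod (\<psi> (Sadj (max 0 r) (?\<xi> \<omega>)))) \<partial>lebI 0 s) \<partial>gauss n)"
        by (intro nn_integral_mono pt)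
      also have "\<dots> = (\<integral>\<^sup>+ r. (\<integral>\<^sup>+\<omega>. ennreal (cmod (\<psi> (Sadj (max 0 r) (?\<xi> \<omega>)))) \<partial>gauss n) \<partial>lebI 0 s)"
        by (rule pl.Fubini'[symmetric]) measurable
      also have "\<dots> \<le> (\<integral>\<^sup>+ r. ennreal K \<partial>lebI 0 s)"
        using K s0 by (intro nn_integral_mono) auto
      also have "\<dots> = ennreal (K * s)"
        using measure_lebI[OF s0(1)] s0 by (simp add: L.emeasure_eq_measure ennreal_mult K_def)
      finally have "ennreal (\<integral>\<omega>. 1 - Re (chf s (?\<xi> \<omega>)) \<partial>gauss n) \<le> ennreal (K * s)" .
      then show ?thesis unfolding A using s0 by (simp add: K_def ennreal_le_iff)
    qed
    have "(\<lambda>n. \<integral>y. (1 - exp (- (\<Sum>i<n. (y \<bullet> ?e i)\<^sup>2) / 2)) \<partial>\<mu> s) \<longlonglongrightarrow> (\<integral>y. (1 - exp (- (norm y)\<^sup>2 / 2)) \<partial>\<mu> s)"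
    proof (rule mu_tendsto[OF s0(1), where C=1])
      show "(\<lambda>n. 1 - exp (- (\<Sum>i<n. (y \<bullet> ?e i)\<^sup>2) / 2)) \<longlonglongrightarrow> 1 - exp (- (norm y)\<^sup>2 / 2)" for y :: 'a
        using parseval_norm[OF e, of y] unfolding sums_def by (intro tendsto_intros) auto
      show "\<bar>1 - exp (- (\<Sum>i<n. (y \<bullet> ?e i)\<^sup>2) / 2)\<bar> \<le> 1" for n and y :: 'a
        by (simp add: sum_nonneg)
    qed measurable
    then show ?thesis by (rule LIMSEQ_le_const2) (use le in auto)
  qed
  then show ?thesis by (intro exI[of _ K]) (auto simp: K_def)
qed

lemma mu_concentrates:
  fixes G :: "nat \<Rightarrow> 'a \<Rightarrow> real"
  assumes s: "s \<longlonglongrightarrow> 0" "\<And>n. s n \<ge> 0"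
    and G: "\<And>n. G n \<in> borel_measurable borel" "\<And>n y. \<bar>G n y\<bar> \<le> C"
    and lim: "\<And>\<sigma> Y. filterlim \<sigma> at_top sequentially \<Longrightarrow> Y \<longlonglongrightarrow> 0 \<Longrightarrow> (\<lambda>k. G (\<sigma> k) (Y k)) \<longlonglongrightarrow> c"
  shows "(\<lambda>n. \<integral>y. G n y \<partial>\<mu> (s n)) \<longlonglongrightarrow> c"
proof (rule tendstoI)
  fix \<epsilon> :: real assume \<epsilon>: "\<epsilon> > 0"
  have C: "\<bar>c\<bar> \<le> C"
  proof (rule LIMSEQ_le_const2)
    show "(\<lambda>k. \<bar>G k 0\<bar>) \<longlonglongrightarrow> \<bar>c\<bar>"
      using lim[OF filterlim_ident tendsto_const] by (intro tendsto_rabs)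
  qed (use G in auto)
  have "\<exists>\<delta>>0. \<exists>N. \<forall>n\<ge>N. \<forall>y. norm y < \<delta> \<longrightarrow> \<bar>G n y - c\<bar> \<le> \<epsilon> / 2"
  proof (rule ccontr)
    assume n: "\<not> ?thesis"
    have "\<exists>n\<ge>k. \<exists>y. norm y < 1 / real (Suc k) \<and> \<bar>G n y - c\<bar> > \<epsilon> / 2" for k
    proof (rule ccontr)
      assume "\<not> ?thesis"
      then have "\<forall>n\<ge>k. \<forall>y. norm y < 1 / real (Suc k) \<longrightarrow> \<bar>G n y - c\<bar> \<le> \<epsilon> / 2" by (meson not_le)
      moreover have "1 / real (Suc k) > 0" by simp
      ultimately show False using n by blast
    qed
    then obtain \<sigma> Y where sY: "\<And>k. \<sigma> k \<ge> k" "\<And>k. norm (Y k) < 1 / real (Suc k)" "\<And>k. \<bar>G (\<sigma> k) (Y k) - c\<bar> > \<epsilon> / 2"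
      by metis
    have "filterlim \<sigma> at_top sequentially"
      by (rule filterlim_at_top_mono[OF filterlim_ident]) (use sY in auto)
    moreover have "Y \<longlonglongrightarrow> 0"
      by (rule Lim_null_comparison[OF always_eventually LIMSEQ_inverse_real_of_nat])
        (use sY(2) in \<open>auto simp: inverse_eq_divide less_imp_le\<close>)
    ultimately have "(\<lambda>k. G (\<sigma> k) (Y k)) \<longlonglongrightarrow> c" by (rule lim)
    from tendstoD[OF this, of "\<epsilon> / 2"] \<epsilon> have "\<forall>\<^sub>F k in sequentially. dist (G (\<sigma> k) (Y k)) c < \<epsilon> / 2" by simp
    then obtain k where "dist (G (\<sigma> k) (Y k)) c < \<epsilon> / 2" unfolding eventually_sequentially by blast
    then show False using sY(3)[of k] by (simp add: dist_real_def)
  qed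
  then obtain \<delta> N where \<delta>: "\<delta> > 0" "\<And>n y. n \<ge> N \<Longrightarrow> norm y < \<delta> \<Longrightarrow> \<bar>G n y - c\<bar> \<le> \<epsilon> / 2" by blast
  define \<kappa> where "\<kappa> = 1 - exp (- \<delta>\<^sup>2 / 2)"
  have \<kappa>: "\<kappa> > 0" using \<delta>(1) by (simp add: \<kappa>_def)
  obtain K where K: "K \<ge> 0" "\<And>s. s \<in> {0..1} \<Longrightarrow> (\<integral>y. (1 - exp (- (norm y)\<^sup>2 / 2)) \<partial>\<mu> s) \<le> K * s"
    using mu_moment by blast
  have pt: "\<bar>G n y - c\<bar> \<le> \<epsilon> / 2 + (2 * C / \<kappa>) * (1 - exp (- (norm y)\<^sup>2 / 2))" if "n \<ge> N" for n y
  proof (cases "norm y < \<delta>")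
    case True
    have "0 \<le> (2 * C / \<kappa>) * (1 - exp (- (norm y)\<^sup>2 / 2))" using C \<kappa> by (intro mult_nonneg_nonneg) auto
    then show ?thesis using \<delta>(2)[OF that True] by linarith
  next
    case False
    then have "\<delta>\<^sup>2 \<le> (norm y)\<^sup>2" using \<delta>(1) by (intro power_mono) auto
    then have "\<kappa> \<le> 1 - exp (- (norm y)\<^sup>2 / 2)" by (simp add: \<kappa>_def)
    then have "(2 * C / \<kappa>) * \<kappa> \<le> (2 * C / \<kappa>) * (1 - exp (- (norm y)\<^sup>2 / 2))" using C \<kappa> by (intro mult_left_mono) auto
    moreover have "\<bar>G n y - c\<bar> \<le> 2 * C" using G(2)[of n y] C by linarith
    ultimately show ?thesis using \<kappa> \<epsilon> by simp
  qed
  have "(\<lambda>n. (2 * C / \<kappa>) * (K * s n)) \<longlonglongrightarrow> (2 * C / \<kappa>) * (K * 0)" by (intro tendsto_intros s)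
  then have "\<forall>\<^sub>F n in sequentially. (2 * C / \<kappa>) * (K * s n) < \<epsilon> / 2"
    by (rule order_tendstoD) (use \<epsilon> in simp)
  moreover have "\<forall>\<^sub>F n in sequentially. s n < 1" using s(1) by (rule order_tendstoD) simp
  moreover have "\<forall>\<^sub>F n in sequentially. n \<ge> N" by (rule eventually_ge_at_top)
  ultimately show "\<forall>\<^sub>F n in sequentially. dist (\<integral>y. G n y \<partial>\<mu> (s n)) c < \<epsilon>"
  proof eventually_elim
    case (elim n)
    interpret m: prob_space "\<mu> (s n)" by (rule mu_prob[OF s(2)])
    have iG: "integrable (\<mu> (s n)) (G n)" by (rule mu_integrable[OF s(2) G(1)]) (use G in auto)
    have ie: "integrable (\<mu> (s n)) (\<lambda>y. exp (- (norm y)\<^sup>2 / 2))"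
      by (rule mu_integrable[OF s(2), where C=1]) auto
    have "\<bar>(\<integral>y. G n y \<partial>\<mu> (s n)) - c\<bar> = \<bar>\<integral>y. G n y - c \<partial>\<mu> (s n)\<bar>"
      using iG by (simp add: m.prob_space)
    also have "\<dots> \<le> (\<integral>y. \<bar>G n y - c\<bar> \<partial>\<mu> (s n))" by (rule integral_abs_bound)
    also have "\<dots> \<le> (\<integral>y. \<epsilon> / 2 + (2 * C / \<kappa>) * (1 - exp (- (norm y)\<^sup>2 / 2)) \<partial>\<mu> (s n))"
      by (rule integral_mono) (use iG ie pt[OF elim(3)] in auto)
    also have "\<dots> = \<epsilon> / 2 + (2 * C / \<kappa>) * (\<integral>y. (1 - exp (- (norm y)\<^sup>2 / 2)) \<partial>\<mu> (s n))"
      using ie by (simp add: m.prob_space)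
    also have "\<dots> \<le> \<epsilon> / 2 + (2 * C / \<kappa>) * (K * s n)"
      using K(2)[of "s n"] s(2)[of n] elim(2) C \<kappa> by (intro add_left_mono mult_left_mono) auto
    also have "\<dots> < \<epsilon>" using elim(1) by simp
    finally show ?case by (simp add: dist_real_def)
  qed
qed

end

section \<open>The generator\<close>

context ou_data
begin

definition CA :: "('a \<Rightarrow> real) \<Rightarrow> ('a \<Rightarrow> 'a) \<Rightarrow> ('a \<Rightarrow> 'a \<Rightarrow> 'a) \<Rightarrow> real \<Rightarrow> ('a \<Rightarrow> 'a) \<Rightarrow> real \<Rightarrow> bool" where
  "CA f g T C \<alpha> D \<longleftrightarrow> C2 f g T C \<and> (\<forall>x. g x \<in> adj_dom DA A \<and> adj_op DA A (g x) = \<alpha> x) \<and>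
     continuous_on UNIV \<alpha> \<and> (\<forall>x. norm (\<alpha> x) \<le> D)"

lemma CA_C2: "CA f g T C \<alpha> D \<Longrightarrow> C2 f g T C"
  by (simp add: CA_def)

lemma CA_in_CA2: "CA f g T C \<alpha> D \<Longrightarrow> f \<in> CA2 DA A"
proof -
  assume a: "CA f g T C \<alpha> D"
  then have "(\<lambda>x. adj_op DA A (grad f x)) = \<alpha>" by (auto simp: CA_def C2_grad[OF CA_C2[OF a]])
  then show ?thesis
    using a C2_grad[OF CA_C2[OF a]] C2_Cb2[OF CA_C2[OF a]]
    by (auto simp: CA2_def CA_def intro: bcontfunI')
qed

lemma CA2_CA:
  assumes "f \<in> CA2 DA A"
  obtains C D where "CA f (grad f) (hess f) C (\<lambda>x. adj_op DA A (grad f x)) D"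
proof -
  have f: "f \<in> Cb2" "\<And>x. grad f x \<in> adj_dom DA A" "(\<lambda>x. adj_op DA A (grad f x)) \<in> bcontfun"
    using assms by (auto simp: CA2_def)
  obtain C where C: "C2 f (grad f) (hess f) C" using Cb2_C2[OF f(1)] .
  obtain D where D: "\<And>x. norm (adj_op DA A (grad f x)) \<le> D" using bcontfun_bound[OF f(3)] by blast
  have "CA f (grad f) (hess f) C (\<lambda>x. adj_op DA A (grad f x)) D"
    using f C D bcontfun_continuous[OF f(3)] by (simp add: CA_def)
  then show thesis by (rule that)
qed

context
  fixes f :: "'a \<Rightarrow> real" and g T C \<alpha> D
  assumes CA: "CA f g T C \<alpha> D"
begin

lemma CA_dom: "g x \<in> adj_dom DA A" and CA_adj: "adj_op DA A (g x) = \<alpha> x"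
  and CA_cont: "continuous_on UNIV \<alpha>" and CA_bound: "norm (\<alpha> x) \<le> D"
  using CA by (auto simp: CA_def)

lemma CA_L0: "L0 Q a \<nu> DA A f x = x \<bullet> \<alpha> x + L1 f x"
  by (simp add: L0_eq C2_grad[OF CA_C2[OF CA]] CA_adj)

lemma transport_tendsto:
  assumes "t \<longlonglongrightarrow> l" "\<And>n. t n \<ge> 0" "x \<longlonglongrightarrow> y"
  shows "(\<lambda>n. S (t n) (x n) \<bullet> \<alpha> (S (t n) (x n))) \<longlonglongrightarrow> S l y \<bullet> \<alpha> (S l y)"
proof -
  have 1: "(\<lambda>n. S (t n) (x n)) \<longlonglongrightarrow> S l y" by (rule c0_joint[OF c0 assms])
  then have "(\<lambda>n. \<alpha> (S (t n) (x n))) \<longlonglongrightarrow> \<alpha> (S l y)"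
    using CA_cont by (auto simp: continuous_on_sequentially comp_def)
  with 1 show ?thesis by (rule tendsto_inner)
qed

lemma transport_continuous: "0 \<le> u \<Longrightarrow> continuous_on {u..v} (\<lambda>s. S s x \<bullet> \<alpha> (S s x))"
  unfolding continuous_on_sequentially comp_def
  by (auto intro!: transport_tendsto tendsto_const order_trans[of 0 u])

lemma transport_eq:
  assumes t: "t \<ge> 0"
  shows "f (S t x) - f x = integral {0..t} (\<lambda>s. S s x \<bullet> \<alpha> (S s x))"
proof -
  have *: "f (S t x) - f x = integral {0..t} (\<lambda>s. S s x \<bullet> \<alpha> (S s x))" if x: "x \<in> DA" for x
  proof -
    have "((\<lambda>s. S s x \<bullet> \<alpha> (S s x)) has_integral f (S t x) - f (S 0 x)) {0..t}"
    proof (rule fundamental_theorem_of_calculus[OF t])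
      fix s assume s: "s \<in> {0..t}"
      then have s0: "0 \<le> s" by simp
      have d: "((\<lambda>s. S s x) has_derivative (\<lambda>r. r *\<^sub>R S s (A x))) (at s within {0..t})"
        using has_vector_derivative_within_subset[OF gen_has_vector_derivative[OF gen x s0], of "{0..t}"]
        by (auto simp: has_vector_derivative_def)
      have "((\<lambda>s. f (S s x)) has_derivative (\<lambda>r. (r *\<^sub>R S s (A x)) \<bullet> g (S s x))) (at s within {0..t})"
        using has_derivative_compose[OF d C2_has_derivative[OF CA_C2[OF CA]]] .
      moreover have "S s (A x) \<bullet> g (S s x) = S s x \<bullet> \<alpha> (S s x)"
        using adj_op_inner[OF CA_dom gen_commute(1)[OF gen x s0]] gen_commute(2)[OF gen x s0] CA_adj by metis
      ultimately show "((\<lambda>s. f (S s x)) has_vector_derivative S s x \<bullet> \<alpha> (S s x)) (at s within {0..t})"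
        by (simp add: has_vector_derivative_def)
    qed
    then show ?thesis by (simp add: integral_unique c0_zero[OF c0])
  qed
  have "x \<in> closure DA" using dense by simp
  then obtain X where X: "\<And>n. X n \<in> DA" "X \<longlonglongrightarrow> x" unfolding closure_sequential by blast
  obtain B where B: "\<And>n. norm (X n) \<le> B" "B > 0" using convergent_imp_Bseq[OF convergentI[OF X(2)]] by (auto simp: Bseq_def)
  obtain M where M: "M \<ge> 1" "\<And>s x. 0 \<le> s \<Longrightarrow> s \<le> t \<Longrightarrow> norm (S s x) \<le> M * norm x" by (rule S_bound) blast
  note fc = C2_continuous[OF CA_C2[OF CA], of UNIV]
  have "(\<lambda>n. f (S t (X n)) - f (X n)) \<longlonglongrightarrow> f (S t x) - f x"
    using fc X(2) bounded_linear.tendsto[OF c0_linear[OF c0 t] X(2)]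
    by (intro tendsto_diff) (auto simp: continuous_on_sequentially comp_def)
  moreover have "(\<lambda>n. \<integral>s. S s (X n) \<bullet> \<alpha> (S s (X n)) \<partial>lebI 0 t) \<longlonglongrightarrow> (\<integral>s. S s x \<bullet> \<alpha> (S s x) \<partial>lebI 0 t)"
  proof (rule integral_dominated_convergence[where w="\<lambda>_. (M * B) * D"])
    show "integrable (lebI 0 t) (\<lambda>_. (M * B) * D)" by (rule finite_measure.integrable_const[OF finite_measure_lebI])
    show "AE s in lebI 0 t. (\<lambda>n. S s (X n) \<bullet> \<alpha> (S s (X n))) \<longlonglongrightarrow> S s x \<bullet> \<alpha> (S s x)"
      by (intro AE_I2 transport_tendsto tendsto_const X) auto
    show "AE s in lebI 0 t. norm (S s (X n) \<bullet> \<alpha> (S s (X n))) \<le> (M * B) * D" for n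
    proof (rule AE_I2)
      fix s assume s: "s \<in> space (lebI 0 t)"
      have "norm (S s (X n)) \<le> M * norm (X n)" using M(2) s by simp
      also have "\<dots> \<le> M * B" using B M(1) by (intro mult_left_mono) auto
      finally have "norm (S s (X n)) \<le> M * B" .
      then have "norm (S s (X n)) * norm (\<alpha> (S s (X n))) \<le> (M * B) * D"
        using CA_bound by (intro mult_mono) (auto intro: order_trans[OF norm_ge_zero])
      then show "norm (S s (X n) \<bullet> \<alpha> (S s (X n))) \<le> (M * B) * D"
        using Cauchy_Schwarz_ineq2[of "S s (X n)" "\<alpha> (S s (X n))"] by simp
    qed
  qed (intro borel_measurable_lebI transport_continuous; simp)+
  ultimately show ?thesis
    using *[OF X(1)] LIMSEQ_unique by (simp add: integral_lebI[OF transport_continuous[OF order_refl]])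
qed

lemma P_diff:
  assumes t: "t \<ge> 0"
  shows "P t f x - f x = integral {0..t} (\<lambda>s. S s x \<bullet> \<alpha> (S s x)) + (\<integral>s. mean_moved f s (S t x) \<partial>lebI 0 t)"
proof -
  have "P t f x - f (S t x) = (\<integral>s. mean_moved f s (S t x) \<partial>lebI 0 t)"
    using dynkin_C2[OF CA_C2[OF CA]] t unfolding dynkin_def P_eq by blast
  then show ?thesis using transport_eq[OF t, of x] by linarith
qed

lemma mean_moved_tendsto:
  assumes t: "t \<longlonglongrightarrow> 0" "\<And>n. t n \<ge> 0" and s: "\<And>n. 0 \<le> s n" "\<And>n. s n \<le> t n"
  shows "(\<lambda>n. mean_moved f (s n) (S (t n) x)) \<longlonglongrightarrow> L1 f x"
  unfolding mean_moved_def
proof -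
  note f = CA_C2[OF CA]
  have s0: "s \<longlonglongrightarrow> 0" by (rule tendsto_sandwich[OF _ _ tendsto_const t(1)]) (use s in auto)
  obtain B where B: "\<And>n. \<bar>t n\<bar> \<le> B" using convergent_imp_Bseq[OF convergentI[OF t(1)]] by (auto simp: Bseq_def)
  obtain M where M: "M \<ge> 1" "\<And>s x. 0 \<le> s \<Longrightarrow> s \<le> B \<Longrightarrow> norm (S s x) \<le> M * norm x" by (rule S_bound) blast
  have sB: "s n \<le> B" for n using s(2)[of n] B[of n] by linarith
  show "(\<lambda>n. \<integral>y. moved f (s n) (S (t n) x + y) \<partial>\<mu> (s n)) \<longlonglongrightarrow> L1 f x"
  proof (rule mu_concentrates[OF s0 s(1)])
    show "(\<lambda>y. moved f (s n) (S (t n) x + y)) \<in> borel_measurable borel" for n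
      by (rule shift_measurable[OF moved_continuous[OF f s(1)]])
    show "\<bar>moved f (s n) (S (t n) x + y)\<bar> \<le> levy_const * (M\<^sup>2 * C)" for n y
      by (rule moved_bound[OF f s(1) M(2)[OF s(1) sB] M(1)])
    fix \<sigma> :: "nat \<Rightarrow> nat" and Y :: "nat \<Rightarrow> 'a" assume \<sigma>: "filterlim \<sigma> at_top sequentially" and Y: "Y \<longlonglongrightarrow> 0"
    have "(\<lambda>k. S (t (\<sigma> k)) x) \<longlonglongrightarrow> S 0 x"
      by (rule c0_joint[OF c0 filterlim_compose[OF t(1) \<sigma>] t(2) tendsto_const])
    from tendsto_add[OF this Y] have "(\<lambda>k. S (t (\<sigma> k)) x + Y k) \<longlonglongrightarrow> x" by (simp add: c0_zero[OF c0])
    from moved_tendsto[OF f filterlim_compose[OF s0 \<sigma>] s(1) this]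
    show "(\<lambda>k. moved f (s (\<sigma> k)) (S (t (\<sigma> k)) x + Y k)) \<longlonglongrightarrow> L1 f x" by (simp add: moved_0[OF f])
  qed
qed

lemma generator_limit:
  "((\<lambda>h. (P h f x - f x) / h) \<longlongrightarrow> L0 Q a \<nu> DA A f x) (at_right 0)"
  unfolding tendsto_at_iff_sequentially comp_def
proof (intro allI impI)
  fix t :: "nat \<Rightarrow> real" assume "\<forall>i. t i \<in> {0<..} - {0}" and t0: "t \<longlonglongrightarrow> 0"
  then have t: "t n > 0" for n by simp
  note f = CA_C2[OF CA]
  define u where "u = (\<lambda>s. S s x \<bullet> \<alpha> (S s x))"
  have near: "\<exists>s\<in>{0..t n}. \<bar>v n - w\<bar> \<le> \<bar>F n s - w\<bar> + 1 / real (Suc n)"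
    if v: "\<And>b. (\<And>s. s \<in> {0..t n} \<Longrightarrow> \<bar>F n s - w\<bar> \<le> b) \<Longrightarrow> \<bar>v n - w\<bar> \<le> b"
    for v :: "nat \<Rightarrow> real" and w and F :: "nat \<Rightarrow> real \<Rightarrow> real" and n
  proof (rule ccontr)
    assume "\<not> ?thesis"
    then have n: "\<not> \<bar>v n - w\<bar> \<le> \<bar>F n s - w\<bar> + 1 / real (Suc n)" if "s \<in> {0..t n}" for s using that by blast
    have "\<bar>F n s - w\<bar> \<le> \<bar>v n - w\<bar> - 1 / real (Suc n)" if "s \<in> {0..t n}" for s using n[OF that] by linarith
    from v[OF this] show False by (simp add: field_simps)
  qed
  have lim: "v \<longlonglongrightarrow> w"
    if v: "\<And>n b. (\<And>s. s \<in> {0..t n} \<Longrightarrow> \<bar>F n s - w\<bar> \<le> b) \<Longrightarrow> \<bar>v n - w\<bar> \<le> b"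
      and F: "\<And>s. (\<And>n. 0 \<le> s n) \<Longrightarrow> (\<And>n. s n \<le> t n) \<Longrightarrow> (\<lambda>n. F n (s n)) \<longlonglongrightarrow> w"
    for v :: "nat \<Rightarrow> real" and w and F :: "nat \<Rightarrow> real \<Rightarrow> real"
  proof -
    have "\<forall>n. \<exists>s\<in>{0..t n}. \<bar>v n - w\<bar> \<le> \<bar>F n s - w\<bar> + 1 / real (Suc n)"
      using near[where F=F and v=v and w=w] v by blast
    then obtain s where s: "\<And>n. s n \<in> {0..t n}" "\<And>n. \<bar>v n - w\<bar> \<le> \<bar>F n (s n) - w\<bar> + 1 / real (Suc n)" by metis
    have "(\<lambda>n. F n (s n)) \<longlonglongrightarrow> w" using F s(1) by simp
    then have "(\<lambda>n. \<bar>F n (s n) - w\<bar>) \<longlonglongrightarrow> 0" by (intro tendsto_rabs_zero LIM_zero)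
    from tendsto_add[OF this LIMSEQ_inverse_real_of_nat]
    have "(\<lambda>n. \<bar>F n (s n) - w\<bar> + 1 / real (Suc n)) \<longlonglongrightarrow> 0" by (simp add: inverse_eq_divide)
    then have "(\<lambda>n. v n - w) \<longlonglongrightarrow> 0"
      by (rule Lim_null_comparison[OF always_eventually, rotated]) (use s(2) in simp)
    then show ?thesis by (simp add: LIM_zero_iff)
  qed
  have 1: "(\<lambda>n. integral {0..t n} u / t n) \<longlonglongrightarrow> x \<bullet> \<alpha> x"
  proof (rule lim[where F="\<lambda>n s. u s"])
    fix n b assume b: "\<And>s. s \<in> {0..t n} \<Longrightarrow> \<bar>u s - x \<bullet> \<alpha> x\<bar> \<le> b"
    have "\<bar>integral {0..t n} u - (t n - 0) * (x \<bullet> \<alpha> x)\<bar> \<le> (t n - 0) * b"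
      by (rule integral_minus_const_bound) (use t[of n] b transport_continuous[of 0 "t n" x] in \<open>auto simp: u_def\<close>)
    moreover have "integral {0..t n} u - (t n - 0) * (x \<bullet> \<alpha> x) = t n * (integral {0..t n} u / t n - x \<bullet> \<alpha> x)"
      using t[of n] by (simp add: field_simps)
    ultimately show "\<bar>integral {0..t n} u / t n - x \<bullet> \<alpha> x\<bar> \<le> b" using t[of n] by (simp add: abs_mult)
  next
    fix s assume s: "\<And>n. 0 \<le> s n" "\<And>n. s n \<le> t n"
    have "s \<longlonglongrightarrow> 0" by (rule tendsto_sandwich[OF _ _ tendsto_const t0]) (use s in auto)
    from transport_tendsto[OF this s(1) tendsto_const, of x] show "(\<lambda>n. u (s n)) \<longlonglongrightarrow> x \<bullet> \<alpha> x"
      by (simp add: u_def c0_zero[OF c0])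
  qed
  have 2: "(\<lambda>n. (\<integral>s. mean_moved f s (S (t n) x) \<partial>lebI 0 (t n)) / t n) \<longlonglongrightarrow> L1 f x"
  proof (rule lim[where F="\<lambda>n s. mean_moved f s (S (t n) x)"])
    fix n b assume b: "\<And>s. s \<in> {0..t n} \<Longrightarrow> \<bar>mean_moved f s (S (t n) x) - L1 f x\<bar> \<le> b"
    interpret finite_measure "lebI 0 (t n)" by (rule finite_measure_lebI)
    have m: "measure (lebI 0 (t n)) {0..t n} = t n" using measure_lebI[of 0 "t n"] t[of n] by simp
    have "(\<lambda>s. mean_moved f s (S (t n) x)) \<in> borel_measurable (lebI 0 (t n))"
      using dynkin_C2[OF f] t[of n] unfolding dynkin_def by (simp add: less_imp_le)
    then have i: "integrable (lebI 0 (t n)) (\<lambda>s. mean_moved f s (S (t n) x))" by (rule mean_moved_integrable[OF f])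
    have "\<bar>\<integral>s. mean_moved f s (S (t n) x) - L1 f x \<partial>lebI 0 (t n)\<bar> \<le> (\<integral>s. \<bar>mean_moved f s (S (t n) x) - L1 f x\<bar> \<partial>lebI 0 (t n))"
      by (rule integral_abs_bound)
    also have "\<dots> \<le> (\<integral>s. b \<partial>lebI 0 (t n))"
      by (rule integral_mono) (use i b in auto)
    also have "\<dots> = t n * b" using m by simp
    also have "(\<integral>s. mean_moved f s (S (t n) x) - L1 f x \<partial>lebI 0 (t n)) =
        t n * ((\<integral>s. mean_moved f s (S (t n) x) \<partial>lebI 0 (t n)) / t n - L1 f x)"
      using i m t[of n] by (simp add: field_simps)
    finally show "\<bar>(\<integral>s. mean_moved f s (S (t n) x) \<partial>lebI 0 (t n)) / t n - L1 f x\<bar> \<le> b"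
      using t[of n] by (simp add: abs_mult)
  next
    fix s assume "\<And>n. 0 \<le> s n" "\<And>n. s n \<le> t n"
    then show "(\<lambda>n. mean_moved f (s n) (S (t n) x)) \<longlonglongrightarrow> L1 f x"
      using t by (intro mean_moved_tendsto t0) (auto intro: less_imp_le)
  qed
  have "(P (t n) f x - f x) / t n = integral {0..t n} u / t n + (\<integral>s. mean_moved f s (S (t n) x) \<partial>lebI 0 (t n)) / t n" for n
    using P_diff[of "t n" x] t[of n] by (simp add: u_def add_divide_distrib)
  then show "(\<lambda>n. (P (t n) f x - f x) / t n) \<longlonglongrightarrow> L0 Q a \<nu> DA A f x"
    using tendsto_add[OF 1 2] by (simp add: CA_L0)
qed

lemma P_diff_bound:
  assumes drift: "\<And>x. \<bar>x \<bullet> \<alpha> x\<bar> \<le> B"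
  shows "\<exists>K. \<forall>h>0. \<forall>x. \<bar>P h f x - f x\<bar> \<le> h * K"
proof -
  note f = CA_C2[OF CA]
  obtain M where M: "M \<ge> 1" "\<And>s x. 0 \<le> s \<Longrightarrow> s \<le> 1 \<Longrightarrow> norm (S s x) \<le> M * norm x" by (rule S_bound) blast
  define K where "K = B + levy_const * (M\<^sup>2 * C) + 2 * C"
  have B: "0 \<le> B" using drift[of 0] by simp
  have LC: "0 \<le> levy_const * (M\<^sup>2 * C)" using levy_const_nonneg C2_nonneg[OF f] by simp
  have "\<bar>P h f x - f x\<bar> \<le> h * K" if h: "h > 0" for h x
  proof (cases "h \<le> 1")
    case True
    interpret finite_measure "lebI 0 h" by (rule finite_measure_lebI)
    have m: "measure (lebI 0 h) {0..h} = h" using measure_lebI[of 0 h] h by simp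
    have "\<bar>integral {0..h} (\<lambda>s. S s x \<bullet> \<alpha> (S s x)) - (h - 0) * 0\<bar> \<le> (h - 0) * B"
      by (rule integral_minus_const_bound) (use h drift transport_continuous in auto)
    then have "\<bar>integral {0..h} (\<lambda>s. S s x \<bullet> \<alpha> (S s x))\<bar> \<le> h * B" by simp
    moreover have "\<bar>\<integral>s. mean_moved f s (S h x) \<partial>lebI 0 h\<bar> \<le> h * (levy_const * (M\<^sup>2 * C))"
    proof -
      have "(\<lambda>s. mean_moved f s (S h x)) \<in> borel_measurable (lebI 0 h)"
        using dynkin_C2[OF f] h unfolding dynkin_def by (simp add: less_imp_le)
      then have i: "integrable (lebI 0 h) (\<lambda>s. mean_moved f s (S h x))" by (rule mean_moved_integrable[OF f])
      have "\<bar>\<integral>s. mean_moved f s (S h x) \<partial>lebI 0 h\<bar> \<le> (\<integral>s. \<bar>mean_moved f s (S h x)\<bar> \<partial>lebI 0 h)" by (rule integral_abs_bound)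
      also have "\<dots> \<le> (\<integral>s. levy_const * (M\<^sup>2 * C) \<partial>lebI 0 h)"
        by (rule integral_mono) (use i True mean_moved_bound[OF f _ M(2) M(1)] in auto)
      finally show ?thesis using m by simp
    qed
    ultimately have "\<bar>P h f x - f x\<bar> \<le> h * B + h * (levy_const * (M\<^sup>2 * C))"
      using P_diff[OF less_imp_le[OF h], of x] by linarith
    also have "\<dots> \<le> h * K" using h C2_nonneg[OF f] by (simp add: K_def distrib_left)
    finally show ?thesis .
  next
    case False
    have "\<bar>P h f x - f x\<bar> \<le> 2 * C"
      using P_abs_le[OF less_imp_le[OF h] C2_continuous[OF f] C2_abs[OF f], of x] C2_abs[OF f, of x] by linarith
    also have "\<dots> \<le> 1 * K" using B LC by (simp add: K_def)
    also have "\<dots> \<le> h * K" using False B LC C2_nonneg[OF f] by (intro mult_right_mono) (auto simp: K_def)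
    finally show ?thesis .
  qed
  then show ?thesis by blast
qed

lemma D0_tildeI:
  assumes g: "g' \<in> bcontfun" and lim: "\<And>x. ((\<lambda>h. (P h f x - f x) / h) \<longlongrightarrow> g' x) (at_right 0)"
  shows "f \<in> D0_tilde DA A"
proof -
  note f = CA_C2[OF CA]
  have eq: "g' x = x \<bullet> \<alpha> x + L1 f x" for x
    using tendsto_unique[OF _ lim generator_limit] by (simp add: CA_L0)
  obtain B where B: "\<And>x. norm (g' x) \<le> B" using bcontfun_bound[OF g] by blast
  have "(\<lambda>x. x \<bullet> adj_op DA A (grad f x)) = (\<lambda>x. g' x - L1 f x)"
    by (auto simp: eq C2_grad[OF f] CA_adj)
  also have "\<dots> \<in> bcontfun"
  proof (rule bcontfunI')
    show "continuous_on UNIV (\<lambda>x. g' x - L1 f x)"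
      by (intro continuous_on_diff bcontfun_continuous[OF g] L1_continuous[OF f])
    show "norm (g' x - L1 f x) \<le> B + levy_const * C" for x
      using B[of x] L1_bound[OF f, of x] by (simp add: abs_le_iff)
  qed
  finally show ?thesis using CA_in_CA2[OF CA] by (simp add: D0_tilde_def)
qed

end

lemma supnorm_le: "(\<And>x. norm (f x) \<le> C) \<Longrightarrow> supnorm f \<le> C"
  unfolding supnorm_def by (rule cSUP_least) auto

lemma abs_le_supnorm:
  fixes f :: "'b \<Rightarrow> real"
  assumes "\<And>x. \<bar>f x\<bar> \<le> C" shows "\<bar>f x\<bar> \<le> supnorm f"
  unfolding supnorm_def using assms by (intro cSUP_upper2[where x=x]) (auto intro: bdd_aboveI2[where M=C])

lemma ou_generatorI:
  assumes f: "f \<in> bcontfun" and g: "g \<in> bcontfun"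
    and lim: "\<And>x. ((\<lambda>h. (P h f x - f x) / h) \<longlongrightarrow> g x) (at_right 0)"
    and K: "\<And>h x. h > 0 \<Longrightarrow> \<bar>P h f x - f x\<bar> \<le> h * K"
  shows "f \<in> gen_dom P" "gen P f = g"
proof -
  have "supnorm (\<lambda>x. P h f x - f x) / h \<le> K" if "h > 0" for h
    using supnorm_le[of "\<lambda>x. P h f x - f x" "h * K"] K[OF that] that by (simp add: field_simps)
  then have "bdd_above ((\<lambda>h. supnorm (\<lambda>x. P h f x - f x) / h) ` {0<..})"
    by (intro bdd_aboveI2[where M=K]) auto
  then show "f \<in> gen_dom P" using f g lim by (auto simp: gen_dom_def)
  show "gen P f = g" unfolding gen_def using tendsto_Lim[OF trivial_limit_at_right_real lim] by auto
qed

lemma D0_tilde_gen: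
  assumes "f \<in> D0_tilde DA A"
  shows "f \<in> gen_dom P" "gen P f = L0 Q a \<nu> DA A f"
proof -
  have f2: "f \<in> CA2 DA A" and d: "(\<lambda>x. x \<bullet> adj_op DA A (grad f x)) \<in> bcontfun"
    using assms by (auto simp: D0_tilde_def)
  obtain C D where CA: "CA f (grad f) (hess f) C (\<lambda>x. adj_op DA A (grad f x)) D" using CA2_CA[OF f2] .
  note f = CA_C2[OF CA]
  obtain B where B: "\<And>x. norm (x \<bullet> adj_op DA A (grad f x)) \<le> B" using bcontfun_bound[OF d] by blast
  then obtain K where K: "\<And>h x. h > 0 \<Longrightarrow> \<bar>P h f x - f x\<bar> \<le> h * K"
  proof -
    have "\<exists>K. \<forall>h>0. \<forall>x. \<bar>P h f x - f x\<bar> \<le> h * K"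
      by (rule P_diff_bound[OF CA, of B]) (use B in simp)
    then show thesis using that by blast
  qed
  have "L0 Q a \<nu> DA A f \<in> bcontfun"
  proof (rule bcontfunI')
    show "continuous_on UNIV (L0 Q a \<nu> DA A f)"
      unfolding L0_eq[abs_def] by (intro continuous_on_add bcontfun_continuous[OF d] L1_continuous[OF f])
    show "norm (L0 Q a \<nu> DA A f x) \<le> B + levy_const * C" for x
      unfolding L0_eq using norm_triangle_mono[OF B[of x], of "L1 f x" "levy_const * C"] L1_bound[OF f, of x] by simp
  qed
  moreover have "f \<in> bcontfun" using C2_abs[OF f] C2_continuous[OF f] by (intro bcontfunI') auto
  ultimately show "f \<in> gen_dom P" "gen P f = L0 Q a \<nu> DA A f"
    using ou_generatorI[OF _ _ generator_limit[OF CA] K] by blast+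
qed

end

section \<open>Invariance and the two cores\<close>

context ou_data
begin

lemma CA_add:
  assumes f: "CA f g T C \<alpha> D" and f': "CA f' g' T' C' \<alpha>' D'"
  shows "CA (\<lambda>x. f x + f' x) (\<lambda>x. g x + g' x) (\<lambda>x v. T x v + T' x v) (C + C') (\<lambda>x. \<alpha> x + \<alpha>' x) (D + D')"
  unfolding CA_def
proof (intro conjI allI)
  show "norm (\<alpha> x + \<alpha>' x) \<le> D + D'" for x
    using norm_triangle_mono[OF CA_bound[OF f] CA_bound[OF f']] .
qed (use CA_dom[OF f] CA_dom[OF f'] CA_adj[OF f] CA_adj[OF f'] in
    \<open>auto intro!: C2_add CA_C2[OF f] CA_C2[OF f'] adj_op_add continuous_on_add CA_cont[OF f] CA_cont[OF f'] simp: adj_op_add\<close>)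

lemma CA_scale:
  assumes f: "CA f g T C \<alpha> D"
  shows "CA (\<lambda>x. c * f x) (\<lambda>x. c *\<^sub>R g x) (\<lambda>x v. c *\<^sub>R T x v) (\<bar>c\<bar> * C) (\<lambda>x. c *\<^sub>R \<alpha> x) (\<bar>c\<bar> * D)"
  unfolding CA_def
  using CA_dom[OF f] CA_adj[OF f] CA_bound[OF f]
  by (auto intro!: C2_scale CA_C2[OF f] adj_op_scale continuous_intros CA_cont[OF f] mult_left_mono simp: adj_op_scale)

lemma CA_wave:
  assumes h: "h \<in> adj_dom DA A"
  shows "CA (wave h c) (\<lambda>x. (- sin (x \<bullet> h + c)) *\<^sub>R h) (\<lambda>x v. (v \<bullet> h) *\<^sub>R ((- cos (x \<bullet> h + c)) *\<^sub>R h)) ((1 + norm h)\<^sup>2)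
    (\<lambda>x. (- sin (x \<bullet> h + c)) *\<^sub>R adj_op DA A h) (norm (adj_op DA A h))"
  unfolding CA_def
proof (intro conjI allI)
  show "norm ((- sin (x \<bullet> h + c)) *\<^sub>R adj_op DA A h) \<le> norm (adj_op DA A h)" for x
  proof -
    have "\<bar>- sin (x \<bullet> h + c)\<bar> * norm (adj_op DA A h) \<le> 1 * norm (adj_op DA A h)" by (intro mult_right_mono) auto
    then show ?thesis by simp
  qed
  show "continuous_on UNIV (\<lambda>x. (- sin (x \<bullet> h + c)) *\<^sub>R adj_op DA A h)" by (intro continuous_intros)
qed (use adj_op_scale[OF h] in \<open>blast intro: C2_wave\<close>)+

lemma CA_integral:
  fixes f :: "'b \<Rightarrow> 'a \<Rightarrow> real"
  assumes M: "finite_measure M" and f: "\<And>\<omega>. \<omega> \<in> space M \<Longrightarrow> CA (f \<omega>) (g \<omega>) (T \<omega>) C (\<alpha> \<omega>) D"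
    and m: "\<And>x. (\<lambda>\<omega>. f \<omega> x) \<in> borel_measurable M" and C: "0 \<le> C" "0 \<le> D"
  shows "\<exists>g' T' \<alpha>'. CA (\<lambda>x. \<integral>\<omega>. f \<omega> x \<partial>M) g' T' (C * measure M (space M)) \<alpha>' (D * measure M (space M))"
proof -
  interpret finite_measure M by fact
  note ci = C2_integral[OF M CA_C2[OF f] m C(1)]
  have ma: "(\<lambda>\<omega>. v \<bullet> \<alpha> \<omega> x) \<in> borel_measurable M" for v x
  proof -
    have "v \<in> closure DA" using dense by simp
    then obtain V where V: "\<And>n. V n \<in> DA" "V \<longlonglongrightarrow> v" unfolding closure_sequential by blast
    show ?thesis
    proof (rule borel_measurable_LIMSEQ_real)
      show "(\<lambda>n. V n \<bullet> \<alpha> \<omega> x) \<longlonglongrightarrow> v \<bullet> \<alpha> \<omega> x" for \<omega> by (intro tendsto_intros V)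
      have "V n \<bullet> \<alpha> \<omega> x = A (V n) \<bullet> g \<omega> x" if "\<omega> \<in> space M" for n \<omega>
        using adj_op_inner[OF CA_dom[OF f[OF that]] V(1)] CA_adj[OF f[OF that]] by metis
      then show "(\<lambda>\<omega>. V n \<bullet> \<alpha> \<omega> x) \<in> borel_measurable M" for n
        using ci(1)[of "A (V n)" x] by (subst measurable_cong) auto
    qed
  qed
  note ab = CA_bound[OF f] and gb = C2_norm[OF CA_C2[OF f]]
  have "CA (\<lambda>x. \<integral>\<omega>. f \<omega> x \<partial>M) (\<lambda>x. wint M (\<lambda>\<omega>. g \<omega> x)) (\<lambda>x v. wint M (\<lambda>\<omega>. T \<omega> x v)) (C * measure M (space M))
     (\<lambda>x. wint M (\<lambda>\<omega>. \<alpha> \<omega> x)) (D * measure M (space M))"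
    unfolding CA_def
  proof (intro conjI allI ci(3))
    fix x
    have "A y \<bullet> wint M (\<lambda>\<omega>. g \<omega> x) = y \<bullet> wint M (\<lambda>\<omega>. \<alpha> \<omega> x)" if y: "y \<in> DA" for y
    proof -
      have "A y \<bullet> wint M (\<lambda>\<omega>. g \<omega> x) = (\<integral>\<omega>. A y \<bullet> g \<omega> x \<partial>M)" by (rule inner_wint[OF M ci(1) gb])
      also have "\<dots> = (\<integral>\<omega>. y \<bullet> \<alpha> \<omega> x \<partial>M)"
      proof (rule Bochner_Integration.integral_cong[OF refl])
        fix \<omega> assume w: "\<omega> \<in> space M"
        show "A y \<bullet> g \<omega> x = y \<bullet> \<alpha> \<omega> x" using adj_op_inner[OF CA_dom[OF f[OF w]] y] CA_adj[OF f[OF w]] by metis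
      qed
      also have "\<dots> = y \<bullet> wint M (\<lambda>\<omega>. \<alpha> \<omega> x)" by (rule inner_wint[OF M ma ab, symmetric])
      finally show ?thesis .
    qed
    from adj_opI[OF this] show "wint M (\<lambda>\<omega>. g \<omega> x) \<in> adj_dom DA A"
      "adj_op DA A (wint M (\<lambda>\<omega>. g \<omega> x)) = wint M (\<lambda>\<omega>. \<alpha> \<omega> x)" by auto
    have "norm (wint M (\<lambda>\<omega>. \<alpha> \<omega> x)) \<le> (\<integral>\<omega>. D \<partial>M)" by (rule norm_wint_le[OF M ma ab]) (use ab in auto)
    then show "norm (wint M (\<lambda>\<omega>. \<alpha> \<omega> x)) \<le> D * measure M (space M)" by (simp add: mult.commute)
  next
    show "continuous_on UNIV (\<lambda>x. wint M (\<lambda>\<omega>. \<alpha> \<omega> x))" by (rule continuous_wint[OF M ma ab CA_cont[OF f]])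
  qed
  then show ?thesis by blast
qed

lemma CA_affine:
  assumes f: "CA f g T C \<alpha> D" and t: "0 \<le> t" and M: "\<And>x. norm (S t x) \<le> M * norm x" "1 \<le> M"
  shows "CA (\<lambda>x. f (w + S t x)) (\<lambda>x. Sadj t (g (w + S t x))) (\<lambda>x v. Sadj t (T (w + S t x) (S t v))) (M\<^sup>2 * C)
    (\<lambda>x. Sadj t (\<alpha> (w + S t x))) (M * D)"
proof -
  have adj: "adjoint (S t) = Sadj t" by (rule adjoint_unique) (simp add: semigroup_adjoint[OF t])
  have M0: "0 \<le> M" using M(2) by simp
  show ?thesis
    unfolding CA_def
  proof (intro conjI allI)
    show "C2 (\<lambda>x. f (w + S t x)) (\<lambda>x. Sadj t (g (w + S t x))) (\<lambda>x v. Sadj t (T (w + S t x) (S t v))) (M\<^sup>2 * C)"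
      using C2_affine[OF CA_C2[OF f] c0_linear[OF c0 t] M, of w] by (simp add: adj)
    show "Sadj t (g (w + S t x)) \<in> adj_dom DA A"
      "adj_op DA A (Sadj t (g (w + S t x))) = Sadj t (\<alpha> (w + S t x))" for x
      using gen_commute[OF gen_adj CA_dom[OF f] t] CA_adj[OF f] by auto
    have "continuous_on UNIV (\<lambda>x. \<alpha> (w + S t x))"
      by (rule continuous_on_compose2[OF CA_cont[OF f]])
        (rule continuous_on_add[OF continuous_on_const linear_continuous_on[OF c0_linear[OF c0 t]]], simp)
    then show "continuous_on UNIV (\<lambda>x. Sadj t (\<alpha> (w + S t x)))"
      by (rule bounded_linear.continuous_on[OF c0_linear[OF c0_adj t]])
    show "norm (Sadj t (\<alpha> (w + S t x))) \<le> M * D" for x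
      using norm_adjoint_le[OF c0_linear[OF c0 t] M(1) M0, of "\<alpha> (w + S t x)"]
        mult_left_mono[OF CA_bound[OF f, of "w + S t x"] M0] by (simp add: adj)
  qed
qed

lemma CA_P:
  assumes f: "CA f g T C \<alpha> D" and t: "0 \<le> t" and M: "\<And>x. norm (S t x) \<le> M * norm x" "1 \<le> M"
  shows "\<exists>g' T' \<alpha>'. CA (P t f) g' T' (M\<^sup>2 * C) \<alpha>' (M * D)"
proof -
  interpret prob_space "\<mu> t" by (rule mu_prob[OF t])
  have D: "0 \<le> D" using CA_bound[OF f, of 0] norm_ge_zero order_trans by blast
  have 0: "0 \<le> M\<^sup>2 * C" "0 \<le> M * D" using M(2) D C2_nonneg[OF CA_C2[OF f]] by auto
  have m: "(\<lambda>y. f (y + S t x)) \<in> borel_measurable (\<mu> t)" for x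
    using mu_measurable[OF t shift_measurable[OF C2_continuous[OF CA_C2[OF f]], of "S t x"]] by (simp add: add.commute)
  have "P t f = (\<lambda>x. \<integral>y. f (y + S t x) \<partial>\<mu> t)" by (auto simp: P_eq add.commute)
  then show ?thesis
    using CA_integral[OF finite_measure_axioms CA_affine[OF f t M] m 0] by (simp add: prob_space)
qed

lemma P_pi_tendsto:
  assumes t: "t \<ge> 0" "s \<ge> 0" and f: "\<And>n. continuous_on UNIV (f n)" "\<And>n x. \<bar>f n x\<bar> \<le> C" "\<And>x. (\<lambda>n. f n x) \<longlonglongrightarrow> f' x"
  shows "(\<lambda>n. P s (P t (f n)) x) \<longlonglongrightarrow> P s (P t f') x"
  using t f by (intro P_tendsto[where C=C] P_continuous[where C=C] P_abs_le P_tendsto) auto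

lemma trig_adj_approx:
  assumes "f \<in> bcontfun"
  shows "\<exists>C g. (\<forall>n. g n \<in> trig (adj_dom DA A)) \<and> (\<forall>n x. \<bar>g n x\<bar> \<le> C) \<and> (\<forall>x. (\<lambda>n. g n x) \<longlonglongrightarrow> f x)"
proof -
  obtain C where C: "\<And>x. norm (f x) \<le> C" using bcontfun_bound[OF assms] by blast
  show ?thesis
  proof (rule trig_approx[OF adj_dom_subspace dense_adj bcontfun_continuous[OF assms], of C])
    show "\<bar>f x\<bar> \<le> C" for x using C[of x] by simp
    fix g assume "\<And>n. g n \<in> trig (adj_dom DA A)" "\<And>n x. \<bar>g n x\<bar> \<le> C + 1" "\<And>x. (\<lambda>n. g n x) \<longlonglongrightarrow> f x"
    then show ?thesis by (intro exI[of _ "C + 1"] exI[of _ g]) simp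
  qed
qed

lemma P_bcontfun: "t \<ge> 0 \<Longrightarrow> f \<in> bcontfun \<Longrightarrow> P t f \<in> bcontfun"
proof -
  assume t: "t \<ge> 0" and f: "f \<in> bcontfun"
  obtain C where C: "\<And>x. norm (f x) \<le> C" using bcontfun_bound[OF f] by blast
  show ?thesis
    using P_continuous[OF t bcontfun_continuous[OF f], of C] P_abs_le[OF t bcontfun_continuous[OF f], of C] C
    by (intro bcontfunI'[where C=C]) auto
qed

lemma P_commute_trig:
  assumes "f \<in> trig V" "s \<ge> 0" "t \<ge> 0"
  shows "P s (P t f) x = P (s + t) f x"
  using assms(1)
proof (induction arbitrary: x rule: trig_induct)
  case zero
  then show ?case by (simp add: P_eq)
next
  case (cons b h c f)
  have w: "wave h c \<in> bcontfun" using abs_wave_le continuous_wave by (intro bcontfunI') auto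
  have f: "f \<in> bcontfun" by (rule trig_bcontfun[OF cons(2)])
  have "P t (\<lambda>x. b * wave h c x + f x) = (\<lambda>x. b * P t (wave h c) x + P t f x)"
    using P_linear[OF assms(3) w f] by blast
  then show ?case
    using P_linear[OF assms(2) P_bcontfun[OF assms(3) w] P_bcontfun[OF assms(3) f]] assms(2,3)
    by (simp add: P_commute_wave cons P_linear[OF _ w f])
qed

lemma P_semigroup:
  assumes f: "f \<in> bcontfun" and s: "s \<ge> 0" and t: "t \<ge> 0"
  shows "P s (P t f) x = P (s + t) f x"
proof -
  obtain C and g :: "nat \<Rightarrow> 'a \<Rightarrow> real" where g: "\<And>n. g n \<in> trig (adj_dom DA A)" "\<And>n x. \<bar>g n x\<bar> \<le> C" "\<And>x. (\<lambda>n. g n x) \<longlonglongrightarrow> f x"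
    using trig_adj_approx[OF f] by blast
  note c = bcontfun_continuous[OF trig_bcontfun[OF g(1)]]
  have "(\<lambda>n. P s (P t (g n)) x) \<longlonglongrightarrow> P s (P t f) x" by (rule P_pi_tendsto[OF t s c g(2,3)])
  moreover have "(\<lambda>n. P (s + t) (g n) x) \<longlonglongrightarrow> P (s + t) f x"
    by (rule P_tendsto[OF _ c g(2,3)]) (use s t in simp)
  ultimately show ?thesis using P_commute_trig[OF g(1) s t] LIMSEQ_unique by simp
qed

lemma gen_dom_limit:
  assumes "f \<in> gen_dom P"
  shows "f \<in> bcontfun" "gen P f \<in> bcontfun" "((\<lambda>h. (P h f x - f x) / h) \<longlongrightarrow> gen P f x) (at_right 0)"
    "\<exists>K. \<forall>h>0. \<forall>x. \<bar>P h f x - f x\<bar> \<le> h * K"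
proof -
  show f: "f \<in> bcontfun" using assms by (simp add: gen_dom_def)
  obtain g where g: "g \<in> bcontfun" "\<And>x. ((\<lambda>h. (P h f x - f x) / h) \<longlongrightarrow> g x) (at_right 0)"
    using assms by (auto simp: gen_dom_def)
  have "gen P f = g" unfolding gen_def using tendsto_Lim[OF trivial_limit_at_right_real g(2)] by auto
  then show "gen P f \<in> bcontfun" "((\<lambda>h. (P h f x - f x) / h) \<longlongrightarrow> gen P f x) (at_right 0)" using g by auto
  obtain C where C: "\<And>x. norm (f x) \<le> C" using bcontfun_bound[OF f] by blast
  have "bdd_above ((\<lambda>h. supnorm (\<lambda>x. P h f x - f x) / h) ` {0<..})" using assms by (simp add: gen_dom_def)
  then obtain K where K: "\<And>h. h > 0 \<Longrightarrow> supnorm (\<lambda>x. P h f x - f x) / h \<le> K" by (auto simp: bdd_above_def)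
  have "\<bar>P h f x - f x\<bar> \<le> h * K" if h: "h > 0" for h x
  proof -
    have "\<bar>P h f x - f x\<bar> \<le> 2 * C" for x
      using P_abs_le[OF less_imp_le[OF h] bcontfun_continuous[OF f], of C x] C[of x] C unfolding real_norm_def by fastforce
    then have "\<bar>P h f x - f x\<bar> \<le> supnorm (\<lambda>x. P h f x - f x)" by (rule abs_le_supnorm)
    also have "\<dots> \<le> h * K" using K[OF h] h by (simp add: field_simps)
    finally show ?thesis .
  qed
  then show "\<exists>K. \<forall>h>0. \<forall>x. \<bar>P h f x - f x\<bar> \<le> h * K" by blast
qed

text \<open>
  The bound on the drift part of \<open>f\<close> does not carry over to \<open>P t f\<close> directly, since \<open>Y\<close> need
  not be integrable; instead \<open>P t\<close> commutes with the generator.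
\<close>
lemma P_D0_tilde:
  assumes f: "f \<in> D0_tilde DA A" and t: "t \<ge> 0"
  shows "P t f \<in> D0_tilde DA A"
proof -
  have "f \<in> CA2 DA A" using f by (simp add: D0_tilde_def)
  then obtain C D where CA: "CA f (grad f) (hess f) C (\<lambda>x. adj_op DA A (grad f x)) D" by (rule CA2_CA)
  obtain M where M: "M \<ge> 1" "\<And>s x. 0 \<le> s \<Longrightarrow> s \<le> t \<Longrightarrow> norm (S s x) \<le> M * norm x" by (rule S_bound) blast
  obtain g' T' \<alpha>' where CA': "CA (P t f) g' T' (M\<^sup>2 * C) \<alpha>' (M * D)"
    using CA_P[OF CA t M(2)[OF t order_refl] M(1)] by blast
  note gd = gen_dom_limit[OF D0_tilde_gen(1)[OF f]]
  obtain K where K: "\<And>h x. h > 0 \<Longrightarrow> \<bar>P h f x - f x\<bar> \<le> h * K" using gd(4) by blast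
  show ?thesis
  proof (rule D0_tildeI[OF CA' P_bcontfun[OF t gd(2)]])
    fix x
    show "((\<lambda>h. (P h (P t f) x - P t f x) / h) \<longlongrightarrow> P t (gen P f) x) (at_right 0)"
      unfolding tendsto_at_iff_sequentially comp_def
    proof (intro allI impI)
      fix h :: "nat \<Rightarrow> real" assume "\<forall>i. h i \<in> {0<..} - {0}" and h0: "h \<longlonglongrightarrow> 0"
      then have h: "h n > 0" for n by simp
      define d where "d n y = (P (h n) f y - f y) / h n" for n y
      have Pf: "P (h n) f \<in> bcontfun" for n by (rule P_bcontfun[OF less_imp_le[OF h] gd(1)])
      have dl: "(\<lambda>n. d n y) \<longlonglongrightarrow> gen P f y" for y
        using gd(3)[of y] h h0 unfolding tendsto_at_iff_sequentially comp_def d_def by fastforce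
      have db: "\<bar>d n y\<bar> \<le> K" for n y
        using K[OF h, of n y] h[of n] by (simp add: d_def field_simps)
      have dc: "continuous_on UNIV (d n)" for n
        unfolding d_def using h[of n]
        by (intro continuous_intros bcontfun_continuous[OF Pf] bcontfun_continuous[OF gd(1)]) auto
      have eq: "P t (d n) x = (P (h n) (P t f) x - P t f x) / h n" for n
      proof -
        have "P t (\<lambda>y. (- 1) * f y + P (h n) f y) x = (- 1) * P t f x + P t (P (h n) f) x"
          by (rule P_linear[OF t gd(1) Pf])
        moreover have "P t (P (h n) f) x = P (h n) (P t f) x"
          using P_semigroup[OF gd(1) t less_imp_le[OF h]] P_semigroup[OF gd(1) less_imp_le[OF h] t] by (simp add: add.commute)
        moreover have "d n = (\<lambda>y. ((- 1) * f y + P (h n) f y) / h n)" by (auto simp: d_def)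
        ultimately show ?thesis by (simp add: P_eq)
      qed
      show "(\<lambda>n. (P (h n) (P t f) x - P t f x) / h n) \<longlonglongrightarrow> P t (gen P f) x"
        unfolding eq[symmetric] by (rule P_tendsto[OF t dc db dl])
    qed
  qed
qed

lemma fun_subspace_D0_tilde: "fun_subspace (D0_tilde DA A)"
  unfolding fun_subspace_def
proof (intro conjI ballI allI)
  have dec: "\<exists>g T C \<alpha> D B. CA f g T C \<alpha> D \<and> continuous_on UNIV (\<lambda>x. x \<bullet> \<alpha> x) \<and> (\<forall>x. \<bar>x \<bullet> \<alpha> x\<bar> \<le> B)"
    if f: "f \<in> D0_tilde DA A" for f
  proof -
    have f2: "f \<in> CA2 DA A" and d: "(\<lambda>x. x \<bullet> adj_op DA A (grad f x)) \<in> bcontfun"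
      using f by (auto simp: D0_tilde_def)
    obtain C D where CA: "CA f (grad f) (hess f) C (\<lambda>x. adj_op DA A (grad f x)) D" using CA2_CA[OF f2] .
    obtain B where B: "\<And>x. norm (x \<bullet> adj_op DA A (grad f x)) \<le> B" using bcontfun_bound[OF d] by blast
    show ?thesis
      using CA B bcontfun_continuous[OF d, of UNIV]
      by (intro exI[of _ "grad f"] exI[of _ "hess f"] exI[of _ C] exI[of _ "\<lambda>x. adj_op DA A (grad f x)"] exI[of _ D] exI[of _ B]) auto
  qed
  have comp: "f \<in> D0_tilde DA A"
    if f: "CA f g T C \<alpha> D" and c: "continuous_on UNIV (\<lambda>x. x \<bullet> \<alpha> x)" "\<And>x. \<bar>x \<bullet> \<alpha> x\<bar> \<le> B" for f g T C \<alpha> D B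
  proof -
    have "(\<lambda>x. x \<bullet> adj_op DA A (grad f x)) = (\<lambda>x. x \<bullet> \<alpha> x)"
      by (auto simp: C2_grad[OF CA_C2[OF f]] CA_adj[OF f])
    moreover have "(\<lambda>x. x \<bullet> \<alpha> x) \<in> bcontfun" using c by (intro bcontfunI') auto
    ultimately show ?thesis using CA_in_CA2[OF f] by (simp add: D0_tilde_def)
  qed
  have z: "0 \<in> adj_dom DA A" by (rule subspace_0[OF adj_dom_subspace])
  have a0: "adj_op DA A 0 = 0" by (rule adj_opI(2)) simp
  have w: "wave 0 0 = (\<lambda>x. 1)" by (auto simp: wave_def)
  show "(\<lambda>x. 0) \<in> D0_tilde DA A"
    using comp[OF CA_scale[OF CA_wave[OF z, of 0], of 0], of 0] by (simp add: a0)
  show "(\<lambda>x. f x + f' x) \<in> D0_tilde DA A" if f: "f \<in> D0_tilde DA A" and f': "f' \<in> D0_tilde DA A" for f f'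
  proof -
    obtain g T C \<alpha> D B where 1: "CA f g T C \<alpha> D" "continuous_on UNIV (\<lambda>x. x \<bullet> \<alpha> x)" "\<And>x. \<bar>x \<bullet> \<alpha> x\<bar> \<le> B" using dec[OF f] by blast
    obtain g' T' C' \<alpha>' D' B' where 2: "CA f' g' T' C' \<alpha>' D'" "continuous_on UNIV (\<lambda>x. x \<bullet> \<alpha>' x)" "\<And>x. \<bar>x \<bullet> \<alpha>' x\<bar> \<le> B'" using dec[OF f'] by blast
    have "\<bar>x \<bullet> (\<alpha> x + \<alpha>' x)\<bar> \<le> B + B'" for x using 1(3)[of x] 2(3)[of x] by (simp add: inner_add_right)
    then show ?thesis by (intro comp[OF CA_add[OF 1(1) 2(1)]]) (auto simp: inner_add_right intro!: continuous_on_add 1 2)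
  qed
  show "(\<lambda>x. c * f x) \<in> D0_tilde DA A" if f: "f \<in> D0_tilde DA A" for c f
  proof -
    obtain g T C \<alpha> D B where 1: "CA f g T C \<alpha> D" "continuous_on UNIV (\<lambda>x. x \<bullet> \<alpha> x)" "\<And>x. \<bar>x \<bullet> \<alpha> x\<bar> \<le> B" using dec[OF f] by blast
    have "\<bar>x \<bullet> c *\<^sub>R \<alpha> x\<bar> \<le> \<bar>c\<bar> * B" for x using 1(3)[of x] by (simp add: abs_mult mult_left_mono)
    then show ?thesis by (intro comp[OF CA_scale[OF 1(1)]]) (auto intro!: continuous_intros 1)
  qed
qed

end

lemma pi_convI:
  assumes "\<And>n. F n \<in> bcontfun" "f \<in> bcontfun" "\<And>n x. \<bar>F n x\<bar> \<le> C" "\<And>x. (\<lambda>n. F n x) \<longlonglongrightarrow> f x"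
  shows "pi_conv F f"
  unfolding pi_conv_def supnorm_def using assms by (auto intro!: bdd_aboveI2[where M=C] cSUP_least)

lemma pi_core_mono:
  assumes E: "pi_core P E" and "E \<subseteq> E'" "fun_subspace E'" "E' \<subseteq> gen_dom P"
  shows "pi_core P E'"
proof -
  have "E' \<subseteq> bcontfun" using assms(4) by (auto simp: gen_dom_def)
  moreover have "\<exists>m F. (\<forall>ns. length ns = m \<longrightarrow> F ns \<in> E') \<and> multi_pi_conv m F f" if "f \<in> bcontfun" for f
    using E that assms(2) unfolding pi_core_def pi_dense_def by (meson subsetD)
  moreover have "\<exists>m F. (\<forall>ns. length ns = m \<longrightarrow> F ns \<in> E') \<and> multi_pi_conv m F f \<and>
      multi_pi_conv m (\<lambda>ns. gen P (F ns)) (gen P f)" if "f \<in> gen_dom P" for f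
    using E that assms(2) unfolding pi_core_def by (meson subsetD)
  ultimately show ?thesis using assms(3,4) unfolding pi_core_def pi_dense_def by blast
qed

lemma multi_pi_conv_2:
  assumes "pi_conv u f" "\<And>i. pi_conv (v i) (u i)" and F: "\<And>i j. F [i, j] = v i j"
  shows "multi_pi_conv 2 F f"
  unfolding multi_pi_conv_def
proof (intro conjI exI allI impI)
  let ?G = "\<lambda>ns. case ns of [] \<Rightarrow> f | i # js \<Rightarrow> (case js of [] \<Rightarrow> u i | j # _ \<Rightarrow> v i j)"
  show "?G [] = f" by simp
  show "?G ns = F ns" if "length ns = 2" for ns
  proof -
    from that obtain i j where "ns = [i, j]" by (auto simp: length_Suc_conv numeral_2_eq_2)
    then show ?thesis by (simp add: F)
  qed
  show "pi_conv (\<lambda>n. ?G (ns @ [n])) (?G ns)" if "length ns < 2" for ns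
  proof (cases ns)
    case (Cons i js)
    then have "js = []" using that by simp
    then show ?thesis using Cons assms(2)[of i] by simp
  qed (simp add: assms(1))
qed simp

context ou_data
begin

definition tavg :: "real \<Rightarrow> ('a \<Rightarrow> real) \<Rightarrow> 'a \<Rightarrow> real" where
  "tavg b f x = (\<integral>s. P s f x \<partial>lebI 0 b)"

lemma wave_bcontfun: "wave h c \<in> bcontfun"
  using abs_wave_le continuous_wave by (intro bcontfunI') auto

lemma continuous_Sadj: "continuous_on {0..b} (\<lambda>s. Sadj s h)"
  by (rule continuous_on_subset[OF c0_continuous[OF c0_adj]]) auto

lemma P_wave_time_continuous: "continuous_on {0..b} (\<lambda>s. P s (wave h c) x)"
proof -
  have "continuous_on {0..b} (\<lambda>s. Re (cis (x \<bullet> Sadj s h + c) * chf s h))"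
    by (intro continuous_intros continuous_Sadj continuous_chf)
  then show ?thesis by (rule continuous_on_cong[THEN iffD1, OF refl, rotated]) (simp add: P_wave)
qed

lemma P_trig_time_continuous: "f \<in> trig V \<Longrightarrow> continuous_on {0..b} (\<lambda>s. P s f x)"
proof (induction rule: trig_induct)
  case zero
  then show ?case by (simp add: P_eq)
next
  case (cons d h c f)
  have "continuous_on {0..b} (\<lambda>s. d * P s (wave h c) x + P s f x)"
    by (intro continuous_intros P_wave_time_continuous cons)
  then show ?case
    by (rule continuous_on_cong[THEN iffD1, OF refl, rotated])
      (simp add: P_linear[OF _ wave_bcontfun trig_bcontfun[OF cons(2)]])
qed

lemma P_0_trig: "f \<in> trig V \<Longrightarrow> P 0 f x = f x"
proof (induction rule: trig_induct)
  case zero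
  then show ?case by (simp add: P_eq)
next
  case (cons d h c f)
  have "P 0 (wave h c) x = wave h c x"
    using P_wave[of 0 h c x] by (simp add: chf_0 c0_zero[OF c0_adj] wave_def)
  then show ?case by (simp add: P_linear[OF _ wave_bcontfun trig_bcontfun[OF cons(2)]] cons)
qed

lemma P_time_measurable:
  assumes f: "f \<in> bcontfun"
  shows "(\<lambda>s. P s f x) \<in> borel_measurable (lebI 0 b)"
proof -
  obtain C and g :: "nat \<Rightarrow> 'a \<Rightarrow> real" where g: "\<And>n. g n \<in> trig (adj_dom DA A)" "\<And>n x. \<bar>g n x\<bar> \<le> C" "\<And>x. (\<lambda>n. g n x) \<longlonglongrightarrow> f x"
    using trig_adj_approx[OF f] by blast
  show ?thesis
  proof (rule borel_measurable_LIMSEQ_real)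
    show "(\<lambda>n. P s (g n) x) \<longlonglongrightarrow> P s f x" if "s \<in> space (lebI 0 b)" for s
      by (rule P_tendsto[OF _ bcontfun_continuous[OF trig_bcontfun[OF g(1)]] g(2,3)]) (use that in simp)
    show "(\<lambda>s. P s (g n) x) \<in> borel_measurable (lebI 0 b)" for n
      by (rule borel_measurable_lebI[OF P_trig_time_continuous[OF g(1)]])
  qed
qed

lemma P_time_integrable:
  assumes f: "f \<in> bcontfun"
  shows "integrable (lebI 0 b) (\<lambda>s. P s f x)"
proof -
  obtain C where C: "\<And>x. norm (f x) \<le> C" using bcontfun_bound[OF f] by blast
  have "\<bar>P s f x\<bar> \<le> C" if "s \<in> {0..b}" for s
    by (rule P_abs_le[OF _ bcontfun_continuous[OF f]]) (use that C in auto)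
  then show ?thesis
    by (intro finite_measure.integrable_const_bound[OF finite_measure_lebI, where B=C] P_time_measurable f) auto
qed

lemma tavg_linear:
  assumes "f \<in> bcontfun" "g \<in> bcontfun"
  shows "tavg b (\<lambda>x. c * f x + g x) x = c * tavg b f x + tavg b g x"
proof -
  have "tavg b (\<lambda>x. c * f x + g x) x = (\<integral>s. c * P s f x + P s g x \<partial>lebI 0 b)"
    unfolding tavg_def by (rule Bochner_Integration.integral_cong) (auto simp: P_linear[OF _ assms])
  then show ?thesis using P_time_integrable[OF assms(1)] P_time_integrable[OF assms(2)] by (simp add: tavg_def)
qed

lemma tavg_near:
  assumes f: "f \<in> bcontfun" and b: "b > 0" and near: "\<And>s. s \<in> {0..b} \<Longrightarrow> \<bar>P s f x - c\<bar> \<le> e"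
  shows "\<bar>1 / b * tavg b f x - c\<bar> \<le> e"
proof -
  interpret finite_measure "lebI 0 b" by (rule finite_measure_lebI)
  have m: "measure (lebI 0 b) {0..b} = b" using measure_lebI[of 0 b] b by simp
  note i = P_time_integrable[OF f, of b x]
  have "\<bar>\<integral>s. P s f x - c \<partial>lebI 0 b\<bar> \<le> (\<integral>s. \<bar>P s f x - c\<bar> \<partial>lebI 0 b)" by (rule integral_abs_bound)
  also have "\<dots> \<le> (\<integral>s. e \<partial>lebI 0 b)" by (rule integral_mono) (use i near in auto)
  also have "\<dots> = b * e" using m by simp
  also have "(\<integral>s. P s f x - c \<partial>lebI 0 b) = b * (1 / b * tavg b f x - c)"
    using i m b by (simp add: tavg_def right_diff_distrib)
  finally show ?thesis using b by (simp add: abs_mult)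
qed

lemma tavg_abs_le:
  assumes f: "f \<in> bcontfun" "\<And>x. \<bar>f x\<bar> \<le> C" and b: "b > 0"
  shows "\<bar>1 / b * tavg b f x\<bar> \<le> C"
  using tavg_near[OF f(1) b, of x 0 C] P_abs_le[OF _ bcontfun_continuous[OF f(1)] f(2)] by simp

lemma tavg_tendsto:
  assumes f: "\<And>n. f n \<in> bcontfun" "\<And>n x. \<bar>f n x\<bar> \<le> C" "\<And>x. (\<lambda>n. f n x) \<longlonglongrightarrow> f' x" and f': "f' \<in> bcontfun"
  shows "(\<lambda>n. tavg b (f n) x) \<longlonglongrightarrow> tavg b f' x"
  unfolding tavg_def
proof (rule integral_dominated_convergence[where w="\<lambda>_. C"])
  show "integrable (lebI 0 b) (\<lambda>_. C)" by (rule finite_measure.integrable_const[OF finite_measure_lebI])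
  show "AE s in lebI 0 b. (\<lambda>n. P s (f n) x) \<longlonglongrightarrow> P s f' x"
    by (intro AE_I2 P_tendsto[OF _ bcontfun_continuous[OF f(1)] f(2,3)]) simp
  show "AE s in lebI 0 b. norm (P s (f n) x) \<le> C" for n
    using P_abs_le[OF _ bcontfun_continuous[OF f(1)] f(2)] by (intro AE_I2) simp
qed (intro P_time_measurable f f')+

lemma tavg_bcontfun:
  assumes f: "f \<in> bcontfun" and b: "b > 0"
  shows "(\<lambda>x. c * tavg b f x) \<in> bcontfun"
proof -
  obtain C where C: "\<And>x. norm (f x) \<le> C" using bcontfun_bound[OF f] by blast
  have "continuous_on UNIV (tavg b f)"
    unfolding continuous_on_sequentially comp_def tavg_def
  proof (intro allI ballI impI, elim conjE)
    fix X :: "nat \<Rightarrow> 'a" and x assume X: "X \<longlonglongrightarrow> x"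
    show "(\<lambda>n. \<integral>s. P s f (X n) \<partial>lebI 0 b) \<longlonglongrightarrow> (\<integral>s. P s f x \<partial>lebI 0 b)"
    proof (rule integral_dominated_convergence[where w="\<lambda>_. C"])
      show "integrable (lebI 0 b) (\<lambda>_. C)" by (rule finite_measure.integrable_const[OF finite_measure_lebI])
      have "(\<lambda>n. P s f (X n)) \<longlonglongrightarrow> P s f x" if "s \<in> space (lebI 0 b)" for s
      proof -
        have "continuous_on UNIV (P s f)"
          by (rule P_continuous[OF _ bcontfun_continuous[OF f], of _ C]) (use that C in auto)
        then show ?thesis using X by (auto simp: continuous_on_sequentially comp_def)
      qed
      then show "AE s in lebI 0 b. (\<lambda>n. P s f (X n)) \<longlonglongrightarrow> P s f x" by (rule AE_I2)
      show "AE s in lebI 0 b. norm (P s f (X n)) \<le> C" for n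
        using P_abs_le[OF _ bcontfun_continuous[OF f], of _ C] C by (intro AE_I2) simp
    qed (intro P_time_measurable f)+
  qed
  moreover have "norm (c * tavg b f x) \<le> \<bar>c\<bar> * (b * C)" for x
  proof -
    have "\<bar>tavg b f x\<bar> \<le> b * C" using tavg_abs_le[OF f _ b, of C x] C b by (simp add: abs_mult field_simps)
    then show ?thesis by (simp add: abs_mult mult_left_mono)
  qed
  ultimately show ?thesis by (intro bcontfunI' continuous_intros)
qed

lemma tavg_CA:
  assumes h: "h \<in> adj_dom DA A"
  shows "\<exists>g T C \<alpha> D. CA (tavg b (wave h c)) g T C \<alpha> D"
proof -
  note w = CA_wave[OF h, of c]
  obtain M where M: "M \<ge> 1" "\<And>s x. 0 \<le> s \<Longrightarrow> s \<le> b \<Longrightarrow> norm (S s x) \<le> M * norm x" by (rule S_bound) blast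
  define C D where "C = M\<^sup>2 * (1 + norm h)\<^sup>2" and "D = M * norm (adj_op DA A h)"
  have "\<forall>s. \<exists>g T \<alpha>. s \<in> {0..b} \<longrightarrow> CA (P s (wave h c)) g T C \<alpha> D"
    using CA_P[OF w _ M(2) M(1)] unfolding C_def D_def by (meson atLeastAtMost_iff)
  then obtain g T \<alpha> where gT: "\<And>s. s \<in> {0..b} \<Longrightarrow> CA (P s (wave h c)) (g s) (T s) C (\<alpha> s) D" by metis
  have "C \<ge> 0" "D \<ge> 0" using M(1) by (auto simp: C_def D_def)
  then show ?thesis
    using CA_integral[where M="lebI 0 b" and f="\<lambda>s. P s (wave h c)" and g=g and T=T and C=C and \<alpha>=\<alpha> and D=D,
        OF finite_measure_lebI _ P_time_measurable[OF wave_bcontfun]] gT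
    unfolding tavg_def[abs_def] by simp blast
qed

lemma P_tavg_wave:
  assumes t: "t \<ge> 0" and b: "b \<ge> 0"
  shows "P t (tavg b (wave h c)) x = integral {t..b + t} (\<lambda>s. P s (wave h c) x)"
proof -
  interpret m: prob_space "\<mu> t" by (rule mu_prob[OF t])
  interpret L: finite_measure "lebI 0 b" by (rule finite_measure_lebI)
  interpret p: pair_sigma_finite "lebI 0 b" "\<mu> t" ..
  have fin: "finite_measure (lebI 0 b \<Otimes>\<^sub>M \<mu> t)"
    by (intro finite_measure_pair_measure L.finite_measure_axioms m.finite_measure_axioms)
  have [measurable_cong]: "sets (\<mu> t) = sets borel" by (rule mu_sets[OF t])
  let ?W = "\<lambda>(s, z). Re (cis (z \<bullet> Sadj (max 0 s) h + c) * chf (max 0 s) h)"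
  have "continuous_on UNIV ?W"
  proof -
    have 1: "continuous_on UNIV (\<lambda>p. Sadj (max 0 (fst p)) h)" for p :: "real \<times> 'a"
      by (rule continuous_on_compose2[OF c0_continuous[OF c0_adj]]) (auto intro!: continuous_intros)
    have 2: "continuous_on UNIV (\<lambda>p. chf (max 0 (fst p)) h)" for p :: "real \<times> 'a"
      by (rule continuous_on_compose2[OF continuous_chf_Ici]) (auto intro!: continuous_intros)
    show ?thesis unfolding case_prod_beta by (intro continuous_intros 1 2)
  qed
  then have [measurable]: "?W \<in> borel_measurable (borel \<Otimes>\<^sub>M borel)"
    unfolding borel_prod by (rule borel_measurable_continuous_onI)
  have [measurable]: "(\<lambda>s. s) \<in> borel_measurable (lebI 0 b)"
    by (rule borel_measurable_lebI) (rule continuous_on_id)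
  have eqW: "P s (wave h c) z = ?W (s, z)" if "s \<ge> 0" for s z using that by (simp add: P_wave)
  have Wb: "\<bar>?W p\<bar> \<le> 1" for p
  proof -
    have "\<bar>?W p\<bar> \<le> cmod (cis (snd p \<bullet> Sadj (max 0 (fst p)) h + c) * chf (max 0 (fst p)) h)"
      unfolding case_prod_beta by (rule abs_Re_le_cmod)
    also have "\<dots> \<le> 1" using norm_chf_le[of "max 0 (fst p)" h] by (simp add: norm_mult)
    finally show ?thesis .
  qed
  have "(\<lambda>(s, y). ?W (s, S t x + y)) \<in> borel_measurable (lebI 0 b \<Otimes>\<^sub>M \<mu> t)" by measurable
  then have int: "integrable (lebI 0 b \<Otimes>\<^sub>M \<mu> t) (\<lambda>(s, y). ?W (s, S t x + y))"
    by (rule finite_measure.integrable_const_bound[OF fin, where B=1, rotated]) (use Wb in \<open>auto simp: case_prod_beta\<close>)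
  have "P t (tavg b (wave h c)) x = (\<integral>y. (\<integral>s. ?W (s, S t x + y) \<partial>lebI 0 b) \<partial>\<mu> t)"
    unfolding P_eq[of t] tavg_def
    by (intro Bochner_Integration.integral_cong refl) (use eqW in auto)
  also have "\<dots> = (\<integral>s. (\<integral>y. ?W (s, S t x + y) \<partial>\<mu> t) \<partial>lebI 0 b)"
    by (rule p.Fubini_integral) (use int in simp)
  also have "\<dots> = (\<integral>s. P (s + t) (wave h c) x \<partial>lebI 0 b)"
  proof (rule Bochner_Integration.integral_cong[OF refl])
    fix s assume "s \<in> space (lebI 0 b)"
    then have s: "s \<ge> 0" by simp
    have "(\<integral>y. ?W (s, S t x + y) \<partial>\<mu> t) = P t (P s (wave h c)) x"
      unfolding P_eq[of t] using eqW[OF s] by simp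
    also have "\<dots> = P (s + t) (wave h c) x" using P_commute_wave[OF t s] by (simp add: add.commute)
    finally show "(\<integral>y. ?W (s, S t x + y) \<partial>\<mu> t) = P (s + t) (wave h c) x" .
  qed
  also have "\<dots> = integral {0..b} (\<lambda>s. P (s + t) (wave h c) x)"
    by (rule integral_lebI, rule continuous_on_compose2[OF P_wave_time_continuous[of "b + t"]])
      (use t in \<open>auto intro!: continuous_intros\<close>)
  also have "\<dots> = integral {t..b + t} (\<lambda>s. P s (wave h c) x)"
    using integral_shift[of 0 t b "\<lambda>s. P s (wave h c) x"]
      continuous_on_subset[OF P_wave_time_continuous[of "b + t" h c x], of "{0 + t..b + t}"] t
    by (simp add: comp_def)
  finally show ?thesis .
qed

lemma tavg_wave_eq: "tavg b (wave h c) x = integral {0..b} (\<lambda>s. P s (wave h c) x)"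
  unfolding tavg_def by (rule integral_lebI[OF P_wave_time_continuous])

lemma integral_P_wave_diff:
  assumes "0 \<le> u" "u \<le> v"
  shows "integral {u..v} (\<lambda>s. P s (wave h c) x) = tavg v (wave h c) x - tavg u (wave h c) x"
  using Henstock_Kurzweil_Integration.integral_combine[OF assms, of "\<lambda>s. P s (wave h c) x"]
    integrable_continuous_real[OF P_wave_time_continuous[of v h c x]] by (simp add: tavg_wave_eq)

lemma tavg_wave_limit:
  assumes b: "b \<ge> 0"
  shows "((\<lambda>t. (P t (tavg b (wave h c)) x - tavg b (wave h c) x) / t) \<longlongrightarrow> P b (wave h c) x - wave h c x) (at_right 0)"
proof -
  define F where "F u = tavg u (wave h c) x" for u
  have F0: "F 0 = 0" by (simp add: F_def tavg_wave_eq)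
  have der: "((\<lambda>t. (F (u + t) - F u) / t) \<longlongrightarrow> P u (wave h c) x) (at_right 0)" if u: "u \<ge> 0" for u
  proof -
    have "((\<lambda>v. integral {0..v} (\<lambda>s. P s (wave h c) x)) has_real_derivative P u (wave h c) x) (at u within {0..u + 1})"
      by (rule integral_has_real_derivative[OF P_wave_time_continuous]) (use u in auto)
    then have "((\<lambda>v. (F v - F u) / (v - u)) \<longlongrightarrow> P u (wave h c) x) (at u within {0..u + 1})"
      by (simp add: has_field_derivative_iff F_def tavg_wave_eq)
    moreover have "filterlim (\<lambda>t. u + t) (at u within {0..u + 1}) (at_right 0)"
      unfolding filterlim_at
    proof
      show "\<forall>\<^sub>F t in at_right 0. u + t \<in> {0..u + 1} \<and> u + t \<noteq> u"
        unfolding eventually_at_right_field using u by (intro exI[of _ 1]) auto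
      have "((\<lambda>t. u + t) \<longlongrightarrow> u + 0) (at_right 0)" by (intro tendsto_intros)
      then show "((\<lambda>t. u + t) \<longlongrightarrow> u) (at_right 0)" by simp
    qed
    ultimately have "((\<lambda>t. (F (u + t) - F u) / (u + t - u)) \<longlongrightarrow> P u (wave h c) x) (at_right 0)"
      by (rule filterlim_compose)
    then show ?thesis by simp
  qed
  have "P 0 (wave h c) x = wave h c x" by (rule P_0_trig[OF trig_wave[of h UNIV]]) simp
  then have "((\<lambda>t. (F (b + t) - F b) / t - (F (0 + t) - F 0) / t) \<longlongrightarrow> P b (wave h c) x - wave h c x) (at_right 0)"
    using tendsto_diff[OF der[OF b] der[of 0]] by simp
  moreover have "\<forall>\<^sub>F t in at_right 0. (F (b + t) - F b) / t - (F (0 + t) - F 0) / t =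
      (P t (tavg b (wave h c)) x - tavg b (wave h c) x) / t"
    using eventually_at_right_less[of 0]
  proof (rule eventually_mono)
    fix t :: real assume t: "0 < t"
    have "P t (tavg b (wave h c)) x = F (b + t) - F t"
      unfolding F_def using P_tavg_wave[OF less_imp_le[OF t] b, of h c x] integral_P_wave_diff[of t "b + t" h c x] t b by simp
    then show "(F (b + t) - F b) / t - (F (0 + t) - F 0) / t = (P t (tavg b (wave h c)) x - tavg b (wave h c) x) / t"
      using F0 by (simp add: F_def diff_divide_distrib)
  qed
  ultimately show ?thesis by (rule Lim_transform_eventually)
qed

lemma tavg_wave_D0_tilde:
  assumes h: "h \<in> adj_dom DA A" and b: "b > 0"
  shows "tavg b (wave h c) \<in> D0_tilde DA A"
proof -
  obtain g T C \<alpha> D where CA: "CA (tavg b (wave h c)) g T C \<alpha> D" using tavg_CA[OF h] by blast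
  have Pb: "P b (wave h c) \<in> bcontfun" by (rule P_bcontfun[OF less_imp_le[OF b] wave_bcontfun])
  have "(\<lambda>x. P b (wave h c) x - wave h c x) \<in> bcontfun"
  proof (rule bcontfunI'[where C="1 + 1"])
    show "continuous_on UNIV (\<lambda>x. P b (wave h c) x - wave h c x)"
      by (intro continuous_on_diff bcontfun_continuous[OF Pb] continuous_wave)
    show "norm (P b (wave h c) x - wave h c x) \<le> 1 + 1" for x
      using P_abs_le[OF less_imp_le[OF b] continuous_wave abs_wave_le, of h c x] abs_wave_le[of h c x] by simp
  qed
  then show ?thesis by (rule D0_tildeI[OF CA]) (rule tavg_wave_limit[OF less_imp_le[OF b]])
qed

lemma P_wave_phase:
  assumes "s \<ge> 0"
  shows "P s (wave h c) x = Re (cis c * ou_semigroup S \<mu> s (\<lambda>z. iexp (z \<bullet> h)) x)"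
    and "ou_semigroup S \<mu> s (\<lambda>z. iexp (z \<bullet> h)) x = cis (x \<bullet> Sadj s h) * chf s h"
proof -
  have "iexp ((S s x + y) \<bullet> h) = cis (S s x \<bullet> h + y \<bullet> h)" for y by (simp add: cis_conv_exp inner_add_left)
  then show e: "ou_semigroup S \<mu> s (\<lambda>z. iexp (z \<bullet> h)) x = cis (x \<bullet> Sadj s h) * chf s h"
    unfolding ou_semigroup_def using mu_cis(1)[OF assms] by (simp add: semigroup_adjoint[OF assms])
  show "P s (wave h c) x = Re (cis c * ou_semigroup S \<mu> s (\<lambda>z. iexp (z \<bullet> h)) x)"
    unfolding e P_wave[OF assms] mult.assoc[symmetric] cis_mult by (simp add: add.commute)
qed

lemma tavg_wave_phi: "tavg b (wave h c) x = cos c * Re (phi S \<mu> b h x) - sin c * Im (phi S \<mu> b h x)"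
proof -
  let ?F = "\<lambda>s. ou_semigroup S \<mu> s (\<lambda>z. iexp (z \<bullet> h)) x"
  have "continuous_on {0..b} (\<lambda>s. cis (x \<bullet> Sadj s h) * chf s h)"
    by (intro continuous_intros continuous_Sadj continuous_chf)
  then have "continuous_on {0..b} ?F"
    by (rule continuous_on_cong[THEN iffD1, OF refl, rotated]) (simp add: P_wave_phase(2))
  then have "((\<lambda>s. Re (cis c * ?F s)) has_integral Re (cis c * phi S \<mu> b h x)) {0..b}"
    unfolding phi_def
    by (intro has_integral_Re has_integral_mult_right integrable_integral integrable_continuous_real)
  then have "integral {0..b} (\<lambda>s. P s (wave h c) x) = Re (cis c * phi S \<mu> b h x)"
    by (intro integral_unique) (rule has_integral_eq[rotated], assumption, simp add: P_wave_phase(1))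
  then show ?thesis by (simp add: tavg_wave_eq)
qed

lemma tavg_wave_D1:
  assumes h: "h \<in> adj_dom DA A" and b: "b > 0"
  shows "tavg b (wave h c) \<in> D1 S \<mu> DA A"
proof -
  have "(\<lambda>x. cos c * Re (phi S \<mu> b h x) + (- sin c) * Im (phi S \<mu> b h x)) \<in> D1 S \<mu> DA A"
    unfolding D1_def using h b by (intro fun_span_add fun_span_scale fun_span_base) blast+
  then show ?thesis by (simp add: tavg_wave_phi[abs_def])
qed

lemma D1_induct [consumes 1, case_names zero cons]:
  assumes "f \<in> D1 S \<mu> DA A" "Z (\<lambda>x. 0)"
    and step: "\<And>d b h c f. b > 0 \<Longrightarrow> h \<in> adj_dom DA A \<Longrightarrow> f \<in> D1 S \<mu> DA A \<Longrightarrow> Z f \<Longrightarrow>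
      Z (\<lambda>x. d * tavg b (wave h c) x + f x)"
  shows "Z f"
  using assms(1) unfolding D1_def
proof (induction rule: fun_span_induct)
  case (cons d g f)
  from cons(1) obtain b h c where g: "b > 0" "h \<in> adj_dom DA A" "g = tavg b (wave h c)"
  proof (elim UnE CollectE exE conjE)
    fix b h assume "g = (\<lambda>x. Re (phi S \<mu> b h x))" "b > 0" "h \<in> adj_dom DA A"
    then show thesis using that[of b h 0] by (simp add: tavg_wave_phi[abs_def])
  next
    fix b h assume "g = (\<lambda>x. Im (phi S \<mu> b h x))" "b > 0" "h \<in> adj_dom DA A"
    then show thesis using that[of b h "- (pi / 2)"] by (simp add: tavg_wave_phi[abs_def])
  qed
  show ?case unfolding g(3) using step[OF g(1,2)] cons(2,3) by (simp add: D1_def)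
qed (rule assms(2))

lemma D1_subset: "D1 S \<mu> DA A \<subseteq> D0_tilde DA A"
proof
  fix f assume "f \<in> D1 S \<mu> DA A"
  then show "f \<in> D0_tilde DA A"
    using fun_subspace_D0_tilde tavg_wave_D0_tilde
    by (induction rule: D1_induct) (auto simp: fun_subspace_def)
qed

lemma fun_subspace_D1: "fun_subspace (D1 S \<mu> DA A)"
  unfolding D1_def by (rule fun_subspace_span)

lemma D0_tilde_bcontfun: "f \<in> D0_tilde DA A \<Longrightarrow> f \<in> bcontfun"
  using D0_tilde_gen(1) by (simp add: gen_dom_def)

lemma P_D1:
  assumes "f \<in> D1 S \<mu> DA A" and t: "t \<ge> 0"
  shows "P t f \<in> D1 S \<mu> DA A"
  using assms(1)
proof (induction rule: D1_induct)
  case zero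
  then show ?case using fun_subspace_D1 by (simp add: P_eq[abs_def] fun_subspace_def)
next
  case (cons d b h c f)
  have 1: "P t (\<lambda>x. d * tavg b (wave h c) x + f x) = (\<lambda>x. d * P t (tavg b (wave h c)) x + P t f x)"
    using P_linear[OF t D0_tilde_bcontfun[OF tavg_wave_D0_tilde[OF cons(2,1)]] D0_tilde_bcontfun[of f]] D1_subset cons(3) by blast
  have "P t (tavg b (wave h c)) \<in> D1 S \<mu> DA A"
  proof (cases "t = 0")
    case True
    then have "P t (tavg b (wave h c)) = tavg b (wave h c)"
      using P_tavg_wave[of 0 b h c] cons(1) by (auto simp: tavg_wave_eq)
    then show ?thesis using tavg_wave_D1[OF cons(2,1)] by simp
  next
    case False
    have "P t (tavg b (wave h c)) = (\<lambda>x. tavg (b + t) (wave h c) x + (- 1) * tavg t (wave h c) x)"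
      using P_tavg_wave[OF t less_imp_le[OF cons(1)]] integral_P_wave_diff[of t "b + t"] t cons(1) by auto
    also have "\<dots> \<in> D1 S \<mu> DA A"
      unfolding D1_def
      by (intro fun_span_add fun_span_scale tavg_wave_D1[unfolded D1_def] cons) (use False t cons(1) in auto)
    finally show ?thesis .
  qed
  then have "(\<lambda>x. d * P t (tavg b (wave h c)) x) \<in> D1 S \<mu> DA A"
    using fun_subspace_D1 unfolding fun_subspace_def by blast
  from fun_span_add[OF this[unfolded D1_def] cons(4)[unfolded D1_def]] show ?case unfolding 1 D1_def .
qed

lemma tavg_trig:
  assumes g: "g \<in> trig (adj_dom DA A)" and b: "b > 0"
  shows "tavg b g \<in> D1 S \<mu> DA A"
    "((\<lambda>t. (P t (tavg b g) x - tavg b g x) / t) \<longlongrightarrow> P b g x - g x) (at_right 0)"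
proof -
  have "tavg b g \<in> D1 S \<mu> DA A \<and> (\<forall>x. ((\<lambda>t. (P t (tavg b g) x - tavg b g x) / t) \<longlongrightarrow> P b g x - g x) (at_right 0))"
    using g
  proof (induction rule: trig_induct)
    case zero
    have "tavg b (\<lambda>x. 0) = (\<lambda>x. 0)" by (simp add: tavg_def[abs_def] P_eq[abs_def])
    then show ?case using fun_subspace_D1 by (simp add: P_eq fun_subspace_def)
  next
    case (cons d h c f)
    note f = trig_bcontfun[OF cons(2)]
    have 1: "tavg b (\<lambda>x. d * wave h c x + f x) = (\<lambda>x. d * tavg b (wave h c) x + tavg b f x)"
      using tavg_linear[OF wave_bcontfun f] by blast
    have 2: "P t (\<lambda>x. d * tavg b (wave h c) x + tavg b f x) x = d * P t (tavg b (wave h c)) x + P t (tavg b f) x" if "t \<ge> 0" for t x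
      using P_linear[OF that, of "tavg b (wave h c)" "tavg b f" d x] tavg_bcontfun[OF wave_bcontfun b, of 1 h c] tavg_bcontfun[OF f b, of 1] by simp
    have "((\<lambda>t. (P t (\<lambda>x. d * tavg b (wave h c) x + tavg b f x) x - (d * tavg b (wave h c) x + tavg b f x)) / t)
        \<longlongrightarrow> P b (\<lambda>x. d * wave h c x + f x) x - (d * wave h c x + f x)) (at_right 0)" for x
    proof -
      have "((\<lambda>t. d * ((P t (tavg b (wave h c)) x - tavg b (wave h c) x) / t) + (P t (tavg b f) x - tavg b f x) / t)
         \<longlongrightarrow> d * (P b (wave h c) x - wave h c x) + (P b f x - f x)) (at_right 0)"
        using cons(3) by (intro tendsto_intros tavg_wave_limit[OF less_imp_le[OF b]]) auto
      moreover have "\<forall>\<^sub>F t in at_right 0. d * ((P t (tavg b (wave h c)) x - tavg b (wave h c) x) / t) + (P t (tavg b f) x - tavg b f x) / t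
         = (P t (\<lambda>x. d * tavg b (wave h c) x + tavg b f x) x - (d * tavg b (wave h c) x + tavg b f x)) / t"
        using eventually_at_right_less[of 0]
        by (rule eventually_mono) (simp add: 2 add_divide_distrib diff_divide_distrib right_diff_distrib)
      ultimately have "((\<lambda>t. (P t (\<lambda>x. d * tavg b (wave h c) x + tavg b f x) x - (d * tavg b (wave h c) x + tavg b f x)) / t)
        \<longlongrightarrow> d * (P b (wave h c) x - wave h c x) + (P b f x - f x)) (at_right 0)"
        by (rule Lim_transform_eventually)
      moreover have "d * (P b (wave h c) x - wave h c x) + (P b f x - f x) =
          P b (\<lambda>x. d * wave h c x + f x) x - (d * wave h c x + f x)"
        by (subst P_linear[OF less_imp_le[OF b] wave_bcontfun f]) (simp add: right_diff_distrib)
      ultimately show ?thesis by simp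
    qed
    moreover have "(\<lambda>x. d * tavg b (wave h c) x + tavg b f x) \<in> D1 S \<mu> DA A"
      using cons(3) unfolding D1_def
      by (intro fun_span_add fun_span_scale tavg_wave_D1[unfolded D1_def] cons(1) b) blast
    ultimately show ?case unfolding 1 by blast
  qed
  then show "tavg b g \<in> D1 S \<mu> DA A"
    "((\<lambda>t. (P t (tavg b g) x - tavg b g x) / t) \<longlongrightarrow> P b g x - g x) (at_right 0)" by auto
qed

lemma gen_tavg_trig:
  assumes g: "g \<in> trig (adj_dom DA A)" and b: "b > 0"
  shows "gen P (\<lambda>x. d * tavg b g x) = (\<lambda>x. d * (P b g x - g x))"
proof
  fix x
  have "((\<lambda>t. d * ((P t (tavg b g) x - tavg b g x) / t)) \<longlongrightarrow> d * (P b g x - g x)) (at_right 0)"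
    by (intro tendsto_intros tavg_trig g b)
  moreover have "P t (\<lambda>x. d * tavg b g x) x = d * P t (tavg b g) x" for t by (simp add: P_eq)
  ultimately have "((\<lambda>t. (P t (\<lambda>x. d * tavg b g x) x - d * tavg b g x) / t) \<longlongrightarrow> d * (P b g x - g x)) (at_right 0)"
    by (simp add: right_diff_distrib)
  then show "gen P (\<lambda>x. d * tavg b g x) x = d * (P b g x - g x)"
    unfolding gen_def by (intro tendsto_Lim) auto
qed

lemma mean_tendsto:
  assumes f: "f \<in> bcontfun" and lim: "((\<lambda>s. P s f x) \<longlongrightarrow> f x) (at_right 0)" and 0: "P 0 f x = f x"
  shows "(\<lambda>n. real (Suc n) * tavg (1 / real (Suc n)) f x) \<longlonglongrightarrow> f x"
proof (rule tendstoI)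
  fix e :: real assume e: "e > 0"
  from tendstoD[OF lim, of "e / 2"] e obtain d where d: "d > 0" "\<And>s. 0 < s \<Longrightarrow> s < d \<Longrightarrow> dist (P s f x) (f x) < e / 2"
    unfolding eventually_at_right_field by auto
  have "\<forall>\<^sub>F n in sequentially. 1 / real (Suc n) < d"
    using LIMSEQ_inverse_real_of_nat d(1) by (intro order_tendstoD) (auto simp: inverse_eq_divide)
  then show "\<forall>\<^sub>F n in sequentially. dist (real (Suc n) * tavg (1 / real (Suc n)) f x) (f x) < e"
  proof (rule eventually_mono)
    fix n assume n: "1 / real (Suc n) < d"
    have "\<bar>1 / (1 / real (Suc n)) * tavg (1 / real (Suc n)) f x - f x\<bar> \<le> e / 2"
    proof (rule tavg_near[OF f])
      fix s assume "s \<in> {0..1 / real (Suc n)}"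
      then show "\<bar>P s f x - f x\<bar> \<le> e / 2"
        using d(2)[of s] n 0 e by (cases "s = 0") (auto simp: dist_real_def)
    qed simp
    then show "dist (real (Suc n) * tavg (1 / real (Suc n)) f x) (f x) < e" using e by (simp add: dist_real_def)
  qed
qed

lemma P_0_gen_dom:
  assumes "f \<in> bcontfun" shows "P 0 f x = f x"
proof -
  obtain C and g :: "nat \<Rightarrow> 'a \<Rightarrow> real" where g: "\<And>n. g n \<in> trig (adj_dom DA A)" "\<And>n x. \<bar>g n x\<bar> \<le> C" "\<And>x. (\<lambda>n. g n x) \<longlonglongrightarrow> f x"
    using trig_adj_approx[OF assms] by blast
  have "(\<lambda>n. P 0 (g n) x) \<longlonglongrightarrow> P 0 f x"
    by (rule P_tendsto[OF _ bcontfun_continuous[OF trig_bcontfun[OF g(1)]] g(2,3)]) simp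
  then show ?thesis using g(3)[of x] LIMSEQ_unique by (simp add: P_0_trig[OF g(1)])
qed

lemma mean_pi_conv:
  assumes f: "f \<in> bcontfun" and lim: "\<And>x. ((\<lambda>s. P s f x) \<longlongrightarrow> f x) (at_right 0)"
  shows "pi_conv (\<lambda>n x. real (Suc n) * tavg (1 / real (Suc n)) f x) f"
proof -
  obtain C where C: "\<And>x. norm (f x) \<le> C" using bcontfun_bound[OF f] by blast
  show ?thesis
  proof (rule pi_convI)
    show "(\<lambda>x. real (Suc n) * tavg (1 / real (Suc n)) f x) \<in> bcontfun" for n by (rule tavg_bcontfun[OF f]) simp
    show "\<bar>real (Suc n) * tavg (1 / real (Suc n)) f x\<bar> \<le> C" for n x
      using tavg_abs_le[OF f, of C "1 / real (Suc n)" x] C by simp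
    show "(\<lambda>n. real (Suc n) * tavg (1 / real (Suc n)) f x) \<longlonglongrightarrow> f x" for x
      by (rule mean_tendsto[OF f lim P_0_gen_dom[OF f]])
  qed (rule f)
qed

lemma D1_pi_dense: "pi_dense (D1 S \<mu> DA A)"
  unfolding pi_dense_def
proof (intro conjI ballI)
  show "D1 S \<mu> DA A \<subseteq> bcontfun" using D1_subset D0_tilde_bcontfun by blast
  fix f :: "'a \<Rightarrow> real" assume f: "f \<in> bcontfun"
  obtain C and g :: "nat \<Rightarrow> 'a \<Rightarrow> real" where g: "\<And>n. g n \<in> trig (adj_dom DA A)" "\<And>n x. \<bar>g n x\<bar> \<le> C" "\<And>x. (\<lambda>n. g n x) \<longlonglongrightarrow> f x"
    using trig_adj_approx[OF f] by blast
  note gb = trig_bcontfun[OF g(1)]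
  define F where "F ns = (\<lambda>x. real (Suc (ns ! 1)) * tavg (1 / real (Suc (ns ! 1))) (g (ns ! 0)) x)" for ns
  have "multi_pi_conv 2 F f"
  proof (rule multi_pi_conv_2[where u=g and v="\<lambda>k n x. real (Suc n) * tavg (1 / real (Suc n)) (g k) x"])
    show "pi_conv g f" by (rule pi_convI[OF gb f g(2,3)])
    show "pi_conv (\<lambda>n x. real (Suc n) * tavg (1 / real (Suc n)) (g k) x) (g k)" for k
    proof (rule mean_pi_conv[OF gb])
      fix x
      have "((\<lambda>s. P s (g k) x) \<longlongrightarrow> P 0 (g k) x) (at 0 within {0..1})"
        using P_trig_time_continuous[OF g(1), of 1 k x] by (simp add: continuous_on)
      then show "((\<lambda>s. P s (g k) x) \<longlongrightarrow> g k x) (at_right 0)"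
        by (simp add: P_0_trig[OF g(1)] at_within_Icc_at_right)
    qed
  qed (simp add: F_def)
  moreover have "F ns \<in> D1 S \<mu> DA A" for ns
    using tavg_trig(1)[OF g(1), of "1 / real (Suc (ns ! 1))" "ns ! 0"] fun_subspace_D1 unfolding F_def fun_subspace_def by simp
  ultimately show "\<exists>m F. (\<forall>ns. length ns = m \<longrightarrow> F ns \<in> D1 S \<mu> DA A) \<and> multi_pi_conv m F f" by blast
qed

lemma D1_pi_core: "pi_core P (D1 S \<mu> DA A)"
  unfolding pi_core_def
proof (intro conjI ballI fun_subspace_D1 D1_pi_dense)
  show "D1 S \<mu> DA A \<subseteq> gen_dom P" using D1_subset D0_tilde_gen(1) by blast
  fix f assume "f \<in> gen_dom P"
  note gd = gen_dom_limit[OF this]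
  note f = gd(1)
  obtain K where K: "\<And>h x. h > 0 \<Longrightarrow> \<bar>P h f x - f x\<bar> \<le> h * K" using gd(4) by blast
  obtain C and g :: "nat \<Rightarrow> 'a \<Rightarrow> real" where g: "\<And>n. g n \<in> trig (adj_dom DA A)" "\<And>n x. \<bar>g n x\<bar> \<le> C" "\<And>x. (\<lambda>n. g n x) \<longlonglongrightarrow> f x"
    using trig_adj_approx[OF f] by blast
  note gb = trig_bcontfun[OF g(1)]
  let ?r = "\<lambda>n. 1 / real (Suc n)"
  have r: "0 < ?r n" for n by simp
  define F where "F ns = (\<lambda>x. real (Suc (ns ! 0)) * tavg (?r (ns ! 0)) (g (ns ! 1)) x)" for ns
  have F1: "F ns \<in> D1 S \<mu> DA A" for ns
    using tavg_trig(1)[OF g(1) r, of "ns ! 0" "ns ! 1"] fun_subspace_D1 unfolding F_def fun_subspace_def by simp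
  have 1: "multi_pi_conv 2 F f"
  proof (rule multi_pi_conv_2[where u="\<lambda>n x. real (Suc n) * tavg (?r n) f x" and v="\<lambda>n k x. real (Suc n) * tavg (?r n) (g k) x"])
    show "pi_conv (\<lambda>n x. real (Suc n) * tavg (?r n) f x) f"
    proof (rule mean_pi_conv[OF f])
      fix x
      have "((\<lambda>h. P h f x - f x) \<longlongrightarrow> 0) (at_right 0)"
      proof (rule Lim_null_comparison)
        show "\<forall>\<^sub>F h in at_right 0. norm (P h f x - f x) \<le> h * K"
          using eventually_at_right_less[of 0] by (rule eventually_mono) (simp add: K)
        show "((\<lambda>h. h * K) \<longlongrightarrow> 0) (at_right 0)" by (intro tendsto_mult_left_zero tendsto_ident_at)
      qed
      then show "((\<lambda>s. P s f x) \<longlongrightarrow> f x) (at_right 0)" by (rule LIM_zero_cancel)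
    qed
    show "pi_conv (\<lambda>k x. real (Suc n) * tavg (?r n) (g k) x) (\<lambda>x. real (Suc n) * tavg (?r n) f x)" for n
    proof (rule pi_convI[where C=C])
      show "\<bar>real (Suc n) * tavg (?r n) (g k) x\<bar> \<le> C" for k x
        using tavg_abs_le[OF gb g(2) r, of n k x] by simp
      show "(\<lambda>k. real (Suc n) * tavg (?r n) (g k) x) \<longlonglongrightarrow> real (Suc n) * tavg (?r n) f x" for x
        by (intro tendsto_intros tavg_tendsto[OF gb g(2,3) f])
    qed (intro tavg_bcontfun gb f r)+
  qed (simp add: F_def)
  have diff_b: "(\<lambda>x. real (Suc n) * (P (?r n) h x - h x)) \<in> bcontfun" if h: "h \<in> bcontfun" for n h
  proof -
    obtain B where B: "\<And>x. norm (h x) \<le> B" using bcontfun_bound[OF h] by blast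
    show ?thesis
    proof (rule bcontfunI'[where C="real (Suc n) * (B + B)"])
      show "continuous_on UNIV (\<lambda>x. real (Suc n) * (P (?r n) h x - h x))"
        by (intro continuous_intros bcontfun_continuous[OF P_bcontfun[OF less_imp_le[OF r] h]] bcontfun_continuous[OF h])
      have "\<bar>P (?r n) h x - h x\<bar> \<le> B + B" for x
        using P_abs_le[OF less_imp_le[OF r] bcontfun_continuous[OF h], of B n x] B by (simp add: abs_le_iff) (smt (verit) B real_norm_def)
      then show "norm (real (Suc n) * (P (?r n) h x - h x)) \<le> real (Suc n) * (B + B)" for x
        by (simp only: real_norm_def abs_mult abs_of_nat) (rule mult_left_mono, auto)
    qed
  qed
  have 2: "multi_pi_conv 2 (\<lambda>ns. gen P (F ns)) (gen P f)"
  proof (rule multi_pi_conv_2[where u="\<lambda>n x. real (Suc n) * (P (?r n) f x - f x)" and v="\<lambda>n k x. real (Suc n) * (P (?r n) (g k) x - g k x)"])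
    show "pi_conv (\<lambda>n x. real (Suc n) * (P (?r n) f x - f x)) (gen P f)"
    proof (rule pi_convI[where C=K])
      show "\<bar>real (Suc n) * (P (?r n) f x - f x)\<bar> \<le> K" for n x
        using mult_left_mono[OF K[OF r, of n x], of "real (Suc n)"] by (simp add: abs_mult)
      have "filterlim ?r (at_right 0) sequentially"
        unfolding filterlim_at using LIMSEQ_inverse_real_of_nat by (auto simp: inverse_eq_divide)
      from filterlim_compose[OF gd(3) this]
      show "(\<lambda>n. real (Suc n) * (P (?r n) f x - f x)) \<longlonglongrightarrow> gen P f x" for x by (simp add: mult.commute)
    qed (intro diff_b f gd(2))+
    show "pi_conv (\<lambda>k x. real (Suc n) * (P (?r n) (g k) x - g k x)) (\<lambda>x. real (Suc n) * (P (?r n) f x - f x))" for n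
    proof (rule pi_convI[where C="real (Suc n) * (C + C)"])
      have "\<bar>P (?r n) (g k) x - g k x\<bar> \<le> C + C" for k x
        using P_abs_le[OF less_imp_le[OF r] bcontfun_continuous[OF gb] g(2), of n k x] g(2)[of k x] by linarith
      then show "\<bar>real (Suc n) * (P (?r n) (g k) x - g k x)\<bar> \<le> real (Suc n) * (C + C)" for k x
        by (simp only: abs_mult abs_of_nat) (rule mult_left_mono, auto)
      show "(\<lambda>k. real (Suc n) * (P (?r n) (g k) x - g k x)) \<longlonglongrightarrow> real (Suc n) * (P (?r n) f x - f x)" for x
        by (intro tendsto_intros g(3) P_tendsto[OF less_imp_le[OF r] bcontfun_continuous[OF gb] g(2,3)])
    qed (intro diff_b gb f)+
    show "gen P (F [n, k]) = (\<lambda>x. real (Suc n) * (P (?r n) (g k) x - g k x))" for n k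
      using gen_tavg_trig[OF g(1) r, of "real (Suc n)" n k] by (simp add: F_def)
  qed
  from F1 1 2 show "\<exists>m F. (\<forall>ns. length ns = m \<longrightarrow> F ns \<in> D1 S \<mu> DA A) \<and> multi_pi_conv m F f \<and>
      multi_pi_conv m (\<lambda>ns. gen P (F ns)) (gen P f)" by blast
qed

lemma D0_tilde_pi_core: "pi_core P (D0_tilde DA A)"
  by (rule pi_core_mono[OF D1_pi_core D1_subset fun_subspace_D0_tilde]) (use D0_tilde_gen(1) in blast)

end

theorem corollary5p10:
  fixes Q :: "'a::{real_inner, polish_space} \<Rightarrow> 'a"
    and a :: 'a
    and \<nu> :: "'a measure"
    and DA :: "'a set" and A :: "'a \<Rightarrow> 'a"
    and S Sadj :: "real \<Rightarrow> 'a \<Rightarrow> 'a"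
    and \<mu> :: "real \<Rightarrow> 'a measure"
  assumes "nonneg_sym_trace_class Q"
    and "levy_measure \<nu>"
    and "generates DA A S"
    and "generates (adj_dom DA A) (adj_op DA A) Sadj"
    and "convolution_laws Q a \<nu> Sadj \<mu>"
  shows "pi_core (ou_semigroup S \<mu>) (D0_tilde DA A) \<and>
    pi_core (ou_semigroup S \<mu>) (D1 S \<mu> DA A) \<and>
    D1 S \<mu> DA A \<subseteq> D0_tilde DA A \<and>
    (\<forall>t\<ge>0. ou_semigroup S \<mu> t ` D0_tilde DA A \<subseteq> D0_tilde DA A) \<and>
    (\<forall>t\<ge>0. ou_semigroup S \<mu> t ` D1 S \<mu> DA A \<subseteq> D1 S \<mu> DA A) \<and>
    (\<forall>f\<in>D0_tilde DA A. gen (ou_semigroup S \<mu>) f = L0 Q a \<nu> DA A f)"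
proof -
  interpret ou_data DA A S Sadj Q a \<nu> \<mu>
    using assms by unfold_locales
  show ?thesis
    using D0_tilde_pi_core D1_pi_core D1_subset P_D0_tilde P_D1 D0_tilde_gen(2) by blast
qed

end
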